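(* Let $p\in(0,1)$, let $\{X_k\}_{k\ge1}$ be the $\{+1,-1\}$-valued Markov chain with parameter $p$ defined in the context, let $\{a_k\}_{k\ge1}$ be a deterministic real sequence, and let $S_0:=0$, $S_n:=\sum_{k=1}^n a_kX_k$, $s_n:=E[(S_n)^2]^{1/2}$, $A_n:=\sum_{k=1}^n a_k^2$. Suppose that $A_n\to\infty$ as $n\to\infty$ and that $a_n^2=O(A_n^{1-\delta})$ as $n\to\infty$ for some $\delta\in(0,1]$. Then $$s_n^2\to\infty\quad\text{as } n\to\infty,$$ and, without changing the distribution of the process $\{S_n:n\ge0\}$, one can redefine $\{S_n:n\ge0\}$ on a richer probability space on which a standard Brownian motion $\{B(t):t\ge0\}$ is defined such that, for each $\lambda<\delta/16$, $$S_n-B(s_n^2)=o(s_n^{1-\lambda})\quad\text{as } n\to\infty,\ \text{a.s.}$$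
   Context: For $p\in(0,1)$, $\{X_k\}_{k\ge1}$ is the $\{+1,-1\}$-valued Markov chain with $P(X_1=+1)=P(X_1=-1)=\tfrac12$ and, for $k\ge1$, $P(X_{k+1}=+1\mid X_k=+1)=P(X_{k+1}=-1\mid X_k=-1)=p$ and $P(X_{k+1}=-1\mid X_k=+1)=P(X_{k+1}=+1\mid X_k=-1)=1-p$. The process $\{S_n\}$ is called the elephant random walk remembering the very recent past (ERWVRP) with memory parameter $p$ and variable step length. "Redefining $\{S_n\}$ on a richer probability space without changing its distribution" means: there exists a probability space carrying both a process with the same distribution as $\{S_n:n\ge0\}$ (again denoted $\{S_n\}$) and a standard Brownian motion $\{B(t)\}$ such that the stated relation holds. *)

theory Defs
  imports "HOL-Probability.Probability" "HOL-Library.Landau_Symbols"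
begin

text \<open>
  Discrete-time Markov chains indexed by \<open>k \<ge> 1\<close> with countable state space \<open>E\<close>.  Measurability into
  \<open>count_space E\<close> says at once that every \<open>X k\<close> is a random variable and that it takes its values in
  \<open>E\<close>.  Since \<^term>\<open>cond_prob\<close> is 0 when the conditioning event is null, the Markov property is only
  demanded for histories of positive probability.
\<close>

definition markov_chain :: "'w measure \<Rightarrow> 's set \<Rightarrow> (nat \<Rightarrow> 'w \<Rightarrow> 's) \<Rightarrow> bool" where
  "markov_chain M E X \<longleftrightarrow>
     prob_space M \<and> countable E \<and>
     (\<forall>k\<ge>1. X k \<in> M \<rightarrow>\<^sub>M count_space E) \<and>
     (\<forall>k\<ge>1. \<forall>x y. \<P>(\<omega> in M. \<forall>i\<in>{1..k}. X i \<omega> = x i) > 0 \<longrightarrow>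
        \<P>(\<omega> in M. X (k + 1) \<omega> = y \<bar> \<forall>i\<in>{1..k}. X i \<omega> = x i) =
        \<P>(\<omega> in M. X (k + 1) \<omega> = y \<bar> X k \<omega> = x k))"

definition erwvrp_steps :: "'w measure \<Rightarrow> real \<Rightarrow> (nat \<Rightarrow> 'w \<Rightarrow> real) \<Rightarrow> bool" where
  "erwvrp_steps M p X \<longleftrightarrow>
     markov_chain M {1, -1} X \<and>
     \<P>(\<omega> in M. X 1 \<omega> = 1) = 1/2 \<and> \<P>(\<omega> in M. X 1 \<omega> = -1) = 1/2 \<and>
     (\<forall>k\<ge>1.
        \<P>(\<omega> in M. X (k + 1) \<omega> = 1 \<bar> X k \<omega> = 1) = p \<and>
        \<P>(\<omega> in M. X (k + 1) \<omega> = -1 \<bar> X k \<omega> = -1) = p \<and>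
        \<P>(\<omega> in M. X (k + 1) \<omega> = -1 \<bar> X k \<omega> = 1) = 1 - p \<and>
        \<P>(\<omega> in M. X (k + 1) \<omega> = 1 \<bar> X k \<omega> = -1) = 1 - p)"

definition walk :: "(nat \<Rightarrow> real) \<Rightarrow> (nat \<Rightarrow> 'w \<Rightarrow> real) \<Rightarrow> nat \<Rightarrow> 'w \<Rightarrow> real" where
  "walk a X n \<omega> = (\<Sum>k=1..n. a k * X k \<omega>)"

definition L2_size :: "'w measure \<Rightarrow> (nat \<Rightarrow> 'w \<Rightarrow> real) \<Rightarrow> nat \<Rightarrow> real" where
  "L2_size M S n = sqrt (\<integral>\<omega>. (S n \<omega>)\<^sup>2 \<partial>M)"

definition same_process_law ::
    "'v measure \<Rightarrow> (nat \<Rightarrow> 'v \<Rightarrow> real) \<Rightarrow> 'w measure \<Rightarrow> (nat \<Rightarrow> 'w \<Rightarrow> real) \<Rightarrow> bool" where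
  "same_process_law M' S' M S \<longleftrightarrow>
     (\<forall>n. S' n \<in> borel_measurable M') \<and> (\<forall>n. S n \<in> borel_measurable M) \<and>
     distr M' (\<Pi>\<^sub>M n\<in>UNIV. borel) (\<lambda>\<omega> n. S' n \<omega>) = distr M (\<Pi>\<^sub>M n\<in>UNIV. borel) (\<lambda>\<omega> n. S n \<omega>)"

text \<open>
  The time index is real, but only times \<open>t \<ge> 0\<close> are constrained.  The second argument of
  \<^term>\<open>normal_density\<close> is the standard deviation, so increments over \<open>[s, t]\<close> have variance \<open>t - s\<close>.
\<close>

definition standard_brownian_motion :: "'w measure \<Rightarrow> (real \<Rightarrow> 'w \<Rightarrow> real) \<Rightarrow> bool" where
  "standard_brownian_motion M B \<longleftrightarrow>
     prob_space M \<and>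
     (\<forall>t\<ge>0. B t \<in> borel_measurable M) \<and>
     (\<forall>\<omega>\<in>space M. B 0 \<omega> = 0) \<and>
     (\<forall>\<omega>\<in>space M. continuous_on {0..} (\<lambda>t. B t \<omega>)) \<and>
     (\<forall>s t. 0 \<le> s \<and> s < t \<longrightarrow>
        distributed M lborel (\<lambda>\<omega>. B t \<omega> - B s \<omega>) (normal_density 0 (sqrt (t - s)))) \<and>
     (\<forall>(n::nat) t. 0 \<le> t 0 \<and> (\<forall>i<n. t i \<le> t (Suc i)) \<longrightarrow>
        prob_space.indep_vars M (\<lambda>_. borel) (\<lambda>i \<omega>. B (t (Suc i)) \<omega> - B (t i) \<omega>) {..<n})"

end

theory Submission
  imports Defs
begin

text \<open>
  With \<open>r = 2 p - 1\<close> the differences \<open>D i = X i - r X (i - 1)\<close> are martingale differences whose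
  conditional variance \<open>1 - r\<^sup>2\<close> is deterministic, and up to boundary terms \<open>S\<close> is, on every block
  of indices, a martingale transform of the \<open>D i\<close>.  Blocks are cut where \<open>A\<close> passes
  \<open>k powr \<alpha>\<close> with \<open>\<alpha> = 7 / \<delta>\<close>.  Lindeberg's replacement method bounds the Wasserstein distance
  between the block sum and a centred Gaussian of variance \<open>(s n)\<^sup>2 - (s m)\<^sup>2\<close>, and on the line this
  distance is attained by the monotone coupling.  Hence, given a Brownian motion, the signs of a
  block can be chosen as a function of its increment over that block: multiplying the increment by
  the last sign before the block, which leaves its law unchanged, gives the chain the right law.
  The coupling errors are summable after division by \<open>k powr (\<alpha> / 2 - 7 / 32)\<close>, a quantity of
  order \<open>s powr (1 - \<delta> / 16)\<close> on the \<open>k\<close>-th block, and the fluctuations of both processes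
  inside a block are controlled by fourth moments and the Borel-Cantelli lemma.
\<close>

section \<open>Rotating independent Gaussians\<close>

text \<open>The Brownian clock is deterministic: block k of \<open>B\<close> runs over exactly the
  variance gained by the walk, so no random time has to be compared with s^2 and the coupling errors
  simply add up. The exponents come from a balance. With \<alpha> * \<delta> = 7 every |a i| on
  block k is at most of order k^(\<alpha>/2 - 7/2), and the block variance is of order k^(\<alpha> -
  1). The bound h + h^(-2) * (sum of cubes) is then best at h = k^(\<alpha>/2 - 3/2), and dividing
  by k^(\<alpha>/2 - 7/32) leaves k^(-41/32); the fourth moments of the fluctuations leave k^(-9/8).
  With \<alpha> * \<delta> = c in place of 7, summability asks for c > 64/13 in the first case and c
  < 8 in the second. Two obstacles shape the details. The variance (s n)^2 need not be monotone
  inside a block, so Brownian fluctuations are controlled on two-sided windows. And a block sum does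
  not determine its signs, so the coupling has to select entire sign vectors.\<close>

lemma std_normal_density_rotate:
  "std_normal_density ((u + v) / sqrt 2) * std_normal_density ((u - v) / sqrt 2)
    = std_normal_density u * std_normal_density v"
proof -
  have "((u + v) / sqrt 2)\<^sup>2 + ((u - v) / sqrt 2)\<^sup>2 = u\<^sup>2 + v\<^sup>2"
    by (simp add: power_divide field_simps power2_eq_square)
  then have "- ((u + v) / sqrt 2)\<^sup>2 / 2 + - ((u - v) / sqrt 2)\<^sup>2 / 2 = - u\<^sup>2 / 2 + - v\<^sup>2 / 2"
    by (simp add: field_simps)
  then show ?thesis
    by (simp add: std_normal_density_def exp_add[symmetric])
qed

text \<open>A planar rotation carried out as two affine substitutions on the line with a Fubini swap
  between them: y = sqrt 2 * u - x for fixed x, then x = (u + v) / sqrt 2 for fixed u. Their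
  Jacobians sqrt 2 and 1 / sqrt 2 cancel.\<close>

lemma nn_integral_gauss_rotate:
  fixes F :: "real \<Rightarrow> real \<Rightarrow> ennreal"
  assumes [measurable]: "case_prod F \<in> borel_measurable (borel \<Otimes>\<^sub>M borel)"
  shows "(\<integral>\<^sup>+x. \<integral>\<^sup>+y. F ((x + y) / sqrt 2) ((x - y) / sqrt 2)
            * ennreal (std_normal_density x * std_normal_density y) \<partial>lborel \<partial>lborel)
       = (\<integral>\<^sup>+u. \<integral>\<^sup>+v. F u v * ennreal (std_normal_density u * std_normal_density v) \<partial>lborel \<partial>lborel)"
proof -
  let ?\<phi> = std_normal_density
  have s2: "sqrt 2 \<noteq> (0::real)" by simp
  have ss: "sqrt 2 * sqrt 2 = (2::real)" by simp
  have "(\<integral>\<^sup>+x. \<integral>\<^sup>+y. F ((x + y) / sqrt 2) ((x - y) / sqrt 2) * ennreal (?\<phi> x * ?\<phi> y) \<partial>lborel \<partial>lborel)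
      = (\<integral>\<^sup>+x. ennreal \<bar>sqrt 2\<bar> * (\<integral>\<^sup>+u. F u ((2 * x - sqrt 2 * u) / sqrt 2) * ennreal (?\<phi> x * ?\<phi> (sqrt 2 * u - x)) \<partial>lborel) \<partial>lborel)"
  proof (intro nn_integral_cong)
    fix x :: real
    show "(\<integral>\<^sup>+y. F ((x + y) / sqrt 2) ((x - y) / sqrt 2) * ennreal (?\<phi> x * ?\<phi> y) \<partial>lborel)
      = ennreal \<bar>sqrt 2\<bar> * (\<integral>\<^sup>+u. F u ((2 * x - sqrt 2 * u) / sqrt 2) * ennreal (?\<phi> x * ?\<phi> (sqrt 2 * u - x)) \<partial>lborel)"
      by (subst nn_integral_real_affine[OF _ s2, where t="-x"])
         (auto simp: algebra_simps)
  qed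
  also have "\<dots> = (\<integral>\<^sup>+x. (\<integral>\<^sup>+u. ennreal (sqrt 2) * (F u ((2 * x - sqrt 2 * u) / sqrt 2) * ennreal (?\<phi> x * ?\<phi> (sqrt 2 * u - x))) \<partial>lborel) \<partial>lborel)"
    by (intro nn_integral_cong) (subst nn_integral_cmult, auto)
  also have "\<dots> = (\<integral>\<^sup>+u. (\<integral>\<^sup>+x. ennreal (sqrt 2) * (F u ((2 * x - sqrt 2 * u) / sqrt 2) * ennreal (?\<phi> x * ?\<phi> (sqrt 2 * u - x))) \<partial>lborel) \<partial>lborel)"
    by (rule lborel_pair.Fubini'[symmetric]) measurable
  also have "\<dots> = (\<integral>\<^sup>+u. (\<integral>\<^sup>+v. F u v * ennreal (?\<phi> u * ?\<phi> v) \<partial>lborel) \<partial>lborel)"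
  proof (rule nn_integral_cong)
    fix u :: real
    have i: "1 / sqrt 2 \<noteq> (0::real)" by simp
    have "(\<integral>\<^sup>+x. ennreal (sqrt 2) * (F u ((2 * x - sqrt 2 * u) / sqrt 2) * ennreal (?\<phi> x * ?\<phi> (sqrt 2 * u - x))) \<partial>lborel)
       = ennreal (sqrt 2) * (\<integral>\<^sup>+x. (F u ((2 * x - sqrt 2 * u) / sqrt 2) * ennreal (?\<phi> x * ?\<phi> (sqrt 2 * u - x))) \<partial>lborel)"
      by (rule nn_integral_cmult) measurable
    also have "\<dots> = ennreal (sqrt 2) * (ennreal \<bar>1 / sqrt 2\<bar> * (\<integral>\<^sup>+v. F u ((2 * (u / sqrt 2 + 1 / sqrt 2 * v) - sqrt 2 * u) / sqrt 2) * ennreal (?\<phi> (u / sqrt 2 + 1 / sqrt 2 * v) * ?\<phi> (sqrt 2 * u - (u / sqrt 2 + 1 / sqrt 2 * v))) \<partial>lborel))"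
      by (subst nn_integral_real_affine[OF _ i, where t="u / sqrt 2"]) auto
    also have "\<dots> = (\<integral>\<^sup>+v. F u ((2 * (u / sqrt 2 + 1 / sqrt 2 * v) - sqrt 2 * u) / sqrt 2) * ennreal (?\<phi> (u / sqrt 2 + 1 / sqrt 2 * v) * ?\<phi> (sqrt 2 * u - (u / sqrt 2 + 1 / sqrt 2 * v))) \<partial>lborel)"
      by (simp add: mult.assoc[symmetric] ennreal_mult[symmetric])
    also have "\<dots> = (\<integral>\<^sup>+v. F u v * ennreal (?\<phi> u * ?\<phi> v) \<partial>lborel)"
    proof (intro nn_integral_cong)
      fix v :: real
      have a: "(2 * (u / sqrt 2 + 1 / sqrt 2 * v) - sqrt 2 * u) / sqrt 2 = v"
        by (simp add: field_simps)
      have b: "u / sqrt 2 + 1 / sqrt 2 * v = (u + v) / sqrt 2"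
        by (simp add: field_simps)
      have c: "sqrt 2 * u - (u + v) / sqrt 2 = (u - v) / sqrt 2"
        by (simp add: field_simps)
      show "F u ((2 * (u / sqrt 2 + 1 / sqrt 2 * v) - sqrt 2 * u) / sqrt 2) * ennreal (?\<phi> (u / sqrt 2 + 1 / sqrt 2 * v) * ?\<phi> (sqrt 2 * u - (u / sqrt 2 + 1 / sqrt 2 * v))) = F u v * ennreal (?\<phi> u * ?\<phi> v)"
        unfolding a unfolding b c std_normal_density_rotate ..
    qed
    finally show "(\<integral>\<^sup>+x. ennreal (sqrt 2) * (F u ((2 * x - sqrt 2 * u) / sqrt 2) * ennreal (?\<phi> x * ?\<phi> (sqrt 2 * u - x))) \<partial>lborel)
       = (\<integral>\<^sup>+v. F u v * ennreal (?\<phi> u * ?\<phi> v) \<partial>lborel)" .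
  qed
  finally show ?thesis .
qed

text \<open>This is the step that halves a Brownian interval: an increment and a fresh Gaussian
  become two independent increments. The marginals come from the convolution of normal laws;
  independence is the product formula on rectangles, where the rotated double integral
  enters.\<close>

lemma (in prob_space) std_normal_rotate:
  assumes ind: "indep_var borel X borel Y"
    and X: "distributed M lborel X std_normal_density"
    and Y: "distributed M lborel Y std_normal_density"
  shows "indep_var borel (\<lambda>\<omega>. (X \<omega> + Y \<omega>) / sqrt 2) borel (\<lambda>\<omega>. (X \<omega> - Y \<omega>) / sqrt 2)"
    and "distributed M lborel (\<lambda>\<omega>. (X \<omega> + Y \<omega>) / sqrt 2) std_normal_density"
    and "distributed M lborel (\<lambda>\<omega>. (X \<omega> - Y \<omega>) / sqrt 2) std_normal_density"
proof -
  have mX[measurable]: "X \<in> borel_measurable M" and mY[measurable]: "Y \<in> borel_measurable M"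
    using X Y by (auto dest: distributed_measurable)
  interpret N: prob_space std_normal_distribution by (rule prob_space_normal_density) simp
  have dX: "distr M lborel X = std_normal_distribution" and dY: "distr M lborel Y = std_normal_distribution"
    using X Y by (auto dest: distributed_distr_eq_density)
  have dX': "distr M borel X = std_normal_distribution" using dX by (simp cong: distr_cong)
  have dY': "distr M borel Y = std_normal_distribution" using dY by (simp cong: distr_cong)
  have "indep_var borel X borel Y" by fact
  then have joint: "distr M (borel \<Otimes>\<^sub>M borel) (\<lambda>x. (X x, Y x)) = std_normal_distribution \<Otimes>\<^sub>M std_normal_distribution"
    using dX' dY' by (simp add: indep_var_distribution_eq)
  have "distributed M lborel (\<lambda>\<omega>. X \<omega> + Y \<omega>) (normal_density (0 + 0) (sqrt (1\<^sup>2 + 1\<^sup>2)))"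
    by (rule add_indep_normal) (use assms in auto)
  then show U: "distributed M lborel (\<lambda>\<omega>. (X \<omega> + Y \<omega>) / sqrt 2) std_normal_density"
    using normal_density_affine[of "\<lambda>\<omega>. X \<omega> + Y \<omega>" 0 "sqrt 2" "1 / sqrt 2" 0] by simp
  have "distributed M lborel (\<lambda>\<omega>. X \<omega> - Y \<omega>) (normal_density (0 - 0) (sqrt (1\<^sup>2 + 1\<^sup>2)))"
    by (rule diff_indep_normal) (use assms in auto)
  then show V: "distributed M lborel (\<lambda>\<omega>. (X \<omega> - Y \<omega>) / sqrt 2) std_normal_density"
    using normal_density_affine[of "\<lambda>\<omega>. X \<omega> - Y \<omega>" 0 "sqrt 2" "1 / sqrt 2" 0] by simp
  let ?U = "\<lambda>\<omega>. (X \<omega> + Y \<omega>) / sqrt 2" and ?V = "\<lambda>\<omega>. (X \<omega> - Y \<omega>) / sqrt 2"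
  have "distr M lborel ?U = std_normal_distribution" using U by (auto dest: distributed_distr_eq_density)
  then have dU: "distr M borel ?U = std_normal_distribution" by (simp cong: distr_cong)
  have "distr M lborel ?V = std_normal_distribution" using V by (auto dest: distributed_distr_eq_density)
  then have dV: "distr M borel ?V = std_normal_distribution" by (simp cong: distr_cong)
  have "std_normal_distribution \<Otimes>\<^sub>M std_normal_distribution = distr M (borel \<Otimes>\<^sub>M borel) (\<lambda>x. (?U x, ?V x))"
  proof (rule pair_measure_eqI)
    show "sigma_finite_measure std_normal_distribution" "sigma_finite_measure std_normal_distribution" by unfold_locales
    show "sets (std_normal_distribution \<Otimes>\<^sub>M std_normal_distribution) = sets (distr M (borel \<Otimes>\<^sub>M borel) (\<lambda>x. (?U x, ?V x)))"
      by (simp cong: sets_pair_measure_cong)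
    fix A B :: "real set" assume "A \<in> sets std_normal_distribution" "B \<in> sets std_normal_distribution"
    then have [measurable]: "A \<in> sets borel" "B \<in> sets borel" by auto
    let ?F = "\<lambda>u v. indicator A u * indicator B v :: ennreal"
    have m: "case_prod ?F \<in> borel_measurable (borel \<Otimes>\<^sub>M borel)" by measurable
    have "emeasure (distr M (borel \<Otimes>\<^sub>M borel) (\<lambda>x. (?U x, ?V x))) (A \<times> B)
        = (\<integral>\<^sup>+\<omega>. ?F (?U \<omega>) (?V \<omega>) \<partial>M)"
      by (subst nn_integral_indicator[symmetric], simp, subst nn_integral_distr)
         (auto intro!: nn_integral_cong simp: indicator_times)
    also have "\<dots> = (\<integral>\<^sup>+z. (case z of (x, y) \<Rightarrow> ?F ((x + y) / sqrt 2) ((x - y) / sqrt 2)) \<partial>distr M (borel \<Otimes>\<^sub>M borel) (\<lambda>x. (X x, Y x)))"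
      by (subst nn_integral_distr) auto
    also have "\<dots> = (\<integral>\<^sup>+x. \<integral>\<^sup>+y. ?F ((x + y) / sqrt 2) ((x - y) / sqrt 2) \<partial>std_normal_distribution \<partial>std_normal_distribution)"
      unfolding joint by (subst N.nn_integral_fst[symmetric]) auto
    also have "\<dots> = (\<integral>\<^sup>+x. ennreal (std_normal_density x) * (\<integral>\<^sup>+y. ?F ((x + y) / sqrt 2) ((x - y) / sqrt 2) \<partial>std_normal_distribution) \<partial>lborel)"
      by (subst nn_integral_density) (auto intro!: N.borel_measurable_nn_integral)
    also have "\<dots> = (\<integral>\<^sup>+x. \<integral>\<^sup>+y. ?F ((x + y) / sqrt 2) ((x - y) / sqrt 2)
            * ennreal (std_normal_density x * std_normal_density y) \<partial>lborel \<partial>lborel)"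
      by (intro nn_integral_cong, subst nn_integral_density, simp, simp, subst nn_integral_cmult[symmetric])
         (auto simp: ennreal_mult ac_simps)
    also have "\<dots> = (\<integral>\<^sup>+u. \<integral>\<^sup>+v. ?F u v * ennreal (std_normal_density u * std_normal_density v) \<partial>lborel \<partial>lborel)"
      by (rule nn_integral_gauss_rotate) (rule m)
    also have "\<dots> = (\<integral>\<^sup>+u. (ennreal (std_normal_density u) * indicator A u) * emeasure std_normal_distribution B \<partial>lborel)"
    proof (intro nn_integral_cong)
      fix u :: real
      have "(\<integral>\<^sup>+v. ?F u v * ennreal (std_normal_density u * std_normal_density v) \<partial>lborel)
        = (\<integral>\<^sup>+v. (ennreal (std_normal_density u) * indicator A u) * (ennreal (std_normal_density v) * indicator B v) \<partial>lborel)"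
        by (intro nn_integral_cong) (auto simp: ennreal_mult ac_simps)
      also have "\<dots> = (ennreal (std_normal_density u) * indicator A u) * emeasure std_normal_distribution B"
        by (subst nn_integral_cmult) (auto simp: emeasure_density)
      finally show "(\<integral>\<^sup>+v. ?F u v * ennreal (std_normal_density u * std_normal_density v) \<partial>lborel)
        = (ennreal (std_normal_density u) * indicator A u) * emeasure std_normal_distribution B" .
    qed
    also have "\<dots> = emeasure std_normal_distribution A * emeasure std_normal_distribution B"
      by (subst nn_integral_multc) (auto simp: emeasure_density)
    finally show "emeasure std_normal_distribution A * emeasure std_normal_distribution B
      = emeasure (distr M (borel \<Otimes>\<^sub>M borel) (\<lambda>x. (?U x, ?V x))) (A \<times> B)" ..
  qed
  then show "indep_var borel ?U borel ?V"
    by (simp add: indep_var_distribution_eq dU dV)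
qed

section \<open>Interleaving independent families\<close>

lemma (in prob_space) indep_vars_reindex_inj:
  assumes X: "indep_vars N X I" and f: "inj_on f J" "f ` J \<subseteq> I"
  shows "indep_vars (\<lambda>j. N (f j)) (\<lambda>j. X (f j)) J"
  unfolding indep_vars_def2
proof (intro conjI ballI indep_setsI)
  show rv: "random_variable (N (f j)) (X (f j))" if "j \<in> J" for j
    using X f that by (auto simp: indep_vars_def2)
  show "{X (f j) -` A \<inter> space M |A. A \<in> sets (N (f j))} \<subseteq> events" if "j \<in> J" for j
    using rv[OF that] by (auto intro: measurable_sets)
  fix A K assume K: "K \<noteq> {}" "K \<subseteq> J" "finite K"
    and A: "\<forall>j\<in>K. A j \<in> {X (f j) -` A \<inter> space M |A. A \<in> sets (N (f j))}"
  have "\<forall>j\<in>K. \<exists>B. A j = X (f j) -` B \<inter> space M \<and> B \<in> sets (N (f j))" using A by blast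
  from bchoice[OF this] obtain B where B: "\<And>j. j \<in> K \<Longrightarrow> A j = X (f j) -` B j \<inter> space M" "\<And>j. j \<in> K \<Longrightarrow> B j \<in> sets (N (f j))"
    by blast
  have inj: "inj_on f K" using f(1) K(2) by (rule inj_on_subset)
  let ?g = "the_inv_into K f"
  have g: "?g (f j) = j" if "j \<in> K" for j using the_inv_into_f_f[OF inj that] .
  have "prob (\<Inter>i\<in>f ` K. X i -` B (?g i) \<inter> space M) = (\<Prod>i\<in>f ` K. prob (X i -` B (?g i) \<inter> space M))"
    by (rule indep_varsD[OF X]) (use K f g B in auto)
  then show "prob (\<Inter>j\<in>K. A j) = (\<Prod>j\<in>K. prob (A j))"
    using K(1) by (simp add: prod.reindex[OF inj] g B)
qed

text \<open>Independence across the pairs and independence inside each pair multiply up. A finite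
  set of components is first completed to whole pairs, the added components being unconstrained, so
  that both product formulas apply.\<close>

lemma (in prob_space) indep_vars_of_pairs:
  fixes Y :: "'k \<Rightarrow> 'a \<Rightarrow> real \<times> real"
  assumes Y: "indep_vars (\<lambda>_. borel) Y UNIV"
    and pair: "\<And>k. indep_var borel (\<lambda>\<omega>. fst (Y k \<omega>)) borel (\<lambda>\<omega>. snd (Y k \<omega>))"
  shows "indep_vars (\<lambda>_. borel) (\<lambda>(k, b) \<omega>. if b then fst (Y k \<omega>) else snd (Y k \<omega>)) (UNIV :: ('k \<times> bool) set)"
    (is "indep_vars _ ?X _")
  unfolding indep_vars_def2
proof (intro conjI ballI indep_setsI)
  have [measurable]: "Y k \<in> borel_measurable M" for k
    using Y by (simp add: indep_vars_def2)
  have f[measurable]: "(\<lambda>\<omega>. fst (Y k \<omega>)) \<in> borel_measurable M" "(\<lambda>\<omega>. snd (Y k \<omega>)) \<in> borel_measurable M" for k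
    using pair by (auto dest: indep_var_rv1 indep_var_rv2)
  show rv[measurable]: "random_variable borel (?X j)" for j
    by (cases j) auto
  show "{?X j -` A \<inter> space M |A. A \<in> sets borel} \<subseteq> events" for j
    using rv[of j] by (auto intro: measurable_sets)
  fix A J assume J: "J \<noteq> {}" "finite J"
    and A: "\<forall>j\<in>J. A j \<in> {?X j -` A \<inter> space M |A. A \<in> sets borel}"
  then have "\<forall>j\<in>J. \<exists>B. A j = ?X j -` B \<inter> space M \<and> B \<in> sets borel" by blast
  from bchoice[OF this] obtain B where B: "\<And>j. j \<in> J \<Longrightarrow> A j = ?X j -` B j \<inter> space M" "\<And>j. j \<in> J \<Longrightarrow> B j \<in> sets borel"
    by blast
  \<comment> \<open>The whole space stands for a component outside \<open>J\<close>; its factor is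
    1.\<close>
  define C where "C j = (if j \<in> J then B j else UNIV)" for j
  have C[measurable]: "C j \<in> sets borel" for j using B by (auto simp: C_def)
  define K where "K = fst ` J"
  have K: "K \<noteq> {}" "finite K" "J \<subseteq> K \<times> UNIV" using J by (auto simp: K_def intro: rev_image_eqI)
  have [measurable]: "C (k, True) \<times> C (k, False) \<in> sets borel" for k
    by (metis C borel_Times)
  have "(\<Inter>j\<in>J. A j) = (\<Inter>k\<in>K. Y k -` (C (k, True) \<times> C (k, False)) \<inter> space M)" (is "?L = ?R")
  proof (intro set_eqI iffI)
    fix \<omega> assume w: "\<omega> \<in> ?L"
    show "\<omega> \<in> ?R"
    proof (intro INT_I)
      fix k assume "k \<in> K"
      have "\<omega> \<in> space M" using w J B by auto
      moreover have "fst (Y k \<omega>) \<in> C (k, True)"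
        using w B(1)[of "(k, True)"] by (auto simp: C_def)
      moreover have "snd (Y k \<omega>) \<in> C (k, False)"
        using w B(1)[of "(k, False)"] by (auto simp: C_def)
      ultimately show "\<omega> \<in> Y k -` (C (k, True) \<times> C (k, False)) \<inter> space M"
        by (cases "Y k \<omega>") auto
    qed
  next
    fix \<omega> assume w: "\<omega> \<in> ?R"
    show "\<omega> \<in> ?L"
    proof (intro INT_I)
      fix j assume j: "j \<in> J"
      obtain k b where jj: "j = (k, b)" by (cases j)
      have "k \<in> K" using j jj by (auto simp: K_def image_iff intro!: bexI[of _ j])
      then have "\<omega> \<in> space M" "Y k \<omega> \<in> C (k, True) \<times> C (k, False)" using w \<open>k \<in> K\<close> K(1) by (simp_all split: if_splits)
      then show "\<omega> \<in> A j"
        using B(1)[OF j] j by (cases b) (auto simp: jj C_def)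
    qed
  qed
  then have "prob (\<Inter>j\<in>J. A j) = (\<Prod>k\<in>K. prob (Y k -` (C (k, True) \<times> C (k, False)) \<inter> space M))"
    using indep_varsD[OF Y K(1,2)] by auto
  also have "\<dots> = (\<Prod>k\<in>K. \<Prod>b\<in>UNIV. prob (?X (k, b) -` C (k, b) \<inter> space M))"
  proof (intro prod.cong refl)
    fix k
    have "Y k -` (C (k, True) \<times> C (k, False)) \<inter> space M
        = (\<lambda>x. (fst (Y k x), snd (Y k x))) -` (C (k, True) \<times> C (k, False)) \<inter> space M" by simp
    then have "prob (Y k -` (C (k, True) \<times> C (k, False)) \<inter> space M)
       = prob ((\<lambda>\<omega>. fst (Y k \<omega>)) -` C (k, True) \<inter> space M) * prob ((\<lambda>\<omega>. snd (Y k \<omega>)) -` C (k, False) \<inter> space M)"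
      using indep_varD[OF pair, of "C (k, True)" "C (k, False)"] C by (simp only:)
    then show "prob (Y k -` (C (k, True) \<times> C (k, False)) \<inter> space M) = (\<Prod>b\<in>UNIV. prob (?X (k, b) -` C (k, b) \<inter> space M))"
      by (simp add: UNIV_bool mult.commute)
  qed
  also have "\<dots> = (\<Prod>j\<in>K \<times> UNIV. prob (?X j -` C j \<inter> space M))"
    by (subst prod.cartesian_product) (auto intro!: prod.cong)
  also have "\<dots> = (\<Prod>j\<in>J. prob (?X j -` C j \<inter> space M))"
    using K by (intro prod.mono_neutral_right) (auto simp: C_def prob_space)
  also have "\<dots> = (\<Prod>j\<in>J. prob (A j))"
    using B by (intro prod.cong refl) (simp add: C_def)
  finally show "prob (\<Inter>j\<in>J. A j) = (\<Prod>j\<in>J. prob (A j))" .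
qed

lemma (in prob_space) indep_normal_split:
  fixes G :: "nat \<times> nat \<Rightarrow> 'a \<Rightarrow> real"
  assumes G: "indep_vars (\<lambda>_. borel) G UNIV"
    and N: "\<And>k. distributed M lborel (G k) std_normal_density"
  defines "G' \<equiv> (\<lambda>(i, j) \<omega>. if i = 0 then (G (0, j div 2) \<omega> + (if even j then 1 else - 1) * G (1, j div 2) \<omega>) / sqrt 2
                          else G (Suc i, j) \<omega>)"
  shows "indep_vars (\<lambda>_. borel) G' UNIV" "\<And>k. distributed M lborel (G' k) std_normal_density"
proof -
  define K :: "nat \<times> nat \<Rightarrow> (nat \<times> nat) set" where
    "K = (\<lambda>(i, j). if i = 0 then {(0, j), (1, j)} else {(Suc i, j)})"
  \<comment> \<open>Later rows are padded with the constant 0 so that every index carries a pair.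
    The injection \<open>f\<close> below never selects these constants.\<close>
  define h :: "nat \<times> nat \<Rightarrow> (nat \<times> nat \<Rightarrow> real) \<Rightarrow> real \<times> real" where
    "h = (\<lambda>(i, j) x. if i = 0 then ((x (0, j) + x (1, j)) / sqrt 2, (x (0, j) - x (1, j)) / sqrt 2) else (x (Suc i, j), 0))"
  define Y where "Y k \<omega> = h k (restrict (\<lambda>i. G i \<omega>) (K k))" for k \<omega>
  have Y0: "Y (0, j) \<omega> = ((G (0, j) \<omega> + G (1, j) \<omega>) / sqrt 2, (G (0, j) \<omega> - G (1, j) \<omega>) / sqrt 2)" for j \<omega>
    by (simp add: Y_def h_def K_def)
  have Y1: "i \<noteq> 0 \<Longrightarrow> Y (i, j) \<omega> = (G (Suc i, j) \<omega>, 0)" for i j \<omega>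
    by (simp add: Y_def h_def K_def)
  have m: "h k \<in> borel_measurable (Pi\<^sub>M (K k) (\<lambda>_. borel))" for k
  proof (cases k)
    case (Pair i j)
    show ?thesis
    proof (cases "i = 0")
      case True
      have [measurable]: "(\<lambda>x. x (0, j)) \<in> borel_measurable (Pi\<^sub>M (K k) (\<lambda>_. borel :: real measure))"
        "(\<lambda>x. x (Suc 0, j)) \<in> borel_measurable (Pi\<^sub>M (K k) (\<lambda>_. borel :: real measure))"
        by (rule measurable_component_singleton, simp add: \<open>k = (i, j)\<close> True K_def)+
      have "h k = (\<lambda>x. ((x (0, j) + x (Suc 0, j)) / sqrt 2, (x (0, j) - x (Suc 0, j)) / sqrt 2))"
        by (simp add: h_def Pair True fun_eq_iff)
      moreover have "\<dots> \<in> borel_measurable (Pi\<^sub>M (K k) (\<lambda>_. borel))"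
        by (intro borel_measurable_Pair) measurable
      ultimately show ?thesis by simp
    next
      case False
      have [measurable]: "(\<lambda>x. x (Suc i, j)) \<in> borel_measurable (Pi\<^sub>M (K k) (\<lambda>_. borel :: real measure))"
        by (rule measurable_component_singleton, simp add: Pair False K_def)+
      have "h k = (\<lambda>x. (x (Suc i, j), 0))"
        by (simp add: h_def Pair False fun_eq_iff)
      moreover have "\<dots> \<in> borel_measurable (Pi\<^sub>M (K k) (\<lambda>_. borel))"
        by (intro borel_measurable_Pair) measurable
      ultimately show ?thesis by simp
    qed
  qed
  have "indep_vars (\<lambda>k. Pi\<^sub>M (K k) (\<lambda>_. borel)) (\<lambda>k \<omega>. restrict (\<lambda>i. G i \<omega>) (K k)) UNIV"
    by (rule indep_vars_restrict[OF G]) (auto simp: disjoint_family_on_def K_def split: if_splits)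
  then have Yind: "indep_vars (\<lambda>_. borel) Y UNIV"
    unfolding Y_def by (rule indep_vars_compose2) (use m in auto)
  have GG: "indep_var borel (G (0, j)) borel (G (1, j))" for j
  proof -
    have "indep_vars (case_bool borel borel) (case_bool (G (0, j)) (G (1, j))) UNIV"
    proof -
      have "indep_vars (\<lambda>_. borel) (\<lambda>b. G ((if b then 0 else 1 :: nat), j)) (UNIV :: bool set)"
        by (rule indep_vars_reindex_inj[OF G]) (auto simp: inj_on_def split: if_splits)
      then show ?thesis
        by (rule indep_vars_cong[THEN iffD1, rotated -1]) (auto split: bool.split)
    qed
    then show ?thesis by (simp add: indep_var_def)
  qed
  note rot = std_normal_rotate[OF GG N N]
  have mG[measurable]: "G k \<in> borel_measurable M" for k
    using G by (cases k) (simp add: indep_vars_def2)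
  have pair: "indep_var borel (\<lambda>\<omega>. fst (Y k \<omega>)) borel (\<lambda>\<omega>. snd (Y k \<omega>))" for k
  proof (cases k)
    case (Pair i j)
    show ?thesis
    proof (cases "i = 0")
      case True then show ?thesis using rot(1) by (simp add: Pair Y0)
    next
      case False
      have "indep_var borel (G (Suc i, j)) borel (\<lambda>_. 0 :: real)"
        unfolding indep_var_distribution_eq
      proof (intro conjI)
        interpret D: prob_space "distr M borel (G (Suc i, j))" by (rule prob_space_distr) simp
        interpret E: prob_space "distr M borel (\<lambda>_. 0 :: real)" by (rule prob_space_distr) simp
        show "distr M borel (G (Suc i, j)) \<Otimes>\<^sub>M distr M borel (\<lambda>_. 0 :: real) = distr M (borel \<Otimes>\<^sub>M borel) (\<lambda>x. (G (Suc i, j) x, 0))"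
        proof (rule pair_measure_eqI)
          fix A B :: "real set" assume "A \<in> sets (distr M borel (G (Suc i, j)))" "B \<in> sets (distr M borel (\<lambda>_. 0 :: real))"
          then have [measurable]: "A \<in> sets borel" "B \<in> sets borel" by auto
          have "(\<lambda>x. (G (Suc i, j) x, 0::real)) -` (A \<times> B) \<inter> space M = (if 0 \<in> B then G (Suc i, j) -` A \<inter> space M else {})" by auto
          then show "emeasure (distr M borel (G (Suc i, j))) A * emeasure (distr M borel (\<lambda>_. 0)) B
              = emeasure (distr M (borel \<Otimes>\<^sub>M borel) (\<lambda>x. (G (Suc i, j) x, 0))) (A \<times> B)"
            by (simp add: emeasure_distr emeasure_space_1)
        qed (unfold_locales, auto cong: sets_pair_measure_cong)
      qed auto
      then show ?thesis using False by (simp add: Pair Y1)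
    qed
  qed
  define f :: "nat \<times> nat \<Rightarrow> (nat \<times> nat) \<times> bool" where
    "f = (\<lambda>(i, j). if i = 0 then ((0, j div 2), even j) else ((i, j), True))"
  have inj: "inj_on f UNIV"
  proof (rule injI)
    fix x y assume e: "f x = f y"
    obtain i j i' j' where [simp]: "x = (i, j)" "y = (i', j')" by (cases x, cases y)
    show "x = y"
    proof (cases "i = 0 \<and> i' = 0")
      case True
      then have "j div 2 = j' div 2" "even j = even j'" using e by (auto simp: f_def)
      then have "j = j'" by (metis dvd_mult_div_cancel odd_two_times_div_two_succ)
      then show ?thesis using True by simp
    qed (use e in \<open>auto simp: f_def split: if_splits\<close>)
  qed
  have G'f: "G' k = (case f k of (k, b) \<Rightarrow> \<lambda>\<omega>. if b then fst (Y k \<omega>) else snd (Y k \<omega>))" for k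
    by (cases k) (auto simp: G'_def f_def Y0 Y1 fun_eq_iff)
  have "indep_vars (\<lambda>_. borel) (\<lambda>k. (case f k of (k, b) \<Rightarrow> \<lambda>\<omega>. if b then fst (Y k \<omega>) else snd (Y k \<omega>))) UNIV"
    by (rule indep_vars_reindex_inj[OF indep_vars_of_pairs[OF Yind pair] inj]) auto
  then show "indep_vars (\<lambda>_. borel) G' UNIV"
    by (simp add: G'f[abs_def])
  show "distributed M lborel (G' k) std_normal_density" for k
  proof (cases k)
    case (Pair i j)
    show ?thesis using rot(2,3)[of "j div 2"] N[of "(Suc i, j)"]
      by (cases "i = 0"; cases "even j") (simp_all add: Pair G'_def)
  qed
qed

text \<open>Entry j of level m is to be the increment over the dyadic interval from j / 2^m to (j +
  1) / 2^m, multiplied by sqrt (2^m), so that every level is standard normal. The recursion splits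
  an increment at the midpoint of its interval.\<close>

primrec levy_incr :: "(nat \<times> nat \<Rightarrow> real) \<Rightarrow> nat \<Rightarrow> nat \<Rightarrow> real" where
  "levy_incr z 0 j = z (0, j)"
| "levy_incr z (Suc m) j = (levy_incr z m (j div 2) + (if even j then 1 else - 1) * z (Suc m, j div 2)) / sqrt 2"

text \<open>Independence within one level would not survive the refinement, which also needs the
  next row to be independent of that level. The induction therefore carries the array
  \<open>G\<close> made of the current level and all rows not yet used.\<close>

lemma (in prob_space) levy_incr_iid:
  fixes \<zeta> :: "nat \<times> nat \<Rightarrow> 'a \<Rightarrow> real"
  assumes "indep_vars (\<lambda>_. borel) \<zeta> UNIV" "\<And>k. distributed M lborel (\<zeta> k) std_normal_density"
  shows "indep_vars (\<lambda>_. borel) (\<lambda>j \<omega>. levy_incr (\<lambda>k. \<zeta> k \<omega>) m j) UNIV"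
    and "distributed M lborel (\<lambda>\<omega>. levy_incr (\<lambda>k. \<zeta> k \<omega>) m j) std_normal_density"
proof -
  define G where "G m = (\<lambda>(i, j) \<omega>. if i = 0 then levy_incr (\<lambda>k. \<zeta> k \<omega>) m j else \<zeta> (m + i, j) \<omega>)" for m
  have "indep_vars (\<lambda>_. borel) (G m) UNIV \<and> (\<forall>k. distributed M lborel (G m k) std_normal_density)" for m
  proof (induction m)
    case 0
    have "G 0 = \<zeta>" by (auto simp: G_def fun_eq_iff)
    then show ?case using assms by simp
  next
    case (Suc m)
    have "G (Suc m) = (\<lambda>(i, j) \<omega>. if i = 0 then (G m (0, j div 2) \<omega> + (if even j then 1 else - 1) * G m (1, j div 2) \<omega>) / sqrt 2
                          else G m (Suc i, j) \<omega>)"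
      by (auto simp: G_def fun_eq_iff)
    then show ?case using indep_normal_split[of "G m"] Suc by simp
  qed
  then have G: "indep_vars (\<lambda>_. borel) (G m) UNIV" "\<And>k. distributed M lborel (G m k) std_normal_density" for m by auto
  have "indep_vars (\<lambda>_. borel) (\<lambda>j. G m (0, j)) UNIV"
    by (rule indep_vars_reindex_inj[OF G(1)]) (auto simp: inj_on_def)
  then show "indep_vars (\<lambda>_. borel) (\<lambda>j \<omega>. levy_incr (\<lambda>k. \<zeta> k \<omega>) m j) UNIV"
    by (simp add: G_def)
  show "distributed M lborel (\<lambda>\<omega>. levy_incr (\<lambda>k. \<zeta> k \<omega>) m j) std_normal_density"
    using G(2)[of m "(0, j)"] by (simp add: G_def)
qed

section \<open>Independence and normality under almost sure limits\<close>

lemma (in prob_space) bounded_AE_convergence: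
  fixes Z :: "nat \<Rightarrow> 'a \<Rightarrow> 'b::{banach, second_countable_topology}"
  assumes [measurable]: "\<And>m. Z m \<in> borel_measurable M" "Z' \<in> borel_measurable M"
    and "AE \<omega> in M. (\<lambda>m. Z m \<omega>) \<longlonglongrightarrow> Z' \<omega>" and "\<And>m \<omega>. norm (Z m \<omega>) \<le> 1"
  shows "(\<lambda>m. integral\<^sup>L M (Z m)) \<longlonglongrightarrow> integral\<^sup>L M Z'"
  by (rule integral_dominated_convergence[where w="\<lambda>_. 1"]) (use assms in auto)

text \<open>Almost sure convergence does not pass through indicators of half-lines, so the product
  formula is first proved for continuous ramps, by dominated convergence in m; then the ramps shrink
  to the indicators. Half-lines form a generator stable under intersection.\<close>

lemma (in prob_space) indep_vars_AE_limit:
  fixes Y :: "nat \<Rightarrow> 'i \<Rightarrow> 'a \<Rightarrow> real"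
  assumes Y: "\<And>m. indep_vars (\<lambda>_. borel) (Y m) I"
    and X[measurable]: "\<And>i. i \<in> I \<Longrightarrow> X i \<in> borel_measurable M"
    and lim: "\<And>i. i \<in> I \<Longrightarrow> AE \<omega> in M. (\<lambda>m. Y m i \<omega>) \<longlonglongrightarrow> X i \<omega>"
  shows "indep_vars (\<lambda>_. borel) X I"
proof -
  \<comment> \<open>For k > 0 this ramp is 1 up to a, 0 from a + 1 / k on, and linear in
    between.\<close>
  define \<phi> :: "nat \<Rightarrow> real \<Rightarrow> real \<Rightarrow> real" where "\<phi> k a x = max 0 (min 1 (1 - real k * (x - a)))" for k a x
  have \<phi>01: "0 \<le> \<phi> k a x" "\<phi> k a x \<le> 1" for k a x by (auto simp: \<phi>_def)
  have \<phi>m[measurable]: "\<phi> k a \<in> borel_measurable borel" for k a unfolding \<phi>_def by measurable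
  have \<phi>c: "continuous_on UNIV (\<phi> k a)" for k a
    unfolding \<phi>_def by (intro continuous_intros)
  have \<phi>lim: "(\<lambda>k. \<phi> k a x) \<longlonglongrightarrow> indicator {..a} x" for a x
  proof (cases "x \<le> a")
    case True
    have "\<phi> k a x = 1" for k using True by (simp add: \<phi>_def max_def min_def mult_nonneg_nonpos)
    then show ?thesis using True by simp
  next
    case False
    obtain K :: nat where K: "1 / (x - a) \<le> real K" using real_arch_simple by blast
    have "\<phi> k a x = 0" if "k \<ge> K" for k
    proof -
      have "1 / (x - a) \<le> real k" using K that by (meson of_nat_le_iff order_trans)
      then have "1 \<le> real k * (x - a)" using False by (simp add: field_simps)
      then show ?thesis by (simp add: \<phi>_def)
    qed
    then have "\<forall>\<^sub>F k in sequentially. \<phi> k a x = 0" by (auto simp: eventually_sequentially)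
    then show ?thesis using False by (simp add: tendsto_eventually)
  qed
  have mY: "i \<in> I \<Longrightarrow> Y m i \<in> borel_measurable M" for m i using Y[of m] by (simp add: indep_vars_def2)
  let ?F = "\<lambda>i. {X i -` A \<inter> space M |A. A \<in> range (\<lambda>a. {..a})}"
  have cdf: "prob (\<Inter>i\<in>J. X i -` {..a i} \<inter> space M) = (\<Prod>i\<in>J. prob (X i -` {..a i} \<inter> space M))"
    if J: "J \<subseteq> I" "finite J" "J \<noteq> {}" for J a
  proof -
    have mX[measurable]: "i \<in> J \<Longrightarrow> X i \<in> borel_measurable M" for i using J X by auto
    have mYJ[measurable]: "i \<in> J \<Longrightarrow> Y m i \<in> borel_measurable M" for i m using J mY by auto
    have aeJ: "AE \<omega> in M. \<forall>i\<in>J. (\<lambda>m. Y m i \<omega>) \<longlonglongrightarrow> X i \<omega>"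
      using lim J by (auto intro!: AE_finite_allI)
    have step: "(\<integral>\<omega>. (\<Prod>i\<in>J. \<phi> k (a i) (X i \<omega>)) \<partial>M) = (\<Prod>i\<in>J. \<integral>\<omega>. \<phi> k (a i) (X i \<omega>) \<partial>M)" for k
    proof (rule LIMSEQ_unique)
      show "(\<lambda>m. \<integral>\<omega>. (\<Prod>i\<in>J. \<phi> k (a i) (Y m i \<omega>)) \<partial>M) \<longlonglongrightarrow> (\<integral>\<omega>. (\<Prod>i\<in>J. \<phi> k (a i) (X i \<omega>)) \<partial>M)"
      proof (rule bounded_AE_convergence)
        show "AE \<omega> in M. (\<lambda>m. \<Prod>i\<in>J. \<phi> k (a i) (Y m i \<omega>)) \<longlonglongrightarrow> (\<Prod>i\<in>J. \<phi> k (a i) (X i \<omega>))"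
          using aeJ by eventually_elim
            (intro tendsto_prod, auto intro!: continuous_on_tendsto_compose[OF \<phi>c])
        show "norm (\<Prod>i\<in>J. \<phi> k (a i) (Y m i \<omega>)) \<le> 1" for m \<omega>
          using \<phi>01 by (simp add: abs_prod prod_le_1)
      qed measurable
      have "(\<integral>\<omega>. (\<Prod>i\<in>J. \<phi> k (a i) (Y m i \<omega>)) \<partial>M) = (\<Prod>i\<in>J. \<integral>\<omega>. \<phi> k (a i) (Y m i \<omega>) \<partial>M)" for m
      proof (rule indep_vars_lebesgue_integral[OF J(2)])
        show "indep_vars (\<lambda>_. borel) (\<lambda>i \<omega>. \<phi> k (a i) (Y m i \<omega>)) J"
          by (rule indep_vars_compose2[OF indep_vars_subset[OF Y J(1)]]) auto
        show "integrable M (\<lambda>\<omega>. \<phi> k (a i) (Y m i \<omega>))" if "i \<in> J" for i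
          by (rule integrable_const_bound[where B=1]) (use \<phi>01 that in auto)
      qed
      moreover have "(\<lambda>m. \<Prod>i\<in>J. \<integral>\<omega>. \<phi> k (a i) (Y m i \<omega>) \<partial>M) \<longlonglongrightarrow> (\<Prod>i\<in>J. \<integral>\<omega>. \<phi> k (a i) (X i \<omega>) \<partial>M)"
      proof (intro tendsto_prod bounded_AE_convergence)
        fix i assume i: "i \<in> J"
        show "AE \<omega> in M. (\<lambda>m. \<phi> k (a i) (Y m i \<omega>)) \<longlonglongrightarrow> \<phi> k (a i) (X i \<omega>)"
          using aeJ by eventually_elim (use i in \<open>auto intro!: continuous_on_tendsto_compose[OF \<phi>c]\<close>)
      qed (use \<phi>01 in auto)
      ultimately show "(\<lambda>m. \<integral>\<omega>. (\<Prod>i\<in>J. \<phi> k (a i) (Y m i \<omega>)) \<partial>M) \<longlonglongrightarrow> (\<Prod>i\<in>J. \<integral>\<omega>. \<phi> k (a i) (X i \<omega>) \<partial>M)"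
        by simp
    qed
    have "(\<integral>\<omega>. (\<Prod>i\<in>J. indicator {..a i} (X i \<omega>)) \<partial>M) = (\<Prod>i\<in>J. \<integral>\<omega>. indicator {..a i} (X i \<omega>) \<partial>M :: real)"
    proof (rule LIMSEQ_unique)
      show "(\<lambda>k. \<integral>\<omega>. (\<Prod>i\<in>J. \<phi> k (a i) (X i \<omega>)) \<partial>M) \<longlonglongrightarrow> (\<integral>\<omega>. (\<Prod>i\<in>J. indicator {..a i} (X i \<omega>)) \<partial>M)"
      proof (rule bounded_AE_convergence)
        show "AE \<omega> in M. (\<lambda>k. \<Prod>i\<in>J. \<phi> k (a i) (X i \<omega>)) \<longlonglongrightarrow> (\<Prod>i\<in>J. indicator {..a i} (X i \<omega>))"
          by (intro AE_I2 tendsto_prod \<phi>lim)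
        show "norm (\<Prod>i\<in>J. \<phi> m (a i) (X i \<omega>)) \<le> 1" for m \<omega>
          using \<phi>01 by (simp add: abs_prod prod_le_1)
      qed measurable
      show "(\<lambda>k. \<integral>\<omega>. (\<Prod>i\<in>J. \<phi> k (a i) (X i \<omega>)) \<partial>M) \<longlonglongrightarrow> (\<Prod>i\<in>J. \<integral>\<omega>. indicator {..a i} (X i \<omega>) \<partial>M)"
        unfolding step
        by (intro tendsto_prod bounded_AE_convergence AE_I2 \<phi>lim) (use \<phi>01 in auto)
    qed
    moreover have "(\<integral>\<omega>. (\<Prod>i\<in>J. indicator {..a i} (X i \<omega>)) \<partial>M) = prob (\<Inter>i\<in>J. X i -` {..a i} \<inter> space M)"
    proof -
      have "(\<Inter>i\<in>J. X i -` {..a i} \<inter> space M) \<in> events"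
        by (intro sets.finite_INT J) auto
      moreover have "(\<integral>\<omega>. (\<Prod>i\<in>J. indicator {..a i} (X i \<omega>)) \<partial>M)
          = (\<integral>\<omega>. indicator (\<Inter>i\<in>J. X i -` {..a i} \<inter> space M) \<omega> \<partial>M :: real)"
      proof (intro Bochner_Integration.integral_cong refl)
        fix \<omega> assume w: "\<omega> \<in> space M"
        show "(\<Prod>i\<in>J. indicator {..a i} (X i \<omega>)) = (indicator (\<Inter>i\<in>J. X i -` {..a i} \<inter> space M) \<omega> :: real)"
        proof (cases "\<forall>i\<in>J. X i \<omega> \<le> a i")
          case True then show ?thesis using w J by (auto simp: indicator_def intro!: prod.neutral)
        next
          case False
          then obtain i where i: "i \<in> J" "\<not> X i \<omega> \<le> a i" by auto
          have p0: "(\<Prod>i\<in>J. indicator {..a i} (X i \<omega>)) = (0::real)"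
            by (rule prod_zero) (use i J in \<open>auto intro!: bexI[of _ i]\<close>)
          have "\<omega> \<notin> (\<Inter>i\<in>J. X i -` {..a i} \<inter> space M)" using i by auto
          then show ?thesis by (rule trans[OF p0 sym[OF indicator_simps(2)]])
        qed
      qed
      ultimately show ?thesis by simp
    qed
    moreover have "(\<integral>\<omega>. indicator {..a i} (X i \<omega>) \<partial>M) = prob (X i -` {..a i} \<inter> space M)" if "i \<in> J" for i
    proof -
      have "(\<integral>\<omega>. indicator {..a i} (X i \<omega>) \<partial>M) = (\<integral>\<omega>. indicator (X i -` {..a i} \<inter> space M) \<omega> \<partial>M :: real)"
        by (intro Bochner_Integration.integral_cong refl) (auto simp: indicator_def)
      moreover have "X i -` {..a i} \<inter> space M \<in> events" using that by measurable
      ultimately show ?thesis by simp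
    qed
    ultimately show ?thesis by simp
  qed
  have "indep_sets ?F I"
  proof (rule indep_setsI)
    show "?F i \<subseteq> events" if "i \<in> I" for i using X[OF that] by (auto intro: measurable_sets)
    fix A J assume J: "J \<noteq> {}" "J \<subseteq> I" "finite J" and "\<forall>j\<in>J. A j \<in> ?F j"
    then have "\<forall>j\<in>J. \<exists>a. A j = X j -` {..a} \<inter> space M" by blast
    from bchoice[OF this] obtain a where a: "\<And>j. j \<in> J \<Longrightarrow> A j = X j -` {..a j} \<inter> space M" by blast
    then show "prob (\<Inter>j\<in>J. A j) = (\<Prod>j\<in>J. prob (A j))"
      using cdf[OF J(2,3,1), of a] by simp
  qed
  then have "indep_sets (\<lambda>i. sigma_sets (space M) (?F i)) I"
  proof (rule indep_sets_sigma)
    show "Int_stable (?F i)" for i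
    proof (rule Int_stableI)
      fix A B assume "A \<in> ?F i" "B \<in> ?F i"
      then obtain a b where "A = X i -` {..a} \<inter> space M" "B = X i -` {..b} \<inter> space M" by blast
      then have "A \<inter> B = X i -` {..min a b} \<inter> space M" by auto
      then show "A \<inter> B \<in> ?F i" by blast
    qed
  qed
  moreover have "sigma_sets (space M) (?F i) = {X i -` A \<inter> space M |A. A \<in> sets borel}" for i
    by (subst sigma_sets_vimage_commute[symmetric, of _ _ UNIV]) (auto simp: borel_eq_atMost)
  ultimately have "indep_sets (\<lambda>i. {X i -` A \<inter> space M |A. A \<in> sets borel}) I" by simp
  then show ?thesis using X by (simp add: indep_vars_def2)
qed

text \<open>Divided by their standard deviations, all approximants have the same law, so their
  characteristic functions form a constant sequence that converges to the one of \<open>V\<close>.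
  Uniqueness of characteristic functions then identifies the law.\<close>

lemma (in prob_space) normal_AE_limit:
  assumes Y: "\<And>m. distributed M lborel (Y m) (normal_density 0 (sqrt (v m)))" "\<And>m. 0 < v m"
    and v: "v \<longlonglongrightarrow> w" "0 < w"
    and X[measurable]: "X \<in> borel_measurable M"
    and lim: "AE \<omega> in M. (\<lambda>m. Y m \<omega>) \<longlonglongrightarrow> X \<omega>"
  shows "distributed M lborel X (normal_density 0 (sqrt w))"
proof -
  define U where "U m \<omega> = Y m \<omega> / sqrt (v m)" for m \<omega>
  define V where "V \<omega> = X \<omega> / sqrt w" for \<omega>
  have U: "distributed M lborel (U m) std_normal_density" for m
    using normal_standard_normal_convert[of "sqrt (v m)" "Y m" 0] Y[of m] by (simp add: U_def[abs_def])
  have mU[measurable]: "U m \<in> borel_measurable M" for m using distributed_measurable[OF U[of m]] by simp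
  have mV[measurable]: "V \<in> borel_measurable M" unfolding V_def by measurable
  have dU: "distr M borel (U m) = std_normal_distribution" for m
    using distributed_distr_eq_density[OF U[of m]] by (simp cong: distr_cong)
  have limU: "AE \<omega> in M. (\<lambda>m. U m \<omega>) \<longlonglongrightarrow> V \<omega>"
    using lim unfolding U_def V_def
    by eventually_elim (intro tendsto_intros, use v in auto)
  have ch: "char (distr M borel Z) t = (\<integral>\<omega>. iexp (t * Z \<omega>) \<partial>M)" if [measurable]: "Z \<in> borel_measurable M" for Z t
    unfolding char_def by (subst integral_distr) auto
  have "char (distr M borel V) = char std_normal_distribution"
  proof
    fix t
    have "(\<lambda>m. char (distr M borel (U m)) t) \<longlonglongrightarrow> char (distr M borel V) t"
      unfolding ch[OF mU] ch[OF mV]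
    proof (rule bounded_AE_convergence)
      show "AE \<omega> in M. (\<lambda>m. iexp (t * U m \<omega>)) \<longlonglongrightarrow> iexp (t * V \<omega>)"
        using limU by eventually_elim (intro tendsto_intros)
    qed auto
    then have "(\<lambda>m. char std_normal_distribution t) \<longlonglongrightarrow> char (distr M borel V) t"
      by (simp add: dU)
    then show "char (distr M borel V) t = char std_normal_distribution t"
      by (simp add: LIMSEQ_const_iff)
  qed
  then have "distr M borel V = std_normal_distribution"
    by (intro Levy_uniqueness real_distribution_distr real_dist_normal_dist) auto
  then have "distr M lborel V = density lborel (\<lambda>x. ennreal (std_normal_density x))"
    by (simp cong: distr_cong)
  then have "distributed M lborel V std_normal_density"
    by (simp add: distributed_def)
  then show ?thesis
    using normal_standard_normal_convert[of "sqrt w" X 0] v(2) by (simp add: V_def[abs_def])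
qed

section \<open>Levy's construction of Brownian motion\<close>

text \<open>The Faber-Schauder tent on [0, 1]: the primitive of a Haar function, scaled to height
  1.\<close>

definition tent :: "real \<Rightarrow> real" where
  "tent s = max 0 (1 - \<bar>2 * s - 1\<bar>)"

definition hat_row :: "(nat \<Rightarrow> real) \<Rightarrow> real \<Rightarrow> real" where
  "hat_row c t = c (nat \<lfloor>t\<rfloor>) * tent (frac t)"

definition lin_walk :: "(nat \<Rightarrow> real) \<Rightarrow> real \<Rightarrow> real" where
  "lin_walk c t = (\<Sum>j<nat \<lfloor>t\<rfloor>. c j) + frac t * c (nat \<lfloor>t\<rfloor>)"

lemma tent_bounds: "0 \<le> tent s" "tent s \<le> 1"
  by (auto simp: tent_def)

lemma tent_outside: "s \<le> 0 \<or> 1 \<le> s \<Longrightarrow> tent s = 0"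
  by (auto simp: tent_def)

lemma tent_half: "0 \<le> s \<Longrightarrow> s \<le> 1 \<Longrightarrow> tent (s / 2) = s"
    "0 \<le> s \<Longrightarrow> s \<le> 1 \<Longrightarrow> tent ((1 + s) / 2) = 1 - s"
  by (auto simp: tent_def field_simps)

lemma floor_frac_nat_add:
  assumes "0 \<le> s" "s < 1"
  shows "nat \<lfloor>real j + s\<rfloor> = j" "frac (real j + s) = s"
proof -
  have "\<lfloor>real j + s\<rfloor> = int j" using assms by (intro floor_unique) auto
  then show "nat \<lfloor>real j + s\<rfloor> = j" "frac (real j + s) = s" by (auto simp: frac_def)
qed

lemma hat_row_at:
  assumes "0 \<le> s" "s \<le> 1"
  shows "hat_row c (real j + s) = c j * tent s"
proof (cases "s = 1")
  case True
  then show ?thesis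
    using floor_frac_nat_add[of 0 "Suc j"] by (simp add: hat_row_def tent_outside frac_def add.commute)
next
  case False
  then show ?thesis using floor_frac_nat_add[of s j] assms by (simp add: hat_row_def)
qed

lemma lin_walk_at:
  assumes "0 \<le> s" "s \<le> 1"
  shows "lin_walk c (real j + s) = (\<Sum>i<j. c i) + s * c j"
proof (cases "s = 1")
  case True
  then show ?thesis
    using floor_frac_nat_add[of 0 "Suc j"] by (simp add: lin_walk_def add.commute)
next
  case False
  then show ?thesis using floor_frac_nat_add[of s j] assms by (simp add: lin_walk_def)
qed

lemma nonneg_real_nat_frac:
  assumes "0 \<le> (t::real)"
  obtains j s where "t = real j + s" "0 \<le> s" "s < 1" "j = nat \<lfloor>t\<rfloor>"
proof (rule that[of "nat \<lfloor>t\<rfloor>" "frac t"])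
  show "t = real (nat \<lfloor>t\<rfloor>) + frac t" using assms by (simp add: frac_def)
qed (simp_all add: frac_lt_1)

text \<open>Floors and fractional parts hide continuity. On a bounded range the row is a finite sum
  of translated tents, which is visibly continuous; \<open>lin_walk\<close> is treated by the same
  device.\<close>

lemma hat_row_sum:
  assumes "0 \<le> t" "t < real K"
  shows "hat_row c t = (\<Sum>j<K. c j * tent (t - real j))"
proof -
  obtain j s where j: "t = real j + s" "0 \<le> s" "s < 1" using nonneg_real_nat_frac[OF assms(1)] .
  have "j < K" using j assms by linarith
  then have "(\<Sum>i<K. c i * tent (t - real i)) = (\<Sum>i\<in>{j}. c i * tent (t - real i))"
  proof (intro sum.mono_neutral_right ballI)
    fix i assume "i \<in> {..<K} - {j}"
    then consider "i < j" | "i > j" by fastforce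
    then have "tent (t - real i) = 0"
      by cases (rule tent_outside, use j in linarith)+
    then show "c i * tent (t - real i) = 0" by simp
  qed auto
  then show ?thesis using j hat_row_at[of s c j] by simp
qed

lemma lin_walk_sum:
  assumes "0 \<le> t" "t < real K"
  shows "lin_walk c t = (\<Sum>j<K. c j * max 0 (min 1 (t - real j)))"
proof -
  obtain j s where j: "t = real j + s" "0 \<le> s" "s < 1" using nonneg_real_nat_frac[OF assms(1)] .
  have jK: "j < K" using j assms by linarith
  have "(\<Sum>i<K. c i * max 0 (min 1 (t - real i))) = (\<Sum>i\<in>insert j {..<j}. c i * max 0 (min 1 (t - real i)))"
  proof (intro sum.mono_neutral_right ballI)
    fix i assume "i \<in> {..<K} - insert j {..<j}"
    then have "i > j" by auto
    then show "c i * max 0 (min 1 (t - real i)) = 0" using j by auto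
  qed (use jK in auto)
  also have "\<dots> = s * c j + (\<Sum>i<j. c i * max 0 (min 1 (t - real i)))"
    using j by simp
  also have "(\<Sum>i<j. c i * max 0 (min 1 (t - real i))) = (\<Sum>i<j. c i)"
    using j by (intro sum.cong) auto
  finally show ?thesis using lin_walk_at[of s c j] j by simp
qed

text \<open>The windows [0, K) are relatively open in the half-line and exhaust it, so continuity
  may be shown with bounds that depend on K.\<close>

lemma continuous_on_nonneg_local:
  fixes f :: "real \<Rightarrow> real"
  assumes "\<And>K::nat. continuous_on {0..<real K} f"
  shows "continuous_on {0..} f"
  unfolding continuous_on_eq_continuous_within
proof
  fix t :: real assume t: "t \<in> {0..}"
  obtain K :: nat where K: "t < real K" using reals_Archimedean2 by blast
  have "continuous (at t within {0..<real K}) f"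
    using assms[of K] K t by (simp add: continuous_on_eq_continuous_within)
  moreover have "at t within {0..<real K} = at t within {0..}"
    by (rule at_within_nhd[of _ "{..<real K}"]) (use K in auto)
  ultimately show "continuous (at t within {0..}) f" by simp
qed

lemma hat_row_continuous: "continuous_on {0..} (hat_row c)"
proof (rule continuous_on_nonneg_local)
  fix K :: nat
  have "continuous_on {0..<real K} (\<lambda>t. \<Sum>j<K. c j * tent (t - real j))"
    unfolding tent_def by (intro continuous_intros)
  then show "continuous_on {0..<real K} (hat_row c)"
    by (rule continuous_on_eq) (auto simp: hat_row_sum)
qed

lemma lin_walk_continuous: "continuous_on {0..} (lin_walk c)"
proof (rule continuous_on_nonneg_local)
  fix K :: nat
  have "continuous_on {0..<real K} (\<lambda>t. \<Sum>j<K. c j * max 0 (min 1 (t - real j)))"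
    by (intro continuous_intros)
  then show "continuous_on {0..<real K} (lin_walk c)"
    by (rule continuous_on_eq) (auto simp: lin_walk_sum)
qed

text \<open>The midpoint of a Brownian bridge over an interval of length 2^(-m) has standard
  deviation 1 / (2 * sqrt (2^m)), which is the scale of these tents. Level m reads row
  \<open>Suc m\<close>, since row 0 supplies the increments over unit intervals.\<close>

definition levy_term :: "(nat \<times> nat \<Rightarrow> real) \<Rightarrow> nat \<Rightarrow> real \<Rightarrow> real" where
  "levy_term z m t = hat_row (\<lambda>j. z (Suc m, j)) (2 ^ m * t) / (2 * sqrt (2 ^ m))"

definition levy_partial :: "(nat \<times> nat \<Rightarrow> real) \<Rightarrow> nat \<Rightarrow> real \<Rightarrow> real" where
  "levy_partial z m t = lin_walk (\<lambda>j. z (0, j)) t + (\<Sum>i<m. levy_term z i t)"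

text \<open>On each level-m interval the partial sum is a straight line whose slope is fixed by
  \<open>levy_incr\<close>. The parity of the index tells whether the interval is the left or the
  right half of its parent, that is, whether the added tent goes up or down on it.\<close>

lemma levy_partial_linear:
  assumes "0 \<le> s" "s \<le> 1"
  shows "levy_partial z m ((real j + s) / 2 ^ m)
     = levy_partial z m (real j / 2 ^ m) + s * levy_incr z m j / sqrt (2 ^ m)"
  using assms
proof (induction m arbitrary: j s)
  case 0
  then show ?case using lin_walk_at[of s _ j] lin_walk_at[of 0 _ j] by (simp add: levy_partial_def)
next
  case (Suc m k s)
  define j where "j = k div 2"
  define e where "e = levy_incr z m j"
  define \<zeta> where "\<zeta> = z (Suc m, j)"
  define q :: real where "q = sqrt (2 ^ m)"
  have q: "q > 0" "sqrt (2 ^ Suc m) = q * sqrt 2" by (auto simp: q_def real_sqrt_mult mult.commute)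
  have s2: "sqrt 2 * sqrt 2 = (2::real)" by simp
  have tm: "levy_term z m ((real j + u) / 2 ^ m) = \<zeta> * tent u / (2 * q)" if "0 \<le> u" "u \<le> 1" for u
    using hat_row_at[OF that, of _ j] by (simp add: levy_term_def \<zeta>_def q_def)
  have lin: "levy_partial z (Suc m) ((real j + u) / 2 ^ m) = levy_partial z m (real j / 2 ^ m) + u * e / q + \<zeta> * tent u / (2 * q)"
    if "0 \<le> u" "u \<le> 1" for u
    using Suc.IH[OF that, of j] tm[OF that] by (simp add: levy_partial_def e_def q_def)
  show ?case
  proof (cases "even k")
    case True
    then have k: "real k = 2 * real j" by (auto simp: j_def)
    have 1: "(real k + s) / 2 ^ Suc m = (real j + s / 2) / 2 ^ m" "real k / 2 ^ Suc m = (real j + 0) / 2 ^ m"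
      by (simp_all add: k field_simps)
    show ?thesis
      unfolding 1 using lin[of "s / 2"] lin[of 0] Suc.prems True q
      by (simp add: tent_half tent_outside j_def[symmetric] e_def[symmetric] \<zeta>_def[symmetric] del: power_Suc)
         (simp add: field_simps)
  next
    case False
    then have k: "real k = 2 * real j + 1" unfolding j_def by (metis False odd_two_times_div_two_succ of_nat_Suc of_nat_mult of_nat_numeral add.commute Suc_eq_plus1)
    have 1: "(real k + s) / 2 ^ Suc m = (real j + (1 + s) / 2) / 2 ^ m" "real k / 2 ^ Suc m = (real j + 1 / 2) / 2 ^ m"
      by (simp_all add: k field_simps)
    have "tent (1/2) = 1" by (simp add: tent_def)
    then show ?thesis
      unfolding 1 using lin[of "(1 + s) / 2"] lin[of "1/2"] Suc.prems False q
      by (simp add: tent_half tent_outside j_def[symmetric] e_def[symmetric] \<zeta>_def[symmetric] del: power_Suc)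
         (simp add: field_simps)
  qed
qed

lemma levy_partial_dyadic:
  "levy_partial z m (real j / 2 ^ m) = (\<Sum>i<j. levy_incr z m i) / sqrt (2 ^ m)"
proof (induction j)
  case 0
  have "hat_row c 0 = 0" "lin_walk c 0 = 0" for c by (simp_all add: hat_row_def lin_walk_def tent_def)
  then show ?case by (simp add: levy_partial_def levy_term_def)
next
  case (Suc j)
  then show ?case using levy_partial_linear[of 1 z m j] by (simp add: add.commute add_divide_distrib)
qed

text \<open>The exponent 1/3 meets two demands. It is below 1/2, so that tents of height 2^(m/3) /
  2^(m/2) are summable, and above 1/4, so that the fourth-moment union bound m * 2^m / 2^(4m/3) over
  the m * 2^m variables is summable. That many indices cover the times in [0, m), hence eventually
  every bounded range.\<close>

definition levy_good :: "(nat \<times> nat \<Rightarrow> real) \<Rightarrow> bool" where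
  "levy_good z \<longleftrightarrow> (\<exists>m0. \<forall>m\<ge>m0. \<forall>j<m * 2 ^ m. \<bar>z (Suc m, j)\<bar> \<le> 2 powr (real m / 3))"

text \<open>The value 0 off the good event makes continuity and the start at 0 hold for every sample
  point, as \<open>standard_brownian_motion\<close> demands, and not merely almost surely.\<close>

definition levy_path :: "(nat \<times> nat \<Rightarrow> real) \<Rightarrow> real \<Rightarrow> real" where
  "levy_path z t = (if levy_good z then lin_walk (\<lambda>j. z (0, j)) t + (\<Sum>i. levy_term z i t) else 0)"

lemma levy_path_continuous: "continuous_on {0..} (levy_path z)"
proof (cases "levy_good z")
  case True
  then obtain m0 where m0: "\<And>m j. m \<ge> m0 \<Longrightarrow> j < m * 2 ^ m \<Longrightarrow> \<bar>z (Suc m, j)\<bar> \<le> 2 powr (real m / 3)"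
    by (auto simp: levy_good_def)
  have "continuous_on {0..} (\<lambda>t. \<Sum>i. levy_term z i t)"
  proof (rule continuous_on_nonneg_local)
    fix K :: nat
    have "uniform_limit {0..<real K} (\<lambda>n t. \<Sum>i<n. levy_term z i t) (\<lambda>t. \<Sum>i. levy_term z i t) sequentially"
    proof (rule Weierstrass_m_test_ev)
      show "summable (\<lambda>m. (2 powr (- 1 / 6) :: real) ^ m)"
        by (rule summable_geometric) (simp add: powr_less_one)
      show "\<forall>\<^sub>F m in sequentially. \<forall>t\<in>{0..<real K}. norm (levy_term z m t) \<le> (2 powr (- 1 / 6)) ^ m"
        unfolding eventually_sequentially
      proof (intro exI[of _ "max m0 K"] allI impI ballI)
        fix m t assume m: "max m0 K \<le> m" and t: "t \<in> {0..<real K}"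
        let ?j = "nat \<lfloor>2 ^ m * t\<rfloor>"
        have "2 ^ m * t < 2 ^ m * real K" using t by simp
        also have "\<dots> \<le> real (m * 2 ^ m)" using m by simp
        finally have "\<lfloor>2 ^ m * t\<rfloor> < int (m * 2 ^ m)" by (simp add: floor_less_iff)
        moreover have "0 \<le> \<lfloor>2 ^ m * t\<rfloor>" using t by simp
        ultimately have j: "?j < m * 2 ^ m" by linarith
        have "norm (levy_term z m t) = \<bar>z (Suc m, ?j)\<bar> * tent (frac (2 ^ m * t)) / (2 * sqrt (2 ^ m))"
          using tent_bounds(1) by (simp add: levy_term_def hat_row_def abs_mult)
        also have "\<dots> \<le> 2 powr (real m / 3) * 1 / sqrt (2 ^ m)"
          using m0[OF _ j] m tent_bounds by (intro frac_le mult_mono) auto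
        also have "sqrt (2 ^ m) = 2 powr (real m / 2)"
          by (simp add: powr_half_sqrt[symmetric] powr_realpow[symmetric] powr_powr)
        also have "2 powr (real m / 3) * 1 / 2 powr (real m / 2) = 2 powr (real m / 3 - real m / 2)"
          by (simp only: powr_diff mult_1_right)
        also have "real m / 3 - real m / 2 = (- 1 / 6) * real m" by simp
        also have "2 powr ((- 1 / 6) * real m) = (2 powr (- 1 / 6)) ^ m"
          by (subst powr_powr[symmetric]) (simp add: powr_realpow)
        finally show "norm (levy_term z m t) \<le> (2 powr (- 1 / 6)) ^ m" .
      qed
    qed
    then show "continuous_on {0..<real K} (\<lambda>t. \<Sum>i. levy_term z i t)"
    proof (rule uniform_limit_theorem[rotated])
      show "\<forall>\<^sub>F n in sequentially. continuous_on {0..<real K} (\<lambda>t. \<Sum>i<n. levy_term z i t)"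
      proof (intro always_eventually allI continuous_on_sum)
        fix i
        show "continuous_on {0..<real K} (levy_term z i)"
          unfolding levy_term_def
          by (intro continuous_intros continuous_on_compose2[OF hat_row_continuous]) auto
      qed
    qed simp
  qed
  then have "continuous_on {0..} (\<lambda>t. lin_walk (\<lambda>j. z (0, j)) t + (\<Sum>i. levy_term z i t))"
    by (intro continuous_on_add lin_walk_continuous)
  then show ?thesis by (rule continuous_on_eq) (simp add: levy_path_def True)
qed (simp add: levy_path_def)

text \<open>Tents of level m and higher vanish at the multiples of 2^(-m), so at these points the
  series is the finite partial sum.\<close>

lemma levy_path_dyadic:
  assumes "levy_good z"
  shows "levy_path z (real j / 2 ^ m) = (\<Sum>i<j. levy_incr z m i) / sqrt (2 ^ m)"
proof -
  have "(\<Sum>i. levy_term z i (real j / 2 ^ m)) = (\<Sum>i<m. levy_term z i (real j / 2 ^ m))"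
  proof (rule suminf_finite)
    fix i assume "i \<notin> {..<m}"
    then have "(2::real) ^ i = 2 ^ (i - m) * 2 ^ m" by (simp add: power_add[symmetric])
    then have "2 ^ i * (real j / 2 ^ m) = real (2 ^ (i - m) * j) + 0" by simp
    then show "levy_term z i (real j / 2 ^ m) = 0"
      unfolding levy_term_def using hat_row_at[of 0 _ "2 ^ (i - m) * j"] by (simp only:) (simp add: tent_outside)
  qed simp
  then show ?thesis
    using levy_partial_dyadic[of z m j] assms by (simp add: levy_path_def levy_partial_def)
qed

lemma levy_path_0: "levy_path z 0 = 0"
  using levy_path_dyadic[of z 0 0] by (cases "levy_good z") (simp_all add: levy_path_def)

section \<open>Fourth moments of Gaussian variables\<close>

lemma (in prob_space) normal_fourth_moment:
  assumes X: "distributed M lborel X (normal_density 0 \<sigma>)" and \<sigma>: "0 < \<sigma>"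
  shows "integrable M (\<lambda>\<omega>. X \<omega> ^ 4)" "expectation (\<lambda>\<omega>. X \<omega> ^ 4) = 3 * \<sigma> ^ 4"
proof -
  have h: "has_bochner_integral lborel (\<lambda>x. normal_density 0 \<sigma> x * x ^ 4) (3 * \<sigma> ^ 4)"
    using normal_moment_even[OF \<sigma>, of 0 2] \<sigma> by (simp add: fact_numeral field_simps)
  show "integrable M (\<lambda>\<omega>. X \<omega> ^ 4)"
    using distributed_integrable[OF X, of "\<lambda>x. x ^ 4"] h by (auto simp: has_bochner_integral_iff)
  show "expectation (\<lambda>\<omega>. X \<omega> ^ 4) = 3 * \<sigma> ^ 4"
    using distributed_integral[OF X, of "\<lambda>x. x ^ 4"] h by (auto simp: has_bochner_integral_iff)
qed

lemma (in prob_space) fourth_moment_Markov: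
  assumes [measurable]: "X \<in> borel_measurable M" and int: "integrable M (\<lambda>\<omega>. X \<omega> ^ 4)" and a: "(0::real) < a"
  shows "prob {\<omega> \<in> space M. a \<le> \<bar>X \<omega>\<bar>} \<le> expectation (\<lambda>\<omega>. X \<omega> ^ 4) / a ^ 4"
proof -
  have "{\<omega> \<in> space M. a \<le> \<bar>X \<omega>\<bar>} \<subseteq> {\<omega> \<in> space M. a ^ 4 \<le> X \<omega> ^ 4}"
    using power_mono[of a "\<bar>X _\<bar>" 4] a by auto
  then have "prob {\<omega> \<in> space M. a \<le> \<bar>X \<omega>\<bar>} \<le> prob {\<omega> \<in> space M. a ^ 4 \<le> X \<omega> ^ 4}"
    by (intro finite_measure_mono) auto
  also have "\<dots> \<le> expectation (\<lambda>\<omega>. X \<omega> ^ 4) / a ^ 4"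
    by (rule integral_Markov_inequality_measure[where A="{}"]) (use int a in auto)
  finally show ?thesis .
qed

lemma dyadic_floor_tendsto:
  assumes "0 \<le> (t::real)"
  shows "(\<lambda>m. real (nat \<lfloor>2 ^ m * t\<rfloor>) / 2 ^ m) \<longlonglongrightarrow> t"
proof (rule tendsto_sandwich[of "\<lambda>m. t - (1/2) ^ m" _ _ "\<lambda>m. t"])
  show "\<forall>\<^sub>F m in sequentially. t - (1/2) ^ m \<le> real (nat \<lfloor>2 ^ m * t\<rfloor>) / 2 ^ m"
  proof (intro always_eventually allI)
    fix m
    have "2 ^ m * t - 1 \<le> real (nat \<lfloor>2 ^ m * t\<rfloor>)" by linarith
    then have "(2 ^ m * t - 1) / 2 ^ m \<le> real (nat \<lfloor>2 ^ m * t\<rfloor>) / 2 ^ m" by (rule divide_right_mono) simp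
    then show "t - (1/2) ^ m \<le> real (nat \<lfloor>2 ^ m * t\<rfloor>) / 2 ^ m" by (simp add: field_simps power_one_over)
  qed
  show "\<forall>\<^sub>F m in sequentially. real (nat \<lfloor>2 ^ m * t\<rfloor>) / 2 ^ m \<le> t"
  proof (intro always_eventually allI)
    fix m
    have "0 \<le> 2 ^ m * t" using assms by simp
    then have "real (nat \<lfloor>2 ^ m * t\<rfloor>) \<le> 2 ^ m * t" by linarith
    then show "real (nat \<lfloor>2 ^ m * t\<rfloor>) / 2 ^ m \<le> t" by (simp add: field_simps)
  qed
  have "(\<lambda>m. t - (1/2) ^ m) \<longlonglongrightarrow> t - 0"
    by (intro tendsto_intros LIMSEQ_power_zero) auto
  then show "(\<lambda>m. t - (1/2) ^ m) \<longlonglongrightarrow> t" by simp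
qed simp

section \<open>Brownian motion from a double array of Gaussians\<close>

locale gaussian_array = prob_space M for M :: "'a measure" +
  fixes \<zeta> :: "nat \<times> nat \<Rightarrow> 'a \<Rightarrow> real"
  assumes indep: "indep_vars (\<lambda>_. borel) \<zeta> UNIV"
    and normal: "\<And>k. distributed M lborel (\<zeta> k) std_normal_density"
begin

definition B :: "real \<Rightarrow> 'a \<Rightarrow> real" where
  "B t \<omega> = levy_path (\<lambda>k. \<zeta> k \<omega>) t"

abbreviation e :: "nat \<Rightarrow> nat \<Rightarrow> 'a \<Rightarrow> real" where
  "e m j \<omega> \<equiv> levy_incr (\<lambda>k. \<zeta> k \<omega>) m j"

lemma measurable_\<zeta>[measurable]: "\<zeta> k \<in> borel_measurable M"
  using distributed_measurable[OF normal[of k]] by simp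

lemma measurable_B[measurable]: "B t \<in> borel_measurable M"
proof -
  have [measurable]: "(\<lambda>\<omega>. levy_term (\<lambda>k. \<zeta> k \<omega>) i t) \<in> borel_measurable M" for i
    unfolding levy_term_def hat_row_def by measurable
  have [measurable]: "(\<lambda>\<omega>. lin_walk (\<lambda>j. \<zeta> (0, j) \<omega>) t) \<in> borel_measurable M"
    unfolding lin_walk_def by measurable
  have [measurable]: "Measurable.pred M (\<lambda>\<omega>. levy_good (\<lambda>k. \<zeta> k \<omega>))"
    unfolding levy_good_def by measurable
  show ?thesis unfolding B_def[abs_def] levy_path_def by measurable
qed

lemma AE_levy_good: "AE \<omega> in M. levy_good (\<lambda>k. \<zeta> k \<omega>)"
proof -
  define A where "A m = {\<omega> \<in> space M. \<exists>j<m * 2 ^ m. 2 powr (real m / 3) < \<bar>\<zeta> (Suc m, j) \<omega>\<bar>}" for m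
  have [measurable]: "A m \<in> sets M" for m unfolding A_def by measurable
  have bound: "prob (A m) \<le> 3 * (real m * (2 powr (- 1 / 3)) ^ m)" for m
  proof -
    let ?a = "2 powr (real m / 3)"
    have "A m \<subseteq> (\<Union>j<m * 2 ^ m. {\<omega> \<in> space M. ?a \<le> \<bar>\<zeta> (Suc m, j) \<omega>\<bar>})"
      unfolding A_def by force
    then have "prob (A m) \<le> prob (\<Union>j<m * 2 ^ m. {\<omega> \<in> space M. ?a \<le> \<bar>\<zeta> (Suc m, j) \<omega>\<bar>})"
      by (intro finite_measure_mono) auto
    also have "\<dots> \<le> (\<Sum>j<m * 2 ^ m. prob {\<omega> \<in> space M. ?a \<le> \<bar>\<zeta> (Suc m, j) \<omega>\<bar>})"
      by (rule finite_measure_subadditive_finite) auto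
    also have "\<dots> \<le> (\<Sum>j<m * 2 ^ m. 3 / ?a ^ 4)"
    proof (rule sum_mono)
      fix j
      show "prob {\<omega> \<in> space M. ?a \<le> \<bar>\<zeta> (Suc m, j) \<omega>\<bar>} \<le> 3 / ?a ^ 4"
        using fourth_moment_Markov[of "\<zeta> (Suc m, j)" ?a] normal_fourth_moment[OF normal[of "(Suc m, j)"]] by simp
    qed
    also have "\<dots> = 3 * real m * (2 ^ m / ?a ^ 4)" by simp
    also have "2 ^ m / ?a ^ 4 = 2 powr (real m - 4 * (real m / 3))"
      unfolding powr_diff by (simp add: powr_realpow powr_powr[symmetric] flip: powr_powr) (simp add: powr_power)
    also have "real m - 4 * (real m / 3) = (- 1 / 3) * real m" by simp
    also have "2 powr ((- 1 / 3) * real m) = (2 powr (- 1 / 3)) ^ m"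
      by (subst powr_powr[symmetric]) (simp add: powr_realpow)
    finally show ?thesis by (simp add: mult.assoc)
  qed
  \<comment> \<open>The differentiated geometric series supplies the factor \<open>Suc m\<close>,
    which dominates m.\<close>
  have "summable (\<lambda>m. of_nat (Suc m) * (2 powr (- 1 / 3) :: real) ^ m)"
    by (rule sums_summable[OF geometric_deriv_sums]) (simp add: powr_less_one)
  then have "summable (\<lambda>m. 3 * (of_nat (Suc m) * (2 powr (- 1 / 3) :: real) ^ m))"
    by (rule summable_mult)
  then have "summable (\<lambda>m. prob (A m))"
  proof (rule summable_comparison_test'[where N=0])
    fix m
    have le: "3 * (real m * (2 powr (- 1 / 3)) ^ m) \<le> 3 * (real (Suc m) * (2 powr (- 1 / 3)) ^ m)"
      by (intro mult_left_mono mult_right_mono) auto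
    show "norm (prob (A m)) \<le> 3 * (real (Suc m) * (2 powr (- 1 / 3)) ^ m)"
      using order_trans[OF bound le] by (simp only: real_norm_def abs_of_nonneg measure_nonneg)
  qed
  then have "AE \<omega> in M. eventually (\<lambda>m. \<omega> \<in> space M - A m) sequentially"
    by (intro borel_cantelli_AE1) (auto simp: emeasure_eq_measure)
  then show ?thesis
  proof eventually_elim
    case (elim \<omega>)
    then obtain m0 where m0: "\<And>m. m \<ge> m0 \<Longrightarrow> \<omega> \<in> space M - A m" by (auto simp: eventually_sequentially)
    show ?case
      unfolding levy_good_def
    proof (intro exI[of _ m0] allI impI)
      fix m j :: nat assume "m0 \<le> m" "j < m * 2 ^ m"
      then show "\<bar>\<zeta> (Suc m, j) \<omega>\<bar> \<le> 2 powr (real m / 3)"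
        using m0[of m] by (auto simp: A_def not_less dest!: spec[of _ j])
    qed
  qed
qed

lemma e_iid: "indep_vars (\<lambda>_. borel) (e m) UNIV" "distributed M lborel (e m j) std_normal_density"
  using levy_incr_iid[OF indep normal] by auto

text \<open>On the good event this is the increment of the path between the level-m dyadic points at
  or just below s and t. It is a scaled sum of independent Gaussians and converges by path
  continuity, so the law and the independence of the increments of \<open>B\<close> are obtained
  from it in the limit.\<close>

definition approx_incr :: "nat \<Rightarrow> real \<Rightarrow> real \<Rightarrow> 'a \<Rightarrow> real" where
  "approx_incr m s t \<omega> = (\<Sum>j\<in>{nat \<lfloor>2 ^ m * s\<rfloor>..<nat \<lfloor>2 ^ m * t\<rfloor>}. e m j \<omega>) / sqrt (2 ^ m)"

lemma approx_incr_tendsto: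
  assumes "0 \<le> s" "s \<le> t"
  shows "AE \<omega> in M. (\<lambda>m. approx_incr m s t \<omega>) \<longlonglongrightarrow> B t \<omega> - B s \<omega>"
  using AE_levy_good
proof eventually_elim
  case (elim \<omega>)
  define k where "k m u = nat \<lfloor>2 ^ m * u\<rfloor>" for m and u :: real
  have lim: "(\<lambda>m. B (real (k m u) / 2 ^ m) \<omega>) \<longlonglongrightarrow> B u \<omega>" if "0 \<le> u" for u
    unfolding B_def
    by (rule continuous_on_tendsto_compose[OF levy_path_continuous])
       (use that dyadic_floor_tendsto[OF that] in \<open>auto simp: k_def\<close>)
  have "approx_incr m s t \<omega> = B (real (k m t) / 2 ^ m) \<omega> - B (real (k m s) / 2 ^ m) \<omega>" for m
  proof -
    have "k m s \<le> k m t" unfolding k_def using assms by (intro nat_mono floor_mono) simp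
    then have "(\<Sum>i<k m t. e m i \<omega>) = (\<Sum>i<k m s. e m i \<omega>) + (\<Sum>i\<in>{k m s..<k m t}. e m i \<omega>)"
      by (simp only: lessThan_atLeast0 sum.atLeastLessThan_concat le0)
    then show ?thesis
      unfolding B_def levy_path_dyadic[OF elim]
      by (simp add: approx_incr_def k_def[symmetric] add_divide_distrib)
  qed
  then show ?case using lim[of s] lim[of t] assms by (simp add: tendsto_diff)
qed

lemma B_increment:
  assumes st: "0 \<le> s" "s < t"
  shows "distributed M lborel (\<lambda>\<omega>. B t \<omega> - B s \<omega>) (normal_density 0 (sqrt (t - s)))"
proof -
  define v where "v m = real (nat \<lfloor>2 ^ m * t\<rfloor>) / 2 ^ m - real (nat \<lfloor>2 ^ m * s\<rfloor>) / 2 ^ m" for m :: nat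
  have v: "v \<longlonglongrightarrow> t - s"
    unfolding v_def by (intro tendsto_diff dyadic_floor_tendsto) (use st in auto)
  then have "\<forall>\<^sub>F m in sequentially. 0 < v m"
    by (rule order_tendstoD(1)) (use st in simp)
  \<comment> \<open>On coarse levels s and t may share their dyadic point, which gives variance 0;
    the sequence is started where this no longer happens.\<close>
  then obtain m0 where m0: "\<And>m. m \<ge> m0 \<Longrightarrow> 0 < v m" by (auto simp: eventually_sequentially)
  show ?thesis
  proof (rule normal_AE_limit)
    show "0 < v (m + m0)" for m using m0 by simp
    show "(\<lambda>m. v (m + m0)) \<longlonglongrightarrow> t - s" using v by (rule LIMSEQ_ignore_initial_segment)
    show "0 < t - s" using st by simp
    show "AE \<omega> in M. (\<lambda>m. approx_incr (m + m0) s t \<omega>) \<longlonglongrightarrow> B t \<omega> - B s \<omega>"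
      using approx_incr_tendsto[of s t] st by (auto elim!: eventually_mono dest: LIMSEQ_ignore_initial_segment)
    show "distributed M lborel (approx_incr (m + m0) s t) (normal_density 0 (sqrt (v (m + m0))))" for m
    proof -
      define n where "n = m + m0"
      let ?I = "{nat \<lfloor>2 ^ n * s\<rfloor>..<nat \<lfloor>2 ^ n * t\<rfloor>}"
      have vn: "v n = real (card ?I) / 2 ^ n" "card ?I > 0"
        using m0[of n] by (auto simp: v_def n_def field_simps of_nat_diff)
      have "distributed M lborel (\<lambda>\<omega>. \<Sum>j\<in>?I. e n j \<omega>) (normal_density (\<Sum>j\<in>?I. 0) (sqrt (\<Sum>j\<in>?I. 1\<^sup>2)))"
        by (rule sum_indep_normal) (use vn(2) e_iid in \<open>auto intro: indep_vars_subset\<close>)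
      then have "distributed M lborel (\<lambda>\<omega>. \<Sum>j\<in>?I. e n j \<omega>) (normal_density 0 (sqrt (real (card ?I))))" by simp
      from normal_density_affine[OF this, of "1 / sqrt (2 ^ n)" 0]
      have "distributed M lborel (\<lambda>\<omega>. (\<Sum>j\<in>?I. e n j \<omega>) / sqrt (2 ^ n)) (normal_density 0 (sqrt (real (card ?I)) / sqrt (2 ^ n)))"
        using vn(2) by simp
      then show ?thesis unfolding approx_incr_def[abs_def] n_def[symmetric] vn(1) by (simp add: real_sqrt_divide)
    qed
  qed measurable
qed

text \<open>At a fixed dyadic level the increments use disjoint ranges of independent variables, and
  independence passes to the limit. Equal consecutive times just give empty ranges.\<close>

lemma B_independent:
  fixes \<tau> :: "nat \<Rightarrow> real"
  assumes \<tau>: "0 \<le> \<tau> 0" "\<And>i. i < n \<Longrightarrow> \<tau> i \<le> \<tau> (Suc i)"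
  shows "indep_vars (\<lambda>_. borel) (\<lambda>i \<omega>. B (\<tau> (Suc i)) \<omega> - B (\<tau> i) \<omega>) {..<n}"
proof -
  have mono: "\<tau> i \<le> \<tau> j" if "i \<le> j" "j \<le> n" for i j
    using that by (induction j rule: dec_induct) (auto intro: order_trans[OF _ \<tau>(2)])
  show ?thesis
  proof (rule indep_vars_AE_limit)
    show "AE \<omega> in M. (\<lambda>m. approx_incr m (\<tau> i) (\<tau> (Suc i)) \<omega>) \<longlonglongrightarrow> B (\<tau> (Suc i)) \<omega> - B (\<tau> i) \<omega>" if "i \<in> {..<n}" for i
      using that mono[of 0 i] \<tau> by (intro approx_incr_tendsto) auto
    show "indep_vars (\<lambda>_. borel) (\<lambda>i. approx_incr m (\<tau> i) (\<tau> (Suc i))) {..<n}" for m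
    proof -
      define K where "K i = {nat \<lfloor>2 ^ m * \<tau> i\<rfloor>..<nat \<lfloor>2 ^ m * \<tau> (Suc i)\<rfloor>}" for i
      have disj: "K i \<inter> K j = {}" if "i < j" "j < n" for i j
      proof -
        have "nat \<lfloor>2 ^ m * \<tau> (Suc i)\<rfloor> \<le> nat \<lfloor>2 ^ m * \<tau> j\<rfloor>"
          using mono[of "Suc i" j] that by (intro nat_mono floor_mono) simp
        then show ?thesis by (auto simp: K_def)
      qed
      have "indep_vars (\<lambda>i. Pi\<^sub>M (K i) (\<lambda>_. borel)) (\<lambda>i \<omega>. restrict (\<lambda>j. e m j \<omega>) (K i)) {..<n}"
      proof (rule indep_vars_restrict[OF e_iid(1)])
        show "disjoint_family_on K {..<n}"
          unfolding disjoint_family_on_def using disj by (metis Int_commute lessThan_iff linorder_neqE_nat)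
      qed simp
      then have "indep_vars (\<lambda>_. borel) (\<lambda>i \<omega>. (\<Sum>j\<in>K i. (restrict (\<lambda>j. e m j \<omega>) (K i)) j) / sqrt (2 ^ m)) {..<n}"
        by (rule indep_vars_compose2) measurable
      moreover have "(\<Sum>j\<in>K i. (restrict (\<lambda>j. e m j \<omega>) (K i)) j) = (\<Sum>j\<in>K i. e m j \<omega>)" for i \<omega>
        by (rule sum.cong) auto
      ultimately show ?thesis by (simp add: approx_incr_def[abs_def] K_def[symmetric])
    qed
  qed measurable
qed

lemma brownian: "standard_brownian_motion M B"
  unfolding standard_brownian_motion_def
proof (intro conjI allI impI ballI)
  show "prob_space M" by (rule prob_space_axioms)
  show "B 0 \<omega> = 0" for \<omega> by (simp add: B_def levy_path_0)
  show "continuous_on {0..} (\<lambda>t. B t \<omega>)" for \<omega>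
    unfolding B_def by (rule levy_path_continuous)
qed (auto intro: B_increment B_independent)

end

theorem brownian_motion_exists:
  obtains M :: "(nat \<Rightarrow> real) measure" and B where "standard_brownian_motion M B"
proof -
  let ?M = "\<Pi>\<^sub>M i\<in>(UNIV :: nat set). std_normal_distribution"
  have N: "prob_space std_normal_distribution" by (rule prob_space_normal_density) simp
  interpret M: prob_space ?M by (rule prob_space_PiM) (rule N)
  let ?\<zeta> = "\<lambda>k \<omega>. \<omega> (prod_encode k) :: real"
  have d: "distr ?M std_normal_distribution (\<lambda>\<omega>. \<omega> i) = std_normal_distribution" for i :: nat
    by (rule distr_PiM_component) (use N in auto)
  have m: "(\<lambda>\<omega>. \<omega> i) \<in> borel_measurable ?M" for i
    using measurable_component_singleton[of i UNIV "\<lambda>_. std_normal_distribution"] by simp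
  have ind: "M.indep_vars (\<lambda>_. borel) (\<lambda>i \<omega>. \<omega> i) (UNIV :: nat set)"
  proof (subst M.indep_vars_iff_distr_eq_PiM)
    have "distr ?M borel (\<lambda>\<omega>. \<omega> i) = std_normal_distribution" for i :: nat
      using d[of i] by (simp cong: distr_cong)
    moreover have "distr ?M (\<Pi>\<^sub>M i\<in>UNIV. borel) (\<lambda>x. \<lambda>i\<in>UNIV. x i) = distr ?M ?M (\<lambda>x. x)"
      by (intro distr_cong) (auto intro!: sets_PiM_cong)
    ultimately show "distr ?M (\<Pi>\<^sub>M i\<in>UNIV. borel) (\<lambda>x. \<lambda>i\<in>UNIV. x i) = (\<Pi>\<^sub>M i\<in>UNIV. distr ?M borel (\<lambda>\<omega>. \<omega> i))"
      by (simp add: distr_id)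
  qed (use m in auto)
  interpret gaussian_array ?M ?\<zeta>
  proof unfold_locales
    show "M.indep_vars (\<lambda>_. borel) ?\<zeta> UNIV"
      by (rule M.indep_vars_reindex_inj[OF ind]) (auto simp: inj_on_def)
    show "distributed ?M lborel (?\<zeta> k) std_normal_density" for k
      using d[of "prod_encode k"] m[of "prod_encode k"] by (simp add: distributed_def cong: distr_cong)
  qed
  show thesis using that[OF brownian] .
qed

section \<open>A fourth-moment maximal inequality\<close>

text \<open>Doob's argument: decompose by the first index j with |Z j| at least x, and compare the
  fourth powers of Z j and Z n there. The martingale property enters only as orthogonality on each
  first-passage event, so the same lemma serves Brownian increments and the sign chain without any
  conditional expectation.\<close>

lemma (in prob_space) fourth_moment_maximal:
  fixes Z :: "nat \<Rightarrow> 'a \<Rightarrow> real"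
  assumes meas: "\<And>j. j \<le> n \<Longrightarrow> Z j \<in> borel_measurable M"
    and int: "\<And>j. j \<le> n \<Longrightarrow> integrable M (\<lambda>\<omega>. Z j \<omega> ^ 4)"
    and x: "0 < x"
    and orth: "\<And>j. j \<le> n \<Longrightarrow>
      expectation (\<lambda>\<omega>. of_bool (x \<le> \<bar>Z j \<omega>\<bar> \<and> (\<forall>i<j. \<bar>Z i \<omega>\<bar> < x)) * Z j \<omega> ^ 3 * (Z n \<omega> - Z j \<omega>)) = 0"
  shows "prob {\<omega> \<in> space M. \<exists>j\<le>n. x \<le> \<bar>Z j \<omega>\<bar>} \<le> expectation (\<lambda>\<omega>. Z n \<omega> ^ 4) / x ^ 4"
proof -
  have m0[measurable]: "\<And>j. j \<in> {..n} \<Longrightarrow> Z j \<in> borel_measurable M" using meas by auto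
  define I where "I j \<omega> = (of_bool (x \<le> \<bar>Z j \<omega>\<bar> \<and> (\<forall>i<j. \<bar>Z i \<omega>\<bar> < x)) :: real)" for j \<omega>
  have I01: "0 \<le> I j \<omega>" "I j \<omega> \<le> 1" for j \<omega> by (auto simp: I_def)
  have mI[measurable]: "I j \<in> borel_measurable M" if "j \<le> n" for j
  proof -
    have [measurable]: "Z i \<in> borel_measurable M" if "i < j" for i using meas that \<open>j \<le> n\<close> by auto
    have [measurable]: "Z j \<in> borel_measurable M" using meas that by auto
    have "(\<lambda>\<omega>. x \<le> \<bar>Z j \<omega>\<bar> \<and> (\<forall>i\<in>{..<j}. \<bar>Z i \<omega>\<bar> < x)) \<in> measurable M (count_space UNIV)"
      by measurable
    then show ?thesis unfolding I_def[abs_def] by (simp add: Ball_def)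
  qed
  have sumI: "(\<Sum>j\<le>n. I j \<omega>) = of_bool (\<exists>j\<le>n. x \<le> \<bar>Z j \<omega>\<bar>)" for \<omega>
  proof (cases "\<exists>j\<le>n. x \<le> \<bar>Z j \<omega>\<bar>")
    case True
    define k where "k = (LEAST j. x \<le> \<bar>Z j \<omega>\<bar>)"
    have k: "x \<le> \<bar>Z k \<omega>\<bar>" "k \<le> n"
      using True unfolding k_def by (auto intro: LeastI Least_le order_trans)
    have kl: "\<bar>Z i \<omega>\<bar> < x" if "i < k" for i
      using not_less_Least[of i "\<lambda>j. x \<le> \<bar>Z j \<omega>\<bar>"] that unfolding k_def by auto
    have "I j \<omega> = of_bool (j = k)" for j
    proof (cases j k rule: linorder_cases)
      case less
      then show ?thesis using kl[OF less] by (simp add: I_def)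
    next
      case equal
      then show ?thesis using k(1) kl by (simp add: I_def)
    next
      case greater
      then show ?thesis using k(1) by (auto simp: I_def not_less)
    qed
    then show ?thesis using True k(2) by simp
  next
    case False
    then have "I j \<omega> = 0" if "j \<le> n" for j using that by (simp add: I_def)
    then have "(\<Sum>j\<le>n. I j \<omega>) = 0" by (intro sum.neutral) auto
    then show ?thesis using False by simp
  qed
  have int3: "integrable M (\<lambda>\<omega>. I j \<omega> * Z j \<omega> ^ 3 * (Z n \<omega> - Z j \<omega>))" and int4: "integrable M (\<lambda>\<omega>. I j \<omega> * Z j \<omega> ^ 4)"
    and int4n: "integrable M (\<lambda>\<omega>. I j \<omega> * Z n \<omega> ^ 4)" if j: "j \<le> n" for j
  proof -
    have [measurable]: "Z j \<in> borel_measurable M" "Z n \<in> borel_measurable M" "I j \<in> borel_measurable M"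
      using meas j mI by auto
    have i1: "integrable M (\<lambda>\<omega>. 3 * Z j \<omega> ^ 4 + Z n \<omega> ^ 4)" using int j by simp
    \<comment> \<open>A crude bound, made for the integrability of the cross term.\<close>
    have b: "\<bar>y\<bar> ^ 3 * \<bar>z - y\<bar> \<le> 3 * y ^ 4 + z ^ 4" for y z :: real
    proof -
      have "\<bar>y\<bar> ^ 3 * \<bar>z - y\<bar> \<le> \<bar>y\<bar> ^ 3 * (\<bar>z\<bar> + \<bar>y\<bar>)" by (intro mult_left_mono) auto
      also have "\<dots> = \<bar>y\<bar> ^ 3 * \<bar>z\<bar> + y ^ 4"
        by (cases "y \<ge> 0") (auto simp: power3_eq_cube power4_eq_xxxx algebra_simps)
      also have "\<bar>y\<bar> ^ 3 * \<bar>z\<bar> \<le> (max \<bar>y\<bar> \<bar>z\<bar>) ^ 3 * (max \<bar>y\<bar> \<bar>z\<bar>)"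
        by (intro mult_mono power_mono) auto
      also have "\<dots> = (max \<bar>y\<bar> \<bar>z\<bar>) ^ 4" by (simp add: power3_eq_cube power4_eq_xxxx mult.assoc)
      also have "\<dots> \<le> y ^ 4 + z ^ 4" by (auto simp: max_def power_even_abs_numeral)
      finally have "\<bar>y\<bar> ^ 3 * \<bar>z - y\<bar> \<le> 2 * y ^ 4 + z ^ 4" by simp
      moreover have "0 \<le> y ^ 4" by simp
      ultimately show ?thesis by linarith
    qed
    show "integrable M (\<lambda>\<omega>. I j \<omega> * Z j \<omega> ^ 3 * (Z n \<omega> - Z j \<omega>))"
    proof (rule Bochner_Integration.integrable_bound[OF i1])
      show "AE \<omega> in M. norm (I j \<omega> * Z j \<omega> ^ 3 * (Z n \<omega> - Z j \<omega>)) \<le> norm (3 * Z j \<omega> ^ 4 + Z n \<omega> ^ 4)"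
      proof (rule AE_I2)
        fix \<omega>
        have "norm (I j \<omega> * Z j \<omega> ^ 3 * (Z n \<omega> - Z j \<omega>)) = I j \<omega> * (\<bar>Z j \<omega>\<bar> ^ 3 * \<bar>Z n \<omega> - Z j \<omega>\<bar>)"
          using I01(1) by (simp add: abs_mult power_abs)
        also have "\<dots> \<le> 1 * (\<bar>Z j \<omega>\<bar> ^ 3 * \<bar>Z n \<omega> - Z j \<omega>\<bar>)" by (intro mult_right_mono I01) auto
        also have "\<dots> \<le> 3 * Z j \<omega> ^ 4 + Z n \<omega> ^ 4" using b by simp
        finally show "norm (I j \<omega> * Z j \<omega> ^ 3 * (Z n \<omega> - Z j \<omega>)) \<le> norm (3 * Z j \<omega> ^ 4 + Z n \<omega> ^ 4)" by simp
      qed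
    qed measurable
    show "integrable M (\<lambda>\<omega>. I j \<omega> * Z j \<omega> ^ 4)"
      by (rule Bochner_Integration.integrable_bound[OF int[OF j]])
         (use I01 in \<open>auto simp: abs_mult intro!: mult_left_le_one_le\<close>)
    show "integrable M (\<lambda>\<omega>. I j \<omega> * Z n \<omega> ^ 4)"
      by (rule Bochner_Integration.integrable_bound[OF int[OF order_refl]])
         (use I01 in \<open>auto simp: abs_mult intro!: mult_left_le_one_le\<close>)
  qed
  \<comment> \<open>Convexity: z^4 lies above its tangent at y. In expectation the linear term
    vanishes by orthogonality.\<close>
  have conv: "y ^ 4 + 4 * (y ^ 3 * (z - y)) \<le> z ^ 4" for y z :: real
  proof -
    have "z ^ 4 - (y ^ 4 + 4 * (y ^ 3 * (z - y))) = (z - y)\<^sup>2 * ((z + y)\<^sup>2 + 2 * y\<^sup>2)"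
      by (simp add: power2_eq_square power4_eq_xxxx power3_eq_cube algebra_simps)
    also have "\<dots> \<ge> 0" by simp
    finally show ?thesis by simp
  qed
  have intI: "integrable M (I j)" if "j \<le> n" for j
    by (rule integrable_const_bound[where B=1]) (use I01 mI that in auto)
  have "x ^ 4 * prob {\<omega> \<in> space M. \<exists>j\<le>n. x \<le> \<bar>Z j \<omega>\<bar>} = x ^ 4 * expectation (\<lambda>\<omega>. \<Sum>j\<le>n. I j \<omega>)"
  proof -
    have "expectation (\<lambda>\<omega>. \<Sum>j\<le>n. I j \<omega>) = expectation (indicator {\<omega> \<in> space M. \<exists>j\<le>n. x \<le> \<bar>Z j \<omega>\<bar>})"
      unfolding sumI by (intro Bochner_Integration.integral_cong) (auto simp: indicator_def)
    moreover have "{\<omega> \<in> space M. \<exists>j\<in>{..n}. x \<le> \<bar>Z j \<omega>\<bar>} \<in> events" by measurable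
    ultimately show ?thesis by (simp add: Bex_def)
  qed
  also have "\<dots> = (\<Sum>j\<le>n. expectation (\<lambda>\<omega>. I j \<omega> * x ^ 4))"
    using intI by (subst Bochner_Integration.integral_sum) (auto simp: sum_distrib_left mult.commute)
  also have "\<dots> \<le> (\<Sum>j\<le>n. expectation (\<lambda>\<omega>. I j \<omega> * Z j \<omega> ^ 4))"
  proof (intro sum_mono integral_mono)
    fix j \<omega> assume "j \<in> {..n}"
    show "I j \<omega> * x ^ 4 \<le> I j \<omega> * Z j \<omega> ^ 4"
      using power_mono[of x "\<bar>Z j \<omega>\<bar>" 4] x by (auto simp: I_def power_even_abs_numeral)
  qed (use intI int4 in auto)
  also have "\<dots> = (\<Sum>j\<le>n. expectation (\<lambda>\<omega>. I j \<omega> * Z j \<omega> ^ 4 + 4 * (I j \<omega> * Z j \<omega> ^ 3 * (Z n \<omega> - Z j \<omega>))))"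
    using int3 int4 orth by (intro sum.cong refl) (simp add: I_def)
  also have "\<dots> \<le> (\<Sum>j\<le>n. expectation (\<lambda>\<omega>. I j \<omega> * Z n \<omega> ^ 4))"
  proof (intro sum_mono integral_mono)
    fix j \<omega> assume "j \<in> {..n}"
    have "I j \<omega> * Z j \<omega> ^ 4 + 4 * (I j \<omega> * Z j \<omega> ^ 3 * (Z n \<omega> - Z j \<omega>))
       = I j \<omega> * (Z j \<omega> ^ 4 + 4 * (Z j \<omega> ^ 3 * (Z n \<omega> - Z j \<omega>)))" by (simp add: algebra_simps)
    also have "\<dots> \<le> I j \<omega> * Z n \<omega> ^ 4" by (intro mult_left_mono conv I01)
    finally show "I j \<omega> * Z j \<omega> ^ 4 + 4 * (I j \<omega> * Z j \<omega> ^ 3 * (Z n \<omega> - Z j \<omega>)) \<le> I j \<omega> * Z n \<omega> ^ 4" .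
  qed (use int3 int4 int4n in auto)
  also have "\<dots> = expectation (\<lambda>\<omega>. (\<Sum>j\<le>n. I j \<omega>) * Z n \<omega> ^ 4)"
    using int4n by (subst Bochner_Integration.integral_sum[symmetric]) (auto simp: sum_distrib_right)
  also have "\<dots> \<le> expectation (\<lambda>\<omega>. Z n \<omega> ^ 4)"
  proof (rule integral_mono)
    show "integrable M (\<lambda>\<omega>. (\<Sum>j\<le>n. I j \<omega>) * Z n \<omega> ^ 4)"
      using int4n by (auto simp: sum_distrib_right)
  qed (use int in \<open>auto simp: sumI\<close>)
  finally show ?thesis using x by (simp add: field_simps)
qed

text \<open>The discrete inequality is applied on the dyadic grids of the window. These are nested,
  so the exceptional events increase and their union keeps the bound; path continuity then reaches
  all times. Returning an event avoids treating the supremum over an uncountable window as a random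
  variable.\<close>

lemma brownian_window_maximal:
  assumes BM: "standard_brownian_motion M B" and t: "0 \<le> lo" "lo < hi" and x: "0 < x"
  obtains A where "A \<in> sets M" "measure M A \<le> 3 * (hi - lo)\<^sup>2 / x ^ 4"
    "\<And>\<omega> t. \<omega> \<in> space M - A \<Longrightarrow> t \<in> {lo..hi} \<Longrightarrow> \<bar>B t \<omega> - B lo \<omega>\<bar> \<le> x"
proof -
  interpret prob_space M using BM by (simp add: standard_brownian_motion_def)
  have mB: "t \<ge> 0 \<Longrightarrow> B t \<in> borel_measurable M" for t
    using BM by (simp add: standard_brownian_motion_def)
  have cont: "\<omega> \<in> space M \<Longrightarrow> continuous_on {0..} (\<lambda>t. B t \<omega>)" for \<omega>
    using BM by (simp add: standard_brownian_motion_def)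
  have inc: "0 \<le> s \<Longrightarrow> s < t \<Longrightarrow> distributed M lborel (\<lambda>\<omega>. B t \<omega> - B s \<omega>) (normal_density 0 (sqrt (t - s)))" for s t
    using BM by (simp add: standard_brownian_motion_def)
  define p where "p m i = lo + real i / 2 ^ m * (hi - lo)" for m i :: nat
  have p0: "p m 0 = lo" and pn: "p m (2 ^ m) = hi" and pmono: "p m i < p m (Suc i)" for m i
    using t by (auto simp: p_def field_simps)
  have pge: "lo \<le> p m i" for m i using t by (simp add: p_def)
  have p_ge0: "0 \<le> p m i" for m i using pge[of m i] t by simp
  have p_double: "p (Suc m) (2 * i) = p m i" for m i by (simp add: p_def)
  define A where "A m = {\<omega> \<in> space M. \<exists>i\<le>2 ^ m. x \<le> \<bar>B (p m i) \<omega> - B lo \<omega>\<bar>}" for m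
  have [measurable]: "B lo \<in> borel_measurable M" "B (p m i) \<in> borel_measurable M" for m i
    using mB t p_ge0 by auto
  have mA[measurable]: "A m \<in> sets M" for m unfolding A_def by measurable
  have bound: "prob (A m) \<le> 3 * (hi - lo)\<^sup>2 / x ^ 4" for m
  proof -
    define n :: nat where "n = 2 ^ m"
    define D where "D i \<omega> = B (p m (Suc i)) \<omega> - B (p m i) \<omega>" for i \<omega>
    have D: "distributed M lborel (D i) (normal_density 0 (sqrt (p m (Suc i) - p m i)))" for i
      unfolding D_def[abs_def] by (intro inc p_ge0 pmono)
    have indD: "indep_vars (\<lambda>_. borel) D {..<n}"
      using BM p_ge0 pmono unfolding standard_brownian_motion_def D_def[abs_def]
      by (auto simp: less_imp_le)
    have intD: "integrable M (D i)" and ED: "expectation (D i) = 0" for i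
    proof -
      have "0 < sqrt (p m (Suc i) - p m i)" using pmono by simp
      note h = normal_moment_nz_1[OF this, of 0]
      show "integrable M (D i)"
        using distributed_integrable[OF D, of "\<lambda>x. x" i] h by (auto simp: has_bochner_integral_iff)
      show "expectation (D i) = 0"
        using distributed_integral[OF D, of "\<lambda>x. x" i] h by (auto simp: has_bochner_integral_iff)
    qed
    let ?Z = "\<lambda>i \<omega>. B (p m i) \<omega> - B lo \<omega>"
    have Zsum: "?Z j \<omega> = (\<Sum>i<j. D i \<omega>)" for j \<omega>
      using sum_lessThan_telescope[of "\<lambda>i. B (p m i) \<omega>" j] by (simp add: D_def p0)
    have int4: "integrable M (\<lambda>\<omega>. ?Z j \<omega> ^ 4)" for j
    proof (cases "j = 0")
      case False
      then have "lo < p m j" using t by (simp add: p_def)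
      then show ?thesis using normal_fourth_moment(1)[OF inc[OF t(1)], of "p m j"] by simp
    qed (simp add: p0)
    have E4: "expectation (\<lambda>\<omega>. ?Z n \<omega> ^ 4) = 3 * (hi - lo)\<^sup>2"
    proof -
      have "sqrt (hi - lo) ^ 4 = (sqrt (hi - lo) ^ 2)\<^sup>2" by (simp flip: power_mult)
      also have "\<dots> = (hi - lo)\<^sup>2" using t by simp
      finally show ?thesis using normal_fourth_moment(2)[OF inc[OF t]] t by (simp add: n_def pn)
    qed
    have "prob {\<omega> \<in> space M. \<exists>j\<le>n. x \<le> \<bar>?Z j \<omega>\<bar>} \<le> expectation (\<lambda>\<omega>. ?Z n \<omega> ^ 4) / x ^ 4"
    proof (rule fourth_moment_maximal[OF _ _ x])
      fix j assume j: "j \<le> n"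
      \<comment> \<open>\<open>?G\<close> is a function of the increments before j,
        \<open>?H\<close> of those from j on. By independence the orthogonality reduces to the mean
        0 of \<open>?H\<close>.\<close>
      let ?G = "\<lambda>f. of_bool (x \<le> \<bar>\<Sum>i<j. f i\<bar> \<and> (\<forall>k\<in>{..<j}. \<bar>\<Sum>i<k. f i\<bar> < x)) * (\<Sum>i<j. f i :: real) ^ 3 :: real"
      let ?H = "\<lambda>f. \<Sum>i\<in>{j..<n}. f i :: real"
      have mG: "?G \<in> borel_measurable (Pi\<^sub>M {..<j} (\<lambda>_. borel))"
      proof -
        have [measurable]: "(\<lambda>f. \<Sum>i<k. f i :: real) \<in> borel_measurable (Pi\<^sub>M {..<j} (\<lambda>_. borel))" if "k \<le> j" for k
          by (rule borel_measurable_sum, rule measurable_component_singleton) (use that in auto)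
        have [measurable]: "(\<lambda>f. \<Sum>i<k. f i :: real) \<in> borel_measurable (Pi\<^sub>M {..<j} (\<lambda>_. borel))" if "k \<in> {..<j}" for k
          by (rule borel_measurable_sum, rule measurable_component_singleton) (use that in auto)
        show ?thesis by measurable
      qed
      have "indep_var (Pi\<^sub>M {..<j} (\<lambda>_. borel)) (\<lambda>\<omega>. restrict (\<lambda>i. D i \<omega>) {..<j}) (Pi\<^sub>M {j..<n} (\<lambda>_. borel)) (\<lambda>\<omega>. restrict (\<lambda>i. D i \<omega>) {j..<n})"
        by (rule indep_var_restrict[OF indD]) (use j in auto)
      then have ind: "indep_var borel (?G \<circ> (\<lambda>\<omega>. restrict (\<lambda>i. D i \<omega>) {..<j})) borel (?H \<circ> (\<lambda>\<omega>. restrict (\<lambda>i. D i \<omega>) {j..<n}))"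
        by (rule indep_var_compose) (use mG in measurable)
      have G: "?G \<circ> (\<lambda>\<omega>. restrict (\<lambda>i. D i \<omega>) {..<j}) = (\<lambda>\<omega>. of_bool (x \<le> \<bar>?Z j \<omega>\<bar> \<and> (\<forall>i<j. \<bar>?Z i \<omega>\<bar> < x)) * ?Z j \<omega> ^ 3)"
        (is "?G' = _")
        unfolding Zsum by (intro ext) (auto simp: Ball_def)
      have H: "?H \<circ> (\<lambda>\<omega>. restrict (\<lambda>i. D i \<omega>) {j..<n}) = (\<lambda>\<omega>. ?Z n \<omega> - ?Z j \<omega>)" (is "?H' = _")
      proof
        fix \<omega>
        have "(\<Sum>i<j. D i \<omega>) + (\<Sum>i\<in>{j..<n}. D i \<omega>) = (\<Sum>i<n. D i \<omega>)"
          using j by (simp add: lessThan_atLeast0 sum.atLeastLessThan_concat)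
        then show "(?H \<circ> (\<lambda>\<omega>. restrict (\<lambda>i. D i \<omega>) {j..<n})) \<omega> = ?Z n \<omega> - ?Z j \<omega>"
          unfolding Zsum by simp
      qed
      have "expectation (\<lambda>\<omega>. ?Z n \<omega> - ?Z j \<omega>) = expectation (\<lambda>\<omega>. \<Sum>i\<in>{j..<n}. D i \<omega>)"
        unfolding H[symmetric] by (simp add: comp_def)
      also have "\<dots> = 0" using intD ED by simp
      finally have E0: "expectation (\<lambda>\<omega>. ?Z n \<omega> - ?Z j \<omega>) = 0" .
      have iH: "integrable M (\<lambda>\<omega>. ?Z n \<omega> - ?Z j \<omega>)"
        unfolding Zsum using intD by simp
      have iG: "integrable M (\<lambda>\<omega>. of_bool (x \<le> \<bar>?Z j \<omega>\<bar> \<and> (\<forall>i<j. \<bar>?Z i \<omega>\<bar> < x)) * ?Z j \<omega> ^ 3)"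
      proof (rule Bochner_Integration.integrable_bound)
        show "integrable M (\<lambda>\<omega>. 1 + ?Z j \<omega> ^ 4)" using int4 by simp
        have "indep_var borel ?G' borel ?H'" by (rule ind)
        then show "(\<lambda>\<omega>. of_bool (x \<le> \<bar>?Z j \<omega>\<bar> \<and> (\<forall>i<j. \<bar>?Z i \<omega>\<bar> < x)) * ?Z j \<omega> ^ 3) \<in> borel_measurable M"
          unfolding G by (rule indep_var_rv1)
        have "\<bar>z\<bar> ^ 3 \<le> 1 + z ^ 4" for z :: real
        proof (cases "\<bar>z\<bar> \<le> 1")
          case True
          then have "\<bar>z\<bar> ^ 3 \<le> 1" by (simp add: power_le_one)
          moreover have "0 \<le> z ^ 4" by simp
          ultimately show ?thesis by linarith
        next
          case False
          then have "\<bar>z\<bar> ^ 3 \<le> \<bar>z\<bar> ^ 4" by (intro power_increasing) auto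
          then show ?thesis by (simp add: power_even_abs_numeral)
        qed
        then show "AE \<omega> in M. norm (of_bool (x \<le> \<bar>?Z j \<omega>\<bar> \<and> (\<forall>i<j. \<bar>?Z i \<omega>\<bar> < x)) * ?Z j \<omega> ^ 3) \<le> norm (1 + ?Z j \<omega> ^ 4)"
          by (intro AE_I2) (auto simp: abs_mult power_abs add_nonneg_nonneg)
      qed
      show "expectation (\<lambda>\<omega>. of_bool (x \<le> \<bar>?Z j \<omega>\<bar> \<and> (\<forall>i<j. \<bar>?Z i \<omega>\<bar> < x)) * ?Z j \<omega> ^ 3 * (?Z n \<omega> - ?Z j \<omega>)) = 0"
        using indep_var_lebesgue_integral[OF ind[unfolded G H] iG iH] E0 by simp
    qed (use int4 in auto)
    then show ?thesis unfolding A_def n_def[symmetric] E4 .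
  qed
  have incA: "incseq A"
  proof (rule incseq_SucI)
    fix m
    show "A m \<subseteq> A (Suc m)"
    proof
      fix \<omega> assume "\<omega> \<in> A m"
      then obtain i where "\<omega> \<in> space M" "i \<le> 2 ^ m" "x \<le> \<bar>B (p m i) \<omega> - B lo \<omega>\<bar>" by (auto simp: A_def)
      then show "\<omega> \<in> A (Suc m)"
        unfolding A_def by (auto intro!: exI[of _ "2 * i"] simp: p_double)
    qed
  qed
  have "prob (\<Union>m. A m) \<le> 3 * (hi - lo)\<^sup>2 / x ^ 4"
  proof (rule LIMSEQ_le_const2)
    show "(\<lambda>m. prob (A m)) \<longlonglongrightarrow> prob (\<Union>m. A m)"
      by (rule finite_Lim_measure_incseq) (use incA in auto)
  qed (use bound in auto)
  moreover have "\<bar>B t \<omega> - B lo \<omega>\<bar> \<le> x" if w: "\<omega> \<in> space M - (\<Union>m. A m)" and u: "t \<in> {lo..hi}" for \<omega> t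
  proof -
    define u where "u = (t - lo) / (hi - lo)"
    have u01: "0 \<le> u" "u \<le> 1" and tu: "t = lo + u * (hi - lo)"
      using u t by (auto simp: u_def field_simps)
    define k where "k m = nat \<lfloor>2 ^ m * u\<rfloor>" for m
    have k: "k m \<le> 2 ^ m" for m
    proof -
      have "2 ^ m * u \<le> 2 ^ m" using u01 by (simp add: mult_left_le)
      then have "\<lfloor>2 ^ m * u\<rfloor> \<le> \<lfloor>(2 ^ m :: real)\<rfloor>" by (rule floor_mono)
      then show ?thesis unfolding k_def by (simp add: nat_le_iff)
    qed
    have "(\<lambda>m. p m (k m)) \<longlonglongrightarrow> lo + u * (hi - lo)"
      unfolding p_def k_def by (intro tendsto_intros dyadic_floor_tendsto u01)
    then have "(\<lambda>m. B (p m (k m)) \<omega>) \<longlonglongrightarrow> B t \<omega>"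
      by (intro continuous_on_tendsto_compose[OF cont]) (use w u t p_ge0 tu in auto)
    then have "(\<lambda>m. \<bar>B (p m (k m)) \<omega> - B lo \<omega>\<bar>) \<longlonglongrightarrow> \<bar>B t \<omega> - B lo \<omega>\<bar>"
      by (intro tendsto_intros)
    moreover have "\<bar>B (p m (k m)) \<omega> - B lo \<omega>\<bar> \<le> x" for m
    proof -
      have "\<omega> \<notin> A m" using w by blast
      then have "\<not> x \<le> \<bar>B (p m (k m)) \<omega> - B lo \<omega>\<bar>" using k[of m] w unfolding A_def by blast
      then show ?thesis by simp
    qed
    ultimately show ?thesis by (intro LIMSEQ_le_const2) auto
  qed
  ultimately show thesis by (intro that[of "\<Union>m. A m"]) auto
qed

section \<open>The sign chain and its martingale differences\<close>

definition signs :: "nat \<Rightarrow> (nat \<Rightarrow> real) set" where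
  "signs n = {1..n} \<rightarrow>\<^sub>E {1, - 1}"

lemma finite_signs: "finite (signs n)"
  unfolding signs_def by (intro finite_PiE) auto

locale elephant = prob_space M for M :: "'w measure" +
  fixes p :: real and X :: "nat \<Rightarrow> 'w \<Rightarrow> real"
  assumes p01: "0 < p" "p < 1" and steps: "erwvrp_steps M p X"
begin

definition r :: real where "r = 2 * p - 1"

definition cyl :: "(nat \<Rightarrow> real) \<Rightarrow> nat \<Rightarrow> 'w set" where
  "cyl x n = {\<omega> \<in> space M. \<forall>i\<in>{1..n}. X i \<omega> = x i}"

text \<open>Index 0 encodes the uniform law of the first sign, whatever u is; products of step
  probabilities can thus start at 0.\<close>

definition step_prob :: "nat \<Rightarrow> real \<Rightarrow> real \<Rightarrow> real" where
  "step_prob n u v = (if n = 0 then 1 / 2 else if u = v then p else 1 - p)"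

text \<open>Dependence on the first n signs, stated pointwise instead of through a sigma-algebra. As
  these signs take finitely many values, such a function is a finite combination of cylinder
  indicators: measurability and integrability come for free, and composition with an arbitrary
  function preserves the property.\<close>

definition adapted :: "nat \<Rightarrow> ('w \<Rightarrow> real) \<Rightarrow> bool" where
  "adapted n Z \<longleftrightarrow> (\<forall>\<omega>\<in>space M. \<forall>\<omega>'\<in>space M. (\<forall>i\<in>{1..n}. X i \<omega> = X i \<omega>') \<longrightarrow> Z \<omega> = Z \<omega>')"

lemma r_bounds: "\<bar>r\<bar> < 1" "r\<^sup>2 < 1"
proof -
  show "\<bar>r\<bar> < 1" using p01 by (auto simp: r_def)
  then show "r\<^sup>2 < 1" by (simp add: abs_square_less_1)
qed

lemma X_count: "1 \<le> k \<Longrightarrow> X k \<in> M \<rightarrow>\<^sub>M count_space {1, -1}"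
  using steps by (simp add: erwvrp_steps_def markov_chain_def)

lemma X_values: "1 \<le> k \<Longrightarrow> \<omega> \<in> space M \<Longrightarrow> X k \<omega> = 1 \<or> X k \<omega> = - 1"
  using measurable_space[OF X_count, of k \<omega>] by auto

lemma X_square: "1 \<le> k \<Longrightarrow> \<omega> \<in> space M \<Longrightarrow> X k \<omega> * X k \<omega> = 1"
  using X_values[of k \<omega>] by auto

lemma X_abs: "1 \<le> k \<Longrightarrow> \<omega> \<in> space M \<Longrightarrow> \<bar>X k \<omega>\<bar> = 1"
  using X_values[of k \<omega>] by auto

lemma X_measurable[measurable]: "1 \<le> k \<Longrightarrow> X k \<in> borel_measurable M"
  using measurable_compose[OF X_count, of k "\<lambda>x. x" borel] by simp

lemma cyl_events[measurable]: "cyl x n \<in> events"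
  unfolding cyl_def by (intro sets.sets_Collect_finite_All) auto

text \<open>Histories of probability 0 are treated apart, because the Markov property speaks only of
  those with positive probability; for null histories both sides vanish by monotonicity.\<close>

lemma prob_cyl_Suc:
  assumes x: "\<And>i. x i = 1 \<or> x i = - 1"
  shows "prob (cyl x (Suc n)) = prob (cyl x n) * step_prob n (x n) (x (Suc n))"
proof (cases "n = 0")
  case True
  have "cyl x 1 = {\<omega> \<in> space M. X 1 \<omega> = x 1}" by (auto simp: cyl_def)
  moreover have "cyl x 0 = space M" by (auto simp: cyl_def)
  moreover have "prob {\<omega> \<in> space M. X 1 \<omega> = x 1} = 1 / 2"
    using steps x[of 1] unfolding erwvrp_steps_def by auto
  ultimately show ?thesis using True by (simp add: step_prob_def prob_space)
next
  case False
  then have n: "1 \<le> n" by simp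
  have eq: "cyl x (Suc n) = {\<omega> \<in> space M. X (n + 1) \<omega> = x (n + 1) \<and> (\<forall>i\<in>{1..n}. X i \<omega> = x i)}"
    by (auto simp: cyl_def le_Suc_eq)
  show ?thesis
  proof (cases "prob (cyl x n) = 0")
    case True
    have "cyl x (Suc n) \<subseteq> cyl x n" by (auto simp: cyl_def)
    then have "prob (cyl x (Suc n)) \<le> prob (cyl x n)" by (intro finite_measure_mono) auto
    then show ?thesis using True by (simp add: measure_le_0_iff)
  next
    case False
    then have pos: "prob {\<omega> \<in> space M. \<forall>i\<in>{1..n}. X i \<omega> = x i} > 0"
      by (simp add: cyl_def zero_less_measure_iff)
    have mk: "\<P>(\<omega> in M. X (n + 1) \<omega> = x (n + 1) \<bar> \<forall>i\<in>{1..n}. X i \<omega> = x i) = \<P>(\<omega> in M. X (n + 1) \<omega> = x (n + 1) \<bar> X n \<omega> = x n)"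
      using steps n pos unfolding erwvrp_steps_def markov_chain_def by blast
    have "\<P>(\<omega> in M. X (n + 1) \<omega> = x (n + 1) \<bar> X n \<omega> = x n) = step_prob n (x n) (x (Suc n))"
      using steps n x[of n] x[of "Suc n"] unfolding erwvrp_steps_def step_prob_def by auto
    moreover have "\<P>(\<omega> in M. X (n + 1) \<omega> = x (n + 1) \<bar> \<forall>i\<in>{1..n}. X i \<omega> = x i) = prob (cyl x (Suc n)) / prob (cyl x n)"
      unfolding eq cond_prob_def by (simp add: cyl_def)
    ultimately have "prob (cyl x (Suc n)) / prob (cyl x n) = step_prob n (x n) (x (Suc n))"
      using mk by simp
    then show ?thesis using False by (simp add: field_simps)
  qed
qed

lemma adaptedD:
  "adapted n Z \<Longrightarrow> \<omega> \<in> space M \<Longrightarrow> \<omega>' \<in> space M \<Longrightarrow> \<forall>i\<in>{1..n}. X i \<omega> = X i \<omega>' \<Longrightarrow> Z \<omega> = Z \<omega>'"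
  unfolding adapted_def by blast

lemma adapted_mono:
  assumes Z: "adapted m Z" and "m \<le> n"
  shows "adapted n Z"
  unfolding adapted_def
proof (intro ballI impI)
  fix \<omega> \<omega>' assume w: "\<omega> \<in> space M" "\<omega>' \<in> space M" and "\<forall>i\<in>{1..n}. X i \<omega> = X i \<omega>'"
  then have "\<forall>i\<in>{1..m}. X i \<omega> = X i \<omega>'" using \<open>m \<le> n\<close> by simp
  then show "Z \<omega> = Z \<omega>'" using Z w unfolding adapted_def by blast
qed

lemma adapted_X: "1 \<le> k \<Longrightarrow> k \<le> n \<Longrightarrow> adapted n (X k)"
  by (auto simp: adapted_def)

lemma adapted_compose: "adapted n Z \<Longrightarrow> adapted n (\<lambda>\<omega>. f (Z \<omega>))"
  unfolding adapted_def by metis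

lemma adapted_compose2: "adapted n Y \<Longrightarrow> adapted n Z \<Longrightarrow> adapted n (\<lambda>\<omega>. f (Y \<omega>) (Z \<omega>))"
  unfolding adapted_def by metis

lemma adapted_sum: "(\<And>i. i \<in> I \<Longrightarrow> adapted n (Z i)) \<Longrightarrow> adapted n (\<lambda>\<omega>. \<Sum>i\<in>I. Z i \<omega>)"
  unfolding adapted_def by (intro ballI impI sum.cong refl) blast

lemma adapted_const: "adapted n (\<lambda>_. c)"
  by (simp add: adapted_def)

lemma adapted_mult: "adapted n Y \<Longrightarrow> adapted n Z \<Longrightarrow> adapted n (\<lambda>\<omega>. Y \<omega> * Z \<omega>)"
  by (rule adapted_compose2)

lemma adapted_power: "adapted n Z \<Longrightarrow> adapted n (\<lambda>\<omega>. Z \<omega> ^ k)"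
  by (rule adapted_compose)

lemma adapted_decompose:
  assumes "adapted n Z"
  shows "\<exists>z. \<forall>\<omega>\<in>space M. Z \<omega> = (\<Sum>x\<in>signs n. z x * indicator (cyl x n) \<omega>)"
proof -
  \<comment> \<open>The value on a cylinder is read off at an arbitrary point of it; on an empty
    cylinder the indicator annihilates whatever value is chosen.\<close>
  define z where "z x = Z (SOME \<omega>. \<omega> \<in> cyl x n)" for x
  have "Z \<omega> = (\<Sum>x\<in>signs n. z x * indicator (cyl x n) \<omega>)" if w: "\<omega> \<in> space M" for \<omega>
  proof -
    define y where "y = restrict (\<lambda>i. X i \<omega>) {1..n}"
    have y: "y \<in> signs n" using X_values w by (auto simp: y_def signs_def)
    have wy: "\<omega> \<in> cyl y n" using w by (auto simp: cyl_def y_def)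
    have uniq: "x = y" if "x \<in> signs n" "\<omega> \<in> cyl x n" for x
      using that y wy unfolding signs_def by (intro PiE_ext) (auto simp: cyl_def)
    have "(\<Sum>x\<in>signs n. z x * indicator (cyl x n) \<omega>) = (\<Sum>x\<in>{y}. z x * indicator (cyl x n) \<omega>)"
      by (rule sum.mono_neutral_right) (use y uniq finite_signs in \<open>auto simp: indicator_def\<close>)
    also have "\<dots> = z y" using wy by simp
    also have "\<dots> = Z \<omega>"
    proof -
      have "(SOME \<omega>. \<omega> \<in> cyl y n) \<in> cyl y n" using wy by (rule someI)
      then show ?thesis using assms wy unfolding z_def adapted_def cyl_def by auto
    qed
    finally show ?thesis ..
  qed
  then show ?thesis by blast
qed

lemma adapted_measurable:
  assumes "adapted n Z" shows "Z \<in> borel_measurable M"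
proof -
  obtain z where z: "\<And>\<omega>. \<omega> \<in> space M \<Longrightarrow> Z \<omega> = (\<Sum>x\<in>signs n. z x * indicator (cyl x n) \<omega>)"
    using adapted_decompose[OF assms] by blast
  have "(\<lambda>\<omega>. \<Sum>x\<in>signs n. z x * indicator (cyl x n) \<omega>) \<in> borel_measurable M" by measurable
  then show ?thesis by (simp cong: measurable_cong add: z)
qed

lemma adapted_integrable:
  assumes "adapted n Z" shows "integrable M Z"
proof -
  obtain z where z: "\<And>\<omega>. \<omega> \<in> space M \<Longrightarrow> Z \<omega> = (\<Sum>x\<in>signs n. z x * indicator (cyl x n) \<omega>)"
    using adapted_decompose[OF assms] by blast
  have "integrable M (\<lambda>\<omega>. \<Sum>x\<in>signs n. z x * indicator (cyl x n) \<omega>)"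
    by (intro Bochner_Integration.integrable_sum integrable_mult_right integrable_real_indicator)
       (auto simp: emeasure_eq_measure)
  then show ?thesis by (rule Bochner_Integration.integrable_cong[THEN iffD1, rotated -1]) (auto simp: z)
qed

text \<open>The conditional mean of the next sign is r times the current sign, since p - (1 - p) =
  r. On each cylinder this is the difference of the probabilities of the two continuations.\<close>

lemma expectation_next:
  assumes Z: "adapted n Z" and n: "1 \<le> n"
  shows "expectation (\<lambda>\<omega>. Z \<omega> * X (Suc n) \<omega>) = r * expectation (\<lambda>\<omega>. Z \<omega> * X n \<omega>)"
proof -
  obtain z where z: "\<And>\<omega>. \<omega> \<in> space M \<Longrightarrow> Z \<omega> = (\<Sum>x\<in>signs n. z x * indicator (cyl x n) \<omega>)"
    using adapted_decompose[OF Z] by blast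
  have int: "integrable M (\<lambda>\<omega>. indicator (cyl x n) \<omega> * X k \<omega>)" if "1 \<le> k" for x k
    by (rule integrable_const_bound[where B=1])
       (use that in \<open>auto simp: X_abs indicator_def\<close>)
  have expand: "expectation (\<lambda>\<omega>. Z \<omega> * X k \<omega>) = (\<Sum>x\<in>signs n. z x * expectation (\<lambda>\<omega>. indicator (cyl x n) \<omega> * X k \<omega>))"
    if "1 \<le> k" for k
  proof -
    have "expectation (\<lambda>\<omega>. Z \<omega> * X k \<omega>) = expectation (\<lambda>\<omega>. \<Sum>x\<in>signs n. z x * (indicator (cyl x n) \<omega> * X k \<omega>))"
      by (intro Bochner_Integration.integral_cong refl) (simp add: z sum_distrib_right mult.assoc)
    then show ?thesis using int[OF that] by simp
  qed
  have one: "expectation (\<lambda>\<omega>. indicator (cyl x n) \<omega> * X (Suc n) \<omega>) = r * expectation (\<lambda>\<omega>. indicator (cyl x n) \<omega> * X n \<omega>)"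
    if x: "x \<in> signs n" for x
  proof -
    \<comment> \<open>The history x, continued by the sign s.\<close>
    define y where "y s i = (if i \<in> {1..n} then x i else s)" for s :: real and i
    have y: "y s i = 1 \<or> y s i = -1" if "s = 1 \<or> s = -1" for s i
      using x that by (auto simp: y_def signs_def PiE_iff)
    have c: "cyl (y s) n = cyl x n" for s by (auto simp: cyl_def y_def)
    have d: "cyl (y s) (Suc n) = {\<omega> \<in> cyl x n. X (Suc n) \<omega> = s}" for s
      by (auto simp: cyl_def y_def le_Suc_eq)
    have pr: "prob (cyl (y s) (Suc n)) = prob (cyl x n) * step_prob n (x n) s" if "s = 1 \<or> s = -1" for s
    proof -
      have "y s n = x n" "y s (Suc n) = s" using n by (auto simp: y_def)
      then show ?thesis using prob_cyl_Suc[of "y s" n] y[OF that] by (simp add: c)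
    qed
    have "expectation (\<lambda>\<omega>. indicator (cyl x n) \<omega> * X (Suc n) \<omega>)
        = expectation (\<lambda>\<omega>. indicator (cyl (y 1) (Suc n)) \<omega> - indicator (cyl (y (- 1)) (Suc n)) \<omega>)"
    proof (intro Bochner_Integration.integral_cong refl)
      fix \<omega> assume "\<omega> \<in> space M"
      then show "indicator (cyl x n) \<omega> * X (Suc n) \<omega> = indicator (cyl (y 1) (Suc n)) \<omega> - indicator (cyl (y (- 1)) (Suc n)) \<omega>"
        unfolding d using X_values[of "Suc n" \<omega>] by (auto simp: indicator_def)
    qed
    also have "\<dots> = prob (cyl (y 1) (Suc n)) - prob (cyl (y (- 1)) (Suc n))"
      by (subst Bochner_Integration.integral_diff) (auto simp: emeasure_eq_measure)
    also have "\<dots> = prob (cyl x n) * (step_prob n (x n) 1 - step_prob n (x n) (- 1))"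
      by (simp add: pr algebra_simps)
    also have "step_prob n (x n) 1 - step_prob n (x n) (- 1) = r * x n"
      using x n by (auto simp: step_prob_def r_def signs_def PiE_iff)
    also have "prob (cyl x n) * (r * x n) = r * expectation (\<lambda>\<omega>. indicator (cyl x n) \<omega> * x n)" by simp
    also have "expectation (\<lambda>\<omega>. indicator (cyl x n) \<omega> * x n) = expectation (\<lambda>\<omega>. indicator (cyl x n) \<omega> * X n \<omega>)"
      by (intro Bochner_Integration.integral_cong refl) (use n in \<open>auto simp: indicator_def cyl_def intro!: bexI[of _ n]\<close>)
    finally show ?thesis .
  qed
  show ?thesis
    using n by (simp add: expand one sum_distrib_left mult.left_commute)
qed

section \<open>Martingale differences and their weighted sums\<close>

definition D :: "nat \<Rightarrow> 'w \<Rightarrow> real" where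
  "D i \<omega> = X i \<omega> - r * X (i - 1) \<omega>"

text \<open>\<open>X 0\<close> is unconstrained, so nothing can be said of \<open>D 1\<close>; hence
  2 \<le> i here and 1 \<le> m in the block estimates.\<close>

lemma adapted_D: "2 \<le> i \<Longrightarrow> i \<le> n \<Longrightarrow> adapted n (D i)"
  unfolding D_def[abs_def] by (rule adapted_compose2) (auto intro: adapted_X)

lemma D_abs: "2 \<le> i \<Longrightarrow> \<omega> \<in> space M \<Longrightarrow> \<bar>D i \<omega>\<bar> \<le> 2"
  using X_abs[of i \<omega>] X_abs[of "i - 1" \<omega>] r_bounds(1) abs_triangle_ineq4[of "X i \<omega>" "r * X (i - 1) \<omega>"]
  by (auto simp: D_def abs_mult)

text \<open>Both are instances of \<open>expectation_next\<close>, once with Z and once with Z * X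
  n: squares of signs are 1, so in the square of the difference only the product X n * X (n + 1)
  remains random.\<close>

lemma expectation_D:
  assumes Z: "adapted n Z" and n: "1 \<le> n"
  shows "expectation (\<lambda>\<omega>. Z \<omega> * D (Suc n) \<omega>) = 0"
    and "expectation (\<lambda>\<omega>. Z \<omega> * (D (Suc n) \<omega>)\<^sup>2) = (1 - r\<^sup>2) * expectation Z"
proof -
  have aX: "adapted (Suc n) (X (Suc n))" "adapted (Suc n) (X n)" "adapted n (X n)"
    using n by (auto intro: adapted_X)
  have Z': "adapted (Suc n) Z" using adapted_mono[OF Z] by simp
  have i: "integrable M (\<lambda>\<omega>. Z \<omega> * X (Suc n) \<omega>)" "integrable M (\<lambda>\<omega>. Z \<omega> * X n \<omega>)"
    by (rule adapted_integrable[of "Suc n"], rule adapted_compose2[OF Z'], rule aX)+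
  show "expectation (\<lambda>\<omega>. Z \<omega> * D (Suc n) \<omega>) = 0"
  proof -
    have "expectation (\<lambda>\<omega>. Z \<omega> * D (Suc n) \<omega>) = expectation (\<lambda>\<omega>. Z \<omega> * X (Suc n) \<omega> - r * (Z \<omega> * X n \<omega>))"
      by (intro Bochner_Integration.integral_cong refl) (simp add: D_def algebra_simps)
    also have "\<dots> = 0" using i expectation_next[OF assms] by simp
    finally show ?thesis .
  qed
  have Zn: "adapted n (\<lambda>\<omega>. Z \<omega> * X n \<omega>)" by (rule adapted_compose2[OF Z aX(3)])
  have iZ: "integrable M Z" by (rule adapted_integrable[OF Z])
  have iZn: "integrable M (\<lambda>\<omega>. Z \<omega> * X n \<omega> * X (Suc n) \<omega>)"
    by (rule adapted_integrable[of "Suc n"], rule adapted_compose2[OF adapted_mono[OF Zn]]) (auto intro: aX)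
  have sq: "expectation (\<lambda>\<omega>. Z \<omega> * X n \<omega> * X n \<omega>) = expectation Z"
    by (intro Bochner_Integration.integral_cong refl) (use n X_square in \<open>simp add: mult.assoc\<close>)
  have "expectation (\<lambda>\<omega>. Z \<omega> * (D (Suc n) \<omega>)\<^sup>2) = expectation (\<lambda>\<omega>. (1 + r\<^sup>2) * Z \<omega> - 2 * r * (Z \<omega> * X n \<omega> * X (Suc n) \<omega>))"
  proof (intro Bochner_Integration.integral_cong refl)
    fix \<omega> assume w: "\<omega> \<in> space M"
    have "(D (Suc n) \<omega>)\<^sup>2 = X (Suc n) \<omega> * X (Suc n) \<omega> + r\<^sup>2 * (X n \<omega> * X n \<omega>) - 2 * r * (X n \<omega> * X (Suc n) \<omega>)"
      by (simp add: D_def power2_eq_square algebra_simps)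
    also have "\<dots> = 1 + r\<^sup>2 - 2 * r * (X n \<omega> * X (Suc n) \<omega>)"
      using X_square[of n, OF n w] X_square[of "Suc n", OF _ w] by simp
    finally have sqD: "(D (Suc n) \<omega>)\<^sup>2 = 1 + r\<^sup>2 - 2 * r * (X n \<omega> * X (Suc n) \<omega>)" .
    show "Z \<omega> * (D (Suc n) \<omega>)\<^sup>2 = (1 + r\<^sup>2) * Z \<omega> - 2 * r * (Z \<omega> * X n \<omega> * X (Suc n) \<omega>)"
      unfolding sqD by (simp add: algebra_simps)
  qed
  also have "\<dots> = (1 + r\<^sup>2) * expectation Z - 2 * r * (r * expectation Z)"
    using iZ iZn expectation_next[OF Zn n] sq by simp
  also have "\<dots> = (1 - r\<^sup>2) * expectation Z" by (simp add: power2_eq_square algebra_simps)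
  finally show "expectation (\<lambda>\<omega>. Z \<omega> * (D (Suc n) \<omega>)\<^sup>2) = (1 - r\<^sup>2) * expectation Z" .
qed

definition wsum :: "(nat \<Rightarrow> real) \<Rightarrow> nat \<Rightarrow> nat \<Rightarrow> 'w \<Rightarrow> real" where
  "wsum b m j \<omega> = (\<Sum>i\<in>{m<..j}. b i * D i \<omega>)"

lemma wsum_Suc: "m \<le> j \<Longrightarrow> wsum b m (Suc j) \<omega> = wsum b m j \<omega> + b (Suc j) * D (Suc j) \<omega>"
proof -
  assume "m \<le> j"
  then have "{m<..Suc j} = insert (Suc j) {m<..j}" by auto
  then show ?thesis by (simp add: wsum_def)
qed

lemma adapted_wsum: "1 \<le> m \<Longrightarrow> j \<le> n \<Longrightarrow> adapted n (wsum b m j)"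
  unfolding wsum_def[abs_def]
  by (intro adapted_sum adapted_compose[of _ "D _" "\<lambda>z. b _ * z"] adapted_D) auto

lemma wsum_second_moment:
  assumes m: "1 \<le> m" and j: "m \<le> j"
  shows "expectation (\<lambda>\<omega>. (wsum b m j \<omega>)\<^sup>2) = (1 - r\<^sup>2) * (\<Sum>i\<in>{m<..j}. (b i)\<^sup>2)"
  using j
proof (induction j rule: dec_induct)
  case base
  then show ?case by (simp add: wsum_def)
next
  case (step j)
  let ?Z = "wsum b m j" and ?b = "b (Suc j)"
  have aZ: "adapted j ?Z" using m by (intro adapted_wsum) auto
  have aD: "adapted (Suc j) (D (Suc j))" using m step by (intro adapted_D) auto
  have "1 \<le> j" using m step by simp
  note e = expectation_D(1)[OF aZ this] expectation_D(2)[OF adapted_const[of _ 1] this]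
  have i: "integrable M (\<lambda>\<omega>. (?Z \<omega>)\<^sup>2)" "integrable M (\<lambda>\<omega>. ?Z \<omega> * D (Suc j) \<omega>)" "integrable M (\<lambda>\<omega>. 1 * (D (Suc j) \<omega>)\<^sup>2)"
    by (rule adapted_integrable[of "Suc j"], intro adapted_mult adapted_power adapted_const aD adapted_mono[OF aZ], simp)+
       (rule adapted_integrable[of "Suc j"], intro adapted_mult adapted_power adapted_const aD)
  have "expectation (\<lambda>\<omega>. (wsum b m (Suc j) \<omega>)\<^sup>2)
      = expectation (\<lambda>\<omega>. (?Z \<omega>)\<^sup>2 + 2 * ?b * (?Z \<omega> * D (Suc j) \<omega>) + ?b\<^sup>2 * (1 * (D (Suc j) \<omega>)\<^sup>2))"
    using step by (intro Bochner_Integration.integral_cong refl) (simp add: wsum_Suc power2_eq_square algebra_simps)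
  also have "\<dots> = expectation (\<lambda>\<omega>. (?Z \<omega>)\<^sup>2) + ?b\<^sup>2 * (1 - r\<^sup>2)"
    using i e by (simp add: prob_space)
  also have "\<dots> = (1 - r\<^sup>2) * (\<Sum>i\<in>{m<..Suc j}. (b i)\<^sup>2)"
  proof -
    have "{m<..Suc j} = insert (Suc j) {m<..j}" using step by auto
    then show ?thesis using step by (simp add: algebra_simps)
  qed
  finally show ?case .
qed

text \<open>Induction over the last index: the term cubic in the old sum is orthogonal to the new
  difference, the quadratic term is controlled by the second moment, and |D| \<le> 2 bounds the
  rest. The constant 48 = 3 * 2^4 is dictated by the pure term b^4; expanding 48 * (V + b^2)^2 then
  leaves ample room for 32 * b^2 * V.\<close>

lemma wsum_fourth_moment:
  assumes m: "1 \<le> m" and j: "m \<le> j"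
  shows "expectation (\<lambda>\<omega>. wsum b m j \<omega> ^ 4) \<le> 48 * (\<Sum>i\<in>{m<..j}. (b i)\<^sup>2)\<^sup>2"
  using j
proof (induction j rule: dec_induct)
  case base
  then show ?case by (simp add: wsum_def)
next
  case (step j)
  let ?Z = "wsum b m j" and ?b = "b (Suc j)" and ?V = "\<Sum>i\<in>{m<..j}. (b i)\<^sup>2"
  have V0: "0 \<le> ?V" by (simp add: sum_nonneg)
  have aZ: "adapted j ?Z" using m by (intro adapted_wsum) auto
  have aD: "adapted (Suc j) (D (Suc j))" using m step by (intro adapted_D) auto
  have j1: "1 \<le> j" using m step by simp
  have aZ3: "adapted j (\<lambda>\<omega>. ?Z \<omega> ^ 3)" by (rule adapted_compose[OF aZ])
  have e3: "expectation (\<lambda>\<omega>. ?Z \<omega> ^ 3 * D (Suc j) \<omega>) = 0"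
    by (rule expectation_D(1)[OF aZ3 j1])
  have i: "integrable M (\<lambda>\<omega>. ?Z \<omega> ^ 4)" "integrable M (\<lambda>\<omega>. (?Z \<omega>)\<^sup>2)"
     "integrable M (\<lambda>\<omega>. ?Z \<omega> ^ 3 * D (Suc j) \<omega>)"
    by (rule adapted_integrable[of "Suc j"], intro adapted_mult adapted_power aD adapted_mono[OF aZ], simp)+
  have pw: "(z + c * d) ^ 4 \<le> z ^ 4 + 4 * c * (z ^ 3 * d) + 32 * c\<^sup>2 * z\<^sup>2 + 48 * c ^ 4" if d: "\<bar>d\<bar> \<le> 2" for z c d :: real
  proof -
    have d2: "d\<^sup>2 \<le> 4" using power_mono[OF d, of 2] by simp
    have d4: "d ^ 4 \<le> 16" using power_mono[OF d, of 4] by (simp add: power_even_abs_numeral)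
    \<comment> \<open>The term linear in z has no sign; it is shared out between the quadratic and
      the quartic term.\<close>
    have "4 * (z * c * d) * (c * d)\<^sup>2 \<le> 2 * ((z * c * d)\<^sup>2 + ((c * d)\<^sup>2)\<^sup>2)"
      using sum_squares_bound[of "z * c * d" "(c * d)\<^sup>2"] by simp
    then have a: "4 * (z * (c * d) ^ 3) \<le> 2 * (c\<^sup>2 * z\<^sup>2 * d\<^sup>2) + 2 * (c ^ 4 * d ^ 4)"
      by (simp add: power2_eq_square power3_eq_cube power4_eq_xxxx algebra_simps)
    have "(z + c * d) ^ 4 = z ^ 4 + 4 * c * (z ^ 3 * d) + 6 * (c\<^sup>2 * z\<^sup>2 * d\<^sup>2) + 4 * (z * (c * d) ^ 3) + c ^ 4 * d ^ 4"
      by (simp add: power2_eq_square power3_eq_cube power4_eq_xxxx algebra_simps)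
    also have "\<dots> \<le> z ^ 4 + 4 * c * (z ^ 3 * d) + 8 * (c\<^sup>2 * z\<^sup>2 * d\<^sup>2) + 3 * (c ^ 4 * d ^ 4)" using a by linarith
    finally have "(z + c * d) ^ 4 \<le> z ^ 4 + 4 * c * (z ^ 3 * d) + 8 * (c\<^sup>2 * z\<^sup>2 * d\<^sup>2) + 3 * (c ^ 4 * d ^ 4)" .
    moreover have "c\<^sup>2 * z\<^sup>2 * d\<^sup>2 \<le> c\<^sup>2 * z\<^sup>2 * 4" by (intro mult_left_mono d2) auto
    moreover have "c ^ 4 * d ^ 4 \<le> c ^ 4 * 16" by (intro mult_left_mono d4) auto
    ultimately have "(z + c * d) ^ 4 \<le> z ^ 4 + 4 * c * (z ^ 3 * d) + 32 * (c\<^sup>2 * z\<^sup>2) + 48 * c ^ 4" by linarith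
    then show ?thesis by (simp add: mult.assoc)
  qed
  have iD4: "integrable M (\<lambda>\<omega>. wsum b m (Suc j) \<omega> ^ 4)"
    by (rule adapted_integrable[of "Suc j"], rule adapted_compose, rule adapted_wsum) (use m in auto)
  have "expectation (\<lambda>\<omega>. wsum b m (Suc j) \<omega> ^ 4)
     \<le> expectation (\<lambda>\<omega>. ?Z \<omega> ^ 4 + 4 * ?b * (?Z \<omega> ^ 3 * D (Suc j) \<omega>) + 32 * ?b\<^sup>2 * (?Z \<omega>)\<^sup>2 + 48 * ?b ^ 4)"
  proof (rule integral_mono)
    fix \<omega> assume "\<omega> \<in> space M"
    then show "wsum b m (Suc j) \<omega> ^ 4 \<le> ?Z \<omega> ^ 4 + 4 * ?b * (?Z \<omega> ^ 3 * D (Suc j) \<omega>) + 32 * ?b\<^sup>2 * (?Z \<omega>)\<^sup>2 + 48 * ?b ^ 4"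
      using pw[of "D (Suc j) \<omega>" "?Z \<omega>" ?b] D_abs[of "Suc j" \<omega>] j1 step by (simp add: wsum_Suc)
  qed (use i iD4 in auto)
  also have "\<dots> = expectation (\<lambda>\<omega>. ?Z \<omega> ^ 4) + 32 * ?b\<^sup>2 * expectation (\<lambda>\<omega>. (?Z \<omega>)\<^sup>2) + 48 * ?b ^ 4"
    using i e3 by (simp add: prob_space)
  also have "\<dots> \<le> 48 * ?V\<^sup>2 + 32 * ?b\<^sup>2 * ?V + 48 * ?b ^ 4"
  proof -
    have "expectation (\<lambda>\<omega>. (?Z \<omega>)\<^sup>2) \<le> 1 * ?V"
      unfolding wsum_second_moment[OF m step(1)] by (rule mult_right_mono) (use V0 in auto)
    then have "32 * ?b\<^sup>2 * expectation (\<lambda>\<omega>. (?Z \<omega>)\<^sup>2) \<le> 32 * ?b\<^sup>2 * ?V" by (intro mult_left_mono) auto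
    then show ?thesis using step.IH by linarith
  qed
  also have "\<dots> \<le> 48 * (?V + ?b\<^sup>2)\<^sup>2"
  proof -
    have "48 * (?V + ?b\<^sup>2)\<^sup>2 - (48 * ?V\<^sup>2 + 32 * ?b\<^sup>2 * ?V + 48 * ?b ^ 4) = 64 * (?b\<^sup>2 * ?V)"
      by (simp add: power2_eq_square power4_eq_xxxx algebra_simps)
    moreover have "0 \<le> ?b\<^sup>2 * ?V" using V0 by simp
    ultimately show ?thesis by linarith
  qed
  also have "?V + ?b\<^sup>2 = (\<Sum>i\<in>{m<..Suc j}. (b i)\<^sup>2)"
  proof -
    have "{m<..Suc j} = insert (Suc j) {m<..j}" using step by auto
    then show ?thesis using step by (simp add: algebra_simps)
  qed
  finally show ?case .
qed

text \<open>The first-passage indicator times the cube of the sum depends on the signs up to m + j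
  only, and every later difference is orthogonal to such functions.\<close>

lemma wsum_maximal:
  assumes m: "1 \<le> m" and n: "m \<le> n" and x: "0 < x"
  shows "prob {\<omega> \<in> space M. \<exists>j\<in>{m..n}. x \<le> \<bar>wsum b m j \<omega>\<bar>} \<le> 48 * (\<Sum>i\<in>{m<..n}. (b i)\<^sup>2)\<^sup>2 / x ^ 4"
proof -
  let ?Z = "\<lambda>i. wsum b m (m + i)"
  have ad: "adapted k (?Z i)" if "m + i \<le> k" for i k
    using m that by (intro adapted_wsum) auto
  have "prob {\<omega> \<in> space M. \<exists>j\<le>n - m. x \<le> \<bar>?Z j \<omega>\<bar>} \<le> expectation (\<lambda>\<omega>. ?Z (n - m) \<omega> ^ 4) / x ^ 4"
  proof (rule fourth_moment_maximal[OF _ _ x])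
    fix j assume j: "j \<le> n - m"
    show "?Z j \<in> borel_measurable M" by (rule adapted_measurable[OF ad[OF order_refl]])
    show "integrable M (\<lambda>\<omega>. ?Z j \<omega> ^ 4)" by (rule adapted_integrable[OF adapted_compose[OF ad[OF order_refl]]])
    define G where "G \<omega> = of_bool (x \<le> \<bar>?Z j \<omega>\<bar> \<and> (\<forall>i<j. \<bar>?Z i \<omega>\<bar> < x)) * ?Z j \<omega> ^ 3" for \<omega>
    have aG: "adapted (m + j) G"
      unfolding adapted_def
    proof (intro ballI impI)
      fix \<omega> \<omega>' assume w: "\<omega> \<in> space M" "\<omega>' \<in> space M" and e: "\<forall>i\<in>{1..m + j}. X i \<omega> = X i \<omega>'"
      have "?Z i \<omega> = ?Z i \<omega>'" if "i \<le> j" for i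
        by (rule adaptedD[OF ad[of i "m + j"] w e]) (use that in simp)
      then show "G \<omega> = G \<omega>'" unfolding G_def by (auto simp: less_imp_le)
    qed
    have z: "expectation (\<lambda>\<omega>. G \<omega> * D i \<omega>) = 0" and iz: "integrable M (\<lambda>\<omega>. G \<omega> * D i \<omega>)" if i: "i \<in> {m + j<..n}" for i
    proof -
      obtain k where k: "i = Suc k" "m + j \<le> k" using i by (cases i) auto
      show "expectation (\<lambda>\<omega>. G \<omega> * D i \<omega>) = 0"
        unfolding k(1) by (rule expectation_D(1)[OF adapted_mono[OF aG k(2)]]) (use m k in simp)
      show "integrable M (\<lambda>\<omega>. G \<omega> * D i \<omega>)"
        by (rule adapted_integrable[of i], rule adapted_compose2[OF adapted_mono[OF aG]]) (use m k in \<open>auto intro: adapted_D\<close>)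
    qed
    have diff: "?Z (n - m) \<omega> - ?Z j \<omega> = (\<Sum>i\<in>{m + j<..n}. b i * D i \<omega>)" for \<omega>
    proof -
      have "{m<..n} = {m<..m + j} \<union> {m + j<..n}" using j n by auto
      moreover have "{m<..m + j} \<inter> {m + j<..n} = {}" by auto
      ultimately have "wsum b m n \<omega> = wsum b m (m + j) \<omega> + (\<Sum>i\<in>{m + j<..n}. b i * D i \<omega>)"
        unfolding wsum_def using sum.union_disjoint[of "{m<..m + j}" "{m + j<..n}" "\<lambda>i. b i * D i \<omega>"] by simp
      then show ?thesis using n by simp
    qed
    have "expectation (\<lambda>\<omega>. G \<omega> * (?Z (n - m) \<omega> - ?Z j \<omega>)) = expectation (\<lambda>\<omega>. \<Sum>i\<in>{m + j<..n}. b i * (G \<omega> * D i \<omega>))"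
      unfolding diff by (simp add: sum_distrib_left mult.left_commute)
    also have "\<dots> = (\<Sum>i\<in>{m + j<..n}. b i * expectation (\<lambda>\<omega>. G \<omega> * D i \<omega>))"
      using iz by simp
    also have "\<dots> = 0" using z by (intro sum.neutral) auto
    finally show "expectation (\<lambda>\<omega>. of_bool (x \<le> \<bar>?Z j \<omega>\<bar> \<and> (\<forall>i<j. \<bar>?Z i \<omega>\<bar> < x)) * ?Z j \<omega> ^ 3 * (?Z (n - m) \<omega> - ?Z j \<omega>)) = 0"
      unfolding G_def .
  qed
  also have "expectation (\<lambda>\<omega>. ?Z (n - m) \<omega> ^ 4) \<le> 48 * (\<Sum>i\<in>{m<..n}. (b i)\<^sup>2)\<^sup>2"
    using wsum_fourth_moment[OF m n, of b] n by simp
  also have "{\<omega> \<in> space M. \<exists>j\<le>n - m. x \<le> \<bar>?Z j \<omega>\<bar>} = {\<omega> \<in> space M. \<exists>j\<in>{m..n}. x \<le> \<bar>wsum b m j \<omega>\<bar>}"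
  proof (intro Collect_cong conj_cong refl iffI)
    fix \<omega> assume "\<exists>j\<in>{m..n}. x \<le> \<bar>wsum b m j \<omega>\<bar>"
    then obtain j where "j \<in> {m..n}" "x \<le> \<bar>wsum b m j \<omega>\<bar>" by blast
    then show "\<exists>j\<le>n - m. x \<le> \<bar>?Z j \<omega>\<bar>" by (intro exI[of _ "j - m"]) auto
  next
    fix \<omega> assume "\<exists>j\<le>n - m. x \<le> \<bar>?Z j \<omega>\<bar>"
    then obtain j where "j \<le> n - m" "x \<le> \<bar>?Z j \<omega>\<bar>" by blast
    then show "\<exists>j\<in>{m..n}. x \<le> \<bar>wsum b m j \<omega>\<bar>" using n by (intro bexI[of _ "m + j"]) auto
  qed
  finally show ?thesis using x by (simp add: divide_right_mono)
qed

end

section \<open>The variance recursion\<close>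

text \<open>The coefficient of \<open>D j\<close> in the sum of a k * X k over k \<le> n: unfolding
  X k = r * X (k - 1) + D k spreads each a k geometrically over the earlier indices. It depends on
  the end index n.\<close>

definition tail_coeff :: "real \<Rightarrow> (nat \<Rightarrow> real) \<Rightarrow> nat \<Rightarrow> nat \<Rightarrow> real" where
  "tail_coeff r a n j = (\<Sum>k\<in>{j..n}. a k * r ^ (k - j))"

text \<open>\<open>covar\<close> and \<open>var_rec\<close> are E (S n * X n), for n \<ge> 1, and E
  ((S n)^2) in recursive form, as \<open>walk_moments\<close> shows. All variance estimates can thus
  be made for deterministic sequences.\<close>

primrec covar :: "real \<Rightarrow> (nat \<Rightarrow> real) \<Rightarrow> nat \<Rightarrow> real" where
  "covar r a 0 = 0"
| "covar r a (Suc n) = r * covar r a n + a (Suc n)"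

primrec var_rec :: "real \<Rightarrow> (nat \<Rightarrow> real) \<Rightarrow> nat \<Rightarrow> real" where
  "var_rec r a 0 = 0"
| "var_rec r a (Suc n) = var_rec r a n + 2 * r * a (Suc n) * covar r a n + (a (Suc n))\<^sup>2"

lemma tail_coeff_gt: "n < j \<Longrightarrow> tail_coeff r a n j = 0"
  by (simp add: tail_coeff_def)

lemma tail_coeff_step:
  assumes "j \<le> n"
  shows "tail_coeff r a n j = a j + r * tail_coeff r a n (Suc j)"
proof -
  have "{j..n} = insert j {Suc j..n}" using assms by auto
  then have "tail_coeff r a n j = a j + (\<Sum>k\<in>{Suc j..n}. a k * r ^ (k - j))"
    by (simp add: tail_coeff_def)
  also have "(\<Sum>k\<in>{Suc j..n}. a k * r ^ (k - j)) = (\<Sum>k\<in>{Suc j..n}. r * (a k * r ^ (k - Suc j)))"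
  proof (intro sum.cong refl)
    fix k assume "k \<in> {Suc j..n}"
    then have "k - j = Suc (k - Suc j)" by auto
    then show "a k * r ^ (k - j) = r * (a k * r ^ (k - Suc j))" by simp
  qed
  finally show ?thesis by (simp add: tail_coeff_def sum_distrib_left)
qed

lemma greaterThanAtMost_head: "m < n \<Longrightarrow> {m<..n} = insert (Suc m) {Suc m<..n}" for m n :: nat
  by auto

text \<open>For m \<ge> 1 this is the second moment of S n = S m + r * b * X m + (sum of b i * D i),
  with b i the tail coefficients and b the one at m + 1: the last sum is orthogonal to the rest, and
  S m correlates with X m through \<open>covar\<close>. The induction runs over m downwards from
  n.\<close>

lemma var_rec_block:
  assumes "m \<le> n"
  shows "var_rec r a n = var_rec r a m + 2 * r * tail_coeff r a n (Suc m) * covar r a m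
    + r\<^sup>2 * (tail_coeff r a n (Suc m))\<^sup>2 + (1 - r\<^sup>2) * (\<Sum>i\<in>{m<..n}. (tail_coeff r a n i)\<^sup>2)"
  using assms
proof (induction m rule: inc_induct)
  case base
  then show ?case by (simp add: tail_coeff_gt)
next
  case (step m)
  show ?case
    unfolding step.IH using step(2) tail_coeff_step[of "Suc m" n r a]
    by (simp add: greaterThanAtMost_head power2_eq_square algebra_simps)
qed

text \<open>The tail recursion inverts to a i = b i - r * b (i + 1), so small tail coefficients
  force small a. This is the source of the lower bounds on the variance.\<close>

lemma sum_sq_le_tail:
  assumes r: "\<bar>r\<bar> < 1"
  shows "(\<Sum>i\<in>{m<..n}. (a i)\<^sup>2) \<le> 4 * (\<Sum>i\<in>{m<..n}. (tail_coeff r a n i)\<^sup>2)"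
proof -
  let ?t = "tail_coeff r a n"
  have r2: "r\<^sup>2 \<le> 1" using r by (simp add: abs_square_le_1)
  have "(\<Sum>i\<in>{m<..n}. (a i)\<^sup>2) \<le> (\<Sum>i\<in>{m<..n}. 2 * (?t i)\<^sup>2 + 2 * (?t (Suc i))\<^sup>2)"
  proof (rule sum_mono)
    fix i assume "i \<in> {m<..n}"
    then have a: "a i = ?t i - r * ?t (Suc i)" using tail_coeff_step[of i n r a] by simp
    have "(a i)\<^sup>2 \<le> 2 * (?t i)\<^sup>2 + 2 * (r * ?t (Suc i))\<^sup>2"
      using sum_squares_bound[of "?t i" "- (r * ?t (Suc i))"] unfolding a
      by (simp add: power2_eq_square algebra_simps)
    also have "(r * ?t (Suc i))\<^sup>2 \<le> 1 * (?t (Suc i))\<^sup>2"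
      unfolding power_mult_distrib by (rule mult_right_mono[OF r2]) simp
    finally show "(a i)\<^sup>2 \<le> 2 * (?t i)\<^sup>2 + 2 * (?t (Suc i))\<^sup>2" by simp
  qed
  also have "\<dots> = 2 * (\<Sum>i\<in>{m<..n}. (?t i)\<^sup>2) + 2 * (\<Sum>i\<in>{m<..n}. (?t (Suc i))\<^sup>2)"
    by (simp add: sum.distrib sum_distrib_left)
  also have "(\<Sum>i\<in>{m<..n}. (?t (Suc i))\<^sup>2) = (\<Sum>i\<in>Suc ` {m<..n}. (?t i)\<^sup>2)"
    by (simp add: sum.reindex)
  also have "\<dots> \<le> (\<Sum>i\<in>insert (Suc n) {m<..n}. (?t i)\<^sup>2)"
    by (rule sum_mono2) auto
  also have "\<dots> = (\<Sum>i\<in>{m<..n}. (?t i)\<^sup>2)"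
    by (simp add: tail_coeff_gt)
  finally show ?thesis by simp
qed

text \<open>Write a + r * v as a convex combination of a / (1 - |r|) and v or -v, with weights 1 -
  |r| and |r|. Convexity of the square produces no cross term, and the shifted sum is absorbed into
  the left-hand side.\<close>

lemma tail_sum_sq_le:
  assumes r: "\<bar>r\<bar> < 1"
  shows "(\<Sum>i\<in>{m<..n}. (tail_coeff r a n i)\<^sup>2) \<le> (\<Sum>i\<in>{m<..n}. (a i)\<^sup>2) / (1 - \<bar>r\<bar>)\<^sup>2"
proof -
  let ?t = "tail_coeff r a n" and ?q = "1 - \<bar>r\<bar>"
  have q: "0 < ?q" using r by simp
  have "(\<Sum>i\<in>{m<..n}. (?t i)\<^sup>2) \<le> (\<Sum>i\<in>{m<..n}. (a i)\<^sup>2 / ?q + \<bar>r\<bar> * (?t (Suc i))\<^sup>2)"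
  proof (rule sum_mono)
    fix i assume "i \<in> {m<..n}"
    then have t: "?t i = a i + r * ?t (Suc i)" using tail_coeff_step[of i n r a] by simp
    define u v where "u = a i" and "v = ?t (Suc i)"
    have "u\<^sup>2 / ?q + \<bar>r\<bar> * v\<^sup>2 - (u + r * v)\<^sup>2 = (if r \<ge> 0 then r / ?q * (u - ?q * v)\<^sup>2 else - r / ?q * (u + ?q * v)\<^sup>2)"
      using q by (auto simp: field_simps power2_eq_square abs_if)
    also have "\<dots> \<ge> 0" using q by (auto intro!: divide_nonpos_pos mult_nonpos_nonneg)
    finally show "(?t i)\<^sup>2 \<le> (a i)\<^sup>2 / ?q + \<bar>r\<bar> * (?t (Suc i))\<^sup>2"
      unfolding t u_def v_def by simp
  qed
  also have "\<dots> = (\<Sum>i\<in>{m<..n}. (a i)\<^sup>2) / ?q + \<bar>r\<bar> * (\<Sum>i\<in>{m<..n}. (?t (Suc i))\<^sup>2)"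
    by (simp add: sum.distrib sum_distrib_left sum_divide_distrib)
  also have "(\<Sum>i\<in>{m<..n}. (?t (Suc i))\<^sup>2) = (\<Sum>i\<in>Suc ` {m<..n}. (?t i)\<^sup>2)"
    by (simp add: sum.reindex)
  finally have 1: "(\<Sum>i\<in>{m<..n}. (?t i)\<^sup>2) \<le> (\<Sum>i\<in>{m<..n}. (a i)\<^sup>2) / ?q + \<bar>r\<bar> * (\<Sum>i\<in>Suc ` {m<..n}. (?t i)\<^sup>2)" .
  have "(\<Sum>i\<in>Suc ` {m<..n}. (?t i)\<^sup>2) \<le> (\<Sum>i\<in>insert (Suc n) {m<..n}. (?t i)\<^sup>2)"
    by (rule sum_mono2) auto
  also have "\<dots> = (\<Sum>i\<in>{m<..n}. (?t i)\<^sup>2)"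
    by (simp add: tail_coeff_gt)
  finally have "\<bar>r\<bar> * (\<Sum>i\<in>Suc ` {m<..n}. (?t i)\<^sup>2) \<le> \<bar>r\<bar> * (\<Sum>i\<in>{m<..n}. (?t i)\<^sup>2)"
    by (rule mult_left_mono) simp
  with 1 have "?q * (\<Sum>i\<in>{m<..n}. (?t i)\<^sup>2) \<le> (\<Sum>i\<in>{m<..n}. (a i)\<^sup>2) / ?q"
    by (simp add: algebra_simps)
  then have "(\<Sum>i\<in>{m<..n}. (?t i)\<^sup>2) \<le> (\<Sum>i\<in>{m<..n}. (a i)\<^sup>2) / ?q / ?q"
    using q by (simp add: pos_le_divide_eq mult.commute)
  then show ?thesis by (simp add: power2_eq_square)
qed

lemma tail_coeff_bound:
  assumes r: "\<bar>r\<bar> < 1" and \<beta>: "0 \<le> \<beta>" "\<And>k. j \<le> k \<Longrightarrow> k \<le> n \<Longrightarrow> \<bar>a k\<bar> \<le> \<beta>"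
  shows "\<bar>tail_coeff r a n j\<bar> \<le> \<beta> / (1 - \<bar>r\<bar>)"
proof (cases "j \<le> Suc n")
  case True
  then show ?thesis using \<beta>(2)
  proof (induction j rule: inc_induct)
    case base
    then show ?case using r \<beta> by (simp add: tail_coeff_gt)
  next
    case (step j)
    have "\<bar>tail_coeff r a n j\<bar> \<le> \<bar>a j\<bar> + \<bar>r\<bar> * \<bar>tail_coeff r a n (Suc j)\<bar>"
      using step(2) tail_coeff_step[of j n r a] abs_triangle_ineq[of "a j" "r * tail_coeff r a n (Suc j)"]
      by (simp add: abs_mult)
    also have "\<dots> \<le> \<beta> + \<bar>r\<bar> * (\<beta> / (1 - \<bar>r\<bar>))"
      using step by (intro add_mono mult_left_mono) auto
    also have "\<dots> = \<beta> / (1 - \<bar>r\<bar>)" using r by (simp add: field_simps)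
    finally show ?case .
  qed
next
  case False
  then show ?thesis using r \<beta> by (simp add: tail_coeff_gt)
qed

lemma covar_bound:
  assumes r: "\<bar>r\<bar> < 1" and \<beta>: "0 \<le> \<beta>" "\<And>k. 1 \<le> k \<Longrightarrow> k \<le> n \<Longrightarrow> \<bar>a k\<bar> \<le> \<beta>"
  shows "\<bar>covar r a n\<bar> \<le> \<beta> / (1 - \<bar>r\<bar>)"
  using \<beta>(2)
proof (induction n)
  case 0
  then show ?case using r \<beta> by simp
next
  case (Suc n)
  have "\<bar>covar r a (Suc n)\<bar> \<le> \<bar>r\<bar> * \<bar>covar r a n\<bar> + \<bar>a (Suc n)\<bar>"
    using abs_triangle_ineq[of "r * covar r a n" "a (Suc n)"] by (simp add: abs_mult)
  also have "\<dots> \<le> \<bar>r\<bar> * (\<beta> / (1 - \<bar>r\<bar>)) + \<beta>"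
    using Suc by (intro add_mono mult_left_mono) auto
  also have "\<dots> = \<beta> / (1 - \<bar>r\<bar>)" using r by (simp add: field_simps)
  finally show ?case .
qed

context elephant
begin

lemma adapted_walk: "adapted n (walk a X n)"
  unfolding walk_def[abs_def] by (intro adapted_sum adapted_compose[of _ "X _" "\<lambda>z. a _ * z"] adapted_X) auto

lemma walk_moments:
  "expectation (\<lambda>\<omega>. (walk a X n \<omega>)\<^sup>2) = var_rec r a n"
  "1 \<le> n \<Longrightarrow> expectation (\<lambda>\<omega>. walk a X n \<omega> * X n \<omega>) = covar r a n"
proof -
  have cov: "1 \<le> n \<Longrightarrow> expectation (\<lambda>\<omega>. walk a X n \<omega> * X n \<omega>) = covar r a n" for n
  proof (induction n)
    case (Suc n)
    show ?case
    proof (cases "n = 0")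
      case True
      have "expectation (\<lambda>\<omega>. walk a X (Suc n) \<omega> * X (Suc n) \<omega>) = expectation (\<lambda>\<omega>. a 1)"
        by (intro Bochner_Integration.integral_cong refl) (use True X_square[of 1] in \<open>simp add: walk_def\<close>)
      then show ?thesis using True by (simp add: prob_space)
    next
      case False
      then have n: "1 \<le> n" by simp
      have i: "integrable M (\<lambda>\<omega>. walk a X n \<omega> * X (Suc n) \<omega>)"
        by (rule adapted_integrable[of "Suc n"], intro adapted_mult adapted_mono[OF adapted_walk] adapted_X) auto
      have "expectation (\<lambda>\<omega>. walk a X (Suc n) \<omega> * X (Suc n) \<omega>) = expectation (\<lambda>\<omega>. walk a X n \<omega> * X (Suc n) \<omega> + a (Suc n))"
      proof (intro Bochner_Integration.integral_cong refl)
        fix \<omega> assume "\<omega> \<in> space M"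
        then show "walk a X (Suc n) \<omega> * X (Suc n) \<omega> = walk a X n \<omega> * X (Suc n) \<omega> + a (Suc n)"
          using X_square[of "Suc n" \<omega>] by (simp add: walk_def algebra_simps)
      qed
      also have "\<dots> = r * covar r a n + a (Suc n)"
        using i expectation_next[OF adapted_walk n] Suc.IH[OF n] by (simp add: prob_space)
      finally show ?thesis by simp
    qed
  qed simp
  then show "1 \<le> n \<Longrightarrow> expectation (\<lambda>\<omega>. walk a X n \<omega> * X n \<omega>) = covar r a n" .
  show "expectation (\<lambda>\<omega>. (walk a X n \<omega>)\<^sup>2) = var_rec r a n"
  proof (induction n)
    case 0
    then show ?case by (simp add: walk_def)
  next
    case (Suc n)
    have i: "integrable M (\<lambda>\<omega>. walk a X n \<omega> * X (Suc n) \<omega>)" "integrable M (\<lambda>\<omega>. (walk a X n \<omega>)\<^sup>2)"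
      by (rule adapted_integrable[of "Suc n"], intro adapted_mult adapted_power adapted_mono[OF adapted_walk] adapted_X, auto)+
    have "expectation (\<lambda>\<omega>. (walk a X (Suc n) \<omega>)\<^sup>2) = expectation (\<lambda>\<omega>. (walk a X n \<omega>)\<^sup>2 + 2 * a (Suc n) * (walk a X n \<omega> * X (Suc n) \<omega>) + (a (Suc n))\<^sup>2)"
    proof (intro Bochner_Integration.integral_cong refl)
      fix \<omega> assume "\<omega> \<in> space M"
      then have "(X (Suc n) \<omega>)\<^sup>2 = 1" using X_square[of "Suc n" \<omega>] by (simp add: power2_eq_square)
      then show "(walk a X (Suc n) \<omega>)\<^sup>2 = (walk a X n \<omega>)\<^sup>2 + 2 * a (Suc n) * (walk a X n \<omega> * X (Suc n) \<omega>) + (a (Suc n))\<^sup>2"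
        by (simp add: walk_def power2_sum power_mult_distrib algebra_simps)
    qed
    also have "\<dots> = var_rec r a n + 2 * a (Suc n) * expectation (\<lambda>\<omega>. walk a X n \<omega> * X (Suc n) \<omega>) + (a (Suc n))\<^sup>2"
      using i Suc by (simp add: prob_space)
    also have "expectation (\<lambda>\<omega>. walk a X n \<omega> * X (Suc n) \<omega>) = r * covar r a n"
    proof (cases "n = 0")
      case True then show ?thesis by (simp add: walk_def)
    next
      case False
      then have n: "1 \<le> n" by simp
      show ?thesis using expectation_next[OF adapted_walk n] cov[OF n] by simp
    qed
    finally show ?case by simp
  qed
qed

lemma L2_size_walk: "(L2_size M (walk a X) n)\<^sup>2 = var_rec r a n"
proof -
  have "0 \<le> expectation (\<lambda>\<omega>. (walk a X n \<omega>)\<^sup>2)" by (rule integral_nonneg_AE) simp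
  then show ?thesis using walk_moments(1)[of a n] by (simp add: L2_size_def)
qed

text \<open>The weights are frozen at an end index N, so that for all j of a block the main part is
  one and the same martingale transform and a single maximal inequality controls it. The price is
  the boundary term at j.\<close>

lemma walk_diff:
  assumes m: "1 \<le> m" "m \<le> j" "j \<le> N"
  shows "walk a X j \<omega> - walk a X m \<omega> = wsum (tail_coeff r a N) m j \<omega>
    + r * tail_coeff r a N (Suc m) * X m \<omega> - r * tail_coeff r a N (Suc j) * X j \<omega>"
  using m(2,3)
proof (induction j rule: dec_induct)
  case base
  then show ?case by (simp add: wsum_def)
next
  case (step j)
  then show ?case
    using tail_coeff_step[of "Suc j" N r a]
    by (simp add: walk_def wsum_Suc D_def algebra_simps)
qed

end

section \<open>Gaussian averaging and smoothing\<close>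

abbreviation "\<gamma> \<equiv> std_normal_distribution"

lemma prob_space_gauss: "prob_space \<gamma>"
  by (rule prob_space_normal_density) simp

lemma gauss_moments:
  "integrable \<gamma> (\<lambda>z. z)" "(\<integral>z. z \<partial>\<gamma>) = 0"
  "integrable \<gamma> (\<lambda>z. z\<^sup>2)" "(\<integral>z. z\<^sup>2 \<partial>\<gamma>) = 1"
  "integrable \<gamma> (\<lambda>z. \<bar>z\<bar>)" "(\<integral>z. \<bar>z\<bar> \<partial>\<gamma>) \<le> 1"
  "integrable \<gamma> (\<lambda>z. \<bar>z\<bar> ^ 3)" "(\<integral>z. \<bar>z\<bar> ^ 3 \<partial>\<gamma>) \<le> 2"
proof -
  have "2 / pi \<le> 1" using pi_ge_two by simp
  then have s: "sqrt (2 / pi) \<le> 1" by (simp only: real_sqrt_le_1_iff)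
  have e: "2 * 0 + 1 = (1::nat)" "sqrt (2 / pi) * 2 ^ 0 * fact 0 = sqrt (2 / pi)"
    "2 * 1 + 1 = (3::nat)" "sqrt (2 / pi) * 2 ^ 1 * fact 1 = sqrt (2 / pi) * 2" by simp_all
  have h1: "(\<integral>z. \<bar>z\<bar> \<partial>\<gamma>) = sqrt (2 / pi)"
    using std_normal_distribution_odd_moments_abs[of 0] unfolding e power_one_right .
  have h3: "(\<integral>z. \<bar>z\<bar> ^ 3 \<partial>\<gamma>) = sqrt (2 / pi) * 2"
    using std_normal_distribution_odd_moments_abs[of 1] unfolding e .
  show "integrable \<gamma> (\<lambda>z. z)" using integrable_std_normal_distribution_moment[of 1] by simp
  show "(\<integral>z. z \<partial>\<gamma>) = 0" using integral_std_normal_distribution_moment_odd[of 1] by simp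
  show "integrable \<gamma> (\<lambda>z. z\<^sup>2)" by (rule integrable_std_normal_distribution_moment)
  show "(\<integral>z. z\<^sup>2 \<partial>\<gamma>) = 1" using std_normal_distribution_even_moments[of 1] by (simp add: has_bochner_integral_iff)
  show "(\<integral>z. \<bar>z\<bar> \<partial>\<gamma>) \<le> 1" "(\<integral>z. \<bar>z\<bar> ^ 3 \<partial>\<gamma>) \<le> 2"
    using h1 h3 s by simp_all
  show "integrable \<gamma> (\<lambda>z. \<bar>z\<bar>)"
    using integrable_std_normal_distribution_moment[of 1] by simp
  show "integrable \<gamma> (\<lambda>z. \<bar>z\<bar> ^ 3)"
    using integrable_abs[OF integrable_std_normal_distribution_moment[of 3]] by (simp add: power_abs)
qed

text \<open>The heat semigroup at time s^2, with half the second derivative as generator.\<close>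

definition gauss_avg :: "real \<Rightarrow> (real \<Rightarrow> real) \<Rightarrow> real \<Rightarrow> real" where
  "gauss_avg s g x = (\<integral>z. g (x + s * z) \<partial>\<gamma>)"

text \<open>\<open>g1\<close> and \<open>g2\<close> act as derivatives only through the Taylor
  remainder, so a Gaussian average needs no differentiation under the integral. The constant L
  drives the estimates; c serves integrability and may grow from step to step.\<close>

definition smooth_bound :: "real \<Rightarrow> (real \<Rightarrow> real) \<Rightarrow> (real \<Rightarrow> real) \<Rightarrow> (real \<Rightarrow> real) \<Rightarrow> real \<Rightarrow> bool" where
  "smooth_bound L g g1 g2 c \<longleftrightarrow>
     g \<in> borel_measurable borel \<and> g1 \<in> borel_measurable borel \<and> g2 \<in> borel_measurable borel \<and>
     (\<forall>x. \<bar>g x\<bar> \<le> c + \<bar>x\<bar>) \<and> (\<forall>x. \<bar>g1 x\<bar> \<le> c) \<and> (\<forall>x. \<bar>g2 x\<bar> \<le> c) \<and>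
     (\<forall>x y. \<bar>g (x + y) - g x - g1 x * y - g2 x * y\<^sup>2 / 2\<bar> \<le> L * \<bar>y\<bar> ^ 3)"

lemma gauss_avg_integrable:
  assumes [measurable]: "g \<in> borel_measurable borel" and g: "\<And>x. \<bar>g x\<bar> \<le> c + \<bar>x\<bar>"
  shows "integrable \<gamma> (\<lambda>z. g (x + s * z))" "\<bar>gauss_avg s g x\<bar> \<le> c + \<bar>s\<bar> + \<bar>x\<bar>"
proof -
  interpret prob_space \<gamma> by (rule prob_space_gauss)
  have i: "integrable \<gamma> (\<lambda>z. c + \<bar>x\<bar> + \<bar>s\<bar> * \<bar>z\<bar>)" using gauss_moments by simp
  have b: "\<bar>g (x + s * z)\<bar> \<le> c + \<bar>x\<bar> + \<bar>s\<bar> * \<bar>z\<bar>" for z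
    using g[of "x + s * z"] abs_triangle_ineq[of x "s * z"] by (simp add: abs_mult)
  show int: "integrable \<gamma> (\<lambda>z. g (x + s * z))"
    by (rule Bochner_Integration.integrable_bound[OF i]) (use b in \<open>auto intro!: AE_I2 order_trans[OF b]\<close>)
  have "\<bar>gauss_avg s g x\<bar> \<le> (\<integral>z. \<bar>g (x + s * z)\<bar> \<partial>\<gamma>)"
    unfolding gauss_avg_def by (rule integral_abs_bound)
  also have "\<dots> \<le> (\<integral>z. c + \<bar>x\<bar> + \<bar>s\<bar> * \<bar>z\<bar> \<partial>\<gamma>)"
    by (rule integral_mono) (use int i b in auto)
  also have "\<dots> = c + \<bar>x\<bar> + \<bar>s\<bar> * (\<integral>z. \<bar>z\<bar> \<partial>\<gamma>)"
    using gauss_moments(5) prob_space by simp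
  also have "\<dots> \<le> c + \<bar>x\<bar> + \<bar>s\<bar> * 1"
    using gauss_moments(6) by (intro add_mono mult_left_mono) auto
  finally show "\<bar>gauss_avg s g x\<bar> \<le> c + \<bar>s\<bar> + \<bar>x\<bar>" by simp
qed

lemma gauss_avg_measurable[measurable]:
  assumes [measurable]: "g \<in> borel_measurable borel"
  shows "gauss_avg s g \<in> borel_measurable borel"
proof -
  interpret prob_space \<gamma> by (rule prob_space_gauss)
  show ?thesis unfolding gauss_avg_def[abs_def] by measurable
qed

lemma gauss_avg_bounded:
  assumes [measurable]: "g \<in> borel_measurable borel" and g: "\<And>x. \<bar>g x\<bar> \<le> c"
  shows "integrable \<gamma> (\<lambda>z. g (x + s * z))" "\<bar>gauss_avg s g x\<bar> \<le> c"
proof -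
  interpret prob_space \<gamma> by (rule prob_space_gauss)
  show int: "integrable \<gamma> (\<lambda>z. g (x + s * z))"
    by (rule integrable_const_bound[where B=c]) (use g in auto)
  have "\<bar>gauss_avg s g x\<bar> \<le> (\<integral>z. \<bar>g (x + s * z)\<bar> \<partial>\<gamma>)"
    unfolding gauss_avg_def by (rule integral_abs_bound)
  also have "\<dots> \<le> (\<integral>z. c \<partial>\<gamma>)"
    by (rule integral_mono) (use int g in auto)
  finally show "\<bar>gauss_avg s g x\<bar> \<le> c" using prob_space by simp
qed

text \<open>Averaging the Taylor inequality keeps the same L. Hence a replacement in Lindeberg's
  method costs the same however much Gaussian noise is already present.\<close>

lemma smooth_bound_gauss_avg:
  assumes "smooth_bound L g g1 g2 c"
  shows "smooth_bound L (gauss_avg s g) (gauss_avg s g1) (gauss_avg s g2) (c + \<bar>s\<bar>)"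
proof -
  interpret prob_space \<gamma> by (rule prob_space_gauss)
  have [measurable]: "g \<in> borel_measurable borel" "g1 \<in> borel_measurable borel" "g2 \<in> borel_measurable borel"
    and g: "\<And>x. \<bar>g x\<bar> \<le> c + \<bar>x\<bar>" and g1: "\<And>x. \<bar>g1 x\<bar> \<le> c" and g2: "\<And>x. \<bar>g2 x\<bar> \<le> c"
    and t: "\<And>x y. \<bar>g (x + y) - g x - g1 x * y - g2 x * y\<^sup>2 / 2\<bar> \<le> L * \<bar>y\<bar> ^ 3"
    using assms by (auto simp: smooth_bound_def)
  have i: "integrable \<gamma> (\<lambda>z. g (x + s * z))" "integrable \<gamma> (\<lambda>z. g1 (x + s * z))" "integrable \<gamma> (\<lambda>z. g2 (x + s * z))" for x
    using gauss_avg_integrable(1)[of g c] gauss_avg_bounded(1)[of g1 c] gauss_avg_bounded(1)[of g2 c] g g1 g2 by auto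
  have "\<bar>gauss_avg s g (x + y) - gauss_avg s g x - gauss_avg s g1 x * y - gauss_avg s g2 x * y\<^sup>2 / 2\<bar> \<le> L * \<bar>y\<bar> ^ 3" for x y
  proof -
    let ?R = "\<lambda>z. g (x + y + s * z) - g (x + s * z) - g1 (x + s * z) * y - g2 (x + s * z) * y\<^sup>2 / 2"
    have e: "gauss_avg s g (x + y) - gauss_avg s g x - gauss_avg s g1 x * y - gauss_avg s g2 x * y\<^sup>2 / 2 = (\<integral>z. ?R z \<partial>\<gamma>)"
      unfolding gauss_avg_def using i by simp
    have "\<bar>gauss_avg s g (x + y) - gauss_avg s g x - gauss_avg s g1 x * y - gauss_avg s g2 x * y\<^sup>2 / 2\<bar> \<le> (\<integral>z. \<bar>?R z\<bar> \<partial>\<gamma>)"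
      unfolding e by (rule integral_abs_bound)
    also have "\<dots> \<le> (\<integral>z. L * \<bar>y\<bar> ^ 3 \<partial>\<gamma>)"
    proof (rule integral_mono)
      show "\<bar>?R z\<bar> \<le> L * \<bar>y\<bar> ^ 3" for z using t[of "x + s * z" y] by (simp add: ac_simps)
    qed (use i in auto)
    finally show ?thesis using prob_space by simp
  qed
  moreover have "\<bar>gauss_avg s g1 x\<bar> \<le> c + \<bar>s\<bar>" "\<bar>gauss_avg s g2 x\<bar> \<le> c + \<bar>s\<bar>" for x
    using gauss_avg_bounded(2)[of g1 c s x] gauss_avg_bounded(2)[of g2 c s x] g1 g2 by auto
  ultimately show ?thesis
    using gauss_avg_integrable(2)[of g c] g by (auto simp: smooth_bound_def)
qed

text \<open>Mean 0 removes the linear term and variance 1 fixes the quadratic one; the factor 2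
  bounds the third absolute moment of the Gaussian.\<close>

lemma gauss_avg_expand:
  assumes g: "smooth_bound L g g1 g2 c"
  shows "\<bar>gauss_avg s g x - g x - g2 x * s\<^sup>2 / 2\<bar> \<le> 2 * L * \<bar>s\<bar> ^ 3"
proof -
  interpret prob_space \<gamma> by (rule prob_space_gauss)
  have [measurable]: "g \<in> borel_measurable borel"
    and gb: "\<And>x. \<bar>g x\<bar> \<le> c + \<bar>x\<bar>"
    and t: "\<And>x y. \<bar>g (x + y) - g x - g1 x * y - g2 x * y\<^sup>2 / 2\<bar> \<le> L * \<bar>y\<bar> ^ 3"
    using assms by (auto simp: smooth_bound_def)
  have L: "0 \<le> L" using t[of 0 1] abs_ge_zero order_trans by fastforce
  have i: "integrable \<gamma> (\<lambda>z. g (x + s * z))" by (rule gauss_avg_integrable(1)[OF _ gb]) simp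
  have one: "measure \<gamma> UNIV = 1" using prob_space by simp
  let ?R = "\<lambda>z. g (x + s * z) - g x - g1 x * (s * z) - g2 x * (s * z)\<^sup>2 / 2"
  have e1: "gauss_avg s g x - g x - g2 x * s\<^sup>2 / 2 = (\<integral>z. g (x + s * z) - g x - (g1 x * s) * z - (g2 x * s\<^sup>2 / 2) * z\<^sup>2 \<partial>\<gamma>)"
    unfolding gauss_avg_def using i gauss_moments(1-4) by (simp add: one)
  have e2: "(\<integral>z. g (x + s * z) - g x - (g1 x * s) * z - (g2 x * s\<^sup>2 / 2) * z\<^sup>2 \<partial>\<gamma>) = (\<integral>z. ?R z \<partial>\<gamma>)"
    by (rule Bochner_Integration.integral_cong) (simp_all add: power_mult_distrib)
  have "\<bar>gauss_avg s g x - g x - g2 x * s\<^sup>2 / 2\<bar> \<le> (\<integral>z. \<bar>?R z\<bar> \<partial>\<gamma>)"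
    unfolding e1 e2 by (rule integral_abs_bound)
  also have "\<dots> \<le> (\<integral>z. L * \<bar>s\<bar> ^ 3 * \<bar>z\<bar> ^ 3 \<partial>\<gamma>)"
  proof (rule integral_mono)
    show "\<bar>?R z\<bar> \<le> L * \<bar>s\<bar> ^ 3 * \<bar>z\<bar> ^ 3" for z
    proof -
      have "L * \<bar>s * z\<bar> ^ 3 = L * \<bar>s\<bar> ^ 3 * \<bar>z\<bar> ^ 3" by (simp add: abs_mult power_mult_distrib)
      then show ?thesis using t[of x "s * z"] by (simp only:)
    qed
    have "integrable \<gamma> (\<lambda>z. g (x + s * z) - g x - (g1 x * s) * z - (g2 x * s\<^sup>2 / 2) * z\<^sup>2)"
      using i gauss_moments by simp
    then have "integrable \<gamma> ?R"
      by (rule Bochner_Integration.integrable_cong[THEN iffD1, rotated -1]) (simp_all add: power_mult_distrib)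
    then show "integrable \<gamma> (\<lambda>z. \<bar>?R z\<bar>)" by simp
  qed (use gauss_moments in simp)
  also have "\<dots> = L * \<bar>s\<bar> ^ 3 * (\<integral>z. \<bar>z\<bar> ^ 3 \<partial>\<gamma>)" by simp
  also have "\<dots> \<le> L * \<bar>s\<bar> ^ 3 * 2"
    using gauss_moments(8) L by (intro mult_left_mono) auto
  finally show ?thesis by simp
qed

text \<open>The semigroup property, from the normality of sums of independent centred normals. A
  vanishing s or t is treated apart because normal densities need a positive standard
  deviation.\<close>

lemma gauss_avg_compose:
  assumes [measurable]: "g \<in> borel_measurable borel" and gb: "\<And>x. \<bar>g x\<bar> \<le> c + \<bar>x\<bar>" and st: "0 \<le> s" "0 \<le> t"
  shows "gauss_avg s (gauss_avg t g) x = gauss_avg (sqrt (s\<^sup>2 + t\<^sup>2)) g x"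
proof -
  interpret N: prob_space \<gamma> by (rule prob_space_gauss)
  show ?thesis
  proof (cases "s = 0 \<or> t = 0")
    case True
    have z: "gauss_avg 0 h x = h x" for h :: "real \<Rightarrow> real" and x using N.prob_space by (simp add: gauss_avg_def)
    then have "gauss_avg 0 h = h" for h :: "real \<Rightarrow> real" by (simp add: fun_eq_iff)
    then show ?thesis using True st z by auto
  next
    case False
    then have pos: "0 < s" "0 < t" using st by auto
    let ?P = "\<gamma> \<Otimes>\<^sub>M \<gamma>"
    interpret P: pair_prob_space \<gamma> \<gamma> ..
    have m: "fst \<in> borel_measurable ?P" "snd \<in> borel_measurable ?P"
      using measurable_fst[of \<gamma> \<gamma>] measurable_snd[of \<gamma> \<gamma>] by simp_all
    have d1: "distr ?P borel fst = \<gamma>"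
      using N.distr_pair_fst[of \<gamma>] by (simp cong: distr_cong)
    have d2: "distr ?P borel snd = \<gamma>"
    proof -
      have "distr ?P \<gamma> snd = distr (distr ?P ?P (\<lambda>(x, y). (y, x))) \<gamma> fst"
        by (subst distr_distr) (auto simp: comp_def case_prod_beta)
      also have "distr ?P ?P (\<lambda>(x, y). (y, x)) = ?P" using P.distr_pair_swap by simp
      finally show ?thesis using N.distr_pair_fst[of \<gamma>] by (simp cong: distr_cong)
    qed
    have ind: "P.indep_var borel fst borel snd"
      unfolding P.indep_var_distribution_eq
    proof (intro conjI m)
      have "distr ?P (borel \<Otimes>\<^sub>M borel) (\<lambda>x. (fst x, snd x)) = distr ?P ?P (\<lambda>x. x)"
        by (rule distr_cong) (auto cong: sets_pair_measure_cong)
      then show "distr ?P borel fst \<Otimes>\<^sub>M distr ?P borel snd = distr ?P (borel \<Otimes>\<^sub>M borel) (\<lambda>x. (fst x, snd x))"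
        by (simp add: d1 d2 distr_id)
    qed
    have D: "distributed ?P lborel fst std_normal_density" "distributed ?P lborel snd std_normal_density"
      using d1 d2 m by (simp_all add: distributed_def cong: distr_cong)
    have s: "distributed ?P lborel (\<lambda>\<omega>. s * fst \<omega>) (normal_density 0 s)"
      using P.normal_density_affine[OF D(1), of s 0] pos by simp
    have t: "distributed ?P lborel (\<lambda>\<omega>. t * snd \<omega>) (normal_density 0 t)"
      using P.normal_density_affine[OF D(2), of t 0] pos by simp
    have ind2: "P.indep_var borel (\<lambda>\<omega>. s * fst \<omega>) borel (\<lambda>\<omega>. t * snd \<omega>)"
      using P.indep_var_compose[OF ind, of "\<lambda>x. s * x" borel "\<lambda>x. t * x" borel] by (simp add: comp_def)
    define w where "w = sqrt (s\<^sup>2 + t\<^sup>2)"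
    have w: "0 < w" using pos by (simp add: w_def add_pos_pos)
    have "distributed ?P lborel (\<lambda>\<omega>. s * fst \<omega> + t * snd \<omega>) (normal_density (0 + 0) w)"
      unfolding w_def by (rule P.add_indep_normal[OF ind2 pos s t])
    then have "distributed ?P lborel (\<lambda>\<omega>. (s * fst \<omega> + t * snd \<omega>) / w) std_normal_density"
      using P.normal_standard_normal_convert[OF w, of "\<lambda>\<omega>. s * fst \<omega> + t * snd \<omega>" 0] by simp
    then have U: "distr ?P borel (\<lambda>\<omega>. (s * fst \<omega> + t * snd \<omega>) / w) = \<gamma>"
      using distributed_distr_eq_density by (fastforce cong: distr_cong)
    have mm: "(\<lambda>\<omega>. (s * fst \<omega> + t * snd \<omega>) / w) \<in> borel_measurable ?P"
      using m by measurable
    have "gauss_avg w g x = (\<integral>z. g (x + w * z) \<partial>distr ?P borel (\<lambda>\<omega>. (s * fst \<omega> + t * snd \<omega>) / w))"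
      unfolding U gauss_avg_def ..
    also have "\<dots> = (\<integral>\<omega>. g (x + s * fst \<omega> + t * snd \<omega>) \<partial>?P)"
      using w by (subst integral_distr[OF mm]) (auto simp: add.assoc)
    also have "\<dots> = (\<integral>\<omega>. (case \<omega> of (y, z) \<Rightarrow> g (x + s * y + t * z)) \<partial>?P)"
      by (simp add: case_prod_beta)
    also have "\<dots> = (\<integral>y. (\<integral>z. g (x + s * y + t * z) \<partial>\<gamma>) \<partial>\<gamma>)"
    proof -
      have "integrable (distr ?P borel (\<lambda>\<omega>. (s * fst \<omega> + t * snd \<omega>) / w)) (\<lambda>z. g (x + w * z))"
        unfolding U by (rule gauss_avg_integrable(1)[OF _ gb]) simp
      then have "integrable ?P (\<lambda>\<omega>. g (x + w * ((s * fst \<omega> + t * snd \<omega>) / w)))"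
        by (subst (asm) integrable_distr_eq[OF mm]) auto
      then have "integrable ?P (\<lambda>(y, z). g (x + s * y + t * z))"
        using w by (simp add: case_prod_unfold add.assoc)
      from P.integral_fst'[OF this] show ?thesis by simp
    qed
    finally show ?thesis by (simp add: gauss_avg_def w_def)
  qed
qed

text \<open>Two successive moving averages over windows of length h. Each moves the function by at
  most h and gains one derivative. The second derivative is (f (x + 2h) - 2 * f (x + h) + f x) /
  h^2, whose Lipschitz constant 4 / h^2 yields the Taylor constant 2 / h^2.\<close>

lemma lipschitz_smoothing:
  fixes f :: "real \<Rightarrow> real"
  assumes lip: "\<And>x y. \<bar>f x - f y\<bar> \<le> \<bar>x - y\<bar>" and h: "0 < h"
  obtains g g1 g2 c where "smooth_bound (2 / h\<^sup>2) g g1 g2 c" "\<And>x. \<bar>g x - f x\<bar> \<le> 2 * h"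
proof -
  have lip_cont: "isCont u x" if u: "\<And>x y. \<bar>u x - u y\<bar> \<le> \<bar>x - y\<bar>" for u :: "real \<Rightarrow> real" and x
    unfolding continuous_at_eps_delta dist_real_def using u order_le_less_trans by blast
  have antideriv: "\<exists>F. \<forall>x. (F has_real_derivative u x) (at x)" if u: "\<And>x y. \<bar>u x - u y\<bar> \<le> \<bar>x - y\<bar>" for u :: "real \<Rightarrow> real"
  proof -
    have "isCont u x" for x by (rule lip_cont[OF u])
    then have "\<exists>F. \<forall>x. - \<infinity> < ereal x \<longrightarrow> ereal x < \<infinity> \<longrightarrow> (F has_vector_derivative u x) (at x)"
      by (intro einterval_antiderivative) auto
    then show ?thesis by (auto simp: has_real_derivative_iff_has_vector_derivative)
  qed
  \<comment> \<open>For an antiderivative \<open>F\<close> of u this is the mean of u over the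
    window from x to x + h.\<close>
  define avg where "avg F x = (F (x + h) - F x) / h" for F :: "real \<Rightarrow> real" and x
  have avg_deriv: "(avg F has_real_derivative (u (x + h) - u x) / h) (at x)"
    if "\<And>x. (F has_real_derivative u x) (at x)" for F u x
  proof -
    have "((\<lambda>x. F (x + h)) has_real_derivative u (x + h)) (at x)"
      using that[of "x + h"] by (simp add: DERIV_shift)
    then have "((\<lambda>x. (F (x + h) - F x) / h) has_real_derivative (u (x + h) - u x) / h) (at x)"
      using that by (intro DERIV_cdivide DERIV_diff) auto
    then show ?thesis by (simp add: avg_def[abs_def])
  qed
  have lip_of_deriv: "\<bar>u x - u y\<bar> \<le> K * \<bar>x - y\<bar>"
    if d: "\<And>x. (u has_real_derivative v x) (at x)" and v: "\<And>x. \<bar>v x\<bar> \<le> K" for u v :: "real \<Rightarrow> real" and K x y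
  proof -
    have *: "\<bar>u b - u a\<bar> \<le> K * \<bar>b - a\<bar>" if ab: "a < b" for a b
    proof -
      obtain z where "u b - u a = (b - a) * v z" using MVT2[OF ab, of u v] d by blast
      then show ?thesis using v[of z] ab by (simp add: abs_mult mult.commute mult_right_mono)
    qed
    show ?thesis using *[of x y] *[of y x] by (cases x y rule: linorder_cases) (auto simp: abs_minus_commute)
  qed
  have avg_close: "\<bar>avg F x - u x\<bar> \<le> h"
    if d: "\<And>x. (F has_real_derivative u x) (at x)" and u: "\<And>x y. \<bar>u x - u y\<bar> \<le> \<bar>x - y\<bar>" for F u x
  proof -
    obtain z where z: "x < z" "z < x + h" "F (x + h) - F x = (x + h - x) * u z"
      using MVT2[of x "x + h" F u] d h by auto
    then have "avg F x = u z" using h by (simp add: avg_def)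
    then show ?thesis using u[of z x] z by simp
  qed
  obtain F where F: "\<And>x. (F has_real_derivative f x) (at x)" using antideriv[OF lip] by blast
  let ?u = "avg F" and ?u' = "\<lambda>x. (f (x + h) - f x) / h"
  have u': "\<And>x. (?u has_real_derivative ?u' x) (at x)" by (rule avg_deriv[OF F])
  have u'b: "\<bar>?u' x\<bar> \<le> 1" for x using lip[of "x + h" x] h by simp
  have ulip: "\<bar>?u x - ?u y\<bar> \<le> \<bar>x - y\<bar>" for x y using lip_of_deriv[OF u' u'b, of x y] by simp
  obtain G where G: "\<And>x. (G has_real_derivative ?u x) (at x)" using antideriv[OF ulip] by blast
  let ?g = "avg G" and ?g1 = "\<lambda>x. (?u (x + h) - ?u x) / h" and ?g2 = "\<lambda>x. (?u' (x + h) - ?u' x) / h"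
  have g1: "\<And>x. (?g has_real_derivative ?g1 x) (at x)" by (rule avg_deriv[OF G])
  have g2: "\<And>x. (?g1 has_real_derivative ?g2 x) (at x)"
  proof -
    fix x
    show "(?g1 has_real_derivative ?g2 x) (at x)"
      using avg_deriv[of ?u ?u' x, OF u'] by (simp add: avg_def[of ?u, abs_def])
  qed
  have close: "\<bar>?g x - f x\<bar> \<le> 2 * h" for x
    using avg_close[OF G ulip, of x] avg_close[OF F lip, of x] by linarith
  have g2lip: "\<bar>?g2 x - ?g2 y\<bar> \<le> 4 / h\<^sup>2 * \<bar>x - y\<bar>" for x y
  proof -
    have "?g2 x - ?g2 y = ((f (x + h + h) - f (y + h + h)) - 2 * (f (x + h) - f (y + h)) + (f x - f y)) / h\<^sup>2"
      using h by (simp add: field_simps power2_eq_square)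
    moreover have "\<bar>(f (x + h + h) - f (y + h + h)) - 2 * (f (x + h) - f (y + h)) + (f x - f y)\<bar> \<le> 4 * \<bar>x - y\<bar>"
    proof -
      have "\<bar>f (x + h + h) - f (y + h + h)\<bar> \<le> \<bar>x - y\<bar>" "\<bar>f (x + h) - f (y + h)\<bar> \<le> \<bar>x - y\<bar>" "\<bar>f x - f y\<bar> \<le> \<bar>x - y\<bar>"
        using lip[of "x + h + h" "y + h + h"] lip[of "x + h" "y + h"] lip[of x y] by simp_all
      then show ?thesis unfolding abs_le_iff by (auto simp: algebra_simps)
    qed
    ultimately show ?thesis by (simp add: divide_right_mono)
  qed
  have remainder: "\<bar>p - q - u * y - v * y\<^sup>2 / 2\<bar> = \<bar>w - v\<bar> * y\<^sup>2 / 2" if "p = q + u * y + w / 2 * y\<^sup>2" for p q u v w y :: real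
  proof -
    have "p - q - u * y - v * y\<^sup>2 / 2 = (w - v) * (y\<^sup>2 / 2)" using that by (simp add: algebra_simps)
    then show ?thesis by (simp only: abs_mult) simp
  qed
  have taylor: "\<bar>?g (x + y) - ?g x - ?g1 x * y - ?g2 x * y\<^sup>2 / 2\<bar> \<le> 2 / h\<^sup>2 * \<bar>y\<bar> ^ 3" for x y
  proof (cases "y = 0")
    case False
    define diff where "diff k = (if k = 0 then ?g else if k = Suc 0 then ?g1 else ?g2)" for k :: nat
    have "\<exists>t. (if x + y < x then x + y < t \<and> t < x else x < t \<and> t < x + y) \<and>
       ?g (x + y) = (\<Sum>m<2. diff m x / fact m * (x + y - x) ^ m) + diff 2 t / fact 2 * (x + y - x)\<^sup>2"
    proof (rule Taylor[of 2 diff ?g "min x (x + y)" "max x (x + y)"])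
      show "\<forall>m t. m < 2 \<and> min x (x + y) \<le> t \<and> t \<le> max x (x + y) \<longrightarrow> (diff m has_real_derivative diff (Suc m) t) (at t)"
        using g1 g2 by (auto simp: diff_def less_2_cases_iff)
    qed (use False in \<open>auto simp: diff_def\<close>)
    then obtain t where t: "(if x + y < x then x + y < t \<and> t < x else x < t \<and> t < x + y)"
      and e: "?g (x + y) = (\<Sum>m<2. diff m x / fact m * (x + y - x) ^ m) + diff 2 t / fact 2 * (x + y - x)\<^sup>2" by blast
    have "?g (x + y) = ?g x + ?g1 x * y + ?g2 t / 2 * y\<^sup>2"
      unfolding e by (simp add: diff_def numeral_2_eq_2)
    from remainder[OF this, of "?g2 x"]
    have "\<bar>?g (x + y) - ?g x - ?g1 x * y - ?g2 x * y\<^sup>2 / 2\<bar> = \<bar>?g2 t - ?g2 x\<bar> * y\<^sup>2 / 2" .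
    also have "\<dots> \<le> (4 / h\<^sup>2 * \<bar>y\<bar>) * y\<^sup>2 / 2"
    proof -
      have "\<bar>?g2 t - ?g2 x\<bar> \<le> 4 / h\<^sup>2 * \<bar>t - x\<bar>" by (rule g2lip)
      also have "\<dots> \<le> 4 / h\<^sup>2 * \<bar>y\<bar>" using t h by (intro mult_left_mono) (auto split: if_splits)
      finally show ?thesis by (intro divide_right_mono mult_right_mono) auto
    qed
    also have "\<dots> = 2 / h\<^sup>2 * (\<bar>y\<bar> * \<bar>y\<bar>\<^sup>2)" by simp
    also have "\<bar>y\<bar> * \<bar>y\<bar>\<^sup>2 = \<bar>y\<bar> ^ 3" by (simp only: power3_eq_cube power2_eq_square mult.assoc)
    finally show ?thesis .
  qed simp
  have meas: "v \<in> borel_measurable borel" if "\<And>x. isCont v x" for v :: "real \<Rightarrow> real"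
    by (rule borel_measurable_continuous_onI) (simp add: continuous_at_imp_continuous_on that)
  have [measurable]: "f \<in> borel_measurable borel" by (rule meas) (rule lip_cont[OF lip])
  have m: "?g \<in> borel_measurable borel" "?g1 \<in> borel_measurable borel" "?g2 \<in> borel_measurable borel"
    using meas[OF DERIV_isCont[OF g1]] meas[OF DERIV_isCont[OF g2]] by simp_all
  define c where "c = \<bar>f 0\<bar> + 2 * h + 1 + 2 / h"
  have gb: "\<bar>?g x\<bar> \<le> c + \<bar>x\<bar>" for x
  proof -
    have "\<bar>?g x\<bar> \<le> \<bar>f 0\<bar> + 2 * h + \<bar>x\<bar>" using close[of x] lip[of x 0] by linarith
    moreover have "0 \<le> 2 / h" using h by simp
    ultimately show ?thesis unfolding c_def by linarith
  qed
  have g1b: "\<bar>?g1 x\<bar> \<le> c" for x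
  proof -
    have "\<bar>?g1 x\<bar> \<le> 1" using ulip[of "x + h" x] h by simp
    moreover have "0 \<le> 2 / h" using h by simp
    ultimately show ?thesis unfolding c_def using h by linarith
  qed
  have g2b: "\<bar>?g2 x\<bar> \<le> c" for x
  proof -
    have "\<bar>?u' (x + h) - ?u' x\<bar> \<le> 2" using u'b[of "x + h"] u'b[of x] by linarith
    then have "\<bar>?g2 x\<bar> \<le> 2 / h" using h unfolding abs_divide by (intro frac_le) auto
    then show ?thesis unfolding c_def using h by linarith
  qed
  show thesis
    by (rule that[of ?g ?g1 ?g2 c]) (use m gb g1b g2b taylor close in \<open>auto simp only: smooth_bound_def\<close>)
qed

section \<open>Lindeberg's method along the chain\<close>

context elephant
begin

lemma adapted_borel_compose_integrable:
  assumes "adapted n Z" shows "integrable M (\<lambda>\<omega>. g (Z \<omega>) :: real)"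
  by (rule adapted_integrable[OF adapted_compose[OF assms]])

text \<open>One difference is exchanged for a Gaussian of the same variance. The first two
  conditional moments agree, so only cubic remainders stay: 8 * L * |c|^3 from |D| \<le> 2, and 2 *
  L * |c|^3 from the Gaussian. The sign X m is known at time j and squares to 1, so it disturbs
  neither moment.\<close>

lemma Lindeberg_step:
  assumes g: "smooth_bound L g g1 g2 K" and Y: "adapted j Y" and m: "1 \<le> m" "m \<le> j"
  shows "\<bar>expectation (\<lambda>\<omega>. g (Y \<omega> + c * X m \<omega> * D (Suc j) \<omega>))
      - expectation (\<lambda>\<omega>. gauss_avg (\<bar>c\<bar> * sqrt (1 - r\<^sup>2)) g (Y \<omega>))\<bar> \<le> 10 * L * \<bar>c\<bar> ^ 3"
proof -
  define s where "s = \<bar>c\<bar> * sqrt (1 - r\<^sup>2)"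
  have j1: "1 \<le> j" using m by simp
  have r1: "1 - r\<^sup>2 > 0" "1 - r\<^sup>2 \<le> 1" using r_bounds by auto
  have s2: "s\<^sup>2 = c\<^sup>2 * (1 - r\<^sup>2)" using r1 by (simp add: s_def power_mult_distrib)
  have "s \<le> \<bar>c\<bar> * 1" unfolding s_def using r1 by (intro mult_left_mono) (auto simp: real_sqrt_le_1_iff)
  then have s3: "\<bar>s\<bar> ^ 3 \<le> \<bar>c\<bar> ^ 3" using r1 by (intro power_mono) (auto simp: s_def)
  have t: "\<And>x y. \<bar>g (x + y) - g x - g1 x * y - g2 x * y\<^sup>2 / 2\<bar> \<le> L * \<bar>y\<bar> ^ 3"
    using g by (auto simp: smooth_bound_def)
  have "0 \<le> L * \<bar>1\<bar> ^ 3" using order_trans[OF abs_ge_zero t[of 0 1]] .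
  then have L: "0 \<le> L" by simp
  have aD: "adapted (Suc j) (D (Suc j))" using j1 by (intro adapted_D) auto
  have aX: "adapted j (X m)" using m by (intro adapted_X)
  have aY': "adapted (Suc j) Y" using adapted_mono[OF Y] by simp
  have aX': "adapted (Suc j) (X m)" using adapted_mono[OF aX] by simp
  have a1: "adapted j (\<lambda>\<omega>. g1 (Y \<omega>) * X m \<omega>)" by (intro adapted_mult adapted_compose[OF Y] aX)
  have a2: "adapted j (\<lambda>\<omega>. g2 (Y \<omega>))" by (rule adapted_compose[OF Y])
  have aU: "adapted (Suc j) (\<lambda>\<omega>. Y \<omega> + c * X m \<omega> * D (Suc j) \<omega>)"
    by (rule adapted_compose2[OF aY' adapted_mult[OF adapted_mult[OF adapted_const aX'] aD]])
  have i: "integrable M (\<lambda>\<omega>. g (Y \<omega> + c * X m \<omega> * D (Suc j) \<omega>))" "integrable M (\<lambda>\<omega>. g (Y \<omega>))" "integrable M (\<lambda>\<omega>. gauss_avg s g (Y \<omega>))"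
    "integrable M (\<lambda>\<omega>. g2 (Y \<omega>))"
    "integrable M (\<lambda>\<omega>. g1 (Y \<omega>) * X m \<omega> * D (Suc j) \<omega>)" "integrable M (\<lambda>\<omega>. g2 (Y \<omega>) * (D (Suc j) \<omega>)\<^sup>2)"
  proof -
    show "integrable M (\<lambda>\<omega>. g (Y \<omega> + c * X m \<omega> * D (Suc j) \<omega>))" by (rule adapted_borel_compose_integrable[OF aU])
    show "integrable M (\<lambda>\<omega>. g (Y \<omega>))" "integrable M (\<lambda>\<omega>. gauss_avg s g (Y \<omega>))" "integrable M (\<lambda>\<omega>. g2 (Y \<omega>))"
      by (rule adapted_borel_compose_integrable[OF Y])+
    show "integrable M (\<lambda>\<omega>. g1 (Y \<omega>) * X m \<omega> * D (Suc j) \<omega>)"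
      by (rule adapted_integrable[of "Suc j"], rule adapted_mult[OF adapted_mono[OF a1] aD]) simp
    show "integrable M (\<lambda>\<omega>. g2 (Y \<omega>) * (D (Suc j) \<omega>)\<^sup>2)"
      by (rule adapted_integrable[of "Suc j"], rule adapted_mult[OF adapted_mono[OF a2] adapted_power[OF aD]]) simp
  qed
  have e1: "expectation (\<lambda>\<omega>. g1 (Y \<omega>) * X m \<omega> * D (Suc j) \<omega>) = 0"
    by (rule expectation_D(1)[OF a1 j1])
  have e2: "expectation (\<lambda>\<omega>. g2 (Y \<omega>) * (D (Suc j) \<omega>)\<^sup>2) = (1 - r\<^sup>2) * expectation (\<lambda>\<omega>. g2 (Y \<omega>))"
    by (rule expectation_D(2)[OF a2 j1])
  let ?Q = "\<lambda>\<omega>. g (Y \<omega>) + c * (g1 (Y \<omega>) * X m \<omega> * D (Suc j) \<omega>) + c\<^sup>2 / 2 * (g2 (Y \<omega>) * (D (Suc j) \<omega>)\<^sup>2)"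
  let ?E = "expectation (\<lambda>\<omega>. g (Y \<omega>)) + s\<^sup>2 / 2 * expectation (\<lambda>\<omega>. g2 (Y \<omega>))"
  have EQ: "expectation ?Q = ?E" using i e1 e2 by (simp add: s2)
  have iQ: "integrable M ?Q" using i by simp
  have "\<bar>expectation (\<lambda>\<omega>. g (Y \<omega> + c * X m \<omega> * D (Suc j) \<omega>)) - ?E\<bar>
      = \<bar>expectation (\<lambda>\<omega>. g (Y \<omega> + c * X m \<omega> * D (Suc j) \<omega>) - ?Q \<omega>)\<bar>"
    unfolding EQ[symmetric] using i iQ by (subst Bochner_Integration.integral_diff) auto
  also have "\<dots> \<le> expectation (\<lambda>\<omega>. \<bar>g (Y \<omega> + c * X m \<omega> * D (Suc j) \<omega>) - ?Q \<omega>\<bar>)"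
    by (rule integral_abs_bound)
  also have "\<dots> \<le> expectation (\<lambda>\<omega>. L * (8 * \<bar>c\<bar> ^ 3))"
  proof (rule integral_mono)
    show "integrable M (\<lambda>\<omega>. \<bar>g (Y \<omega> + c * X m \<omega> * D (Suc j) \<omega>) - ?Q \<omega>\<bar>)"
      by (intro integrable_abs Bochner_Integration.integrable_diff i(1) iQ)
    fix \<omega> assume w: "\<omega> \<in> space M"
    let ?y = "c * X m \<omega> * D (Suc j) \<omega>"
    have "(X m \<omega>)\<^sup>2 = 1" using X_square[OF m(1) w] by (simp add: power2_eq_square)
    then have Qe: "?Q \<omega> = g (Y \<omega>) + g1 (Y \<omega>) * ?y + g2 (Y \<omega>) * ?y\<^sup>2 / 2"
      by (simp add: power_mult_distrib)
    have "g (Y \<omega> + ?y) - ?Q \<omega> = g (Y \<omega> + ?y) - g (Y \<omega>) - g1 (Y \<omega>) * ?y - g2 (Y \<omega>) * ?y\<^sup>2 / 2"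
      unfolding Qe by (simp only: diff_diff_eq add.assoc)
    then have "\<bar>g (Y \<omega> + ?y) - ?Q \<omega>\<bar> \<le> L * \<bar>?y\<bar> ^ 3"
      using t[of "Y \<omega>" ?y] by (simp only:)
    also have "\<bar>?y\<bar> \<le> \<bar>c\<bar> * 2"
      using D_abs[of "Suc j" \<omega>] X_abs[OF m(1) w] j1 w by (simp add: abs_mult mult_left_mono)
    then have "L * \<bar>?y\<bar> ^ 3 \<le> L * (\<bar>c\<bar> * 2) ^ 3" using L by (intro mult_left_mono power_mono) auto
    also have "L * (\<bar>c\<bar> * 2) ^ 3 = L * (8 * \<bar>c\<bar> ^ 3)" by (simp add: power_mult_distrib)
    finally show "\<bar>g (Y \<omega> + ?y) - ?Q \<omega>\<bar> \<le> L * (8 * \<bar>c\<bar> ^ 3)" .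
  qed simp
  also have "\<dots> = L * (8 * \<bar>c\<bar> ^ 3)" by (simp add: prob_space)
  finally have A: "\<bar>expectation (\<lambda>\<omega>. g (Y \<omega> + c * X m \<omega> * D (Suc j) \<omega>)) - ?E\<bar> \<le> L * (8 * \<bar>c\<bar> ^ 3)" .
  let ?R = "\<lambda>\<omega>. gauss_avg s g (Y \<omega>) - g (Y \<omega>) - g2 (Y \<omega>) * s\<^sup>2 / 2"
  have "expectation ?R = expectation (\<lambda>\<omega>. gauss_avg s g (Y \<omega>)) - ?E"
    using i by simp
  then have "\<bar>expectation (\<lambda>\<omega>. gauss_avg s g (Y \<omega>)) - ?E\<bar> \<le> expectation (\<lambda>\<omega>. \<bar>?R \<omega>\<bar>)"
    using integral_abs_bound[of M ?R] by simp
  also have "\<dots> \<le> expectation (\<lambda>\<omega>. 2 * L * \<bar>s\<bar> ^ 3)"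
    by (rule integral_mono) (use i gauss_avg_expand[OF g] in auto)
  also have "\<dots> = 2 * L * \<bar>s\<bar> ^ 3" by (simp add: prob_space)
  also have "\<dots> \<le> 2 * L * \<bar>c\<bar> ^ 3" using L s3 by (intro mult_left_mono) auto
  finally have B: "\<bar>expectation (\<lambda>\<omega>. gauss_avg s g (Y \<omega>)) - ?E\<bar> \<le> 2 * L * \<bar>c\<bar> ^ 3" .
  show ?thesis using A B unfolding s_def[symmetric] by (simp add: algebra_simps)
qed

text \<open>Differences are replaced from the last to the first: at stage j the standard deviation
  \<open>\<tau> j\<close> stands for all indices beyond j. Keeping the Gaussian part inside the test
  function lets the whole argument stay on \<open>M\<close>.\<close>

lemma Lindeberg_smooth:
  assumes g: "smooth_bound L g g1 g2 K" and m: "1 \<le> m" "m \<le> n"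
  shows "\<bar>expectation (\<lambda>\<omega>. g (X m \<omega> * wsum b m n \<omega>)) - gauss_avg (sqrt ((1 - r\<^sup>2) * (\<Sum>i\<in>{m<..n}. (b i)\<^sup>2))) g 0\<bar>
      \<le> 10 * L * (\<Sum>i\<in>{m<..n}. \<bar>b i\<bar> ^ 3)"
proof -
  define \<tau> where "\<tau> j = sqrt ((1 - r\<^sup>2) * (\<Sum>i\<in>{j<..n}. (b i)\<^sup>2))" for j
  have r1: "0 \<le> 1 - r\<^sup>2" using r_bounds by simp
  have gm: "g \<in> borel_measurable borel" and gb: "\<And>x. \<bar>g x\<bar> \<le> K + \<bar>x\<bar>" using g by (auto simp: smooth_bound_def)
  have "\<bar>expectation (\<lambda>\<omega>. g (X m \<omega> * wsum b m n \<omega>)) - expectation (\<lambda>\<omega>. gauss_avg (\<tau> j) g (X m \<omega> * wsum b m j \<omega>))\<bar>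
      \<le> 10 * L * (\<Sum>i\<in>{j<..n}. \<bar>b i\<bar> ^ 3)" if "m \<le> j" "j \<le> n" for j
    using that(2,1)
  proof (induction j rule: inc_induct)
    case base
    have "gauss_avg 0 g = g" using prob_space.prob_space[OF prob_space_gauss] by (simp add: gauss_avg_def fun_eq_iff)
    then show ?case by (simp add: \<tau>_def)
  next
    case (step j)
    let ?Y = "\<lambda>\<omega>. X m \<omega> * wsum b m j \<omega>" and ?c = "b (Suc j)"
    have Y: "adapted j ?Y" using m step by (intro adapted_mult adapted_X adapted_wsum) auto
    have wS: "X m \<omega> * wsum b m (Suc j) \<omega> = ?Y \<omega> + ?c * X m \<omega> * D (Suc j) \<omega>" for \<omega>
      using step by (simp add: wsum_Suc algebra_simps)
    have comp: "gauss_avg (\<bar>?c\<bar> * sqrt (1 - r\<^sup>2)) (gauss_avg (\<tau> (Suc j)) g) x = gauss_avg (\<tau> j) g x" for x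
    proof -
      have "(\<bar>?c\<bar> * sqrt (1 - r\<^sup>2))\<^sup>2 + (\<tau> (Suc j))\<^sup>2 = (1 - r\<^sup>2) * (\<Sum>i\<in>{j<..n}. (b i)\<^sup>2)"
      proof -
        have "(\<tau> (Suc j))\<^sup>2 = (1 - r\<^sup>2) * (\<Sum>i\<in>{Suc j<..n}. (b i)\<^sup>2)"
          unfolding \<tau>_def using r1 by (intro real_sqrt_pow2 mult_nonneg_nonneg sum_nonneg) auto
        then show ?thesis
          using r1 step by (simp add: power_mult_distrib greaterThanAtMost_head) (simp add: algebra_simps)
      qed
      then show ?thesis
        using gauss_avg_compose[OF gm gb, of "\<bar>?c\<bar> * sqrt (1 - r\<^sup>2)" "\<tau> (Suc j)" x] r1
        by (simp add: \<tau>_def sum_nonneg)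
    qed
    have "\<bar>expectation (\<lambda>\<omega>. gauss_avg (\<tau> (Suc j)) g (?Y \<omega> + ?c * X m \<omega> * D (Suc j) \<omega>))
        - expectation (\<lambda>\<omega>. gauss_avg (\<bar>?c\<bar> * sqrt (1 - r\<^sup>2)) (gauss_avg (\<tau> (Suc j)) g) (?Y \<omega>))\<bar> \<le> 10 * L * \<bar>?c\<bar> ^ 3"
      by (rule Lindeberg_step[OF smooth_bound_gauss_avg[OF g] Y m(1)]) (use step in simp)
    then have "\<bar>expectation (\<lambda>\<omega>. gauss_avg (\<tau> (Suc j)) g (X m \<omega> * wsum b m (Suc j) \<omega>))
        - expectation (\<lambda>\<omega>. gauss_avg (\<tau> j) g (?Y \<omega>))\<bar> \<le> 10 * L * \<bar>?c\<bar> ^ 3"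
      unfolding comp wS .
    moreover have "(\<Sum>i\<in>{j<..n}. \<bar>b i\<bar> ^ 3) = \<bar>?c\<bar> ^ 3 + (\<Sum>i\<in>{Suc j<..n}. \<bar>b i\<bar> ^ 3)"
      using step by (simp add: greaterThanAtMost_head)
    ultimately show ?case using step.IH step.prems by (simp add: distrib_left)
  qed
  from this[of m] m show ?thesis by (simp add: wsum_def \<tau>_def prob_space)
qed

text \<open>Smoothing costs 2 * h on the chain side and 2 * h on the Gaussian side; the rest is 10 *
  L with L = 2 / h^2. The width h stays free, to be matched to the block.\<close>

lemma Lindeberg_Lipschitz:
  fixes f :: "real \<Rightarrow> real"
  assumes lip: "\<And>x y. \<bar>f x - f y\<bar> \<le> \<bar>x - y\<bar>" and h: "0 < h" and m: "1 \<le> m" "m \<le> n"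
  shows "\<bar>expectation (\<lambda>\<omega>. f (X m \<omega> * wsum b m n \<omega>)) - (\<integral>z. f (sqrt ((1 - r\<^sup>2) * (\<Sum>i\<in>{m<..n}. (b i)\<^sup>2)) * z) \<partial>\<gamma>)\<bar>
      \<le> 4 * h + 20 / h\<^sup>2 * (\<Sum>i\<in>{m<..n}. \<bar>b i\<bar> ^ 3)"
proof -
  interpret N: prob_space \<gamma> by (rule prob_space_gauss)
  obtain g g1 g2 c where g: "smooth_bound (2 / h\<^sup>2) g g1 g2 c" and close: "\<And>x. \<bar>g x - f x\<bar> \<le> 2 * h"
    using lipschitz_smoothing[OF lip h] by metis
  define s where "s = sqrt ((1 - r\<^sup>2) * (\<Sum>i\<in>{m<..n}. (b i)\<^sup>2))"
  let ?Y = "\<lambda>\<omega>. X m \<omega> * wsum b m n \<omega>"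
  have Y: "adapted n ?Y" using m by (intro adapted_mult adapted_X adapted_wsum) auto
  have main: "\<bar>expectation (\<lambda>\<omega>. g (?Y \<omega>)) - gauss_avg s g 0\<bar> \<le> 20 / h\<^sup>2 * (\<Sum>i\<in>{m<..n}. \<bar>b i\<bar> ^ 3)"
    using Lindeberg_smooth[OF g m, of b] by (simp add: s_def)
  have "\<bar>expectation (\<lambda>\<omega>. f (?Y \<omega>)) - expectation (\<lambda>\<omega>. g (?Y \<omega>))\<bar> \<le> 2 * h"
  proof -
    have i: "integrable M (\<lambda>\<omega>. f (?Y \<omega>))" "integrable M (\<lambda>\<omega>. g (?Y \<omega>))"
      by (rule adapted_borel_compose_integrable[OF Y])+
    have "\<bar>expectation (\<lambda>\<omega>. f (?Y \<omega>) - g (?Y \<omega>))\<bar> \<le> expectation (\<lambda>\<omega>. \<bar>f (?Y \<omega>) - g (?Y \<omega>)\<bar>)"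
      by (rule integral_abs_bound)
    also have "\<dots> \<le> expectation (\<lambda>\<omega>. 2 * h)"
      by (rule integral_mono) (use i close in \<open>auto simp: abs_minus_commute\<close>)
    finally show ?thesis using i by (simp add: prob_space)
  qed
  moreover have "\<bar>gauss_avg s g 0 - (\<integral>z. f (s * z) \<partial>\<gamma>)\<bar> \<le> 2 * h"
  proof -
    have [measurable]: "f \<in> borel_measurable borel"
    proof (rule borel_measurable_continuous_onI)
      have "isCont f x" for x
        unfolding continuous_at_eps_delta dist_real_def using lip order_le_less_trans by blast
      then show "continuous_on UNIV f" by (simp add: continuous_at_imp_continuous_on)
    qed
    have gm: "g \<in> borel_measurable borel" and gb: "\<And>x. \<bar>g x\<bar> \<le> c + \<bar>x\<bar>" using g by (auto simp: smooth_bound_def)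
    have fb: "\<bar>f x\<bar> \<le> \<bar>f 0\<bar> + \<bar>x\<bar>" for x using lip[of x 0] by simp
    have i: "integrable \<gamma> (\<lambda>z. g (s * z))" "integrable \<gamma> (\<lambda>z. f (s * z))"
      using gauss_avg_integrable(1)[OF gm gb, of 0 s] gauss_avg_integrable(1)[of f "\<bar>f 0\<bar>" 0 s] fb by simp_all
    have "\<bar>(\<integral>z. g (s * z) - f (s * z) \<partial>\<gamma>)\<bar> \<le> (\<integral>z. \<bar>g (s * z) - f (s * z)\<bar> \<partial>\<gamma>)"
      by (rule integral_abs_bound)
    also have "\<dots> \<le> (\<integral>z. 2 * h \<partial>\<gamma>)"
      by (rule integral_mono) (use i close in auto)
    finally show ?thesis using i N.prob_space by (simp add: gauss_avg_def)
  qed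
  ultimately show ?thesis using main unfolding s_def by linarith
qed

end

section \<open>Quantile coupling\<close>

text \<open>The Kantorovich potential on the line: slope +1 on the union U of the intervals leading
  from u up to q, slope -1 elsewhere. If q x < u x, monotonicity keeps U out of the interval from q
  x to u x except perhaps for its end point, so the slope there is -1, as the sign of the difference
  requires.\<close>

lemma monotone_potential:
  fixes q u :: "real \<Rightarrow> real"
  assumes q: "mono q" and u: "mono u"
  obtains f where "\<And>x y. \<bar>f x - f y\<bar> \<le> \<bar>x - y\<bar>" "\<And>x. f (q x) - f (u x) = \<bar>q x - u x\<bar>"
proof -
  define U where "U = (\<Union>x. {u x<..<q x})"
  have [measurable]: "U \<in> sets borel" unfolding U_def by (intro borel_open open_UN) auto
  have fin: "emeasure lborel (U \<inter> {a<..b}) < \<infinity>" for a b :: real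
    by (rule order_le_less_trans[OF emeasure_mono[of _ "{a..b}"]]) (auto simp: emeasure_lborel_Icc_eq)
  have fmb: "U \<inter> {a<..b} \<in> fmeasurable lborel" for a b :: real
    using fin[of a b] by (intro fmeasurableI) auto
  define \<mu> where "\<mu> a b = measure lborel (U \<inter> {a<..b})" for a b :: real
  have \<mu>0: "0 \<le> \<mu> a b" for a b by (simp add: \<mu>_def)
  have \<mu>1: "\<mu> a b \<le> b - a" if "a \<le> b" for a b
  proof -
    have "\<mu> a b \<le> measure lborel {a<..b}"
      unfolding \<mu>_def by (rule measure_mono_fmeasurable) (use that in \<open>auto intro!: fmeasurableI simp: emeasure_lborel_Ioc\<close>)
    then show ?thesis using that by simp
  qed
  have \<mu>add: "\<mu> a c = \<mu> a b + \<mu> b c" if "a \<le> b" "b \<le> c" for a b c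
  proof -
    have "U \<inter> {a<..c} = (U \<inter> {a<..b}) \<union> (U \<inter> {b<..c})" using that by auto
    moreover have "(U \<inter> {a<..b}) \<inter> (U \<inter> {b<..c}) = {}" by auto
    ultimately show ?thesis unfolding \<mu>_def using measure_Un3[OF fmb[of a b] fmb[of b c]] by simp
  qed
  \<comment> \<open>Twice the signed measure of U between 0 and x, minus x, has these slopes almost
    everywhere.\<close>
  define f where "f x = 2 * (if 0 \<le> x then \<mu> 0 x else - \<mu> x 0) - x" for x
  have fdiff: "f y - f x = 2 * \<mu> x y - (y - x)" if "x \<le> y" for x y
    using that \<mu>add[of 0 x y] \<mu>add[of x 0 y] \<mu>add[of x y 0] by (auto simp: f_def)
  have lip: "\<bar>f x - f y\<bar> \<le> \<bar>x - y\<bar>" for x y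
    using fdiff[of x y] fdiff[of y x] \<mu>0[of x y] \<mu>0[of y x] \<mu>1[of x y] \<mu>1[of y x]
    by (cases "x \<le> y") auto
  have up: "f (q x) - f (u x) = \<bar>q x - u x\<bar>" if x: "u x < q x" for x
  proof -
    have "measure lborel {u x<..<q x} \<le> \<mu> (u x) (q x)"
      unfolding \<mu>_def by (rule measure_mono_fmeasurable) (use fmb in \<open>auto simp: U_def\<close>)
    then have "\<mu> (u x) (q x) = q x - u x" using \<mu>1[of "u x" "q x"] x by simp
    then show ?thesis using fdiff[of "u x" "q x"] x by simp
  qed
  have down: "f (q x) - f (u x) = \<bar>q x - u x\<bar>" if x: "q x < u x" for x
  proof -
    have "U \<inter> {q x<..u x} \<subseteq> {u x}"
    proof
      fix z assume "z \<in> U \<inter> {q x<..u x}"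
      then obtain y where y: "u y < z" "z < q y" "q x < z" "z \<le> u x" by (auto simp: U_def)
      have "\<not> y \<le> x" using monoD[OF q, of y x] y by auto
      then have "u x \<le> u y" using monoD[OF u, of x y] by auto
      then show "z \<in> {u x}" using y by auto
    qed
    then have "\<mu> (q x) (u x) \<le> measure lborel {u x}"
      unfolding \<mu>_def by (intro measure_mono_fmeasurable) (auto intro!: fmeasurableI)
    then have "\<mu> (q x) (u x) = 0" using \<mu>0[of "q x" "u x"] by simp
    then show ?thesis using fdiff[of "q x" "u x"] x by simp
  qed
  have "f (q x) - f (u x) = \<bar>q x - u x\<bar>" for x
    using up[of x] down[of x] by (cases "u x" "q x" rule: linorder_cases) auto
  with lip show thesis by (rule that)
qed

text \<open>The distribution function is continuous because there are no atoms, and strictly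
  increasing because the density is positive. For c strictly between 0 and 1 the sublevel set is
  therefore a half-line of mass c.\<close>

lemma gauss_cdf_uniform:
  assumes c: "0 \<le> c" "c \<le> 1"
  shows "measure \<gamma> {x. cdf \<gamma> x \<le> c} = c"
proof -
  interpret real_distribution \<gamma> by (rule real_dist_normal_dist)
  have pos: "cdf \<gamma> a < cdf \<gamma> b" if "a < b" for a b
  proof -
    have "emeasure \<gamma> {a<..b} \<noteq> 0"
    proof
      assume "emeasure \<gamma> {a<..b} = 0"
      then have "AE x in lborel. ennreal (std_normal_density x) * indicator {a<..b} x = 0"
        by (subst (asm) emeasure_density) (auto simp: nn_integral_0_iff_AE)
      moreover have "std_normal_density x \<noteq> 0" for x using normal_density_pos[of 1 0 x] by linarith
      ultimately have "AE x in lborel. x \<notin> {a<..b}"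
        by (auto simp: indicator_def elim!: eventually_mono split: if_splits)
      then have "{a<..b} \<in> null_sets lborel" by (subst (asm) AE_iff_null_sets[symmetric]) auto
      then show False using that by (simp add: null_sets_def)
    qed
    then have "0 < measure \<gamma> {a<..b}" by (simp add: emeasure_eq_measure zero_less_measure_iff)
    then show ?thesis using cdf_diff_eq[OF that] by simp
  qed
  have cont: "isCont (cdf \<gamma>) x" for x
  proof -
    have "emeasure \<gamma> {x} = 0"
      by (subst emeasure_density) (auto intro!: nn_integral_null_set simp: null_sets_def)
    then show ?thesis by (simp add: isCont_cdf emeasure_eq_measure)
  qed
  consider "c = 0" | "c = 1" | "0 < c" "c < 1" using c by linarith
  then show ?thesis
  proof cases
    case 1
    have "\<not> cdf \<gamma> x \<le> 0" for x using pos[of "x - 1" x] cdf_nonneg[of "x - 1"] by linarith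
    then show ?thesis using 1 by simp
  next
    case 2
    then show ?thesis using cdf_bounded_prob prob_space by simp
  next
    case 3
    obtain a where a: "cdf \<gamma> a < c"
      using order_tendstoD(2)[OF cdf_lim_at_bot 3(1)] by (auto simp: eventually_at_bot_linorder)
    obtain b where b: "c < cdf \<gamma> b"
      using order_tendstoD(1)[OF cdf_lim_at_top_prob 3(2)] by (auto simp: eventually_at_top_linorder)
    have "a \<le> b" using a b cdf_nondecreasing[of b a] by linarith
    then obtain x where x: "cdf \<gamma> x = c"
      using IVT'[of "cdf \<gamma>" a c b] a b cont by (auto intro: continuous_at_imp_continuous_on)
    have "cdf \<gamma> y \<le> c \<longleftrightarrow> y \<le> x" for y
      using pos[of x y] x cdf_nondecreasing[of y x] by (cases "y \<le> x") auto
    then have "{y. cdf \<gamma> y \<le> c} = {..x}" by auto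
    then show ?thesis using x by (simp add: cdf_def)
  qed
qed

text \<open>The quantile transform for a finite set: list \<open>V\<close> by increasing Z and cut
  the line into consecutive pieces whose Gaussian masses are the given probabilities. The ordering
  makes the selection monotone in Z.\<close>

lemma quantile_selector:
  fixes V :: "'b set" and Z pr :: "'b \<Rightarrow> real"
  assumes V: "finite V" and pr: "\<And>v. v \<in> V \<Longrightarrow> 0 \<le> pr v" "sum pr V = 1"
  shows "\<exists>h :: real \<Rightarrow> 'b. (\<forall>x. h x \<in> V) \<and> (\<forall>v\<in>V. {x. h x = v} \<in> sets borel \<and> measure \<gamma> {x. h x = v} = pr v)
    \<and> mono (\<lambda>x. Z (h x))"
proof -
  interpret real_distribution \<gamma> by (rule real_dist_normal_dist)
  obtain xs0 where "set xs0 = V" "distinct xs0" using finite_distinct_list[OF V] by blast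
  then obtain xs where xs: "set xs = V" "distinct xs" "sorted (map Z xs)"
    by (metis distinct_sort set_sort sorted_sort_key)
  define C where "C i = (\<Sum>j<i. pr (xs ! j))" for i
  let ?n = "length xs"
  have C0: "C 0 = 0" by (simp add: C_def)
  have Cn: "C ?n = 1"
  proof -
    have "sum pr V = sum_list (map pr xs)" using xs by (metis sum_list_distinct_conv_sum_set)
    also have "\<dots> = C ?n" by (simp add: C_def sum_list_sum_nth lessThan_atLeast0)
    finally show ?thesis using pr by simp
  qed
  have prn: "0 \<le> pr (xs ! j)" if "j < ?n" for j using pr(1) xs(1) that by auto
  have Cmono: "C i \<le> C j" if "i \<le> j" "j \<le> ?n" for i j
    unfolding C_def by (rule sum_mono2) (use that prn in auto)
  have n0: "0 < ?n" using Cn C0 by (cases ?n) auto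
  define idx where "idx x = (LEAST i. cdf \<gamma> x \<le> C (Suc i))" for x
  have idx: "cdf \<gamma> x \<le> C (Suc (idx x))" "idx x < ?n" "\<And>j. j < idx x \<Longrightarrow> C (Suc j) < cdf \<gamma> x" for x
  proof -
    have *: "cdf \<gamma> x \<le> C (Suc (?n - 1))" using cdf_bounded_prob[of x] Cn n0 by simp
    show "cdf \<gamma> x \<le> C (Suc (idx x))" unfolding idx_def by (rule LeastI[of "\<lambda>i. cdf \<gamma> x \<le> C (Suc i)", OF *])
    have "idx x \<le> ?n - 1" unfolding idx_def by (rule Least_le[of "\<lambda>i. cdf \<gamma> x \<le> C (Suc i)", OF *])
    then show "idx x < ?n" using n0 by linarith
    show "C (Suc j) < cdf \<gamma> x" if "j < idx x" for j
      using not_less_Least[of j "\<lambda>i. cdf \<gamma> x \<le> C (Suc i)"] that unfolding idx_def by auto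
  qed
  have idx_mono: "idx x \<le> idx y" if "x \<le> y" for x y
    unfolding idx_def[of x]
    by (rule Least_le) (use idx(1)[of y] cdf_nondecreasing[OF that] in linarith)
  define h where "h x = xs ! idx x" for x
  have hV: "h x \<in> V" for x using idx(2) xs(1) by (auto simp: h_def)
  have [measurable]: "cdf \<gamma> \<in> borel_measurable borel"
    by (rule borel_measurable_mono) (simp add: mono_def cdf_nondecreasing)
  have level: "{x. h x = xs ! k} = {x. cdf \<gamma> x \<le> C (Suc k)} - (if k = 0 then {} else {x. cdf \<gamma> x \<le> C k})" if k: "k < ?n" for k
  proof -
    have i1: "h x = xs ! k \<longleftrightarrow> idx x = k" for x
      unfolding h_def using nth_eq_iff_index_eq[OF xs(2) idx(2) k] .
    have i2: "idx x = k \<longleftrightarrow> cdf \<gamma> x \<le> C (Suc k) \<and> (k = 0 \<or> C k < cdf \<gamma> x)" for x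
    proof
      assume "idx x = k"
      then show "cdf \<gamma> x \<le> C (Suc k) \<and> (k = 0 \<or> C k < cdf \<gamma> x)"
        using idx(1)[of x] idx(3)[of "k - 1" x] by (cases k) auto
    next
      assume a: "cdf \<gamma> x \<le> C (Suc k) \<and> (k = 0 \<or> C k < cdf \<gamma> x)"
      have "idx x \<le> k" unfolding idx_def by (rule Least_le) (use a in blast)
      moreover have "k \<le> idx x"
      proof (rule ccontr)
        assume "\<not> k \<le> idx x"
        then have "C (Suc (idx x)) \<le> C k" using k by (intro Cmono) auto
        then show False using idx(1)[of x] a \<open>\<not> k \<le> idx x\<close> by auto
      qed
      ultimately show "idx x = k" by simp
    qed
    show ?thesis unfolding i1 i2 by (cases "k = 0") (auto simp: not_le)
  qed
  have C01: "0 \<le> C k" "C k \<le> 1" if "k \<le> ?n" for k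
    using Cmono[of 0 k] Cmono[of k ?n] that C0 Cn by auto
  have hm: "{x. h x = v} \<in> sets borel" and hp: "measure \<gamma> {x. h x = v} = pr v" if v: "v \<in> V" for v
  proof -
    obtain k where k: "k < ?n" "v = xs ! k" using v xs(1) by (metis in_set_conv_nth)
    show "{x. h x = v} \<in> sets borel" unfolding k(2) level[OF k(1)] by auto
    have "measure \<gamma> ({x. cdf \<gamma> x \<le> C (Suc k)} - (if k = 0 then {} else {x. cdf \<gamma> x \<le> C k})) = C (Suc k) - C k"
    proof (cases "k = 0")
      case True
      then show ?thesis using gauss_cdf_uniform[OF C01[of "Suc k"]] k C0 by simp
    next
      case False
      have "C k \<le> C (Suc k)" using k by (intro Cmono) auto
      then have "{x. cdf \<gamma> x \<le> C k} \<subseteq> {x. cdf \<gamma> x \<le> C (Suc k)}" by auto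
      then have "measure \<gamma> ({x. cdf \<gamma> x \<le> C (Suc k)} - {x. cdf \<gamma> x \<le> C k}) = measure \<gamma> {x. cdf \<gamma> x \<le> C (Suc k)} - measure \<gamma> {x. cdf \<gamma> x \<le> C k}"
        by (intro finite_measure_Diff) auto
      then show ?thesis using False gauss_cdf_uniform[OF C01[of "Suc k"]] gauss_cdf_uniform[OF C01[of k]] k by simp
    qed
    then show "measure \<gamma> {x. h x = v} = pr v"
      unfolding k(2) level[OF k(1)] by (simp add: C_def)
  qed
  have "mono (\<lambda>x. Z (h x))"
  proof (rule monoI)
    fix x y :: real assume "x \<le> y"
    then have "map Z xs ! idx x \<le> map Z xs ! idx y"
      using xs(3) idx(2)[of y] idx_mono by (intro sorted_nth_mono) auto
    then show "Z (h x) \<le> Z (h y)" using idx(2) by (simp add: h_def)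
  qed
  with hV hm hp show ?thesis by blast
qed

text \<open>\<open>h\<close> selects an element v rather than the number Z v: several sign vectors
  may share one sum, and the law of the vector itself must be reproduced. Since the cost of the
  monotone coupling is attained by one 1-Lipschitz potential, any bound on all Lipschitz
  discrepancies bounds that cost.\<close>

lemma (in prob_space) quantile_coupling:
  fixes Y :: "'a \<Rightarrow> 'b" and Z :: "'b \<Rightarrow> real"
  assumes V: "finite V" and Y: "\<And>\<omega>. \<omega> \<in> space M \<Longrightarrow> Y \<omega> \<in> V"
    and mY: "\<And>v. v \<in> V \<Longrightarrow> {\<omega> \<in> space M. Y \<omega> = v} \<in> events"
  obtains h :: "real \<Rightarrow> 'b" where "\<And>x. h x \<in> V" "\<And>v. v \<in> V \<Longrightarrow> {x. h x = v} \<in> sets borel"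
    "\<And>v. v \<in> V \<Longrightarrow> measure \<gamma> {x. h x = v} = prob {\<omega> \<in> space M. Y \<omega> = v}"
    "\<And>w K. 0 \<le> w \<Longrightarrow> (\<And>f :: real \<Rightarrow> real. (\<And>x y. \<bar>f x - f y\<bar> \<le> \<bar>x - y\<bar>) \<Longrightarrow>
        \<bar>expectation (\<lambda>\<omega>. f (Z (Y \<omega>))) - (\<integral>x. f (w * x) \<partial>\<gamma>)\<bar> \<le> K) \<Longrightarrow>
        (\<integral>x. \<bar>Z (h x) - w * x\<bar> \<partial>\<gamma>) \<le> K"
    "\<And>w. integrable \<gamma> (\<lambda>x. \<bar>Z (h x) - w * x\<bar>)"
proof -
  interpret N: prob_space \<gamma> by (rule prob_space_gauss)
  let ?pr = "\<lambda>v. prob {\<omega> \<in> space M. Y \<omega> = v}"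
  have "(\<Sum>v\<in>V. ?pr v) = prob (\<Union>v\<in>V. {\<omega> \<in> space M. Y \<omega> = v})"
    by (rule finite_measure_finite_Union[symmetric]) (use V mY in \<open>auto simp: disjoint_family_on_def\<close>)
  also have "(\<Union>v\<in>V. {\<omega> \<in> space M. Y \<omega> = v}) = space M" using Y by auto
  finally have s1: "(\<Sum>v\<in>V. ?pr v) = 1" by (simp add: prob_space)
  have "\<exists>h :: real \<Rightarrow> 'b. (\<forall>x. h x \<in> V) \<and> (\<forall>v\<in>V. {x. h x = v} \<in> sets borel \<and> measure \<gamma> {x. h x = v} = ?pr v)
    \<and> mono (\<lambda>x. Z (h x))"
    by (rule quantile_selector[OF V _ s1]) simp
  then obtain h :: "real \<Rightarrow> 'b" where h: "\<And>x. h x \<in> V" "\<And>v. v \<in> V \<Longrightarrow> {x. h x = v} \<in> sets borel"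
    "\<And>v. v \<in> V \<Longrightarrow> measure \<gamma> {x. h x = v} = ?pr v" "mono (\<lambda>x. Z (h x))"
    by blast
  have expand1: "(\<integral>x. F (h x) \<partial>\<gamma>) = (\<Sum>v\<in>V. F v * ?pr v)" and int1: "integrable \<gamma> (\<lambda>x. F (h x))" for F :: "'b \<Rightarrow> real"
  proof -
    have e: "F (h x) = (\<Sum>v\<in>V. F v * indicator {x. h x = v} x)" for x
    proof -
      have "(\<Sum>v\<in>V. F v * indicator {x. h x = v} x) = (\<Sum>v\<in>{h x}. F v * indicator {x. h x = v} x)"
        by (rule sum.mono_neutral_right) (use V h(1) in \<open>auto simp: indicator_def\<close>)
      then show ?thesis by simp
    qed
    have i: "integrable \<gamma> (\<lambda>x. F v * indicator {x. h x = v} x)" if "v \<in> V" for v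
      using h(2)[OF that] by (intro integrable_mult_right integrable_real_indicator) (auto simp: N.emeasure_eq_measure)
    show "integrable \<gamma> (\<lambda>x. F (h x))" unfolding e using i by auto
    show "(\<integral>x. F (h x) \<partial>\<gamma>) = (\<Sum>v\<in>V. F v * ?pr v)"
      unfolding e using i h by (subst Bochner_Integration.integral_sum) auto
  qed
  have expand2: "expectation (\<lambda>\<omega>. F (Y \<omega>)) = (\<Sum>v\<in>V. F v * ?pr v)" for F :: "'b \<Rightarrow> real"
  proof -
    have e: "F (Y \<omega>) = (\<Sum>v\<in>V. F v * indicator {\<omega> \<in> space M. Y \<omega> = v} \<omega>)" if "\<omega> \<in> space M" for \<omega>
    proof -
      have "(\<Sum>v\<in>V. F v * indicator {\<omega> \<in> space M. Y \<omega> = v} \<omega>) = (\<Sum>v\<in>{Y \<omega>}. F v * indicator {\<omega> \<in> space M. Y \<omega> = v} \<omega>)"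
        by (rule sum.mono_neutral_right) (use V Y that in \<open>auto simp: indicator_def\<close>)
      then show ?thesis using that by simp
    qed
    have "expectation (\<lambda>\<omega>. F (Y \<omega>)) = expectation (\<lambda>\<omega>. \<Sum>v\<in>V. F v * indicator {\<omega> \<in> space M. Y \<omega> = v} \<omega>)"
      by (rule Bochner_Integration.integral_cong[OF refl e])
    also have "\<dots> = (\<Sum>v\<in>V. F v * ?pr v)"
      using mY by (subst Bochner_Integration.integral_sum) (auto simp: emeasure_eq_measure intro!: integrable_mult_right)
    finally show ?thesis .
  qed
  have intw: "integrable \<gamma> (\<lambda>x. w * x)" for w using gauss_moments(1) by simp
  have "(\<integral>x. \<bar>Z (h x) - w * x\<bar> \<partial>\<gamma>) \<le> K"
    if w: "0 \<le> w" and K: "\<And>f :: real \<Rightarrow> real. (\<And>x y. \<bar>f x - f y\<bar> \<le> \<bar>x - y\<bar>) \<Longrightarrow>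
        \<bar>expectation (\<lambda>\<omega>. f (Z (Y \<omega>))) - (\<integral>x. f (w * x) \<partial>\<gamma>)\<bar> \<le> K" for w K
  proof -
    have "mono (\<lambda>x. w * x)" using w by (auto intro!: monoI mult_left_mono)
    then obtain f where f: "\<And>x y. \<bar>f x - f y\<bar> \<le> \<bar>x - y\<bar>" "\<And>x. f (Z (h x)) - f (w * x) = \<bar>Z (h x) - w * x\<bar>"
      using monotone_potential[OF h(4)] by blast
    have [measurable]: "f \<in> borel_measurable borel"
    proof (rule borel_measurable_continuous_onI)
      have "isCont f x" for x
        unfolding continuous_at_eps_delta dist_real_def using f(1) order_le_less_trans by blast
      then show "continuous_on UNIV f" by (simp add: continuous_at_imp_continuous_on)
    qed
    have fb: "\<bar>f x\<bar> \<le> \<bar>f 0\<bar> + \<bar>x\<bar>" for x using f(1)[of x 0] by simp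
    have i: "integrable \<gamma> (\<lambda>x. f (w * x))"
      using gauss_avg_integrable(1)[of f "\<bar>f 0\<bar>" 0 w] fb by simp
    have "(\<integral>x. \<bar>Z (h x) - w * x\<bar> \<partial>\<gamma>) = (\<integral>x. f (Z (h x)) - f (w * x) \<partial>\<gamma>)"
      using f(2) by simp
    also have "\<dots> = expectation (\<lambda>\<omega>. f (Z (Y \<omega>))) - (\<integral>x. f (w * x) \<partial>\<gamma>)"
      using int1[of "\<lambda>v. f (Z v)"] i expand1[of "\<lambda>v. f (Z v)"] expand2[of "\<lambda>v. f (Z v)"] by simp
    also have "\<dots> \<le> K" using K[OF f(1)] by linarith
    finally show ?thesis .
  qed
  moreover have "integrable \<gamma> (\<lambda>x. \<bar>Z (h x) - w * x\<bar>)" for w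
    using int1[of Z] intw by (intro integrable_abs Bochner_Integration.integrable_diff)
  ultimately show thesis using h by (intro that[of h]) auto
qed

section \<open>The coupled chain\<close>

lemma (in prob_space) sign_event_decompose:
  fixes X :: "nat \<Rightarrow> 'a \<Rightarrow> real"
  assumes m: "\<And>k. 1 \<le> k \<Longrightarrow> X k \<in> borel_measurable M"
    and v: "\<And>k \<omega>. 1 \<le> k \<Longrightarrow> \<omega> \<in> space M \<Longrightarrow> X k \<omega> = 1 \<or> X k \<omega> = - 1"
  shows "prob {\<omega> \<in> space M. Q (restrict (\<lambda>i. X i \<omega>) {1..n})}
     = (\<Sum>s\<in>{s\<in>signs n. Q s}. prob {\<omega> \<in> space M. \<forall>i\<in>{1..n}. X i \<omega> = s i})"
proof -
  let ?c = "\<lambda>s. {\<omega> \<in> space M. \<forall>i\<in>{1..n}. X i \<omega> = s i}"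
  have c: "?c s \<in> events" for s
    by (intro sets.sets_Collect_finite_All) (use m in auto)
  have "{\<omega> \<in> space M. Q (restrict (\<lambda>i. X i \<omega>) {1..n})} = (\<Union>s\<in>{s\<in>signs n. Q s}. ?c s)" (is "?L = ?R")
  proof (intro set_eqI iffI)
    fix \<omega> assume w: "\<omega> \<in> ?L"
    let ?s = "restrict (\<lambda>i. X i \<omega>) {1..n}"
    have "?s \<in> signs n" using v w by (auto simp: signs_def)
    then show "\<omega> \<in> ?R" using w by (intro UN_I[of ?s]) auto
  next
    fix \<omega> assume "\<omega> \<in> ?R"
    then obtain s where s: "s \<in> signs n" "Q s" "\<omega> \<in> ?c s" by blast
    then have "restrict (\<lambda>i. X i \<omega>) {1..n} = s"
      by (intro extensionalityI[of _ "{1..n}"]) (auto simp: signs_def PiE_def)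
    then show "\<omega> \<in> ?L" using s by simp
  qed
  also have "prob \<dots> = (\<Sum>s\<in>{s\<in>signs n. Q s}. prob (?c s))"
  proof (rule finite_measure_finite_Union)
    show "disjoint_family_on ?c {s \<in> signs n. Q s}"
      unfolding disjoint_family_on_def
    proof (intro ballI impI)
      fix s t assume st: "s \<in> {s \<in> signs n. Q s}" "t \<in> {s \<in> signs n. Q s}" "s \<noteq> t"
      then obtain i where "i \<in> {1..n}" "s i \<noteq> t i"
        unfolding signs_def by (metis (no_types, lifting) PiE_ext mem_Collect_eq)
      then show "?c s \<inter> ?c t = {}" by auto
    qed
  qed (use c finite_signs in auto)
  finally show ?thesis .
qed

text \<open>The law of the walk is fixed by finite-dimensional events, and each of these is a finite
  union of sign cylinders. The lengths e n suffice because they are unbounded, which suits signs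
  that are built block by block.\<close>

lemma walk_law_eq:
  fixes X :: "nat \<Rightarrow> 'a \<Rightarrow> real" and X' :: "nat \<Rightarrow> 'b \<Rightarrow> real"
  assumes M: "prob_space M" "\<And>k. 1 \<le> k \<Longrightarrow> X k \<in> borel_measurable M" "\<And>k \<omega>. 1 \<le> k \<Longrightarrow> \<omega> \<in> space M \<Longrightarrow> X k \<omega> = 1 \<or> X k \<omega> = - 1"
    and M': "prob_space M'" "\<And>k. 1 \<le> k \<Longrightarrow> X' k \<in> borel_measurable M'" "\<And>k \<omega>. 1 \<le> k \<Longrightarrow> \<omega> \<in> space M' \<Longrightarrow> X' k \<omega> = 1 \<or> X' k \<omega> = - 1"
    and cyl: "\<And>n s. s \<in> signs (e n) \<Longrightarrow> measure M' {\<omega> \<in> space M'. \<forall>i\<in>{1..e n}. X' i \<omega> = s i} = measure M {\<omega> \<in> space M. \<forall>i\<in>{1..e n}. X i \<omega> = s i}"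
    and e: "\<And>n. n \<le> (e n :: nat)"
  shows "same_process_law M' (walk a X') M (walk a X)"
proof -
  interpret M: prob_space M by fact
  interpret M': prob_space M' by fact
  have mw: "walk a X n \<in> borel_measurable M" for n
    unfolding walk_def[abs_def] by (intro borel_measurable_sum borel_measurable_times M(2)) auto
  have mw': "walk a X' n \<in> borel_measurable M'" for n
    unfolding walk_def[abs_def] by (intro borel_measurable_sum borel_measurable_times M'(2)) auto
  let ?P = "\<Pi>\<^sub>M n\<in>(UNIV :: nat set). (borel :: real measure)"
  have mp: "(\<lambda>\<omega> n. walk a X n \<omega>) \<in> M \<rightarrow>\<^sub>M ?P" using mw by (intro measurable_PiM_single') auto
  have mp': "(\<lambda>\<omega> n. walk a X' n \<omega>) \<in> M' \<rightarrow>\<^sub>M ?P" using mw' by (intro measurable_PiM_single') auto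
  have "distr M' ?P (\<lambda>\<omega> n. walk a X' n \<omega>) = distr M ?P (\<lambda>\<omega> n. walk a X n \<omega>)"
  proof (rule measure_eqI_PiM_infinite)
    show "sets (distr M' ?P (\<lambda>\<omega> n. walk a X' n \<omega>)) = sets ?P" "sets (distr M ?P (\<lambda>\<omega> n. walk a X n \<omega>)) = sets ?P" by auto
    show "finite_measure (distr M' ?P (\<lambda>\<omega> n. walk a X' n \<omega>))"
      using M'.prob_space_distr[OF mp'] by (simp add: prob_space_def)
    fix A :: "nat \<Rightarrow> real set" and J assume J: "finite J" "J \<subseteq> UNIV" and A: "\<And>j. j \<in> J \<Longrightarrow> A j \<in> sets borel"
    obtain n0 where n0: "\<And>j. j \<in> J \<Longrightarrow> j \<le> n0" using J(1) by (metis finite_nat_set_iff_bounded_le)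
    define n where "n = e n0"
    have n: "j \<le> n" if "j \<in> J" for j using n0[OF that] e[of n0] by (simp add: n_def)
    define Q where "Q s \<longleftrightarrow> (\<forall>j\<in>J. (\<Sum>k=1..j. a k * s k) \<in> A j)" for s
    have Qw: "Q (restrict (\<lambda>i. Y i) {1..n}) \<longleftrightarrow> (\<forall>j\<in>J. (\<Sum>k=1..j. a k * Y k) \<in> A j)" for Y
    proof -
      have "(\<Sum>k=1..j. a k * restrict (\<lambda>i. Y i) {1..n} k) = (\<Sum>k=1..j. a k * Y k)" if "j \<in> J" for j
        using n[OF that] by (intro sum.cong) auto
      then show ?thesis by (simp add: Q_def)
    qed
    have E: "(\<lambda>\<omega> n. walk a X n \<omega>) -` prod_emb UNIV (\<lambda>_. borel) J (Pi\<^sub>E J A) \<inter> space M = {\<omega> \<in> space M. Q (restrict (\<lambda>i. X i \<omega>) {1..n})}"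
      unfolding Qw by (auto simp: prod_emb_def walk_def PiE_iff)
    have E': "(\<lambda>\<omega> n. walk a X' n \<omega>) -` prod_emb UNIV (\<lambda>_. borel) J (Pi\<^sub>E J A) \<inter> space M' = {\<omega> \<in> space M'. Q (restrict (\<lambda>i. X' i \<omega>) {1..n})}"
      unfolding Qw by (auto simp: prod_emb_def walk_def PiE_iff)
    have d: "M.prob {\<omega> \<in> space M. Q (restrict (\<lambda>i. X i \<omega>) {1..n})} = (\<Sum>s\<in>{s\<in>signs n. Q s}. M.prob {\<omega> \<in> space M. \<forall>i\<in>{1..n}. X i \<omega> = s i})"
      by (rule M.sign_event_decompose) (use M in auto)
    have d': "M'.prob {\<omega> \<in> space M'. Q (restrict (\<lambda>i. X' i \<omega>) {1..n})} = (\<Sum>s\<in>{s\<in>signs n. Q s}. M'.prob {\<omega> \<in> space M'. \<forall>i\<in>{1..n}. X' i \<omega> = s i})"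
      by (rule M'.sign_event_decompose) (use M' in auto)
    have "M'.prob {\<omega> \<in> space M'. Q (restrict (\<lambda>i. X' i \<omega>) {1..n})} = M.prob {\<omega> \<in> space M. Q (restrict (\<lambda>i. X i \<omega>) {1..n})}"
      unfolding d d'
      by (intro sum.cong refl) (use cyl in \<open>auto simp: n_def\<close>)
    moreover have "prod_emb UNIV (\<lambda>_. borel) J (Pi\<^sub>E J A) \<in> sets ?P"
      using J A by (intro sets_PiM_I) auto
    ultimately show "emeasure (distr M' ?P (\<lambda>\<omega> n. walk a X' n \<omega>)) (prod_emb UNIV (\<lambda>_. borel) J (Pi\<^sub>E J A))
        = emeasure (distr M ?P (\<lambda>\<omega> n. walk a X n \<omega>)) (prod_emb UNIV (\<lambda>_. borel) J (Pi\<^sub>E J A))"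
      by (simp add: emeasure_distr mp mp' E E' M.emeasure_eq_measure M'.emeasure_eq_measure)
  qed
  then show ?thesis using mw mw' by (simp add: same_process_law_def)
qed

context elephant
begin

lemma prob_cyl_block:
  assumes x: "\<And>i. x i = 1 \<or> x i = - 1" and mn: "m \<le> n"
  shows "prob (cyl x n) = prob (cyl x m) * (\<Prod>i\<in>{m..<n}. step_prob i (x i) (x (Suc i)))"
  using mn
proof (induction n rule: dec_induct)
  case (step n)
  then show ?case using prob_cyl_Suc[of x n, OF x] by (simp add: prod.atLeastLessThan_Suc)
qed simp

text \<open>The value 1 at time 0 lets the initial block, which no sign precedes, be treated like
  the others.\<close>

definition X0 :: "nat \<Rightarrow> 'w \<Rightarrow> real" where
  "X0 m \<omega> = (if m = 0 then 1 else X m \<omega>)"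

text \<open>After time 0 a step probability depends only on whether the two signs agree. Multiplying
  a block by the sign before it thus makes its law independent of the past, and the histories can be
  summed out. The update v(m := 1) expresses the normalised start.\<close>

lemma prob_relative_block:
  assumes v: "\<And>i. v i = 1 \<or> v i = - 1" and mn: "m \<le> n"
  shows "prob {\<omega> \<in> space M. \<forall>i\<in>{m<..n}. X0 m \<omega> * X i \<omega> = v i}
     = (\<Prod>i\<in>{m..<n}. step_prob i ((v(m := 1)) i) (v (Suc i)))"
proof -
  let ?\<pi> = "\<Prod>i\<in>{m..<n}. step_prob i ((v(m := 1)) i) (v (Suc i))"
  define y where "y s = (if m = 0 then 1 else s m)" for s :: "nat \<Rightarrow> real"
  \<comment> \<open>The history s followed by the block v, turned back into absolute signs.\<close>
  define ext where "ext s i = (if m < i then y s * v i else if i = 0 then 1 else s i)" for s i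
  have ys: "y s = 1 \<or> y s = - 1" if "s \<in> signs m" for s
    using that by (auto simp: y_def signs_def PiE_iff)
  have exts: "ext s i = 1 \<or> ext s i = - 1" if s: "s \<in> signs m" for s i
    using ys[OF s] v[of i] s by (auto simp: ext_def signs_def PiE_iff)
  have pr: "prob (cyl (ext s) n) = prob (cyl s m) * ?\<pi>" if s: "s \<in> signs m" for s
  proof -
    have "cyl (ext s) m = cyl s m" by (auto simp: cyl_def ext_def)
    moreover have "(\<Prod>i\<in>{m..<n}. step_prob i (ext s i) (ext s (Suc i))) = ?\<pi>"
    proof (intro prod.cong refl)
      fix i assume i: "i \<in> {m..<n}"
      show "step_prob i (ext s i) (ext s (Suc i)) = step_prob i ((v(m := 1)) i) (v (Suc i))"
        using i ys[OF s] by (auto simp: step_prob_def ext_def y_def)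
    qed
    ultimately show ?thesis using prob_cyl_block[of "ext s", OF exts[OF s] mn] by simp
  qed
  have "{\<omega> \<in> space M. \<forall>i\<in>{m<..n}. X0 m \<omega> * X i \<omega> = v i} = (\<Union>s\<in>signs m. cyl (ext s) n)" (is "?L = ?R")
  proof (intro set_eqI iffI)
    fix \<omega> assume w: "\<omega> \<in> ?L"
    let ?s = "restrict (\<lambda>i. X i \<omega>) {1..m}"
    have s: "?s \<in> signs m" using X_values w by (auto simp: signs_def)
    have yX: "y ?s = X0 m \<omega>" by (auto simp: y_def X0_def)
    have "X i \<omega> = ext ?s i" if "i \<in> {1..n}" for i
    proof (cases "m < i")
      case True
      then have "X0 m \<omega> * X i \<omega> = v i" using w that by auto
      then have "X0 m \<omega> * (X0 m \<omega> * X i \<omega>) = X0 m \<omega> * v i" by simp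
      moreover have "X0 m \<omega> * X0 m \<omega> = 1" using w X_square[of m \<omega>] by (auto simp: X0_def)
      ultimately show ?thesis using True yX by (simp add: ext_def mult.assoc[symmetric])
    next
      case False
      then show ?thesis using that by (simp add: ext_def)
    qed
    then show "\<omega> \<in> ?R" using w s by (intro UN_I[of ?s]) (auto simp: cyl_def)
  next
    fix \<omega> assume "\<omega> \<in> ?R"
    then obtain s where s: "s \<in> signs m" and w: "\<omega> \<in> space M" and e: "\<And>i. i \<in> {1..n} \<Longrightarrow> X i \<omega> = ext s i"
      by (auto simp: cyl_def)
    have yX: "X0 m \<omega> = y s" using e[of m] mn by (auto simp: X0_def y_def ext_def)
    show "\<omega> \<in> ?L"
    proof (intro CollectI conjI ballI w)
      fix i assume "i \<in> {m<..n}"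
      then have "X i \<omega> = y s * v i" using e[of i] by (simp add: ext_def)
      then show "X0 m \<omega> * X i \<omega> = v i" using ys[OF s] yX by auto
    qed
  qed
  also have "prob \<dots> = (\<Sum>s\<in>signs m. prob (cyl (ext s) n))"
  proof (rule finite_measure_finite_Union)
    show "disjoint_family_on (\<lambda>s. cyl (ext s) n) (signs m)"
      unfolding disjoint_family_on_def
    proof (intro ballI impI)
      fix s t assume st: "s \<in> signs m" "t \<in> signs m" "s \<noteq> t"
      then obtain i where "i \<in> {1..m}" "s i \<noteq> t i"
        unfolding signs_def by (metis PiE_ext)
      then show "cyl (ext s) n \<inter> cyl (ext t) n = {}" using mn by (force simp: cyl_def ext_def)
    qed
  qed (use finite_signs in auto)
  also have "\<dots> = (\<Sum>s\<in>signs m. prob (cyl s m)) * ?\<pi>"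
    by (simp add: pr sum_distrib_right)
  also have "(\<Sum>s\<in>signs m. prob (cyl s m)) = 1"
    using sign_event_decompose[of X "\<lambda>_. True" m] X_values by (simp add: cyl_def prob_space)
  finally show ?thesis by simp
qed

end

lemma gauss_symmetric: "distr \<gamma> borel uminus = \<gamma>"
proof -
  interpret prob_space \<gamma> by (rule prob_space_gauss)
  have "distr \<gamma> lborel (\<lambda>x. x) = \<gamma>" using distr_id2[of lborel \<gamma>] by simp
  then have "distributed \<gamma> lborel (\<lambda>x. x) std_normal_density" by (simp add: distributed_def)
  from normal_density_affine[OF this, of "- 1" 0]
  have "distributed \<gamma> lborel uminus std_normal_density" by simp
  then have "distr \<gamma> lborel uminus = \<gamma>" by (rule distributed_distr_eq_density)
  then show ?thesis by (simp cong: distr_cong)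
qed

lemma walk_diff_sum:
  assumes "m \<le> n"
  shows "walk a X n \<omega> - walk a X m \<omega> = (\<Sum>i\<in>{m<..n}. a i * X i \<omega>)"
proof -
  have "{1..n} = {1..m} \<union> {m<..n}" "{1..m} \<inter> {m<..n} = {}" using assms by auto
  then show ?thesis
    using sum.union_disjoint[of "{1..m}" "{m<..n}" "\<lambda>i. a i * X i \<omega>"] by (simp add: walk_def)
qed

context elephant
begin

text \<open>The quantile coupling for the vector of signs relative to the sign before the block; its
  sum weighted by \<open>a\<close> is the block increment times that sign.\<close>

lemma relative_block_selector:
  assumes mn: "m \<le> n"
  shows "\<exists>h :: real \<Rightarrow> nat \<Rightarrow> real. (\<forall>z. h z \<in> {m<..n} \<rightarrow>\<^sub>E {1, - 1}) \<and>
    (\<forall>v\<in>{m<..n} \<rightarrow>\<^sub>E {1, - 1}. {z. h z = v} \<in> sets borel \<and>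
       measure \<gamma> {z. h z = v} = prob {\<omega> \<in> space M. \<forall>i\<in>{m<..n}. X0 m \<omega> * X i \<omega> = v i}) \<and>
    (\<forall>w K. 0 \<le> w \<longrightarrow> (\<forall>f :: real \<Rightarrow> real. (\<forall>x y. \<bar>f x - f y\<bar> \<le> \<bar>x - y\<bar>) \<longrightarrow>
        \<bar>expectation (\<lambda>\<omega>. f (X0 m \<omega> * (walk a X n \<omega> - walk a X m \<omega>))) - (\<integral>x. f (w * x) \<partial>\<gamma>)\<bar> \<le> K) \<longrightarrow>
        (\<integral>z. \<bar>(\<Sum>i\<in>{m<..n}. a i * h z i) - w * z\<bar> \<partial>\<gamma>) \<le> K) \<and>
    (\<forall>w. integrable \<gamma> (\<lambda>z. \<bar>(\<Sum>i\<in>{m<..n}. a i * h z i) - w * z\<bar>))"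
proof -
  let ?V = "{m<..n} \<rightarrow>\<^sub>E {1, - 1 :: real}"
  let ?Y = "\<lambda>\<omega>. restrict (\<lambda>i. X0 m \<omega> * X i \<omega>) {m<..n}"
  let ?Z = "\<lambda>v. \<Sum>i\<in>{m<..n}. a i * v i"
  have X0v: "X0 m \<omega> = 1 \<or> X0 m \<omega> = - 1" if "\<omega> \<in> space M" for \<omega>
    using X_values[of m \<omega>] that by (auto simp: X0_def)
  have mX0[measurable]: "X0 m \<in> borel_measurable M"
    unfolding X0_def[abs_def] using X_measurable[of m] by (cases "m = 0") auto
  have mX[measurable]: "X i \<in> borel_measurable M" if "i \<in> {m<..n}" for i
    using X_measurable[of i] that by auto
  have V: "finite ?V" by (intro finite_PiE) auto
  have YV: "?Y \<omega> \<in> ?V" if w: "\<omega> \<in> space M" for \<omega>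
  proof (rule restrict_PiE_iff[THEN iffD2], intro ballI)
    fix i assume "i \<in> {m<..n}"
    then show "X0 m \<omega> * X i \<omega> \<in> {1, - 1}" using X0v[OF w] X_values[of i, OF _ w] by auto
  qed
  have Yeq: "{\<omega> \<in> space M. ?Y \<omega> = v} = {\<omega> \<in> space M. \<forall>i\<in>{m<..n}. X0 m \<omega> * X i \<omega> = v i}" if v: "v \<in> ?V" for v
  proof -
    have "?Y \<omega> = v \<longleftrightarrow> (\<forall>i\<in>{m<..n}. X0 m \<omega> * X i \<omega> = v i)" for \<omega>
    proof
      assume "?Y \<omega> = v" then show "\<forall>i\<in>{m<..n}. X0 m \<omega> * X i \<omega> = v i" by auto
    next
      assume "\<forall>i\<in>{m<..n}. X0 m \<omega> * X i \<omega> = v i"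
      then show "?Y \<omega> = v" using v by (intro extensionalityI[of _ "{m<..n}"]) (auto simp: PiE_def)
    qed
    then show ?thesis by simp
  qed
  have mY: "{\<omega> \<in> space M. ?Y \<omega> = v} \<in> events" if "v \<in> ?V" for v
    unfolding Yeq[OF that] by (intro sets.sets_Collect_finite_All) auto
  have ZY: "?Z (?Y \<omega>) = X0 m \<omega> * (walk a X n \<omega> - walk a X m \<omega>)" for \<omega>
    unfolding walk_diff_sum[OF mn] by (simp add: sum_distrib_left mult.left_commute)
  obtain h :: "real \<Rightarrow> nat \<Rightarrow> real" where h: "\<And>z. h z \<in> ?V" "\<And>v. v \<in> ?V \<Longrightarrow> {z. h z = v} \<in> sets borel"
    "\<And>v. v \<in> ?V \<Longrightarrow> measure \<gamma> {z. h z = v} = prob {\<omega> \<in> space M. ?Y \<omega> = v}"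
    "\<And>w K. 0 \<le> w \<Longrightarrow> (\<And>f :: real \<Rightarrow> real. (\<And>x y. \<bar>f x - f y\<bar> \<le> \<bar>x - y\<bar>) \<Longrightarrow>
        \<bar>expectation (\<lambda>\<omega>. f (?Z (?Y \<omega>))) - (\<integral>x. f (w * x) \<partial>\<gamma>)\<bar> \<le> K) \<Longrightarrow>
        (\<integral>z. \<bar>?Z (h z) - w * z\<bar> \<partial>\<gamma>) \<le> K"
    "\<And>w. integrable \<gamma> (\<lambda>z. \<bar>?Z (h z) - w * z\<bar>)"
    using quantile_coupling[of ?V ?Y ?Z, OF V YV mY] by blast
  show ?thesis
  proof (intro exI[of _ h] conjI allI impI ballI)
    fix v assume "v \<in> ?V"
    then show "measure \<gamma> {z. h z = v} = prob {\<omega> \<in> space M. \<forall>i\<in>{m<..n}. X0 m \<omega> * X i \<omega> = v i}"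
      using h(3) Yeq by simp
  next
    fix w K :: real assume "0 \<le> w" and "\<forall>f :: real \<Rightarrow> real. (\<forall>x y. \<bar>f x - f y\<bar> \<le> \<bar>x - y\<bar>) \<longrightarrow>
        \<bar>expectation (\<lambda>\<omega>. f (X0 m \<omega> * (walk a X n \<omega> - walk a X m \<omega>))) - (\<integral>x. f (w * x) \<partial>\<gamma>)\<bar> \<le> K"
    then show "(\<integral>z. \<bar>?Z (h z) - w * z\<bar> \<partial>\<gamma>) \<le> K"
      unfolding ZY[symmetric] by (intro h(4)) blast+
  qed (use h in auto)
qed

text \<open>Given the past, st k * N k is again standard normal, so the relative block chosen from
  it has the right conditional law. Multiplying by \<open>st k\<close> restores absolute signs and
  at the same time turns the target st k * N k back into N k. Errors are claimed from k = 1 on; the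
  initial block only has to have the right law.\<close>

lemma block_coupling:
  fixes M' :: "'v measure" and N :: "nat \<Rightarrow> 'v \<Rightarrow> real" and e :: "nat \<Rightarrow> nat"
  assumes e: "strict_mono e" "e 0 = 0"
    and M': "prob_space M'" and mN: "\<And>k. N k \<in> borel_measurable M'"
    and dN: "\<And>k. distr M' borel (N k) = \<gamma>" and iN: "\<And>n. prob_space.indep_vars M' (\<lambda>_. borel) N {..<n}"
    and w: "\<And>k. 0 \<le> w k"
    and K: "\<And>k f. 1 \<le> k \<Longrightarrow> (\<And>x y. \<bar>f x - f y :: real\<bar> \<le> \<bar>x - y :: real\<bar>) \<Longrightarrow>
      \<bar>expectation (\<lambda>\<omega>. f (X (e k) \<omega> * (walk a X (e (Suc k)) \<omega> - walk a X (e k) \<omega>))) - (\<integral>z. f (w k * z) \<partial>\<gamma>)\<bar> \<le> K k"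
  shows "\<exists>X'. same_process_law M' (walk a X') M (walk a X) \<and> (\<forall>k\<ge>1.
    integrable M' (\<lambda>\<omega>. \<bar>walk a X' (e (Suc k)) \<omega> - walk a X' (e k) \<omega> - w k * N k \<omega>\<bar>) \<and>
    (\<integral>\<omega>. \<bar>walk a X' (e (Suc k)) \<omega> - walk a X' (e k) \<omega> - w k * N k \<omega>\<bar> \<partial>M') \<le> 2 * K k)"
proof -
  interpret P: prob_space M' by fact
  have ek: "e k < e (Suc k)" for k using e(1) by (simp add: strict_mono_Suc_iff)
  have emono: "e j \<le> e k" if "j \<le> k" for j k using e(1) that by (simp add: strict_mono_less_eq)
  define blk where "blk k = {e k<..e (Suc k)}" for k
  define V where "V k = blk k \<rightarrow>\<^sub>E {1, - 1 :: real}" for k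
  have finV: "finite (V k)" for k unfolding V_def blk_def by (intro finite_PiE) auto
  let ?Z = "\<lambda>k v. \<Sum>i\<in>blk k. a i * v i"
  have "\<forall>k. \<exists>h :: real \<Rightarrow> nat \<Rightarrow> real. (\<forall>z. h z \<in> V k) \<and>
    (\<forall>v\<in>V k. {z. h z = v} \<in> sets borel \<and>
       measure \<gamma> {z. h z = v} = prob {\<omega> \<in> space M. \<forall>i\<in>blk k. X0 (e k) \<omega> * X i \<omega> = v i}) \<and>
    (\<forall>w K. 0 \<le> w \<longrightarrow> (\<forall>f :: real \<Rightarrow> real. (\<forall>x y. \<bar>f x - f y\<bar> \<le> \<bar>x - y\<bar>) \<longrightarrow>
        \<bar>expectation (\<lambda>\<omega>. f (X0 (e k) \<omega> * (walk a X (e (Suc k)) \<omega> - walk a X (e k) \<omega>))) - (\<integral>x. f (w * x) \<partial>\<gamma>)\<bar> \<le> K) \<longrightarrow>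
        (\<integral>z. \<bar>?Z k (h z) - w * z\<bar> \<partial>\<gamma>) \<le> K) \<and>
    (\<forall>w. integrable \<gamma> (\<lambda>z. \<bar>?Z k (h z) - w * z\<bar>))"
    unfolding V_def blk_def by (intro allI relative_block_selector less_imp_le ek)
  from choice[OF this] obtain h :: "nat \<Rightarrow> real \<Rightarrow> nat \<Rightarrow> real" where h: "\<And>k z. h k z \<in> V k"
    "\<And>k v. v \<in> V k \<Longrightarrow> {z. h k z = v} \<in> sets borel"
    "\<And>k v. v \<in> V k \<Longrightarrow> measure \<gamma> {z. h k z = v} = prob {\<omega> \<in> space M. \<forall>i\<in>blk k. X0 (e k) \<omega> * X i \<omega> = v i}"
    "\<And>k w K. 0 \<le> w \<Longrightarrow> (\<forall>f :: real \<Rightarrow> real. (\<forall>x y. \<bar>f x - f y\<bar> \<le> \<bar>x - y\<bar>) \<longrightarrow>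
        \<bar>expectation (\<lambda>\<omega>. f (X0 (e k) \<omega> * (walk a X (e (Suc k)) \<omega> - walk a X (e k) \<omega>))) - (\<integral>x. f (w * x) \<partial>\<gamma>)\<bar> \<le> K) \<Longrightarrow>
        (\<integral>z. \<bar>?Z k (h k z) - w * z\<bar> \<partial>\<gamma>) \<le> K"
    "\<And>k w. integrable \<gamma> (\<lambda>z. \<bar>?Z k (h k z) - w * z\<bar>)"
    by blast
  have hval: "h k z i = 1 \<or> h k z i = - 1" if "i \<in> blk k" for k z i
    using h(1)[of k z] that unfolding V_def by (auto simp: PiE_iff)
  have mh[measurable]: "(\<lambda>z. h k z i) \<in> borel_measurable borel" for k i
  proof -
    have "h k z i = (\<Sum>v\<in>V k. v i * indicator {z. h k z = v} z)" for z
    proof -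
      have "(\<Sum>v\<in>V k. v i * indicator {z. h k z = v} z) = (\<Sum>v\<in>{h k z}. v i * indicator {z. h k z = v} z)"
        by (rule sum.mono_neutral_right) (use finV h(1) in \<open>auto simp: indicator_def\<close>)
      then show ?thesis by simp
    qed
    moreover have "(\<lambda>z. \<Sum>v\<in>V k. v i * indicator {z. h k z = v} z) \<in> borel_measurable borel"
      by (intro borel_measurable_sum borel_measurable_times borel_measurable_const borel_measurable_indicator h(2))
    ultimately show ?thesis by simp
  qed
  \<comment> \<open>\<open>st k\<close> is the sign of the new chain at index e k, with start value
    1; it is a function of the N i with i < k.\<close>
  define st where "st k \<omega> = rec_nat 1 (\<lambda>k s. s * h k (s * N k \<omega>) (e (Suc k))) k" for k \<omega>
  have st0: "st 0 \<omega> = 1" and stS: "st (Suc k) \<omega> = st k \<omega> * h k (st k \<omega> * N k \<omega>) (e (Suc k))" for k \<omega>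
    by (simp_all add: st_def)
  have eb: "e (Suc k) \<in> blk k" for k using ek by (simp add: blk_def)
  have st1: "st k \<omega> = 1 \<or> st k \<omega> = - 1" for k \<omega>
  proof (induction k)
    case (Suc k)
    then show ?case using hval[OF eb[of k], of "st k \<omega> * N k \<omega>"] by (auto simp: stS)
  qed (simp add: st0)
  note mN[measurable]
  have mst[measurable]: "st k \<in> borel_measurable M'" for k
  proof (induction k)
    case 0
    have "st 0 = (\<lambda>_. 1)" by (simp add: st0 fun_eq_iff)
    then show ?case by simp
  next
    case (Suc k)
    note Suc[measurable]
    have "st (Suc k) = (\<lambda>\<omega>. st k \<omega> * h k (st k \<omega> * N k \<omega>) (e (Suc k)))" by (simp add: stS fun_eq_iff)
    moreover have "\<dots> \<in> borel_measurable M'" by measurable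
    ultimately show ?case by simp
  qed
  \<comment> \<open>The number of the block that contains i.\<close>
  define \<kappa> where "\<kappa> i = (LEAST k. i \<le> e (Suc k))" for i
  have \<kappa>: "\<kappa> i = k" if "i \<in> blk k" for i k
    unfolding \<kappa>_def
  proof (rule Least_equality)
    show "i \<le> e (Suc k)" using that by (simp add: blk_def)
    fix j assume j: "i \<le> e (Suc j)"
    show "k \<le> j"
    proof (rule ccontr)
      assume "\<not> k \<le> j"
      then have "e (Suc j) \<le> e k" by (intro emono) auto
      then show False using j that by (simp add: blk_def)
    qed
  qed
  define X' where "X' i \<omega> = (if 1 \<le> i then st (\<kappa> i) \<omega> * h (\<kappa> i) (st (\<kappa> i) \<omega> * N (\<kappa> i) \<omega>) i else 1)" for i \<omega>
  have blk1: "1 \<le> i" if "i \<in> blk k" for i k using that by (simp add: blk_def)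
  have X'blk: "X' i \<omega> = st k \<omega> * h k (st k \<omega> * N k \<omega>) i" if "i \<in> blk k" for i k \<omega>
    using \<kappa>[OF that] blk1[OF that] by (simp add: X'_def)
  have X'e: "X' (e (Suc k)) \<omega> = st (Suc k) \<omega>" for k \<omega>
    using X'blk[OF eb] by (simp add: stS)
  have inblk: "\<exists>k. i \<in> blk k" if "1 \<le> i" for i
  proof -
    have "i \<le> e (Suc i)" using strict_mono_imp_increasing[OF e(1), of "Suc i"] by simp
    then have le: "i \<le> e (Suc (\<kappa> i))" unfolding \<kappa>_def by (rule LeastI)
    have "e (\<kappa> i) < i"
    proof (cases "\<kappa> i")
      case 0 then show ?thesis using e(2) that by simp
    next
      case (Suc j)
      then have "\<not> i \<le> e (Suc j)" using not_less_Least[of j "\<lambda>k. i \<le> e (Suc k)"] by (simp add: \<kappa>_def)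
      then show ?thesis by (simp add: Suc)
    qed
    then have "i \<in> blk (\<kappa> i)" using le by (simp add: blk_def)
    then show ?thesis ..
  qed
  have X'v: "X' i \<omega> = 1 \<or> X' i \<omega> = - 1" if i: "1 \<le> i" for i \<omega>
  proof -
    obtain k where k: "i \<in> blk k" using inblk[OF i] ..
    show ?thesis using X'blk[OF k] hval[OF k, of "st k \<omega> * N k \<omega>"] st1[of k \<omega>] by auto
  qed
  have mX': "X' i \<in> borel_measurable M'" for i
  proof -
    have "(\<lambda>\<omega>. st (\<kappa> i) \<omega> * h (\<kappa> i) (st (\<kappa> i) \<omega> * N (\<kappa> i) \<omega>) i) \<in> borel_measurable M'" by measurable
    then show ?thesis by (cases "1 \<le> i") (simp_all add: X'_def[abs_def])
  qed
  have cyl: "P.prob {\<omega> \<in> space M'. \<forall>i\<in>{1..e n}. X' i \<omega> = s i} = prob {\<omega> \<in> space M. \<forall>i\<in>{1..e n}. X i \<omega> = s i}"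
    if s: "s \<in> signs (e n)" for n s
  proof -
    define x where "x i = (if i \<in> {1..e n} then s i else 1)" for i
    have x1: "x i = 1 \<or> x i = - 1" for i using s by (auto simp: x_def signs_def PiE_iff)
    define y where "y k = (if k = 0 then 1 else x (e k))" for k
    have y1: "y k = 1 \<or> y k = - 1" for k using x1 by (simp add: y_def)
    have yy: "y k * (y k * u) = u" for k u using y1[of k] by auto
    define vk where "vk k = restrict (\<lambda>i. y k * x i) (blk k)" for k
    have vkV: "vk k \<in> V k" for k
      unfolding vk_def V_def
    proof (rule restrict_PiE_iff[THEN iffD2], intro ballI)
      show "y k * x i \<in> {1, - 1}" for i using y1[of k] x1[of i] by auto
    qed
    \<comment> \<open>As long as the prescribed signs are met, \<open>st k\<close> equals y k. The
      cylinder therefore becomes one condition on each N k separately, and independence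
      applies.\<close>
    define Ak where "Ak k = {z. h k (y k * z) = vk k}" for k
    have iff: "(\<forall>i\<in>{1..e m}. X' i \<omega> = x i) \<longleftrightarrow> (\<forall>k<m. N k \<omega> \<in> Ak k)" for m \<omega>
    proof (induction m)
      case 0 then show ?case using e(2) by simp
    next
      case (Suc m)
      have "{1..e (Suc m)} = {1..e m} \<union> blk m" using ek[of m] by (auto simp: blk_def)
      then have "(\<forall>i\<in>{1..e (Suc m)}. X' i \<omega> = x i) \<longleftrightarrow> (\<forall>k<m. N k \<omega> \<in> Ak k) \<and> (\<forall>i\<in>blk m. X' i \<omega> = x i)"
        using Suc by (simp only: ball_Un)
      moreover have "(\<forall>i\<in>blk m. X' i \<omega> = x i) \<longleftrightarrow> N m \<omega> \<in> Ak m" if "\<forall>k<m. N k \<omega> \<in> Ak k"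
      proof -
        have sty: "st m \<omega> = y m"
        proof (cases m)
          case 0 then show ?thesis by (simp add: y_def st0)
        next
          case (Suc j)
          have "e m \<in> {1..e m}" using eb[of j] blk1 by (auto simp: Suc)
          then have "X' (e m) \<omega> = x (e m)" using Suc.IH that by blast
          then show ?thesis using X'e[of j \<omega>] by (simp add: y_def Suc)
        qed
        have "(\<forall>i\<in>blk m. X' i \<omega> = x i) \<longleftrightarrow> (\<forall>i\<in>blk m. h m (y m * N m \<omega>) i = y m * x i)"
        proof (intro ball_cong refl)
          fix i assume i: "i \<in> blk m"
          show "X' i \<omega> = x i \<longleftrightarrow> h m (y m * N m \<omega>) i = y m * x i"
            unfolding X'blk[OF i] sty using yy[of m] by metis
        qed
        also have "\<dots> \<longleftrightarrow> h m (y m * N m \<omega>) = vk m"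
        proof
          assume "\<forall>i\<in>blk m. h m (y m * N m \<omega>) i = y m * x i"
          then show "h m (y m * N m \<omega>) = vk m"
            using h(1)[of m "y m * N m \<omega>"] unfolding V_def vk_def
            by (intro extensionalityI[of _ "blk m"]) (auto simp: PiE_def)
        qed (simp add: vk_def)
        finally show ?thesis by (simp add: Ak_def)
      qed
      ultimately show ?case by (auto simp: less_Suc_eq)
    qed
    have mA: "Ak k \<in> sets borel" and pA: "measure \<gamma> (Ak k) = measure \<gamma> {z. h k z = vk k}" for k
    proof -
      consider "y k = 1" | "y k = - 1" using y1 by blast
      then have "Ak k \<in> sets borel \<and> measure \<gamma> (Ak k) = measure \<gamma> {z. h k z = vk k}"
      proof cases
        case 1 then show ?thesis using h(2)[OF vkV] by (simp add: Ak_def)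
      next
        case 2
        then have A: "Ak k = uminus -` {z. h k z = vk k} \<inter> space borel" by (auto simp: Ak_def)
        have "Ak k \<in> sets borel" unfolding A by (rule measurable_sets[OF _ h(2)[OF vkV]]) simp
        moreover have "measure \<gamma> (Ak k) = measure (distr \<gamma> borel uminus) {z. h k z = vk k}"
          using h(2)[OF vkV] by (subst measure_distr) (auto simp: A)
        ultimately show ?thesis by (simp add: gauss_symmetric)
      qed
      then show "Ak k \<in> sets borel" "measure \<gamma> (Ak k) = measure \<gamma> {z. h k z = vk k}" by auto
    qed
    have pvk: "measure \<gamma> {z. h k z = vk k} = (\<Prod>i\<in>{e k..<e (Suc k)}. step_prob i (x i) (x (Suc i)))" for k
    proof -
      define v where "v i = (if i \<in> blk k then y k * x i else 1)" for i
      have v1: "v i = 1 \<or> v i = - 1" for i using y1[of k] x1[of i] by (auto simp: v_def)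
      have "measure \<gamma> {z. h k z = vk k} = prob {\<omega> \<in> space M. \<forall>i\<in>{e k<..e (Suc k)}. X0 (e k) \<omega> * X i \<omega> = v i}"
        unfolding h(3)[OF vkV] by (rule arg_cong[where f=prob]) (auto simp: vk_def v_def blk_def)
      also have "\<dots> = (\<Prod>i\<in>{e k..<e (Suc k)}. step_prob i ((v(e k := 1)) i) (v (Suc i)))"
        by (rule prob_relative_block[OF v1]) (use ek less_imp_le in blast)
      also have "\<dots> = (\<Prod>i\<in>{e k..<e (Suc k)}. step_prob i (x i) (x (Suc i)))"
      proof (intro prod.cong refl)
        fix i assume i: "i \<in> {e k..<e (Suc k)}"
        have "v (Suc i) = y k * x (Suc i)" using i by (simp add: v_def blk_def)
        \<comment> \<open>At index 0 \<open>step_prob\<close> ignores its arguments, so no agreement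
          is required there.\<close>
        moreover have "i = 0 \<or> (v(e k := 1)) i = y k * x i"
        proof (cases "i = e k")
          case True
          have "k \<noteq> 0 \<or> i = 0" using True e(2) by (cases k) auto
          then show ?thesis using True x1[of i] by (auto simp: y_def)
        next
          case False then show ?thesis using i by (simp add: v_def blk_def)
        qed
        ultimately show "step_prob i ((v(e k := 1)) i) (v (Suc i)) = step_prob i (x i) (x (Suc i))"
          using y1[of k] by (auto simp: step_prob_def)
      qed
      finally show ?thesis .
    qed
    have "P.prob {\<omega> \<in> space M'. \<forall>i\<in>{1..e n}. X' i \<omega> = s i} = P.prob {\<omega> \<in> space M'. \<forall>k<n. N k \<omega> \<in> Ak k}"
    proof -
      have "(\<forall>i\<in>{1..e n}. X' i \<omega> = s i) \<longleftrightarrow> (\<forall>i\<in>{1..e n}. X' i \<omega> = x i)" for \<omega> by (simp add: x_def)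
      then show ?thesis using iff[of n] by simp
    qed
    also have "\<dots> = (\<Prod>k<n. measure \<gamma> (Ak k))"
    proof (cases "n = 0")
      case True then show ?thesis by (simp add: P.prob_space)
    next
      case False
      have "{\<omega> \<in> space M'. \<forall>k<n. N k \<omega> \<in> Ak k} = (\<Inter>k\<in>{..<n}. N k -` Ak k \<inter> space M')" using False by auto
      also have "P.prob \<dots> = (\<Prod>k<n. P.prob (N k -` Ak k \<inter> space M'))"
        by (rule P.indep_varsD_finite[OF iN]) (use False mA in auto)
      also have "\<dots> = (\<Prod>k<n. measure \<gamma> (Ak k))"
      proof (intro prod.cong refl)
        fix k
        have "measure \<gamma> (Ak k) = measure (distr M' borel (N k)) (Ak k)" by (simp add: dN)
        then show "P.prob (N k -` Ak k \<inter> space M') = measure \<gamma> (Ak k)" by (simp add: measure_distr mA)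
      qed
      finally show ?thesis .
    qed
    also have "\<dots> = (\<Prod>k<n. \<Prod>i\<in>{e k..<e (Suc k)}. step_prob i (x i) (x (Suc i)))" by (simp add: pA pvk)
    also have "\<dots> = prob (cyl x (e n))"
    proof (induction n)
      case 0
      have "cyl x 0 = space M" by (auto simp: cyl_def)
      then show ?case using e(2) by (simp add: prob_space)
    next
      case (Suc n)
      then show ?case using prob_cyl_block[of x "e n" "e (Suc n)", OF x1] ek[of n] by simp
    qed
    also have "cyl x (e n) = {\<omega> \<in> space M. \<forall>i\<in>{1..e n}. X i \<omega> = s i}" by (auto simp: cyl_def x_def)
    finally show ?thesis .
  qed
  have law: "same_process_law M' (walk a X') M (walk a X)"
    by (rule walk_law_eq[where e=e, OF prob_space_axioms X_measurable X_values M' mX' X'v cyl])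
      (use strict_mono_imp_increasing[OF e(1)] in auto)
  have err: "integrable M' (\<lambda>\<omega>. \<bar>walk a X' (e (Suc k)) \<omega> - walk a X' (e k) \<omega> - w k * N k \<omega>\<bar>)"
      "(\<integral>\<omega>. \<bar>walk a X' (e (Suc k)) \<omega> - walk a X' (e k) \<omega> - w k * N k \<omega>\<bar> \<partial>M') \<le> 2 * K k" if k: "1 \<le> k" for k
  proof -
    define G where "G z = \<bar>?Z k (h k z) - w k * z\<bar>" for z
    have mG[measurable]: "G \<in> borel_measurable borel" unfolding G_def by measurable
    have ek1: "e k \<noteq> 0" using strict_mono_less[OF e(1), of 0 k] k e(2) by simp
    have iG: "integrable \<gamma> G" unfolding G_def by (rule h(5))
    have GK: "(\<integral>z. G z \<partial>\<gamma>) \<le> K k"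
      unfolding G_def
    proof (rule h(4)[OF w], intro allI impI)
      fix f :: "real \<Rightarrow> real" assume "\<forall>x y. \<bar>f x - f y\<bar> \<le> \<bar>x - y\<bar>"
      then show "\<bar>expectation (\<lambda>\<omega>. f (X0 (e k) \<omega> * (walk a X (e (Suc k)) \<omega> - walk a X (e k) \<omega>))) - (\<integral>x. f (w k * x) \<partial>\<gamma>)\<bar> \<le> K k"
        using K[OF k, of f] ek1 by (simp add: X0_def)
    qed
    have mu: "uminus \<in> \<gamma> \<rightarrow>\<^sub>M (borel :: real measure)" by simp
    have iG': "integrable \<gamma> (\<lambda>z. G (- z))" and GK': "(\<integral>z. G (- z) \<partial>\<gamma>) \<le> K k"
      using integrable_distr_eq[OF mu mG] integral_distr[OF mu mG] iG GK by (simp_all add: gauss_symmetric)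
    have mGm: "(\<lambda>z. G (- z)) \<in> borel_measurable borel" by measurable
    have i1: "integrable M' (\<lambda>\<omega>. G (N k \<omega>))" "(\<integral>\<omega>. G (N k \<omega>) \<partial>M') \<le> K k"
      using integrable_distr_eq[OF mN[of k] mG] integral_distr[OF mN[of k] mG] iG GK by (simp_all add: dN)
    have i2: "integrable M' (\<lambda>\<omega>. G (- N k \<omega>))" "(\<integral>\<omega>. G (- N k \<omega>) \<partial>M') \<le> K k"
      using integrable_distr_eq[OF mN[of k] mGm] integral_distr[OF mN[of k] mGm] iG' GK' by (simp_all add: dN)
    \<comment> \<open>\<open>st k\<close> is one of two signs. Adding the costs for both doubles the
      bound, but spares an argument about the independence of \<open>st k\<close> and
      \<open>N k\<close>.\<close>
    have bound: "\<bar>walk a X' (e (Suc k)) \<omega> - walk a X' (e k) \<omega> - w k * N k \<omega>\<bar> \<le> G (N k \<omega>) + G (- N k \<omega>)" for \<omega>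
    proof -
      have "walk a X' (e (Suc k)) \<omega> - walk a X' (e k) \<omega> = (\<Sum>i\<in>blk k. a i * X' i \<omega>)"
        unfolding blk_def by (rule walk_diff_sum) (use ek less_imp_le in blast)
      also have "\<dots> = st k \<omega> * ?Z k (h k (st k \<omega> * N k \<omega>))"
        by (simp add: sum_distrib_left X'blk mult.left_commute)
      finally have d: "walk a X' (e (Suc k)) \<omega> - walk a X' (e k) \<omega> = st k \<omega> * ?Z k (h k (st k \<omega> * N k \<omega>))" .
      have "0 \<le> G z" for z by (simp add: G_def)
      then show ?thesis
        unfolding d using st1[of k \<omega>]
        by (elim disjE) (simp_all add: G_def add_increasing add_increasing2)
    qed
    have [measurable]: "walk a X' n \<in> borel_measurable M'" for n
      unfolding walk_def[abs_def] by (intro borel_measurable_sum borel_measurable_times mX') auto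
    have i12: "integrable M' (\<lambda>\<omega>. G (N k \<omega>) + G (- N k \<omega>))" using i1 i2 by simp
    show int: "integrable M' (\<lambda>\<omega>. \<bar>walk a X' (e (Suc k)) \<omega> - walk a X' (e k) \<omega> - w k * N k \<omega>\<bar>)"
      by (rule Bochner_Integration.integrable_bound[OF i12])
        (use bound in \<open>auto intro!: AE_I2 intro: order_trans[OF bound]\<close>)
    have "(\<integral>\<omega>. \<bar>walk a X' (e (Suc k)) \<omega> - walk a X' (e k) \<omega> - w k * N k \<omega>\<bar> \<partial>M') \<le> (\<integral>\<omega>. G (N k \<omega>) + G (- N k \<omega>) \<partial>M')"
      by (rule integral_mono[OF int i12 bound])
    also have "\<dots> \<le> K k + K k" using i1 i2 by simp
    finally show "(\<integral>\<omega>. \<bar>walk a X' (e (Suc k)) \<omega> - walk a X' (e k) \<omega> - w k * N k \<omega>\<bar> \<partial>M') \<le> 2 * K k" by simp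
  qed
  show ?thesis using law err by blast
qed

end

section \<open>Block scales\<close>

text \<open>With 1 added to A the asymptotic bound holds at every index: the base is at least 1, so
  the finitely many exceptions go into the constant.\<close>

lemma uniform_step_bound:
  fixes a A :: "nat \<Rightarrow> real"
  assumes A: "A = (\<lambda>n. \<Sum>k=1..n. (a k)\<^sup>2)" and \<delta>: "0 < \<delta>" "\<delta> \<le> 1"
    and O: "(\<lambda>n. (a n)\<^sup>2) \<in> O(\<lambda>n. A n powr (1 - \<delta>))"
  obtains C where "0 < C" "\<And>n. (a n)\<^sup>2 \<le> C * (1 + A n) powr (1 - \<delta>)"
proof -
  have A0: "0 \<le> A n" for n unfolding A by (simp add: sum_nonneg)
  obtain c where c: "c > 0" "\<forall>\<^sub>F n in sequentially. norm ((a n)\<^sup>2) \<le> c * norm (A n powr (1 - \<delta>))"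
    using landau_o.bigE[OF O] by blast
  then obtain n0 where n0: "\<And>n. n \<ge> n0 \<Longrightarrow> (a n)\<^sup>2 \<le> c * A n powr (1 - \<delta>)"
    by (auto simp: eventually_sequentially)
  define C where "C = c + (\<Sum>n<n0. (a n)\<^sup>2)"
  have s0: "0 \<le> (\<Sum>n<n0. (a n)\<^sup>2)" by (simp add: sum_nonneg)
  have "(a n)\<^sup>2 \<le> C * (1 + A n) powr (1 - \<delta>)" for n
  proof (cases "n < n0")
    case True
    have "(a n)\<^sup>2 \<le> (\<Sum>n<n0. (a n)\<^sup>2)" by (rule member_le_sum) (use True in auto)
    also have "\<dots> \<le> C * 1" using c by (simp add: C_def)
    also have "\<dots> \<le> C * (1 + A n) powr (1 - \<delta>)"
      using A0[of n] \<delta> c s0 by (intro mult_left_mono ge_one_powr_ge_zero) (auto simp: C_def)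
    finally show ?thesis .
  next
    case False
    then have "(a n)\<^sup>2 \<le> c * A n powr (1 - \<delta>)" using n0 by simp
    also have "\<dots> \<le> C * (1 + A n) powr (1 - \<delta>)"
      using A0[of n] \<delta> c s0 by (intro mult_mono powr_mono2) (auto simp: C_def)
    finally show ?thesis .
  qed
  moreover have "0 < C" using c s0 by (simp add: C_def)
  ultimately show thesis using that by blast
qed

lemma powr_increment:
  fixes k :: nat and \<alpha> :: real
  assumes k: "1 \<le> k" and \<alpha>: "1 \<le> \<alpha>"
  shows "\<alpha> * real k powr (\<alpha> - 1) \<le> real (Suc k) powr \<alpha> - real k powr \<alpha>"
    and "real (Suc k) powr \<alpha> - real k powr \<alpha> \<le> \<alpha> * 2 powr (\<alpha> - 1) * real k powr (\<alpha> - 1)"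
proof -
  have "\<exists>z>real k. z < real (Suc k) \<and> real (Suc k) powr \<alpha> - real k powr \<alpha> = (real (Suc k) - real k) * (\<alpha> * z powr (\<alpha> - 1))"
  proof (rule MVT2)
    fix x assume "real k \<le> x"
    then show "((\<lambda>x. x powr \<alpha>) has_real_derivative \<alpha> * x powr (\<alpha> - 1)) (at x)"
      using k by (intro has_real_derivative_powr) auto
  qed simp
  then obtain z where z: "real k < z" "z < real (Suc k)" and e: "real (Suc k) powr \<alpha> - real k powr \<alpha> = \<alpha> * z powr (\<alpha> - 1)"
    by auto
  show "\<alpha> * real k powr (\<alpha> - 1) \<le> real (Suc k) powr \<alpha> - real k powr \<alpha>"
    unfolding e using z \<alpha> by (intro mult_left_mono powr_mono2) auto
  have "z powr (\<alpha> - 1) \<le> (2 * real k) powr (\<alpha> - 1)" using z k \<alpha> by (intro powr_mono2) auto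
  also have "\<dots> = 2 powr (\<alpha> - 1) * real k powr (\<alpha> - 1)" by (rule powr_mult)
  finally have "\<alpha> * z powr (\<alpha> - 1) \<le> \<alpha> * (2 powr (\<alpha> - 1) * real k powr (\<alpha> - 1))"
    using \<alpha> by (intro mult_left_mono) auto
  then show "real (Suc k) powr \<alpha> - real k powr \<alpha> \<le> \<alpha> * 2 powr (\<alpha> - 1) * real k powr (\<alpha> - 1)"
    unfolding e by (simp add: mult.assoc)
qed

text \<open>\<open>\<nu> k\<close> is the first index at which A reaches k^\<alpha>. Since A may
  jump, the point is that the overshoot, at most one squared step, is negligible: \<alpha> *
  \<delta> = 7 makes a squared step of order at most k^(\<alpha> - 7), against a block mass of order
  k^(\<alpha> - 1).\<close>

lemma block_scales:
  fixes a A :: "nat \<Rightarrow> real"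
  assumes A: "A = (\<lambda>n. \<Sum>k=1..n. (a k)\<^sup>2)" and \<delta>: "0 < \<delta>" "\<delta> \<le> 1"
    and O: "(\<lambda>n. (a n)\<^sup>2) \<in> O(\<lambda>n. A n powr (1 - \<delta>))"
    and lim: "filterlim A at_top sequentially"
  defines "\<alpha> \<equiv> 7 / \<delta>"
  shows "\<exists>(\<nu> :: nat \<Rightarrow> nat) k0 C. 1 \<le> k0 \<and> 1 \<le> C
    \<and> (\<forall>k\<ge>k0. \<nu> k < \<nu> (Suc k))
    \<and> (\<forall>k\<ge>k0. \<forall>i\<le>\<nu> (Suc k). \<bar>a i\<bar> \<le> C * real k powr (\<alpha> / 2 - 7 / 2))
    \<and> (\<forall>k\<ge>k0. (\<Sum>i\<in>{\<nu> k<..\<nu> (Suc k)}. (a i)\<^sup>2) \<le> C * real k powr (\<alpha> - 1))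
    \<and> (\<forall>k\<ge>k0. real k powr (\<alpha> - 1) \<le> (\<Sum>i\<in>{\<nu> k<..\<nu> (Suc k)}. (a i)\<^sup>2))
    \<and> (\<forall>k\<ge>k0. real k powr \<alpha> \<le> A (\<nu> k))"
proof -
  have \<alpha>7: "7 \<le> \<alpha>" using \<delta> by (simp add: \<alpha>_def field_simps)
  have \<alpha>\<delta>: "\<alpha> * (1 - \<delta>) = \<alpha> - 7" using \<delta> by (simp add: \<alpha>_def field_simps)
  have A0: "A 0 = 0" by (simp add: A)
  have AS: "A (Suc n) = A n + (a (Suc n))\<^sup>2" for n by (simp add: A)
  have Amono: "A m \<le> A n" if "m \<le> n" for m n
    using that by (induction n rule: dec_induct) (auto simp: AS intro: order_trans)
  have Anonneg: "0 \<le> A n" for n using Amono[of 0 n] A0 by simp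
  obtain C0 where C0: "0 < C0" "\<And>n. (a n)\<^sup>2 \<le> C0 * (1 + A n) powr (1 - \<delta>)"
    using uniform_step_bound[OF A \<delta> O] by blast
  define T where "T k = real k powr \<alpha>" for k :: nat
  define \<nu> where "\<nu> k = (LEAST n. T k \<le> A n)" for k
  have ex: "\<exists>n. T k \<le> A n" for k
  proof -
    have "\<forall>\<^sub>F n in sequentially. T k \<le> A n" using lim by (simp add: filterlim_at_top)
    then show ?thesis by (auto simp: eventually_sequentially)
  qed
  have \<nu>T: "T k \<le> A (\<nu> k)" for k unfolding \<nu>_def by (rule LeastI_ex[OF ex])
  have \<nu>less: "A n < T k" if "n < \<nu> k" for n k
    using not_less_Least[of n "\<lambda>n. T k \<le> A n"] that unfolding \<nu>_def by (simp add: not_le)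
  have Tmono: "T k \<le> T (Suc k)" for k unfolding T_def using \<alpha>7 by (intro powr_mono2) auto
  have \<nu>mono: "\<nu> k \<le> \<nu> (Suc k)" for k
    unfolding \<nu>_def[of k] by (rule Least_le) (use Tmono[of k] \<nu>T[of "Suc k"] in linarith)
  have T1: "1 \<le> T k" if "1 \<le> k" for k
    unfolding T_def using that \<alpha>7 by (intro ge_one_powr_ge_zero) auto
  have over: "A (\<nu> k) \<le> T k + (a (\<nu> k))\<^sup>2" if "1 \<le> k" for k
  proof -
    have "\<nu> k \<noteq> 0"
    proof
      assume "\<nu> k = 0"
      then show False using \<nu>T[of k] T1[OF that] A0 by simp
    qed
    then obtain j where j: "\<nu> k = Suc j" by (cases "\<nu> k") auto
    then show ?thesis using \<nu>less[of j k] by (simp add: AS)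
  qed
  \<comment> \<open>Once 1 + A is at least x0, a squared step is at most half of 1 + A, so the
    overshoot can be absorbed; before that, A is bounded outright.\<close>
  define x0 where "x0 = (2 * C0) powr (1 / \<delta>)"
  have Aup: "A (\<nu> k) \<le> (3 + x0) * T k" if k: "1 \<le> k" for k
  proof (cases "x0 \<le> 1 + A (\<nu> k)")
    case True
    define x where "x = A (\<nu> k)"
    have x0': "0 \<le> x" using Anonneg by (simp add: x_def)
    have "x0 powr \<delta> \<le> (1 + x) powr \<delta>" using True \<delta> by (intro powr_mono2) (auto simp: x0_def x_def)
    moreover have "x0 powr \<delta> = 2 * C0" using C0 \<delta> by (simp add: x0_def powr_powr)
    ultimately have "2 * C0 * (1 + x) powr (1 - \<delta>) \<le> (1 + x) powr \<delta> * (1 + x) powr (1 - \<delta>)"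
      by (intro mult_right_mono) auto
    also have "\<dots> = 1 + x" using x0' by (simp add: powr_add[symmetric])
    finally have "C0 * (1 + x) powr (1 - \<delta>) \<le> (1 + x) / 2" by simp
    then have "x \<le> T k + (1 + x) / 2" using over[OF k] C0(2)[of "\<nu> k"] unfolding x_def by linarith
    then have "x \<le> 3 * T k" using T1[OF k] by (simp add: field_simps)
    also have "\<dots> \<le> (3 + x0) * T k" using T1[OF k] by (intro mult_right_mono) (auto simp: x0_def)
    finally show ?thesis by (simp add: x_def)
  next
    case False
    then have "A (\<nu> k) \<le> x0 * 1" by simp
    also have "\<dots> \<le> (3 + x0) * T k" using T1[OF k] by (intro mult_mono) (auto simp: x0_def)
    finally show ?thesis .
  qed
  define D where "D = (4 + x0) * 2 powr \<alpha>"
  have D1: "1 \<le> D"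
  proof -
    have "1 * 1 \<le> (4 + x0) * 2 powr \<alpha>" using \<alpha>7 by (intro mult_mono ge_one_powr_ge_zero) (auto simp: x0_def)
    then show ?thesis by (simp add: D_def)
  qed
  define C1 where "C1 = sqrt (C0 * D powr (1 - \<delta>))"
  have C1: "0 \<le> C1" "C1\<^sup>2 = C0 * D powr (1 - \<delta>)" using C0 by (auto simp: C1_def)
  have sq: "(a i)\<^sup>2 \<le> C1\<^sup>2 * real k powr (\<alpha> - 7)" if k: "1 \<le> k" and i: "i \<le> \<nu> (Suc k)" for i k
  proof -
    have "1 + A i \<le> 1 + A (\<nu> (Suc k))" using Amono[OF i] by simp
    also have "\<dots> \<le> T (Suc k) + (3 + x0) * T (Suc k)" using Aup[of "Suc k"] T1[of "Suc k"] by simp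
    also have "\<dots> = (4 + x0) * T (Suc k)" by (simp add: algebra_simps)
    also have "\<dots> \<le> (4 + x0) * (2 * real k) powr \<alpha>"
      unfolding T_def using k \<alpha>7 by (intro mult_left_mono powr_mono2) (auto simp: x0_def)
    also have "(2 * real k) powr \<alpha> = 2 powr \<alpha> * real k powr \<alpha>" by (rule powr_mult)
    finally have "1 + A i \<le> D * real k powr \<alpha>" by (simp add: D_def mult.assoc)
    then have "(1 + A i) powr (1 - \<delta>) \<le> (D * real k powr \<alpha>) powr (1 - \<delta>)"
      using \<delta> Anonneg[of i] by (intro powr_mono2) auto
    also have "\<dots> = D powr (1 - \<delta>) * real k powr (\<alpha> - 7)"
      by (simp add: powr_mult powr_powr \<alpha>\<delta>)
    finally have "C0 * (1 + A i) powr (1 - \<delta>) \<le> C0 * (D powr (1 - \<delta>) * real k powr (\<alpha> - 7))"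
      using C0 by (intro mult_left_mono) auto
    then show ?thesis using C0(2)[of i] C1 by simp
  qed
  have bnd: "\<bar>a i\<bar> \<le> C1 * real k powr (\<alpha> / 2 - 7 / 2)" if "1 \<le> k" "i \<le> \<nu> (Suc k)" for i k
  proof (rule power2_le_imp_le)
    have "(real k powr (\<alpha> / 2 - 7 / 2))\<^sup>2 = real k powr (\<alpha> - 7)"
      by (simp add: power2_eq_square powr_add[symmetric])
    then show "\<bar>a i\<bar>\<^sup>2 \<le> (C1 * real k powr (\<alpha> / 2 - 7 / 2))\<^sup>2"
      using sq[OF that] by (simp add: power_mult_distrib)
  qed (use C1 in simp)
  have diffA: "(\<Sum>i\<in>{\<nu> k<..\<nu> (Suc k)}. (a i)\<^sup>2) = A (\<nu> (Suc k)) - A (\<nu> k)" for k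
  proof -
    have "{1..\<nu> (Suc k)} = {1..\<nu> k} \<union> {\<nu> k<..\<nu> (Suc k)}" "{1..\<nu> k} \<inter> {\<nu> k<..\<nu> (Suc k)} = {}"
      using \<nu>mono[of k] by auto
    then show ?thesis
      using sum.union_disjoint[of "{1..\<nu> k}" "{\<nu> k<..\<nu> (Suc k)}" "\<lambda>i. (a i)\<^sup>2"] by (simp add: A)
  qed
  have p7: "real k powr (\<alpha> - 7) \<le> real k powr (\<alpha> - 1)" if "1 \<le> k" for k :: nat
    using that by (intro powr_mono) auto
  have up: "(\<Sum>i\<in>{\<nu> k<..\<nu> (Suc k)}. (a i)\<^sup>2) \<le> (\<alpha> * 2 powr (\<alpha> - 1) + C1\<^sup>2) * real k powr (\<alpha> - 1)" if k: "1 \<le> k" for k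
  proof -
    have "A (\<nu> (Suc k)) - A (\<nu> k) \<le> (T (Suc k) - T k) + (a (\<nu> (Suc k)))\<^sup>2"
      using over[of "Suc k"] \<nu>T[of k] by simp
    also have "T (Suc k) - T k \<le> \<alpha> * 2 powr (\<alpha> - 1) * real k powr (\<alpha> - 1)"
      unfolding T_def by (rule powr_increment(2)) (use k \<alpha>7 in auto)
    also have "(a (\<nu> (Suc k)))\<^sup>2 \<le> C1\<^sup>2 * real k powr (\<alpha> - 1)"
      using sq[OF k, of "\<nu> (Suc k)"] mult_left_mono[OF p7[OF k], of "C1\<^sup>2"] by simp
    finally show ?thesis by (simp add: diffA distrib_right)
  qed
  \<comment> \<open>From here on k is at least C1^2, which brings a squared step below k^(\<alpha> -
    1). As k^\<alpha> grows by at least seven times that amount, the block mass stays large after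
    the overshoot is subtracted.\<close>
  define k0 where "k0 = max 1 (nat \<lceil>C1\<^sup>2\<rceil>)"
  have low: "real k powr (\<alpha> - 1) \<le> (\<Sum>i\<in>{\<nu> k<..\<nu> (Suc k)}. (a i)\<^sup>2)" if k: "k0 \<le> k" for k
  proof -
    have k1: "1 \<le> k" "C1\<^sup>2 \<le> real k" using k unfolding k0_def by linarith+
    have "C1\<^sup>2 * real k powr (\<alpha> - 7) \<le> real k powr 1 * real k powr (\<alpha> - 7)"
      using k1 by (intro mult_right_mono) auto
    also have "\<dots> = real k powr (\<alpha> - 6)" unfolding powr_add[symmetric] by simp
    also have "\<dots> \<le> real k powr (\<alpha> - 1)" using k1 by (intro powr_mono) auto
    finally have s: "(a (\<nu> k))\<^sup>2 \<le> real k powr (\<alpha> - 1)" using sq[OF k1(1), of "\<nu> k"] \<nu>mono[of k] by simp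
    have "7 * real k powr (\<alpha> - 1) \<le> \<alpha> * real k powr (\<alpha> - 1)" using \<alpha>7 by (intro mult_right_mono) auto
    also have "\<dots> \<le> T (Suc k) - T k" unfolding T_def by (rule powr_increment(1)) (use k1 \<alpha>7 in auto)
    also have "\<dots> \<le> A (\<nu> (Suc k)) - A (\<nu> k) + (a (\<nu> k))\<^sup>2" using over[OF k1(1)] \<nu>T[of "Suc k"] by simp
    finally show ?thesis unfolding diffA using s powr_ge_zero[of "real k" "\<alpha> - 1"] by linarith
  qed
  have strict: "\<nu> k < \<nu> (Suc k)" if k: "k0 \<le> k" for k
  proof (rule ccontr)
    assume "\<not> \<nu> k < \<nu> (Suc k)"
    then have "(\<Sum>i\<in>{\<nu> k<..\<nu> (Suc k)}. (a i)\<^sup>2) = 0" by simp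
    moreover have "0 < real k powr (\<alpha> - 1)" using k by (auto simp: k0_def)
    ultimately show False using low[OF k] by simp
  qed
  define C where "C = 1 + C1 + (\<alpha> * 2 powr (\<alpha> - 1) + C1\<^sup>2)"
  have "0 \<le> \<alpha> * 2 powr (\<alpha> - 1)" using \<alpha>7 by simp
  then have C: "1 \<le> C" "C1 \<le> C" "\<alpha> * 2 powr (\<alpha> - 1) + C1\<^sup>2 \<le> C"
    using C1(1) zero_le_power2[of C1] unfolding C_def by linarith+
  have k01: "1 \<le> k0" by (simp add: k0_def)
  show ?thesis
  proof (intro exI[of _ \<nu>] exI[of _ k0] exI[of _ C] conjI allI impI)
    fix k i assume k: "k0 \<le> k" and "i \<le> \<nu> (Suc k)"
    then have "\<bar>a i\<bar> \<le> C1 * real k powr (\<alpha> / 2 - 7 / 2)" using k01 by (intro bnd) auto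
    also have "\<dots> \<le> C * real k powr (\<alpha> / 2 - 7 / 2)" by (intro mult_right_mono C) auto
    finally show "\<bar>a i\<bar> \<le> C * real k powr (\<alpha> / 2 - 7 / 2)" .
  next
    fix k assume k: "k0 \<le> k"
    then have "(\<Sum>i\<in>{\<nu> k<..\<nu> (Suc k)}. (a i)\<^sup>2) \<le> (\<alpha> * 2 powr (\<alpha> - 1) + C1\<^sup>2) * real k powr (\<alpha> - 1)"
      using k01 by (intro up) auto
    also have "\<dots> \<le> C * real k powr (\<alpha> - 1)" by (intro mult_right_mono C) auto
    finally show "(\<Sum>i\<in>{\<nu> k<..\<nu> (Suc k)}. (a i)\<^sup>2) \<le> C * real k powr (\<alpha> - 1)" .
    show "real k powr \<alpha> \<le> A (\<nu> k)" using \<nu>T[of k] by (simp add: T_def)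
  qed (use k01 C strict low in auto)
qed

context elephant
begin

lemma var_rec_ge: "(1 - r\<^sup>2) / 4 * (\<Sum>i=1..n. (a i)\<^sup>2) \<le> var_rec r a n"
proof -
  have r1: "0 \<le> 1 - r\<^sup>2" using r_bounds by simp
  have "{0<..n} = {1..n}" by auto
  then have "(1 - r\<^sup>2) / 4 * (\<Sum>i=1..n. (a i)\<^sup>2) \<le> (1 - r\<^sup>2) / 4 * (4 * (\<Sum>i\<in>{0<..n}. (tail_coeff r a n i)\<^sup>2))"
    using sum_sq_le_tail[OF r_bounds(1), where m=0 and n=n and a=a] r1 by (intro mult_left_mono) auto
  also have "\<dots> \<le> r\<^sup>2 * (tail_coeff r a n 1)\<^sup>2 + (1 - r\<^sup>2) * (\<Sum>i\<in>{0<..n}. (tail_coeff r a n i)\<^sup>2)"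
    by simp
  also have "\<dots> = var_rec r a n"
    using var_rec_block[of 0 n r a] by simp
  finally show ?thesis .
qed

text \<open>Carries the scales of A over to the variance and the walk. The variance may go down
  inside a block, so strict growth is claimed between block ends only, with a bound on the variation
  in between. One constant C serves all clauses.\<close>

lemma scaled_blocks:
  fixes A :: "nat \<Rightarrow> real"
  assumes A: "A = (\<lambda>n. \<Sum>k=1..n. (a k)\<^sup>2)" and \<delta>: "0 < \<delta>" "\<delta> \<le> 1"
    and O: "(\<lambda>n. (a n)\<^sup>2) \<in> O(\<lambda>n. A n powr (1 - \<delta>))"
    and lim: "filterlim A at_top sequentially"
  defines "\<alpha> \<equiv> 7 / \<delta>"
  shows "\<exists>(\<nu> :: nat \<Rightarrow> nat) k0 C. 1 \<le> k0 \<and> 1 \<le> C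
    \<and> (\<forall>k\<ge>k0. 1 \<le> \<nu> k \<and> \<nu> k < \<nu> (Suc k))
    \<and> (\<forall>k\<ge>k0. 0 < var_rec r a (\<nu> k))
    \<and> (\<forall>k\<ge>k0. var_rec r a (\<nu> k) < var_rec r a (\<nu> (Suc k)))
    \<and> (\<forall>k\<ge>k0. \<forall>n. \<nu> k \<le> n \<longrightarrow> n \<le> \<nu> (Suc k) \<longrightarrow> \<bar>var_rec r a n - var_rec r a (\<nu> k)\<bar> \<le> C * real k powr (\<alpha> - 1))
    \<and> (\<forall>k\<ge>k0. \<forall>n. \<nu> k \<le> n \<longrightarrow> real k powr \<alpha> \<le> C * var_rec r a n)
    \<and> (\<forall>k\<ge>k0. \<forall>f :: real \<Rightarrow> real. (\<forall>x y. \<bar>f x - f y\<bar> \<le> \<bar>x - y\<bar>) \<longrightarrow>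
      \<bar>expectation (\<lambda>\<omega>. f (X (\<nu> k) \<omega> * (walk a X (\<nu> (Suc k)) \<omega> - walk a X (\<nu> k) \<omega>)))
        - (\<integral>z. f (sqrt (var_rec r a (\<nu> (Suc k)) - var_rec r a (\<nu> k)) * z) \<partial>\<gamma>)\<bar> \<le> C * real k powr (\<alpha> / 2 - 3 / 2))
    \<and> (AE \<omega> in M. \<forall>\<^sub>F k in sequentially. \<forall>n\<in>{\<nu> k..\<nu> (Suc k)}.
       \<bar>walk a X n \<omega> - walk a X (\<nu> k) \<omega>\<bar> \<le> C * real k powr (\<alpha> / 2 - 7 / 32))"
proof -
  obtain \<nu> :: "nat \<Rightarrow> nat" and k1 :: nat and C1 :: real where k1: "1 \<le> k1" and C1: "1 \<le> C1"
    and b1: "\<forall>k\<ge>k1. \<nu> k < \<nu> (Suc k)"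
    and b2: "\<forall>k\<ge>k1. \<forall>i\<le>\<nu> (Suc k). \<bar>a i\<bar> \<le> C1 * real k powr (\<alpha> / 2 - 7 / 2)"
    and b3: "\<forall>k\<ge>k1. (\<Sum>i\<in>{\<nu> k<..\<nu> (Suc k)}. (a i)\<^sup>2) \<le> C1 * real k powr (\<alpha> - 1)"
    and b4: "\<forall>k\<ge>k1. real k powr (\<alpha> - 1) \<le> (\<Sum>i\<in>{\<nu> k<..\<nu> (Suc k)}. (a i)\<^sup>2)"
    and b5: "\<forall>k\<ge>k1. real k powr \<alpha> \<le> A (\<nu> k)"
    using block_scales[OF A \<delta> O lim, folded \<alpha>_def] by blast
  have \<nu>less: "\<nu> k < \<nu> (Suc k)" if "k1 \<le> k" for k using b1 that by simp
  have ab: "\<bar>a i\<bar> \<le> C1 * real k powr (\<alpha> / 2 - 7 / 2)" if "k1 \<le> k" "i \<le> \<nu> (Suc k)" for k i using b2 that by simp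
  have up: "(\<Sum>i\<in>{\<nu> k<..\<nu> (Suc k)}. (a i)\<^sup>2) \<le> C1 * real k powr (\<alpha> - 1)" if "k1 \<le> k" for k using b3 that by simp
  have low: "real k powr (\<alpha> - 1) \<le> (\<Sum>i\<in>{\<nu> k<..\<nu> (Suc k)}. (a i)\<^sup>2)" if "k1 \<le> k" for k using b4 that by simp
  have A\<nu>: "real k powr \<alpha> \<le> A (\<nu> k)" if "k1 \<le> k" for k using b5 that by simp
  have \<alpha>7: "7 \<le> \<alpha>" using \<delta> by (simp add: \<alpha>_def field_simps)
  define \<rho> where "\<rho> = 1 - \<bar>r\<bar>"
  have \<rho>: "0 < \<rho>" using r_bounds by (simp add: \<rho>_def)
  define \<sigma> where "\<sigma> = 1 - r\<^sup>2"
  have \<sigma>: "0 < \<sigma>" "\<sigma> \<le> 1" using r_bounds by (auto simp: \<sigma>_def)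
  define t where "t = var_rec r a"
  \<comment> \<open>A common bound for the tail coefficients of the block and for
    \<open>covar\<close> at its start: the bound on |a i| times the geometric factor 1 /
    \<rho>.\<close>
  define P where "P k = C1 / \<rho> * real k powr (\<alpha> / 2 - 7 / 2)" for k
  have P0: "0 \<le> P k" for k using C1 \<rho> by (simp add: P_def)
  have P2: "(P k)\<^sup>2 = C1\<^sup>2 / \<rho>\<^sup>2 * real k powr (\<alpha> - 7)" for k
  proof -
    have "(real k powr (\<alpha> / 2 - 7 / 2))\<^sup>2 = real k powr (\<alpha> - 7)"
      by (simp add: power2_eq_square powr_add[symmetric])
    then show ?thesis by (simp add: P_def power_mult_distrib power_divide)
  qed
  have tailP: "\<bar>tail_coeff r a n i\<bar> \<le> P k" if "k1 \<le> k" "n \<le> \<nu> (Suc k)" for k n i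
    using tail_coeff_bound[OF r_bounds(1), of "C1 * real k powr (\<alpha> / 2 - 7 / 2)" i n a] ab[OF that(1)] that(2) C1
    by (simp add: P_def \<rho>_def)
  have covP: "\<bar>covar r a (\<nu> k)\<bar> \<le> P k" if "k1 \<le> k" for k
    using covar_bound[OF r_bounds(1), of "C1 * real k powr (\<alpha> / 2 - 7 / 2)" "\<nu> k" a] ab[OF that] \<nu>less[OF that] C1
    by (simp add: P_def \<rho>_def)
  \<comment> \<open>What separates the variance increment from the variance of the martingale part
    are the boundary terms of \<open>var_rec_block\<close>, of order k^(\<alpha> - 7).\<close>
  have remainder: "\<bar>t n - t (\<nu> k) - \<sigma> * (\<Sum>i\<in>{\<nu> k<..n}. (tail_coeff r a n i)\<^sup>2)\<bar> \<le> 3 * (P k)\<^sup>2"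
    if k: "k1 \<le> k" and n: "\<nu> k \<le> n" "n \<le> \<nu> (Suc k)" for k n
  proof -
    let ?b = "tail_coeff r a n (Suc (\<nu> k))" and ?c = "covar r a (\<nu> k)"
    have b: "\<bar>?b\<bar> \<le> P k" by (rule tailP[OF k n(2)])
    have c: "\<bar>?c\<bar> \<le> P k" by (rule covP[OF k])
    have "t n - t (\<nu> k) - \<sigma> * (\<Sum>i\<in>{\<nu> k<..n}. (tail_coeff r a n i)\<^sup>2) = 2 * (r * (?b * ?c)) + r\<^sup>2 * ?b\<^sup>2"
      using var_rec_block[OF n(1), of r a] by (simp add: t_def \<sigma>_def mult.assoc)
    also have "\<bar>\<dots>\<bar> \<le> \<bar>2 * (r * (?b * ?c))\<bar> + \<bar>r\<^sup>2 * ?b\<^sup>2\<bar>" by (rule abs_triangle_ineq)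
    also have "\<bar>2 * (r * (?b * ?c))\<bar> \<le> 2 * (1 * (P k * P k))"
      unfolding abs_mult using b c r_bounds by (intro mult_mono) auto
    also have "\<bar>r\<^sup>2 * ?b\<^sup>2\<bar> \<le> 1 * (P k)\<^sup>2"
      using r_bounds b power_mono[OF b, of 2] by (simp add: abs_mult) (intro mult_mono[of "r\<^sup>2" 1, simplified], auto)
    finally show ?thesis by (simp add: power2_eq_square)
  qed
  \<comment> \<open>Chosen so that the boundary terms take at most \<sigma> / 8 of k^(\<alpha> - 1),
    half of the lower bound \<sigma> / 4 for the main term.\<close>
  define k0 where "k0 = max k1 (nat \<lceil>24 * C1\<^sup>2 / (\<rho>\<^sup>2 * \<sigma>)\<rceil>)"
  have k0: "1 \<le> k0" "k1 \<le> k0" using k1 by (auto simp: k0_def)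
  have P2small: "3 * (P k)\<^sup>2 \<le> \<sigma> / 8 * real k powr (\<alpha> - 1)" if k: "k0 \<le> k" for k
  proof -
    have kk: "24 * C1\<^sup>2 / (\<rho>\<^sup>2 * \<sigma>) \<le> real k" "1 \<le> k" using k k0 unfolding k0_def by linarith+
    then have c: "3 * C1\<^sup>2 / \<rho>\<^sup>2 \<le> \<sigma> / 8 * real k" using \<rho> \<sigma> by (simp add: field_simps)
    have "3 * (P k)\<^sup>2 = (3 * C1\<^sup>2 / \<rho>\<^sup>2) * real k powr (\<alpha> - 7)" by (simp add: P2)
    also have "\<dots> \<le> (\<sigma> / 8 * real k) * real k powr (\<alpha> - 2)"
      using c kk \<sigma> by (intro mult_mono powr_mono) auto
    also have "\<dots> = \<sigma> / 8 * (real k powr 1 * real k powr (\<alpha> - 2))" using kk by simp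
    also have "\<dots> = \<sigma> / 8 * real k powr (\<alpha> - 1)" unfolding powr_add[symmetric] by simp
    finally show ?thesis .
  qed
  have tlow: "\<sigma> / 8 * real k powr (\<alpha> - 1) \<le> t (\<nu> (Suc k)) - t (\<nu> k)" if k: "k0 \<le> k" for k
  proof -
    have kk: "k1 \<le> k" using k k0 by simp
    have "real k powr (\<alpha> - 1) \<le> 4 * (\<Sum>i\<in>{\<nu> k<..\<nu> (Suc k)}. (tail_coeff r a (\<nu> (Suc k)) i)\<^sup>2)"
      using low[OF kk] sum_sq_le_tail[OF r_bounds(1), where m="\<nu> k" and n="\<nu> (Suc k)" and a=a] by simp
    then have "\<sigma> / 4 * real k powr (\<alpha> - 1) \<le> \<sigma> * (\<Sum>i\<in>{\<nu> k<..\<nu> (Suc k)}. (tail_coeff r a (\<nu> (Suc k)) i)\<^sup>2)"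
      using \<sigma> mult_left_mono[of "real k powr (\<alpha> - 1)" _ "\<sigma> / 4"] by fastforce
    then show ?thesis using remainder[OF kk _ order_refl] less_imp_le[OF \<nu>less[OF kk]] P2small[OF k]
      by (simp add: abs_le_iff)
  qed
  have tail_sq: "(\<Sum>i\<in>{\<nu> k<..n}. (tail_coeff r a n i)\<^sup>2) \<le> C1 / \<rho>\<^sup>2 * real k powr (\<alpha> - 1)"
    if k: "k1 \<le> k" and n: "n \<le> \<nu> (Suc k)" for k n
  proof -
    have "(\<Sum>i\<in>{\<nu> k<..n}. (tail_coeff r a n i)\<^sup>2) \<le> (\<Sum>i\<in>{\<nu> k<..n}. (a i)\<^sup>2) / \<rho>\<^sup>2"
      unfolding \<rho>_def by (rule tail_sum_sq_le[OF r_bounds(1)])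
    also have "(\<Sum>i\<in>{\<nu> k<..n}. (a i)\<^sup>2) \<le> (\<Sum>i\<in>{\<nu> k<..\<nu> (Suc k)}. (a i)\<^sup>2)"
      by (rule sum_mono2) (use n in auto)
    also have "\<dots> \<le> C1 * real k powr (\<alpha> - 1)" by (rule up[OF k])
    finally show ?thesis using \<rho> by (simp add: divide_right_mono)
  qed
  have tup: "\<bar>t n - t (\<nu> k)\<bar> \<le> (1 + C1 / \<rho>\<^sup>2) * real k powr (\<alpha> - 1)"
    if k: "k0 \<le> k" and n: "\<nu> k \<le> n" "n \<le> \<nu> (Suc k)" for k n
  proof -
    have kk: "k1 \<le> k" using k k0 by simp
    let ?s = "\<Sum>i\<in>{\<nu> k<..n}. (tail_coeff r a n i)\<^sup>2"
    have s0: "0 \<le> ?s" by (simp add: sum_nonneg)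
    then have s: "0 \<le> \<sigma> * ?s" "\<sigma> * ?s \<le> 1 * ?s" using \<sigma> s0 mult_right_mono[OF \<sigma>(2) s0] by auto
    have "\<sigma> / 8 * real k powr (\<alpha> - 1) \<le> 1 * real k powr (\<alpha> - 1)" using \<sigma> by (intro mult_right_mono) auto
    then have "\<bar>t n - t (\<nu> k)\<bar> \<le> real k powr (\<alpha> - 1) + C1 / \<rho>\<^sup>2 * real k powr (\<alpha> - 1)"
      using remainder[OF kk n] P2small[OF k] tail_sq[OF kk n(2)] s by (simp add: abs_le_iff)
    then show ?thesis by (simp add: distrib_right)
  qed
  have tge: "real k powr \<alpha> \<le> 4 / \<sigma> * t n" if k: "k0 \<le> k" and n: "\<nu> k \<le> n" for k n
  proof -
    have "real k powr \<alpha> \<le> A (\<nu> k)" using A\<nu> k k0 by simp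
    also have "\<dots> \<le> A n" unfolding A by (rule sum_mono2) (use n in auto)
    also have "\<sigma> / 4 * A n \<le> t n" using var_rec_ge[of a n] by (simp add: A t_def \<sigma>_def)
    then have "A n \<le> 4 / \<sigma> * t n" using \<sigma> by (simp add: field_simps)
    finally show ?thesis .
  qed
  have tpos: "0 < t (\<nu> k)" if k: "k0 \<le> k" for k
  proof -
    have "0 < real k powr \<alpha>" using k k0 by auto
    then have "0 < 4 / \<sigma> * t (\<nu> k)" using tge[OF k order_refl] by linarith
    moreover have "0 < 4 / \<sigma>" using \<sigma> by simp
    ultimately show ?thesis by (rule zero_less_mult_pos)
  qed
  have \<nu>1: "1 \<le> \<nu> k" if k: "k0 \<le> k" for k
  proof (rule ccontr)
    assume "\<not> 1 \<le> \<nu> k"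
    then have "\<nu> k = 0" by simp
    then show False using tpos[OF k] by (simp add: t_def)
  qed
  \<comment> \<open>One summand per error: the boundary term, the Lindeberg bound, and the exchange
    of the variance v of the martingale part for the true increment u.\<close>
  define Ce where "Ce = C1 / \<rho> + (4 + 20 * (C1 / \<rho> * (C1 / \<rho>\<^sup>2))) + 3 * C1\<^sup>2 / \<rho>\<^sup>2 / sqrt (\<sigma> / 8)"
  have coupling: "\<bar>expectation (\<lambda>\<omega>. f (X (\<nu> k) \<omega> * (walk a X (\<nu> (Suc k)) \<omega> - walk a X (\<nu> k) \<omega>)))
        - (\<integral>z. f (sqrt (t (\<nu> (Suc k)) - t (\<nu> k)) * z) \<partial>\<gamma>)\<bar> \<le> Ce * real k powr (\<alpha> / 2 - 3 / 2)"
    if k: "k0 \<le> k" and lip: "\<And>x y. \<bar>f x - f y :: real\<bar> \<le> \<bar>x - y :: real\<bar>" for k f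
  proof -
    interpret N: prob_space \<gamma> by (rule prob_space_gauss)
    have kk: "k1 \<le> k" and k1': "1 \<le> k" using k k0 by auto
    define m n where "m = \<nu> k" and "n = \<nu> (Suc k)"
    have m1: "1 \<le> m" using \<nu>1[OF k] by (simp add: m_def)
    have mn: "m < n" using \<nu>less[OF kk] by (simp add: m_def n_def)
    \<comment> \<open>\<open>?s\<close> is the smoothing width h. It balances the two Lindeberg
      terms, because the cube sum is of order k^(\<alpha>/2 - 7/2) * k^(\<alpha> - 1), the cube of
      \<open>?s\<close>.\<close>
    let ?b = "tail_coeff r a n" and ?s = "real k powr (\<alpha> / 2 - 3 / 2)"
    have s0: "0 < ?s" using k1' by simp
    have f1: "\<bar>expectation (\<lambda>\<omega>. f (X m \<omega> * (walk a X n \<omega> - walk a X m \<omega>))) - expectation (\<lambda>\<omega>. f (X m \<omega> * wsum ?b m n \<omega>))\<bar> \<le> P k"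
    proof -
      have ad: "adapted n (\<lambda>\<omega>. X m \<omega> * (walk a X n \<omega> - walk a X m \<omega>))" "adapted n (\<lambda>\<omega>. X m \<omega> * wsum ?b m n \<omega>)"
        using m1 mn by (auto intro!: adapted_mult adapted_X adapted_wsum adapted_compose2[where f="(-)"] adapted_walk adapted_mono[OF adapted_walk])
      have i: "integrable M (\<lambda>\<omega>. f (X m \<omega> * (walk a X n \<omega> - walk a X m \<omega>)))" "integrable M (\<lambda>\<omega>. f (X m \<omega> * wsum ?b m n \<omega>))"
        by (rule adapted_borel_compose_integrable, rule ad)+
      have "\<bar>expectation (\<lambda>\<omega>. f (X m \<omega> * (walk a X n \<omega> - walk a X m \<omega>)) - f (X m \<omega> * wsum ?b m n \<omega>))\<bar>
         \<le> expectation (\<lambda>\<omega>. \<bar>f (X m \<omega> * (walk a X n \<omega> - walk a X m \<omega>)) - f (X m \<omega> * wsum ?b m n \<omega>)\<bar>)"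
        by (rule integral_abs_bound)
      also have "\<dots> \<le> expectation (\<lambda>\<omega>. P k)"
      proof (rule integral_mono)
        fix \<omega> assume w: "\<omega> \<in> space M"
        have "walk a X n \<omega> - walk a X m \<omega> = wsum ?b m n \<omega> + r * ?b (Suc m) * X m \<omega>"
          using walk_diff[OF m1 less_imp_le[OF mn] order_refl, of a \<omega>] by (simp add: tail_coeff_gt)
        then have "X m \<omega> * (walk a X n \<omega> - walk a X m \<omega>) - X m \<omega> * wsum ?b m n \<omega> = r * ?b (Suc m)"
          using X_square[OF m1 w] by (simp add: algebra_simps)
        then have "\<bar>f (X m \<omega> * (walk a X n \<omega> - walk a X m \<omega>)) - f (X m \<omega> * wsum ?b m n \<omega>)\<bar> \<le> \<bar>r * ?b (Suc m)\<bar>"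
          using lip[of "X m \<omega> * (walk a X n \<omega> - walk a X m \<omega>)" "X m \<omega> * wsum ?b m n \<omega>"] by simp
        also have "\<dots> \<le> 1 * P k"
          unfolding abs_mult using r_bounds tailP[OF kk, of n "Suc m"] by (intro mult_mono) (auto simp: n_def)
        finally show "\<bar>f (X m \<omega> * (walk a X n \<omega> - walk a X m \<omega>)) - f (X m \<omega> * wsum ?b m n \<omega>)\<bar> \<le> P k" by simp
      qed (use i in auto)
      finally show ?thesis using i by (simp add: prob_space)
    qed
    define v where "v = \<sigma> * (\<Sum>i\<in>{m<..n}. (?b i)\<^sup>2)"
    have v0: "0 \<le> v" using \<sigma> by (simp add: v_def sum_nonneg)
    have LL: "\<bar>expectation (\<lambda>\<omega>. f (X m \<omega> * wsum ?b m n \<omega>)) - (\<integral>z. f (sqrt v * z) \<partial>\<gamma>)\<bar>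
        \<le> 4 * ?s + 20 / ?s\<^sup>2 * (\<Sum>i\<in>{m<..n}. \<bar>?b i\<bar> ^ 3)"
      unfolding v_def \<sigma>_def by (rule Lindeberg_Lipschitz[OF lip s0 m1]) (use mn in simp)
    have "(\<Sum>i\<in>{m<..n}. \<bar>?b i\<bar> ^ 3) \<le> (\<Sum>i\<in>{m<..n}. P k * (?b i)\<^sup>2)"
    proof (rule sum_mono)
      fix i
      have "\<bar>?b i\<bar> ^ 3 = \<bar>?b i\<bar> * (?b i)\<^sup>2" by (simp add: power3_eq_cube power2_eq_square)
      also have "\<dots> \<le> P k * (?b i)\<^sup>2" by (intro mult_right_mono tailP[OF kk]) (auto simp: n_def)
      finally show "\<bar>?b i\<bar> ^ 3 \<le> P k * (?b i)\<^sup>2" .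
    qed
    also have "\<dots> \<le> P k * (C1 / \<rho>\<^sup>2 * real k powr (\<alpha> - 1))"
      unfolding sum_distrib_left[symmetric] m_def
      by (intro mult_left_mono tail_sq[OF kk] P0) (simp add: n_def)
    also have "\<dots> = C1 / \<rho> * (C1 / \<rho>\<^sup>2) * (?s\<^sup>2 * ?s)"
    proof -
      have "real k powr (\<alpha> / 2 - 7 / 2) * real k powr (\<alpha> - 1) = ?s\<^sup>2 * ?s"
        unfolding power2_eq_square powr_add[symmetric] by (rule arg_cong[where f="\<lambda>e. real k powr e"]) simp
      then show ?thesis by (simp add: P_def mult.assoc mult.left_commute)
    qed
    finally have "20 / ?s\<^sup>2 * (\<Sum>i\<in>{m<..n}. \<bar>?b i\<bar> ^ 3) \<le> 20 / ?s\<^sup>2 * (C1 / \<rho> * (C1 / \<rho>\<^sup>2) * (?s\<^sup>2 * ?s))"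
      by (rule mult_left_mono) simp
    also have "\<dots> = 20 * (C1 / \<rho> * (C1 / \<rho>\<^sup>2)) * ?s"
      using s0 by simp
    finally have f2: "\<bar>expectation (\<lambda>\<omega>. f (X m \<omega> * wsum ?b m n \<omega>)) - (\<integral>z. f (sqrt v * z) \<partial>\<gamma>)\<bar>
        \<le> (4 + 20 * (C1 / \<rho> * (C1 / \<rho>\<^sup>2))) * ?s"
      using LL by (simp only: distrib_right)
    define u where "u = t n - t m"
    have u: "\<sigma> / 8 * real k powr (\<alpha> - 1) \<le> u" using tlow[OF k] by (simp add: u_def m_def n_def)
    have u0: "0 < u" by (rule less_le_trans[OF _ u]) (use \<sigma> k1' in simp)
    have uv: "\<bar>u - v\<bar> \<le> 3 * (P k)\<^sup>2"
      using remainder[OF kk _ order_refl] mn by (simp add: u_def v_def m_def n_def)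
    have f3: "\<bar>(\<integral>z. f (sqrt v * z) \<partial>\<gamma>) - (\<integral>z. f (sqrt u * z) \<partial>\<gamma>)\<bar> \<le> \<bar>sqrt v - sqrt u\<bar>"
    proof -
      have [measurable]: "f \<in> borel_measurable borel"
      proof (rule borel_measurable_continuous_onI)
        have "isCont f x" for x
          unfolding continuous_at_eps_delta dist_real_def using lip order_le_less_trans by blast
        then show "continuous_on UNIV f" by (simp add: continuous_at_imp_continuous_on)
      qed
      have fb: "\<bar>f x\<bar> \<le> \<bar>f 0\<bar> + \<bar>x\<bar>" for x using lip[of x 0] by simp
      have i: "integrable \<gamma> (\<lambda>z. f (c * z))" for c
        using gauss_avg_integrable(1)[of f "\<bar>f 0\<bar>" 0 c] fb by simp
      have "\<bar>(\<integral>z. f (sqrt v * z) - f (sqrt u * z) \<partial>\<gamma>)\<bar> \<le> (\<integral>z. \<bar>f (sqrt v * z) - f (sqrt u * z)\<bar> \<partial>\<gamma>)"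
        by (rule integral_abs_bound)
      also have "\<dots> \<le> (\<integral>z. \<bar>sqrt v - sqrt u\<bar> * \<bar>z\<bar> \<partial>\<gamma>)"
      proof (rule integral_mono)
        show "\<bar>f (sqrt v * z) - f (sqrt u * z)\<bar> \<le> \<bar>sqrt v - sqrt u\<bar> * \<bar>z\<bar>" for z
          using lip[of "sqrt v * z" "sqrt u * z"] by (simp add: abs_mult[symmetric] left_diff_distrib)
      qed (use i gauss_moments(5) in auto)
      also have "\<dots> = \<bar>sqrt v - sqrt u\<bar> * (\<integral>z. \<bar>z\<bar> \<partial>\<gamma>)" by simp
      also have "\<dots> \<le> \<bar>sqrt v - sqrt u\<bar> * 1" using gauss_moments(6) by (intro mult_left_mono) auto
      finally show ?thesis using i by simp
    qed
    \<comment> \<open>The difference of the roots is at most |v - u| / sqrt u, and the lower bound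
      on the variance increment keeps u away from 0.\<close>
    have "\<bar>sqrt v - sqrt u\<bar> \<le> 3 * (P k)\<^sup>2 / sqrt u"
    proof -
      have "\<bar>sqrt v - sqrt u\<bar> * sqrt u \<le> \<bar>sqrt v - sqrt u\<bar> * (sqrt v + sqrt u)" using v0 by (intro mult_left_mono) auto
      also have "\<dots> = \<bar>(sqrt v - sqrt u) * (sqrt v + sqrt u)\<bar>" using v0 u0 by (simp add: abs_mult)
      also have "(sqrt v - sqrt u) * (sqrt v + sqrt u) = v - u" using v0 u0 by (simp add: algebra_simps)
      finally show ?thesis using uv u0 by (simp add: field_simps abs_minus_commute)
    qed
    also have "\<dots> \<le> 3 * (P k)\<^sup>2 / sqrt (\<sigma> / 8 * real k powr (\<alpha> - 1))"
      using u u0 \<sigma> k1' by (intro divide_left_mono) auto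
    also have "\<dots> = 3 * C1\<^sup>2 / \<rho>\<^sup>2 / sqrt (\<sigma> / 8) * (real k powr (\<alpha> - 7) / real k powr ((\<alpha> - 1) / 2))"
    proof -
      have "sqrt (\<sigma> / 8 * real k powr (\<alpha> - 1)) = sqrt (\<sigma> / 8) * real k powr ((\<alpha> - 1) / 2)"
      proof -
        have "sqrt (real k powr (\<alpha> - 1)) = (real k powr (\<alpha> - 1)) powr (1 / 2)" by (simp add: powr_half_sqrt)
        also have "\<dots> = real k powr ((\<alpha> - 1) / 2)" by (simp add: powr_powr)
        finally show ?thesis by (simp only: real_sqrt_mult)
      qed
      then show ?thesis by (simp add: P2)
    qed
    also have "\<dots> \<le> 3 * C1\<^sup>2 / \<rho>\<^sup>2 / sqrt (\<sigma> / 8) * ?s"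
    proof (rule mult_left_mono)
      show "real k powr (\<alpha> - 7) / real k powr ((\<alpha> - 1) / 2) \<le> ?s"
        unfolding powr_diff[symmetric] using k1' by (intro powr_mono) (auto simp: field_simps)
    qed (use \<sigma> in simp)
    finally have f4: "\<bar>sqrt v - sqrt u\<bar> \<le> 3 * C1\<^sup>2 / \<rho>\<^sup>2 / sqrt (\<sigma> / 8) * ?s" .
    have f5: "P k \<le> C1 / \<rho> * ?s"
      unfolding P_def using C1 \<rho> k1' by (intro mult_left_mono powr_mono) auto
    have "\<bar>expectation (\<lambda>\<omega>. f (X m \<omega> * (walk a X n \<omega> - walk a X m \<omega>))) - (\<integral>z. f (sqrt u * z) \<partial>\<gamma>)\<bar>
       \<le> C1 / \<rho> * ?s + (4 + 20 * (C1 / \<rho> * (C1 / \<rho>\<^sup>2))) * ?s + 3 * C1\<^sup>2 / \<rho>\<^sup>2 / sqrt (\<sigma> / 8) * ?s"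
      using f1 f2 f3 f4 f5 by linarith
    then show ?thesis unfolding Ce_def u_def m_def n_def by (simp add: distrib_right)
  qed
  have fluct: "AE \<omega> in M. \<forall>\<^sub>F k in sequentially. \<forall>n\<in>{\<nu> k..\<nu> (Suc k)}.
       \<bar>walk a X n \<omega> - walk a X (\<nu> k) \<omega>\<bar> \<le> (1 + 2 * C1 / \<rho>) * real k powr (\<alpha> / 2 - 7 / 32)"
  proof -
    \<comment> \<open>The martingale part reaches its threshold somewhere in block k. Blocks before
      k0, to which the estimates do not apply, are given the empty event.\<close>
    define F where "F k = (if k0 \<le> k then {\<omega> \<in> space M. \<exists>j\<in>{\<nu> k..\<nu> (Suc k)}.
       real k powr (\<alpha> / 2 - 7 / 32) \<le> \<bar>wsum (tail_coeff r a (\<nu> (Suc k))) (\<nu> k) j \<omega>\<bar>} else {})" for k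
    have mF: "F k \<in> events" for k
    proof (cases "k0 \<le> k")
      case True
      have [measurable]: "wsum (tail_coeff r a (\<nu> (Suc k))) (\<nu> k) j \<in> borel_measurable M" for j
        by (rule adapted_measurable[OF adapted_wsum[OF \<nu>1[OF True] order_refl]])
      show ?thesis unfolding F_def using True by simp
    qed (simp add: F_def)
    let ?K = "48 * (C1 / \<rho>\<^sup>2)\<^sup>2"
    have pF: "prob (F k) \<le> ?K * real k powr (- 9 / 8)" for k
    proof (cases "k0 \<le> k")
      case True
      have kk: "k1 \<le> k" and k1': "1 \<le> k" using True k0 by auto
      let ?x = "real k powr (\<alpha> / 2 - 7 / 32)" and ?V = "\<Sum>i\<in>{\<nu> k<..\<nu> (Suc k)}. (tail_coeff r a (\<nu> (Suc k)) i)\<^sup>2"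
      have x0: "0 < ?x" using k1' by simp
      have V0: "0 \<le> ?V" by (simp add: sum_nonneg)
      have "prob (F k) \<le> 48 * ?V\<^sup>2 / ?x ^ 4"
        unfolding F_def using True wsum_maximal[OF \<nu>1[OF True] less_imp_le[OF \<nu>less[OF kk]] x0] by simp
      also have "\<dots> \<le> 48 * (C1 / \<rho>\<^sup>2 * real k powr (\<alpha> - 1))\<^sup>2 / ?x ^ 4"
        by (intro divide_right_mono mult_left_mono power_mono tail_sq[OF kk order_refl] V0) auto
      also have "\<dots> = ?K * ((real k powr (\<alpha> - 1))\<^sup>2 / ?x ^ 4)"
        unfolding power_mult_distrib by simp
      \<comment> \<open>The exponent is 2 * (\<alpha> - 1) - 4 * (\<alpha>/2 - 7/32) = -9/8, below
        -1 as Borel-Cantelli requires.\<close>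
      also have "(real k powr (\<alpha> - 1))\<^sup>2 / ?x ^ 4 = real k powr (- 9 / 8)"
      proof -
        have "(real k powr (\<alpha> - 1))\<^sup>2 = real k powr (2 * \<alpha> - 2)"
          by (simp add: power2_eq_square powr_add[symmetric])
        moreover have "?x ^ 4 = real k powr (2 * \<alpha> - 7 / 8)"
          by (simp add: power4_eq_xxxx powr_add[symmetric])
        ultimately show ?thesis by (simp add: powr_diff[symmetric])
      qed
      finally show ?thesis .
    qed (simp add: F_def)
    have "summable (\<lambda>k. ?K * real k powr (- 9 / 8))"
      by (intro summable_mult) (simp add: summable_real_powr_iff)
    then have "summable (\<lambda>k. prob (F k))"
      by (rule summable_comparison_test'[where N=0]) (use pF in simp)
    then have "AE \<omega> in M. \<forall>\<^sub>F k in sequentially. \<omega> \<in> space M - F k"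
      by (intro borel_cantelli_AE1 mF) (auto simp: emeasure_eq_measure)
    then show ?thesis
    proof eventually_elim
      case (elim \<omega>)
      then show ?case
        using eventually_ge_at_top[of k0]
      proof eventually_elim
        case (elim k)
        then have k: "k0 \<le> k" and kk: "k1 \<le> k" and k1': "1 \<le> k" and w: "\<omega> \<in> space M" using k0 by auto
        show ?case
        proof
          fix n assume n: "n \<in> {\<nu> k..\<nu> (Suc k)}"
          let ?b = "tail_coeff r a (\<nu> (Suc k))" and ?x = "real k powr (\<alpha> / 2 - 7 / 32)"
          have ws: "\<bar>wsum ?b (\<nu> k) n \<omega>\<bar> < ?x" using elim n k by (auto simp: F_def not_le)
          have bX: "\<bar>r * ?b i * X j \<omega>\<bar> \<le> P k" if "1 \<le> j" for i j
          proof -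
            have "\<bar>r\<bar> * \<bar>?b i\<bar> \<le> 1 * P k" using r_bounds tailP[OF kk order_refl, of i] by (intro mult_mono) auto
            then show ?thesis using X_abs[OF that w] by (simp add: abs_mult)
          qed
          have n1: "1 \<le> n" using \<nu>1[OF k] n by simp
          have "\<bar>walk a X n \<omega> - walk a X (\<nu> k) \<omega>\<bar> \<le> ?x + 2 * P k"
            using walk_diff[OF \<nu>1[OF k], of n "\<nu> (Suc k)" a \<omega>] n ws bX[OF \<nu>1[OF k], of "Suc (\<nu> k)"] bX[OF n1, of "Suc n"]
            by simp
          also have "P k \<le> C1 / \<rho> * ?x"
            unfolding P_def using C1 \<rho> k1' by (intro mult_left_mono powr_mono) auto
          finally show "\<bar>walk a X n \<omega> - walk a X (\<nu> k) \<omega>\<bar> \<le> (1 + 2 * C1 / \<rho>) * ?x"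
            by (simp add: distrib_right)
        qed
      qed
    qed
  qed
  define C where "C = (1 + C1 / \<rho>\<^sup>2) + 4 / \<sigma> + Ce + (1 + 2 * C1 / \<rho>)"
  have p: "0 \<le> C1 / \<rho>\<^sup>2" "0 \<le> 4 / \<sigma>" "0 \<le> C1 / \<rho>" "0 \<le> Ce" "0 \<le> 2 * C1 / \<rho>"
    using C1 \<rho> \<sigma> by (auto simp: Ce_def intro!: add_nonneg_nonneg)
  have C: "1 \<le> C" "1 + C1 / \<rho>\<^sup>2 \<le> C" "4 / \<sigma> \<le> C" "Ce \<le> C" "1 + 2 * C1 / \<rho> \<le> C"
    using p unfolding C_def by linarith+
  show ?thesis
  proof (intro exI[of _ \<nu>] exI[of _ k0] exI[of _ C] conjI allI impI)
    fix k n assume k: "k0 \<le> k" and n: "\<nu> k \<le> n" "n \<le> \<nu> (Suc k)"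
    have "\<bar>t n - t (\<nu> k)\<bar> \<le> (1 + C1 / \<rho>\<^sup>2) * real k powr (\<alpha> - 1)" by (rule tup[OF k n])
    also have "\<dots> \<le> C * real k powr (\<alpha> - 1)" by (intro mult_right_mono C) auto
    finally show "\<bar>var_rec r a n - var_rec r a (\<nu> k)\<bar> \<le> C * real k powr (\<alpha> - 1)" by (simp add: t_def)
  next
    fix k n assume k: "k0 \<le> k" and n: "\<nu> k \<le> n"
    have "0 < real k powr \<alpha>" using k k0 by auto
    then have "0 < 4 / \<sigma> * t n" using tge[OF k n] by linarith
    moreover have "0 < 4 / \<sigma>" using \<sigma> by simp
    ultimately have "0 < t n" by (rule zero_less_mult_pos)
    then have "0 \<le> t n" by simp
    then have "4 / \<sigma> * t n \<le> C * t n" by (intro mult_right_mono C)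
    then show "real k powr \<alpha> \<le> C * var_rec r a n" using tge[OF k n] by (simp add: t_def)
  next
    fix k and f :: "real \<Rightarrow> real" assume k: "k0 \<le> k" and f: "\<forall>x y. \<bar>f x - f y\<bar> \<le> \<bar>x - y\<bar>"
    have "Ce * real k powr (\<alpha> / 2 - 3 / 2) \<le> C * real k powr (\<alpha> / 2 - 3 / 2)" by (intro mult_right_mono C) auto
    then show "\<bar>expectation (\<lambda>\<omega>. f (X (\<nu> k) \<omega> * (walk a X (\<nu> (Suc k)) \<omega> - walk a X (\<nu> k) \<omega>)))
        - (\<integral>z. f (sqrt (var_rec r a (\<nu> (Suc k)) - var_rec r a (\<nu> k)) * z) \<partial>\<gamma>)\<bar> \<le> C * real k powr (\<alpha> / 2 - 3 / 2)"
      using coupling[OF k, of f] f unfolding t_def by auto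
  next
    have le: "(1 + 2 * C1 / \<rho>) * real k powr (\<alpha> / 2 - 7 / 32) \<le> C * real k powr (\<alpha> / 2 - 7 / 32)" for k
      by (intro mult_right_mono C) auto
    show "AE \<omega> in M. \<forall>\<^sub>F k in sequentially. \<forall>n\<in>{\<nu> k..\<nu> (Suc k)}.
       \<bar>walk a X n \<omega> - walk a X (\<nu> k) \<omega>\<bar> \<le> C * real k powr (\<alpha> / 2 - 7 / 32)"
      using fluct by (auto elim!: eventually_mono intro: order_trans[OF _ le])
  next
    fix k assume k: "k0 \<le> k"
    have "0 < \<sigma> / 8 * real k powr (\<alpha> - 1)" using \<sigma> k k0 by auto
    then show "var_rec r a (\<nu> k) < var_rec r a (\<nu> (Suc k))" using tlow[OF k] by (simp add: t_def)
    show "0 < var_rec r a (\<nu> k)" using tpos[OF k] by (simp add: t_def)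
    show "1 \<le> \<nu> k" by (rule \<nu>1[OF k])
    show "\<nu> k < \<nu> (Suc k)" using \<nu>less k k0 by simp
  qed (use k0 C in auto)
qed

end

section \<open>The strong approximation\<close>

text \<open>A Kronecker argument for nonnegative terms: the weighted series has finite mean, so it
  converges almost surely, and by monotonicity g n dominates all earlier weights. First moments of
  the coupling errors are therefore enough.\<close>

lemma (in prob_space) AE_weighted_partial_sums:
  fixes f :: "nat \<Rightarrow> 'a \<Rightarrow> real" and g :: "nat \<Rightarrow> real"
  assumes f: "\<And>i. integrable M (f i)" "\<And>i \<omega>. 0 \<le> f i \<omega>"
    and g: "\<And>i. 0 < g i" "\<And>i j. i \<le> j \<Longrightarrow> g i \<le> g j"
    and sum: "summable (\<lambda>i. expectation (f i) / g i)"
  shows "AE \<omega> in M. \<exists>Q\<ge>0. \<forall>n. (\<Sum>i<n. f i \<omega>) \<le> Q * g n"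
proof -
  have [measurable]: "f i \<in> borel_measurable M" for i using f(1) by auto
  have "(\<integral>\<^sup>+\<omega>. (\<Sum>i. ennreal (f i \<omega> / g i)) \<partial>M) = (\<Sum>i. \<integral>\<^sup>+\<omega>. ennreal (f i \<omega> / g i) \<partial>M)"
    by (rule nn_integral_suminf) auto
  also have "\<dots> = (\<Sum>i. ennreal (expectation (f i) / g i))"
  proof (intro suminf_cong)
    fix i
    have "(\<integral>\<^sup>+\<omega>. ennreal (f i \<omega> / g i) \<partial>M) = ennreal (expectation (\<lambda>\<omega>. f i \<omega> / g i))"
      by (rule nn_integral_eq_integral) (use f g(1)[of i] in \<open>auto intro!: AE_I2 divide_nonneg_pos\<close>)
    then show "(\<integral>\<^sup>+\<omega>. ennreal (f i \<omega> / g i) \<partial>M) = ennreal (expectation (f i) / g i)" by simp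
  qed
  also have "\<dots> = ennreal (\<Sum>i. expectation (f i) / g i)"
    by (rule suminf_ennreal2[OF _ sum]) (use f g(1) in \<open>auto intro!: divide_nonneg_pos integral_nonneg_AE\<close>)
  finally have "(\<integral>\<^sup>+\<omega>. (\<Sum>i. ennreal (f i \<omega> / g i)) \<partial>M) \<noteq> \<infinity>" by simp
  then have "AE \<omega> in M. (\<Sum>i. ennreal (f i \<omega> / g i)) \<noteq> \<infinity>"
    by (intro nn_integral_noteq_infinite) auto
  then show ?thesis
  proof eventually_elim
    case (elim \<omega>)
    have nn: "0 \<le> f i \<omega> / g i" for i using f(2) g(1)[of i] by (intro divide_nonneg_pos) auto
    have sm: "summable (\<lambda>i. f i \<omega> / g i)"
      by (rule summable_suminf_not_top) (use elim nn in auto)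
    define Q where "Q = (\<Sum>i. f i \<omega> / g i)"
    have "(\<Sum>i<n. f i \<omega>) \<le> Q * g n" for n
    proof -
      have "(\<Sum>i<n. f i \<omega>) \<le> (\<Sum>i<n. f i \<omega> / g i * g n)"
      proof (rule sum_mono)
        fix i assume "i \<in> {..<n}"
        then have "f i \<omega> / g i * g i \<le> f i \<omega> / g i * g n" by (intro mult_left_mono g(2) nn) auto
        then show "f i \<omega> \<le> f i \<omega> / g i * g n" using g(1)[of i] by simp
      qed
      also have "\<dots> = (\<Sum>i<n. f i \<omega> / g i) * g n" by (simp add: sum_distrib_right)
      also have "\<dots> \<le> Q * g n"
        unfolding Q_def by (intro mult_right_mono sum_le_suminf sm) (use nn g(1)[of n] in auto)
      finally show ?thesis .
    qed
    moreover have "0 \<le> Q" unfolding Q_def by (rule suminf_nonneg[OF sm nn])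
    ultimately show ?case by blast
  qed
qed

lemma strict_mono_block:
  fixes e :: "nat \<Rightarrow> nat"
  assumes e: "strict_mono e" "e 0 = 0" and n: "e i0 \<le> n"
  obtains i where "i0 \<le> i" "e i \<le> n" "n < e (Suc i)"
proof -
  define i where "i = (LEAST i. n < e (Suc i))"
  have "n < e (Suc n)" using strict_mono_imp_increasing[OF e(1), of "Suc n"] by simp
  then have 1: "n < e (Suc i)" unfolding i_def by (rule LeastI)
  have 2: "e i \<le> n"
  proof (cases i)
    case 0 then show ?thesis using e(2) by simp
  next
    case (Suc j)
    then have "\<not> n < e (Suc j)" using not_less_Least[of j "\<lambda>i. n < e (Suc i)"] by (simp add: i_def)
    then show ?thesis by (simp add: Suc)
  qed
  have 3: "i0 \<le> i"
  proof (rule ccontr)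
    assume "\<not> i0 \<le> i"
    then have "e (Suc i) \<le> e i0" using e(1) by (simp add: strict_mono_less_eq)
    then show False using 1 n by simp
  qed
  show thesis using 3 2 1 by (rule that)
qed

text \<open>Block fluctuations are proved for the given walk on \<open>M\<close> but used for its
  copy on \<open>M'\<close>; a measurable path property that holds almost surely travels along the
  common law.\<close>

lemma same_process_law_AE:
  assumes law: "same_process_law M' S' M S"
    and P: "Measurable.pred (\<Pi>\<^sub>M n\<in>(UNIV :: nat set). (borel :: real measure)) P"
    and AE: "AE \<omega> in M. P (\<lambda>n. S n \<omega>)"
  shows "AE \<omega> in M'. P (\<lambda>n. S' n \<omega>)"
proof -
  let ?P = "\<Pi>\<^sub>M n\<in>(UNIV :: nat set). (borel :: real measure)"
  have m: "(\<lambda>\<omega> n. S n \<omega>) \<in> M \<rightarrow>\<^sub>M ?P" "(\<lambda>\<omega> n. S' n \<omega>) \<in> M' \<rightarrow>\<^sub>M ?P"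
    using law by (auto simp: same_process_law_def intro!: measurable_PiM_single')
  have s: "{x \<in> space ?P. P x} \<in> sets ?P" using P by (simp add: pred_def)
  have ae: "AE x in distr M ?P (\<lambda>\<omega> n. S n \<omega>). P x"
    by (subst AE_distr_iff[OF m(1) s]) (rule AE)
  have eq: "distr M' ?P (\<lambda>\<omega> n. S' n \<omega>) = distr M ?P (\<lambda>\<omega> n. S n \<omega>)"
    using law unfolding same_process_law_def by blast
  have "AE x in distr M' ?P (\<lambda>\<omega> n. S' n \<omega>). P x" unfolding eq by (rule ae)
  then show ?thesis by (subst (asm) AE_distr_iff[OF m(2) s])
qed

lemma brownian_block_increments:
  fixes \<tau> :: "nat \<Rightarrow> real"
  assumes BM: "standard_brownian_motion M B" and \<tau>: "strict_mono \<tau>" "0 \<le> \<tau> 0"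
  defines "N \<equiv> \<lambda>i \<omega>. (B (\<tau> (Suc i)) \<omega> - B (\<tau> i) \<omega>) / sqrt (\<tau> (Suc i) - \<tau> i)"
  shows "N i \<in> borel_measurable M" "distr M borel (N i) = \<gamma>" "prob_space.indep_vars M (\<lambda>_. borel) N {..<n}"
proof -
  interpret prob_space M using BM by (simp add: standard_brownian_motion_def)
  have less: "\<tau> i < \<tau> (Suc i)" for i using \<tau>(1) by (simp add: strict_mono_Suc_iff)
  have nn: "0 \<le> \<tau> i" for i using \<tau> by (meson le0 order_trans strict_mono_less_eq)
  have D: "distributed M lborel (\<lambda>\<omega>. B (\<tau> (Suc i)) \<omega> - B (\<tau> i) \<omega>) (normal_density 0 (sqrt (\<tau> (Suc i) - \<tau> i)))"
    using BM nn[of i] less[of i] by (simp add: standard_brownian_motion_def)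
  then have N: "distributed M lborel (N i) std_normal_density"
    using normal_standard_normal_convert[of "sqrt (\<tau> (Suc i) - \<tau> i)" "\<lambda>\<omega>. B (\<tau> (Suc i)) \<omega> - B (\<tau> i) \<omega>" 0] less[of i]
    by (simp add: N_def)
  then show "N i \<in> borel_measurable M" using distributed_measurable[OF N] by simp
  show "distr M borel (N i) = \<gamma>"
    using distributed_distr_eq_density[OF N] by (simp cong: distr_cong)
  have "indep_vars (\<lambda>_. borel) (\<lambda>i \<omega>. B (\<tau> (Suc i)) \<omega> - B (\<tau> i) \<omega>) {..<n}"
    using BM \<tau>(2) less less_imp_le unfolding standard_brownian_motion_def by blast
  then show "indep_vars (\<lambda>_. borel) N {..<n}"
    unfolding N_def by (rule indep_vars_compose2[where Y="\<lambda>i x. x / sqrt (\<tau> (Suc i) - \<tau> i)"]) auto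
qed

theorem theorem2p3:
  fixes M :: "'w measure" and p \<delta> :: real
    and X :: "nat \<Rightarrow> 'w \<Rightarrow> real" and a :: "nat \<Rightarrow> real"
    and S :: "nat \<Rightarrow> 'w \<Rightarrow> real" and s A :: "nat \<Rightarrow> real"
  assumes "0 < p" "p < 1"
    and "erwvrp_steps M p X"
    and "S = walk a X"
    and "s = L2_size M S"
    and "A = (\<lambda>n. \<Sum>k=1..n. (a k)\<^sup>2)"
    and "filterlim A at_top sequentially"
    and "0 < \<delta>" "\<delta> \<le> 1"
    and "(\<lambda>n. (a n)\<^sup>2) \<in> O(\<lambda>n. A n powr (1 - \<delta>))"
  shows "filterlim (\<lambda>n. (s n)\<^sup>2) at_top sequentially \<and>
    (\<exists>(M' :: (nat \<Rightarrow> real) measure) S' B.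
       prob_space M' \<and>
       same_process_law M' S' M S \<and>
       standard_brownian_motion M' B \<and>
       (\<forall>l < \<delta> / 16. AE \<omega> in M'.
          (\<lambda>n. S' n \<omega> - B ((s n)\<^sup>2) \<omega>) \<in> o(\<lambda>n. s n powr (1 - l))))"
proof -
  interpret elephant M p X
  proof (rule elephant.intro)
    show "prob_space M" using assms(3) by (simp add: erwvrp_steps_def markov_chain_def)
  qed (unfold_locales, use assms in auto)
  define t where "t = var_rec r a"
  have s2: "(s n)\<^sup>2 = t n" for n by (simp add: assms(4,5) L2_size_walk t_def)
  have s0: "0 \<le> s n" for n by (simp add: assms(5) L2_size_def)
  have \<sigma>: "0 < 1 - r\<^sup>2" using r_bounds by simp
  have tlim: "filterlim t at_top sequentially"
  proof (rule filterlim_at_top_mono)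
    show "filterlim (\<lambda>n. (1 - r\<^sup>2) / 4 * A n) at_top sequentially"
      by (rule filterlim_tendsto_pos_mult_at_top[OF tendsto_const _ assms(7)]) (use \<sigma> in simp)
    show "\<forall>\<^sub>F n in sequentially. (1 - r\<^sup>2) / 4 * A n \<le> t n"
      using var_rec_ge[of a] by (intro always_eventually) (simp add: assms(6) t_def)
  qed
  have slim: "filterlim s at_top sequentially"
  proof -
    have "s = (\<lambda>n. sqrt (t n))" using s0 by (simp add: s2[symmetric] fun_eq_iff)
    then show ?thesis using filterlim_compose[OF sqrt_at_top tlim] by simp
  qed
  define \<alpha> where "\<alpha> = 7 / \<delta>"
  have \<alpha>7: "7 \<le> \<alpha>" using assms(8,9) by (simp add: \<alpha>_def field_simps)
  define \<kappa> where "\<kappa> = \<alpha> / 2 - 7 / 32"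
  obtain \<nu> :: "nat \<Rightarrow> nat" and k0 :: nat and C :: real where k0: "1 \<le> k0" and C: "1 \<le> C"
    and b1: "\<forall>k\<ge>k0. 1 \<le> \<nu> k \<and> \<nu> k < \<nu> (Suc k)"
    and b2: "\<forall>k\<ge>k0. 0 < t (\<nu> k)"
    and b3: "\<forall>k\<ge>k0. t (\<nu> k) < t (\<nu> (Suc k))"
    and b4: "\<forall>k\<ge>k0. \<forall>n. \<nu> k \<le> n \<longrightarrow> n \<le> \<nu> (Suc k) \<longrightarrow> \<bar>t n - t (\<nu> k)\<bar> \<le> C * real k powr (\<alpha> - 1)"
    and b5: "\<forall>k\<ge>k0. \<forall>n. \<nu> k \<le> n \<longrightarrow> real k powr \<alpha> \<le> C * t n"
    and b6: "\<forall>k\<ge>k0. \<forall>f :: real \<Rightarrow> real. (\<forall>x y. \<bar>f x - f y\<bar> \<le> \<bar>x - y\<bar>) \<longrightarrow>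
      \<bar>expectation (\<lambda>\<omega>. f (X (\<nu> k) \<omega> * (walk a X (\<nu> (Suc k)) \<omega> - walk a X (\<nu> k) \<omega>)))
        - (\<integral>z. f (sqrt (t (\<nu> (Suc k)) - t (\<nu> k)) * z) \<partial>\<gamma>)\<bar> \<le> C * real k powr (\<alpha> / 2 - 3 / 2)"
    and b7: "AE \<omega> in M. \<forall>\<^sub>F k in sequentially. \<forall>n\<in>{\<nu> k..\<nu> (Suc k)}.
       \<bar>walk a X n \<omega> - walk a X (\<nu> k) \<omega>\<bar> \<le> C * real k powr \<kappa>"
    using scaled_blocks[OF assms(6,8,9,10,7), folded \<alpha>_def t_def, folded \<kappa>_def] by blast
  \<comment> \<open>The scales hold from k0 on only, so the first block runs from 0 to \<nu> (k0 +
    1) and the later blocks are renumbered accordingly.\<close>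
  define e where "e i = (if i = 0 then 0 else \<nu> (k0 + i))" for i
  have e0: "e 0 = 0" and eS: "e (Suc i) = \<nu> (Suc (k0 + i))" and e1: "1 \<le> i \<Longrightarrow> e i = \<nu> (k0 + i)" for i
    by (auto simp: e_def)
  have emono: "strict_mono e"
    unfolding strict_mono_Suc_iff
  proof
    fix i :: nat show "e i < e (Suc i)"
      using b1[rule_format, of "k0 + i"] b1[rule_format, of "Suc (k0 + i)"] by (cases "i = 0") (auto simp: eS e_def)
  qed
  define \<tau> where "\<tau> i = t (e i)" for i
  have \<tau>0: "\<tau> 0 = 0" by (simp add: \<tau>_def e0 t_def)
  have \<tau>mono: "strict_mono \<tau>"
    unfolding strict_mono_Suc_iff
  proof
    fix i :: nat show "\<tau> i < \<tau> (Suc i)"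
      using b3[rule_format, of "k0 + i"] b2[rule_format, of "Suc (k0 + i)"]
      by (cases "i = 0") (auto simp: \<tau>_def eS e_def t_def)
  qed
  obtain M' :: "(nat \<Rightarrow> real) measure" and B where BM: "standard_brownian_motion M' B"
    by (rule brownian_motion_exists)
  interpret P: prob_space M' using BM by (simp add: standard_brownian_motion_def)
  define w where "w i = sqrt (\<tau> (Suc i) - \<tau> i)" for i
  define N where "N i \<omega> = (B (\<tau> (Suc i)) \<omega> - B (\<tau> i) \<omega>) / w i" for i \<omega>
  have w: "0 < w i" for i using \<tau>mono by (simp add: w_def strict_mono_Suc_iff)
  have wN: "w i * N i \<omega> = B (\<tau> (Suc i)) \<omega> - B (\<tau> i) \<omega>" for i \<omega> using w[of i] by (simp add: N_def)
  have \<tau>00: "0 \<le> \<tau> 0" by (simp add: \<tau>0)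
  have N_eq: "N = (\<lambda>i \<omega>. (B (\<tau> (Suc i)) \<omega> - B (\<tau> i) \<omega>) / sqrt (\<tau> (Suc i) - \<tau> i))"
    by (simp add: N_def w_def fun_eq_iff)
  have N1: "N i \<in> borel_measurable M'" and N2: "distr M' borel (N i) = \<gamma>"
    and N3: "P.indep_vars (\<lambda>_. borel) N {..<n}" for i n
    unfolding N_eq by (rule brownian_block_increments[OF BM \<tau>mono \<tau>00])+
  have "\<exists>X'. same_process_law M' (walk a X') M (walk a X) \<and> (\<forall>i\<ge>1.
    integrable M' (\<lambda>\<omega>. \<bar>walk a X' (e (Suc i)) \<omega> - walk a X' (e i) \<omega> - w i * N i \<omega>\<bar>) \<and>
    (\<integral>\<omega>. \<bar>walk a X' (e (Suc i)) \<omega> - walk a X' (e i) \<omega> - w i * N i \<omega>\<bar> \<partial>M')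
      \<le> 2 * (C * real (k0 + i) powr (\<alpha> / 2 - 3 / 2)))"
  proof (rule block_coupling[OF emono e0 P.prob_space_axioms, where N=N and w=w and a=a and K="\<lambda>i. C * real (k0 + i) powr (\<alpha> / 2 - 3 / 2)"])
    fix i :: nat and f :: "real \<Rightarrow> real" assume i: "1 \<le> i" and f: "\<And>x y. \<bar>f x - f y\<bar> \<le> \<bar>x - y\<bar>"
    show "\<bar>expectation (\<lambda>\<omega>. f (X (e i) \<omega> * (walk a X (e (Suc i)) \<omega> - walk a X (e i) \<omega>))) - (\<integral>z. f (w i * z) \<partial>\<gamma>)\<bar>
        \<le> C * real (k0 + i) powr (\<alpha> / 2 - 3 / 2)"
      using b6[rule_format, of "k0 + i" f] f i by (simp add: e1 eS w_def \<tau>_def)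
  qed (rule N1 N2 N3 less_imp_le[OF w])+
  then obtain X' where law: "same_process_law M' (walk a X') M (walk a X)"
    and err: "\<And>i. 1 \<le> i \<Longrightarrow> integrable M' (\<lambda>\<omega>. \<bar>walk a X' (e (Suc i)) \<omega> - walk a X' (e i) \<omega> - w i * N i \<omega>\<bar>)"
      "\<And>i. 1 \<le> i \<Longrightarrow> (\<integral>\<omega>. \<bar>walk a X' (e (Suc i)) \<omega> - walk a X' (e i) \<omega> - w i * N i \<omega>\<bar> \<partial>M')
        \<le> 2 * (C * real (k0 + i) powr (\<alpha> / 2 - 3 / 2))"
    by blast
  define S' where "S' = walk a X'"
  have AE1: "AE \<omega> in M'. \<forall>\<^sub>F k in sequentially. \<forall>n\<in>{\<nu> k..\<nu> (Suc k)}. \<bar>S' n \<omega> - S' (\<nu> k) \<omega>\<bar> \<le> C * real k powr \<kappa>"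
    unfolding S'_def
    by (rule same_process_law_AE[OF law _ b7]) (unfold eventually_sequentially, measurable)
  \<comment> \<open>Index i stands for block \<open>Suc i\<close> of \<open>e\<close>, which is
    block k0 + Suc i of \<open>\<nu>\<close>; the initial block, without an error bound, is left
    out.\<close>
  define g where "g i = real (k0 + Suc i) powr \<kappa>" for i
  have g1: "1 \<le> g i" for i unfolding g_def using \<alpha>7 by (intro ge_one_powr_ge_zero) (auto simp: \<kappa>_def)
  have gmono: "g i \<le> g j" if "i \<le> j" for i j
    unfolding g_def using that \<alpha>7 by (intro powr_mono2) (auto simp: \<kappa>_def)
  have AE2: "AE \<omega> in M'. \<exists>Q\<ge>0. \<forall>n. (\<Sum>i<n. \<bar>S' (e (Suc (Suc i))) \<omega> - S' (e (Suc i)) \<omega> - w (Suc i) * N (Suc i) \<omega>\<bar>) \<le> Q * g n"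
  proof (rule P.AE_weighted_partial_sums)
    show "integrable M' (\<lambda>\<omega>. \<bar>S' (e (Suc (Suc i))) \<omega> - S' (e (Suc i)) \<omega> - w (Suc i) * N (Suc i) \<omega>\<bar>)" for i
      unfolding S'_def by (rule err(1)) simp
    \<comment> \<open>The exponent is (\<alpha>/2 - 3/2) - \<kappa>.\<close>
    have "summable (\<lambda>k. real k powr (- 41 / 32))" by (simp add: summable_real_powr_iff)
    then have "summable (\<lambda>i. real (i + (k0 + 1)) powr (- 41 / 32))" by (rule summable_ignore_initial_segment)
    then have "summable (\<lambda>i. 2 * C * real (k0 + Suc i) powr (- 41 / 32))"
      by (intro summable_mult) (simp add: ac_simps)
    then show "summable (\<lambda>i. P.expectation (\<lambda>\<omega>. \<bar>S' (e (Suc (Suc i))) \<omega> - S' (e (Suc i)) \<omega> - w (Suc i) * N (Suc i) \<omega>\<bar>) / g i)"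
    proof (rule summable_comparison_test'[where N=0])
      fix i
      let ?E = "P.expectation (\<lambda>\<omega>. \<bar>S' (e (Suc (Suc i))) \<omega> - S' (e (Suc i)) \<omega> - w (Suc i) * N (Suc i) \<omega>\<bar>)"
      have E0: "0 \<le> ?E" by (rule integral_nonneg_AE) simp
      have "?E / g i \<le> 2 * (C * real (k0 + Suc i) powr (\<alpha> / 2 - 3 / 2)) / g i"
        using err(2)[of "Suc i"] g1[of i] unfolding S'_def by (intro divide_right_mono) auto
      also have "\<dots> = 2 * C * (real (k0 + Suc i) powr (\<alpha> / 2 - 3 / 2) / real (k0 + Suc i) powr \<kappa>)"
        by (simp add: g_def)
      also have "real (k0 + Suc i) powr (\<alpha> / 2 - 3 / 2) / real (k0 + Suc i) powr \<kappa> = real (k0 + Suc i) powr (- 41 / 32)"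
        unfolding powr_diff[symmetric] by (simp add: \<kappa>_def)
      finally show "norm (?E / g i) \<le> 2 * C * real (k0 + Suc i) powr (- 41 / 32)"
        using E0 g1[of i] by simp
    qed
  qed (use g1 gmono less_le_trans[OF zero_less_one] in auto)
  \<comment> \<open>Inside a block the clock may fall below its starting value, hence a window on
    both sides of it. The cut at 0 is there because \<open>B\<close> is described for nonnegative
    times only.\<close>
  define lo where "lo i = max 0 (\<tau> (Suc i) - C * real (k0 + Suc i) powr (\<alpha> - 1))" for i
  define hi where "hi i = \<tau> (Suc i) + C * real (k0 + Suc i) powr (\<alpha> - 1)" for i
  have \<tau>pos: "0 < \<tau> (Suc i)" for i using strict_monoD[OF \<tau>mono, of 0 "Suc i"] \<tau>0 by simp
  have cpos: "0 < C * real (k0 + Suc i) powr (\<alpha> - 1)" for i using C by (intro mult_pos_pos) auto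
  have AE3: "AE \<omega> in M'. \<forall>\<^sub>F i in sequentially. \<forall>u\<in>{lo i..hi i}. \<bar>B u \<omega> - B (lo i) \<omega>\<bar> \<le> g i"
  proof -
    have "\<exists>F. F \<in> sets M' \<and> P.prob F \<le> 3 * (hi i - lo i)\<^sup>2 / g i ^ 4 \<and>
       (\<forall>\<omega>\<in>space M' - F. \<forall>u\<in>{lo i..hi i}. \<bar>B u \<omega> - B (lo i) \<omega>\<bar> \<le> g i)" for i
    proof -
      have h: "0 \<le> lo i" "lo i < hi i" "0 < g i" using \<tau>pos[of i] cpos[of i] g1[of i] by (auto simp: lo_def hi_def)
      show ?thesis by (rule brownian_window_maximal[OF BM h]) blast
    qed
    then obtain F where F: "\<And>i. F i \<in> sets M'" "\<And>i. P.prob (F i) \<le> 3 * (hi i - lo i)\<^sup>2 / g i ^ 4"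
       "\<And>i \<omega> u. \<omega> \<in> space M' - F i \<Longrightarrow> u \<in> {lo i..hi i} \<Longrightarrow> \<bar>B u \<omega> - B (lo i) \<omega>\<bar> \<le> g i"
      by metis
    have pF: "P.prob (F i) \<le> 12 * C\<^sup>2 * real (k0 + Suc i) powr (- 9 / 8)" for i
    proof -
      let ?k = "real (k0 + Suc i)"
      have "0 \<le> hi i - lo i" "hi i - lo i \<le> 2 * C * ?k powr (\<alpha> - 1)"
        using \<tau>pos[of i] cpos[of i] by (auto simp: lo_def hi_def)
      then have "(hi i - lo i)\<^sup>2 \<le> (2 * C * ?k powr (\<alpha> - 1))\<^sup>2" by (intro power_mono)
      then have "3 * (hi i - lo i)\<^sup>2 / g i ^ 4 \<le> 3 * (2 * C * ?k powr (\<alpha> - 1))\<^sup>2 / g i ^ 4"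
        using g1[of i] by (intro divide_right_mono) auto
      also have "\<dots> = 12 * C\<^sup>2 * ((?k powr (\<alpha> - 1))\<^sup>2 / g i ^ 4)" by (simp add: power_mult_distrib)
      also have "(?k powr (\<alpha> - 1))\<^sup>2 / g i ^ 4 = ?k powr (- 9 / 8)"
      proof -
        have "(?k powr (\<alpha> - 1))\<^sup>2 = ?k powr (2 * \<alpha> - 2)"
          by (simp add: power2_eq_square powr_add[symmetric])
        moreover have "g i ^ 4 = ?k powr (2 * \<alpha> - 7 / 8)"
          by (simp add: g_def \<kappa>_def power4_eq_xxxx powr_add[symmetric])
        ultimately show ?thesis by (simp only: powr_diff[symmetric]) simp
      qed
      finally show ?thesis using F(2)[of i] by linarith
    qed
    have "summable (\<lambda>k. real k powr (- 9 / 8))" by (simp add: summable_real_powr_iff)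
    then have "summable (\<lambda>i. real (i + (k0 + 1)) powr (- 9 / 8))" by (rule summable_ignore_initial_segment)
    then have "summable (\<lambda>i. 12 * C\<^sup>2 * real (k0 + Suc i) powr (- 9 / 8))"
      by (intro summable_mult) (simp add: ac_simps)
    then have "summable (\<lambda>i. P.prob (F i))"
      by (rule summable_comparison_test'[where N=0]) (use pF in simp)
    then have "AE \<omega> in M'. \<forall>\<^sub>F i in sequentially. \<omega> \<in> space M' - F i"
      by (intro borel_cantelli_AE1 F) (auto simp: P.emeasure_eq_measure)
    then show ?thesis
      by eventually_elim (auto elim!: eventually_mono intro: F(3))
  qed
  \<comment> \<open>At the end point \<delta> / 16 the bound is an O. Every smaller l then gives an
    o because s tends to infinity, with one null set for all l.\<close>
  have main: "AE \<omega> in M'. (\<lambda>n. S' n \<omega> - B ((s n)\<^sup>2) \<omega>) \<in> O(\<lambda>n. s n powr (1 - \<delta> / 16))"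
    using AE1 AE2 AE3
  proof eventually_elim
    case (elim \<omega>)
    obtain Q where Q: "0 \<le> Q" "\<And>n. (\<Sum>i<n. \<bar>S' (e (Suc (Suc i))) \<omega> - S' (e (Suc i)) \<omega> - w (Suc i) * N (Suc i) \<omega>\<bar>) \<le> Q * g n"
      using elim(2) by blast
    obtain K1 where K1: "\<And>k n. K1 \<le> k \<Longrightarrow> n \<in> {\<nu> k..\<nu> (Suc k)} \<Longrightarrow> \<bar>S' n \<omega> - S' (\<nu> k) \<omega>\<bar> \<le> C * real k powr \<kappa>"
      using elim(1) unfolding eventually_sequentially by blast
    obtain K2 where K2: "\<And>i u. K2 \<le> i \<Longrightarrow> u \<in> {lo i..hi i} \<Longrightarrow> \<bar>B u \<omega> - B (lo i) \<omega>\<bar> \<le> g i"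
      using elim(3) unfolding eventually_sequentially by blast
    \<comment> \<open>The mismatch left by the initial block is a fixed number for each sample
      point; g i \<ge> 1 absorbs it.\<close>
    define R where "R = \<bar>S' (e 1) \<omega> - B (\<tau> 1) \<omega>\<bar>"
    have walkB: "\<bar>S' (e (Suc i)) \<omega> - B (\<tau> (Suc i)) \<omega>\<bar> \<le> R + Q * g i" for i
    proof -
      have "S' (e (Suc n)) \<omega> - B (\<tau> (Suc n)) \<omega> = S' (e 1) \<omega> - B (\<tau> 1) \<omega>
          + (\<Sum>i<n. S' (e (Suc (Suc i))) \<omega> - S' (e (Suc i)) \<omega> - w (Suc i) * N (Suc i) \<omega>)" for n
        by (induction n) (auto simp: wN)
      then have "\<bar>S' (e (Suc i)) \<omega> - B (\<tau> (Suc i)) \<omega>\<bar> \<le> R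
          + \<bar>\<Sum>j<i. S' (e (Suc (Suc j))) \<omega> - S' (e (Suc j)) \<omega> - w (Suc j) * N (Suc j) \<omega>\<bar>"
        unfolding R_def by (simp only: abs_triangle_ineq)
      also have "\<bar>\<Sum>j<i. S' (e (Suc (Suc j))) \<omega> - S' (e (Suc j)) \<omega> - w (Suc j) * N (Suc j) \<omega>\<bar> \<le> Q * g i"
        by (rule order_trans[OF sum_abs Q(2)])
      finally show ?thesis by simp
    qed
    \<comment> \<open>Half of 1 - \<delta> / 16, so that t^q is s^(1 - \<delta> / 16), while
      \<alpha> * q = \<kappa> links this power to the block index.\<close>
    define q where "q = 1 / 2 - \<delta> / 32"
    have q0: "0 \<le> q" using assms(9) by (simp add: q_def)
    have \<alpha>q: "\<alpha> * q = \<kappa>" using assms(8) by (simp add: q_def \<kappa>_def \<alpha>_def field_simps)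
    define L where "L = (C + (R + Q) + 2) * C powr q"
    show ?case
    proof (rule bigoI[where c=L])
      define i0 where "i0 = Suc (max K1 K2)"
      show "\<forall>\<^sub>F n in sequentially. norm (S' n \<omega> - B ((s n)\<^sup>2) \<omega>) \<le> L * norm (s n powr (1 - \<delta> / 16))"
        unfolding eventually_sequentially
      proof (intro exI[of _ "e i0"] allI impI)
        fix n assume "e i0 \<le> n"
        then obtain j where j: "i0 \<le> j" "e j \<le> n" "n < e (Suc j)"
          by (rule strict_mono_block[OF emono e0])
        then obtain i where i: "j = Suc i" "max K1 K2 \<le> i" by (cases j) (auto simp: i0_def)
        define k where "k = k0 + Suc i"
        have k: "k0 \<le> k" "K1 \<le> k" "K2 \<le> i" using i by (auto simp: k_def)
        have ek: "e (Suc i) = \<nu> k" "e (Suc (Suc i)) = \<nu> (Suc k)" by (simp_all add: k_def eS)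
        have nk: "\<nu> k \<le> n" "n \<le> \<nu> (Suc k)" using j i ek by auto
        have gk: "g i = real k powr \<kappa>" by (simp add: g_def k_def)
        have d1: "\<bar>S' n \<omega> - S' (e (Suc i)) \<omega>\<bar> \<le> C * g i"
          unfolding ek gk by (rule K1[OF k(2)]) (use nk in simp)
        have tn: "\<bar>t n - \<tau> (Suc i)\<bar> \<le> C * real k powr (\<alpha> - 1)"
          unfolding \<tau>_def ek using b4 k nk by blast
        have tn0: "0 \<le> t n" using s2[of n] zero_le_power2[of "s n"] by simp
        have in1: "t n \<in> {lo i..hi i}"
          using tn tn0 unfolding lo_def hi_def k_def by (auto simp: abs_le_iff)
        have in2: "\<tau> (Suc i) \<in> {lo i..hi i}"
          using cpos[of i] \<tau>pos[of i] unfolding lo_def hi_def by auto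
        have d3: "\<bar>B (\<tau> (Suc i)) \<omega> - B (t n) \<omega>\<bar> \<le> 2 * g i"
          using K2[OF k(3) in1] K2[OF k(3) in2] by linarith
        have "R \<le> R * g i" using g1[of i] mult_left_mono[of 1 "g i" R] by (simp add: R_def)
        then have "\<bar>S' n \<omega> - B (t n) \<omega>\<bar> \<le> C * g i + (R * g i + Q * g i) + 2 * g i"
          using d1 d3 walkB[of i] by linarith
        also have "\<dots> = (C + (R + Q) + 2) * g i" by (simp add: algebra_simps)
        also have "\<dots> \<le> (C + (R + Q) + 2) * (C powr q * s n powr (1 - \<delta> / 16))"
        proof (rule mult_left_mono)
          have "g i = (real k powr \<alpha>) powr q" by (simp add: gk powr_powr \<alpha>q)
          also have "\<dots> \<le> (C * t n) powr q" using b5 k nk q0 by (intro powr_mono2) auto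
          also have "\<dots> = C powr q * t n powr q" by (rule powr_mult)
          also have "t n powr q = s n powr (1 - \<delta> / 16)"
          proof (cases "s n = 0")
            case True
            then show ?thesis using s2[of n] by simp
          next
            case False
            then have "t n = s n powr 2" using s0[of n] by (simp add: s2[symmetric])
            then show ?thesis by (simp add: powr_powr q_def)
          qed
          finally show "g i \<le> C powr q * s n powr (1 - \<delta> / 16)" .
          show "0 \<le> C + (R + Q) + 2" using C Q by (simp add: R_def)
        qed
        finally show "norm (S' n \<omega> - B ((s n)\<^sup>2) \<omega>) \<le> L * norm (s n powr (1 - \<delta> / 16))"
          by (simp add: L_def s2 mult.assoc)
      qed
    qed
  qed
  have small: "AE \<omega> in M'. (\<lambda>n. S' n \<omega> - B ((s n)\<^sup>2) \<omega>) \<in> o(\<lambda>n. s n powr (1 - l))" if l: "l < \<delta> / 16" for l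
  proof -
    have "(\<lambda>n. s n powr (1 - \<delta> / 16)) \<in> o(\<lambda>n. s n powr (1 - l))"
    proof (rule smalloI_tendsto)
      have "((\<lambda>n. s n powr - (\<delta> / 16 - l)) \<longlongrightarrow> 0) sequentially"
        by (rule tendsto_neg_powr[OF _ slim]) (use l in simp)
      moreover have "s n powr (1 - \<delta> / 16) / s n powr (1 - l) = s n powr - (\<delta> / 16 - l)" for n
        unfolding powr_diff[symmetric] by simp
      ultimately show "((\<lambda>n. s n powr (1 - \<delta> / 16) / s n powr (1 - l)) \<longlongrightarrow> 0) sequentially" by simp
      have "\<forall>\<^sub>F n in sequentially. 0 < s n" using slim by (simp add: filterlim_at_top_dense)
      then show "\<forall>\<^sub>F n in sequentially. s n powr (1 - l) \<noteq> 0" by eventually_elim simp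
    qed
    then show ?thesis
      using main by (auto elim!: eventually_mono intro: landau_o.big_small_trans)
  qed
  have "filterlim (\<lambda>n. (s n)\<^sup>2) at_top sequentially" using tlim by (simp add: s2)
  moreover have "same_process_law M' S' M S" using law by (simp add: S'_def assms(4))
  ultimately show ?thesis using BM small P.prob_space_axioms by blast
qed

end
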